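(* Let $n\ge1$, let $E,F\subset\mathbb{R}^n$ be measurable sets of finite Lebesgue measure and let $H=(-\Delta)^\alpha$ on $L^2(\mathbb{R}^n)$. Assume that either (i) $\alpha\ge1$, or (ii) $\alpha\in(\frac12,1)$ and $$\int_{\mathbb{R}^n\times\mathbb{R}^n}\mathbf{1}_F(x)\,|x-y|^{2\gamma}\,\mathbf{1}_E(y)\,dx\,dy<+\infty,\qquad\gamma=\frac{n(1-\alpha)}{2\alpha-1}.$$ Then $\mathbf{1}_Fe^{-iTH}\mathbf{1}_E$ is a compact operator on $L^2(\mathbb{R}^n)$ for every real $T\neq0$.
   Context: For $\alpha>0$, $(-\Delta)^\alpha$ is the nonnegative selfadjoint operator on $L^2(\mathbb{R}^n)$ with Fourier multiplier $|\xi|^{2\alpha}$, and $e^{-iTH}$ is the corresponding unitary group. $\mathbf{1}_E$ denotes the indicator function of $E$ and also the operator of multiplication by it. *)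

theory Defs
  imports "HOL-Analysis.Analysis"
begin

definition square_integrable :: "('a::euclidean_space \<Rightarrow> complex) \<Rightarrow> bool" where
  "square_integrable f \<longleftrightarrow>
     f \<in> borel_measurable lebesgue \<and> integrable lebesgue (\<lambda>x. (norm (f x))\<^sup>2)"

lemma square_integrable_zero: "square_integrable (\<lambda>x. 0)"
  by (simp add: square_integrable_def)

lemma square_integrable_add:
  assumes "square_integrable f" "square_integrable g"
  shows "square_integrable (\<lambda>x. f x + g x)"
proof -
  have [measurable]: "f \<in> borel_measurable lebesgue" "g \<in> borel_measurable lebesgue"
    using assms by (auto simp: square_integrable_def)
  have "integrable lebesgue (\<lambda>x. 2 * (norm (f x))\<^sup>2 + 2 * (norm (g x))\<^sup>2)"
    using assms by (auto simp: square_integrable_def)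
  then have "integrable lebesgue (\<lambda>x. (norm (f x + g x))\<^sup>2)"
  proof (rule Bochner_Integration.integrable_bound)
    have "(norm (a + b))\<^sup>2 \<le> 2 * (norm a)\<^sup>2 + 2 * (norm b)\<^sup>2" for a b :: complex
    proof -
      have "(norm (a + b))\<^sup>2 \<le> (norm a + norm b)\<^sup>2"
        by (simp add: norm_triangle_ineq power_mono)
      also have "\<dots> \<le> 2 * (norm a)\<^sup>2 + 2 * (norm b)\<^sup>2"
        using sum_squares_bound[of "norm a" "norm b"] by (simp add: power2_sum)
      finally show ?thesis .
    qed
    then show "AE x in lebesgue. norm ((norm (f x + g x))\<^sup>2)
        \<le> norm (2 * (norm (f x))\<^sup>2 + 2 * (norm (g x))\<^sup>2)"
      by simp
  qed measurable
  then show ?thesis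
    by (simp add: square_integrable_def)
qed

lemma square_integrable_mult:
  assumes "square_integrable f"
  shows "square_integrable (\<lambda>x. c * f x)"
  using assms by (auto simp: square_integrable_def norm_mult power_mult_distrib)

lemma square_integrable_inner:
  assumes "square_integrable f" "square_integrable g"
  shows "integrable lebesgue (\<lambda>x. f x \<bullet> g x)"
proof -
  have [measurable]: "f \<in> borel_measurable lebesgue" "g \<in> borel_measurable lebesgue"
    using assms by (auto simp: square_integrable_def)
  have "integrable lebesgue (\<lambda>x. (norm (f x))\<^sup>2 + (norm (g x))\<^sup>2)"
    using assms by (auto simp: square_integrable_def)
  then show ?thesis
  proof (rule Bochner_Integration.integrable_bound)
    have "\<bar>a \<bullet> b\<bar> \<le> (norm a)\<^sup>2 + (norm b)\<^sup>2" for a b :: complex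
    proof -
      have "\<bar>a \<bullet> b\<bar> \<le> norm a * norm b"
        by (rule Cauchy_Schwarz_ineq2)
      moreover have "0 \<le> norm a * norm b"
        by simp
      ultimately show ?thesis
        using sum_squares_bound[of "norm a" "norm b"] by simp
    qed
    then show "AE x in lebesgue. norm (f x \<bullet> g x) \<le> norm ((norm (f x))\<^sup>2 + (norm (g x))\<^sup>2)"
      by simp
  qed measurable
qed

quotient_type (overloaded) 'a L2 = "'a::euclidean_space \<Rightarrow> complex" /
  partial: "\<lambda>f g. square_integrable f \<and> square_integrable g \<and> (AE x in lebesgue. f x = g x)"
  by (rule part_equivpI) (auto intro!: exI[of _ "\<lambda>x. 0"] simp: square_integrable_zero symp_def transp_def
      elim!: eventually_elim2 intro: eventually_mono)

instantiation L2 :: (euclidean_space) real_inner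
begin

lift_definition zero_L2 :: "'a L2" is "\<lambda>x. 0"
  by (simp add: square_integrable_zero)

lift_definition plus_L2 :: "'a L2 \<Rightarrow> 'a L2 \<Rightarrow> 'a L2" is "\<lambda>f g x. f x + g x"
  by (auto intro: square_integrable_add elim: eventually_elim2)

lift_definition uminus_L2 :: "'a L2 \<Rightarrow> 'a L2" is "\<lambda>f x. - f x"
  using square_integrable_mult[where c = "-1"] by (auto elim: eventually_mono)

definition minus_L2 :: "'a L2 \<Rightarrow> 'a L2 \<Rightarrow> 'a L2" where
  "minus_L2 f g = f + (- g)"

lift_definition scaleR_L2 :: "real \<Rightarrow> 'a L2 \<Rightarrow> 'a L2" is "\<lambda>c f x. of_real c * f x"
  using square_integrable_mult by (auto elim: eventually_mono)

lift_definition inner_L2 :: "'a L2 \<Rightarrow> 'a L2 \<Rightarrow> real" is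
  "\<lambda>f g. \<integral>x. f x \<bullet> g x \<partial>lebesgue"
proof -
  fix f f' g g' :: "'a \<Rightarrow> complex"
  assume a: "square_integrable f \<and> square_integrable f' \<and> (AE x in lebesgue. f x = f' x)"
    and b: "square_integrable g \<and> square_integrable g' \<and> (AE x in lebesgue. g x = g' x)"
  show "(\<integral>x. f x \<bullet> g x \<partial>lebesgue) = (\<integral>x. f' x \<bullet> g' x \<partial>lebesgue)"
  proof (rule integral_cong_AE)
    show "AE x in lebesgue. f x \<bullet> g x = f' x \<bullet> g' x"
      using a b by (auto elim: eventually_elim2)
  qed (use a b square_integrable_inner borel_measurable_integrable in blast)+
qed

definition norm_L2 :: "'a L2 \<Rightarrow> real" where
  "norm_L2 f = sqrt (f \<bullet> f)"

definition sgn_L2 :: "'a L2 \<Rightarrow> 'a L2" where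
  "sgn_L2 f = inverse (norm f) *\<^sub>R f"

definition dist_L2 :: "'a L2 \<Rightarrow> 'a L2 \<Rightarrow> real" where
  "dist_L2 f g = norm (f - g)"

definition uniformity_L2 :: "('a L2 \<times> 'a L2) filter" where
  "uniformity_L2 = (INF e\<in>{0<..}. principal {(f, g). dist f g < e})"

definition open_L2 :: "'a L2 set \<Rightarrow> bool" where
  "open_L2 S \<longleftrightarrow> (\<forall>f\<in>S. eventually (\<lambda>(f', g). f' = f \<longrightarrow> g \<in> S) uniformity)"

instance
proof
  fix f g h :: "'a L2" and r s :: real
  show "f + g + h = f + (g + h)"
    by transfer (auto intro!: square_integrable_add simp: add.assoc)
  show "f + g = g + f"
    by transfer (auto intro!: square_integrable_add simp: add.commute)
  show "0 + f = f"
    by transfer auto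
  show "- f + f = 0"
    by transfer (auto simp: square_integrable_zero)
  show "f - g = f + - g"
    by (rule minus_L2_def)
  show "r *\<^sub>R (f + g) = r *\<^sub>R f + r *\<^sub>R g"
    by transfer (auto intro!: square_integrable_add square_integrable_mult simp: distrib_left)
  show "(r + s) *\<^sub>R f = r *\<^sub>R f + s *\<^sub>R f"
    by transfer (auto intro!: square_integrable_add square_integrable_mult simp: distrib_right)
  show "r *\<^sub>R s *\<^sub>R f = (r * s) *\<^sub>R f"
    by transfer (use square_integrable_mult in \<open>auto simp: mult.assoc\<close>)
  show "1 *\<^sub>R f = f"
    by transfer auto
  show "f \<bullet> g = g \<bullet> f"
    by transfer (simp add: inner_commute)
  show "(f + g) \<bullet> h = f \<bullet> h + g \<bullet> h"
    by transfer (simp add: inner_add_left square_integrable_inner)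
  show "(r *\<^sub>R f) \<bullet> g = r * (f \<bullet> g)"
    by transfer (simp flip: scaleR_conv_of_real)
  show "0 \<le> f \<bullet> f"
    by transfer simp
  show "(f \<bullet> f = 0) = (f = 0)"
  proof transfer
    fix f :: "'a \<Rightarrow> complex"
    assume "square_integrable f \<and> square_integrable f \<and> (AE x in lebesgue. f x = f x)"
    then have f: "square_integrable f" by simp
    show "((\<integral>x. f x \<bullet> f x \<partial>lebesgue) = 0) =
        (square_integrable f \<and> square_integrable (\<lambda>x::'a. 0) \<and> (AE x in lebesgue. f x = 0))"
      by (subst integral_nonneg_eq_0_iff_AE[OF square_integrable_inner[OF f f]])
         (auto simp: f square_integrable_zero)
  qed
  show "norm f = sqrt (f \<bullet> f)"
    by (rule norm_L2_def)
  show "sgn f = inverse (norm f) *\<^sub>R f"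
    by (rule sgn_L2_def)
  show "dist f g = norm (f - g)"
    by (rule dist_L2_def)
  show "uniformity = (INF e\<in>{0<..}. principal {(f, g :: 'a L2). dist f g < e})"
    by (rule uniformity_L2_def)
  show "open S \<longleftrightarrow> (\<forall>f\<in>S. eventually (\<lambda>(f', g). f' = f \<longrightarrow> g \<in> S) uniformity)" for S :: "'a L2 set"
    by (rule open_L2_def)
qed

end

lift_definition scaleC_L2 :: "complex \<Rightarrow> 'a::euclidean_space L2 \<Rightarrow> 'a L2" (infixr \<open>*\<^sub>C\<close> 75)
  is "\<lambda>c f x. c * f x"
  using square_integrable_mult by (auto elim: eventually_mono)

definition linear_L2 :: "('a::euclidean_space L2 \<Rightarrow> 'a L2) \<Rightarrow> bool" where
  "linear_L2 K \<longleftrightarrow> (\<forall>f g. K (f + g) = K f + K g) \<and> (\<forall>c f. K (c *\<^sub>C f) = c *\<^sub>C K f)"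

definition unitary_L2 :: "('a::euclidean_space L2 \<Rightarrow> 'a L2) \<Rightarrow> bool" where
  "unitary_L2 U \<longleftrightarrow> linear_L2 U \<and> surj U \<and> (\<forall>f. norm (U f) = norm f)"

definition compact_operator_L2 :: "('a::euclidean_space L2 \<Rightarrow> 'a L2) \<Rightarrow> bool" where
  "compact_operator_L2 K \<longleftrightarrow> linear_L2 K \<and> (\<forall>B. bounded B \<longrightarrow> compact (closure (K ` B)))"

text \<open>Only used for Lebesgue measurable \<open>A\<close>; otherwise the product need not be square integrable
  and the value is unspecified.\<close>

definition indicator_L2 :: "'a::euclidean_space set \<Rightarrow> 'a L2 \<Rightarrow> 'a L2" where
  "indicator_L2 A f = abs_L2 (\<lambda>x. indicator A x * rep_L2 f x)"

definition fourier_integral :: "('a::euclidean_space \<Rightarrow> complex) \<Rightarrow> 'a \<Rightarrow> complex" where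
  "fourier_integral f \<xi> =
     of_real ((2 * pi) powr (- real DIM('a) / 2)) * (\<integral>x. cis (- (x \<bullet> \<xi>)) * f x \<partial>lebesgue)"

text \<open>The Plancherel transform: the continuous extension of the Fourier integral from
  \<open>L\<^sup>1 \<inter> L\<^sup>2\<close> to \<open>L\<^sup>2\<close>, whose graph is the closure of that of the Fourier integral.\<close>

definition fourier_L2 :: "'a::euclidean_space L2 \<Rightarrow> 'a L2" where
  "fourier_L2 f = (THE g. (f, g) \<in> closure {(u, v).
     integrable lebesgue (rep_L2 u) \<and>
     (AE \<xi> in lebesgue. rep_L2 v \<xi> = fourier_integral (rep_L2 u) \<xi>)})"

text \<open>Unbounded operators on \<open>L\<^sup>2\<close> are represented by their graphs. The domain of \<open>(-\<Delta>)\<^sup>\<alpha>\<close> is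
  maximal: it consists of the \<open>f\<close> for which the multiplier applied to the transform of \<open>f\<close> is
  again square integrable.\<close>

definition fractional_laplacian :: "real \<Rightarrow> ('a::euclidean_space L2 \<times> 'a L2) set" where
  "fractional_laplacian \<alpha> = {(f, g).
     AE \<xi> in lebesgue. rep_L2 (fourier_L2 g) \<xi> = of_real (norm \<xi> powr (2 * \<alpha>)) * rep_L2 (fourier_L2 f) \<xi>}"

text \<open>\<open>U t = exp (-itH)\<close> in the sense of Stone's theorem: \<open>U\<close> is the strongly continuous unitary
  group whose infinitesimal generator, domain included, is \<open>-iH\<close>.\<close>

definition is_unitary_group ::
  "(real \<Rightarrow> 'a::euclidean_space L2 \<Rightarrow> 'a L2) \<Rightarrow> ('a L2 \<times> 'a L2) set \<Rightarrow> bool" where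
  "is_unitary_group U H \<longleftrightarrow>
     (\<forall>t. unitary_L2 (U t)) \<and> U 0 = id \<and> (\<forall>s t. U (s + t) = U s \<circ> U t) \<and>
     (\<forall>f. continuous_on UNIV (\<lambda>t. U t f)) \<and>
     (\<forall>f g. (f, g) \<in> H \<longleftrightarrow> ((\<lambda>t. (U t f - f) /\<^sub>R t) \<longlongrightarrow> (- \<i>) *\<^sub>C g) (at 0))"

definition unitary_group :: "('a::euclidean_space L2 \<times> 'a L2) set \<Rightarrow> real \<Rightarrow> 'a L2 \<Rightarrow> 'a L2" where
  "unitary_group H = (THE U. is_unitary_group U H)"

end

theory Submission
  imports Defs "HOL-Complex_Analysis.Complex_Analysis" "HOL-Probability.Probability"
begin

text \<open>Regularise the propagator by the multiplier \<open>exp (- (\<epsilon> + \<i>T) (norm \<xi>) powr (2\<alpha>))\<close>, whose convolution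
  kernel \<open>k\<^sub>\<epsilon>\<close> is an absolutely convergent integral. Uniformly in \<open>0 < \<epsilon> \<le> 1\<close>, \<open>k\<^sub>\<epsilon>(z)\<close> is bounded if
  \<open>\<alpha> \<ge> 1\<close> and grows at most like \<open>1 + (norm z) powr \<gamma>\<close> if \<open>1/2 < \<alpha> < 1\<close>. To see this, rotate all of
  \<open>\<xi>\<close>-space by a small complex angle, which makes the integrand decay in the directions transversal
  to \<open>z\<close>, and slice the integral along \<open>z\<close>. On each slice the rotated ray is moved back to the real
  axis up to the frequency \<open>X\<close> beyond which no stationary point occurs; there van der Corput's
  second derivative test applies, and the rest of the contour is estimated by absolute values.

  Hence the truncated operators \<open>1\<^sub>F k\<^sub>\<epsilon> 1\<^sub>E\<close> are Hilbert--Schmidt with norms bounded uniformly in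
  \<open>\<epsilon>\<close>. The bound passes to the strong limit \<open>\<epsilon> \<rightarrow> 0\<close> through finite orthonormal families, so the
  limit is compact. That the limit is \<open>1\<^sub>F exp (- \<i>T H) 1\<^sub>E\<close> follows from Plancherel's theorem: the
  multipliers \<open>exp (- \<i>t (norm \<xi>) powr (2\<alpha>))\<close> form a unitary group generated by \<open>- \<i>H\<close>, and the norm of
  the difference of two such groups is constant on the dense domain of \<open>H\<close>.\<close>

section \<open>Oscillatory integrals\<close>

text \<open>Write \<open>Y = growth X\<close>. The bound on one slice is Y times a profile in
  \<open>r / Y\<close>: the second derivative test gives the factor Y along z, since the second
  derivative of the phase is at least of order \<open>1 / Y\<^sup>2\<close> on [1, X], and the same
  Y is the width on which the rotated integrand decays across z. Integrating over the n - 1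
  transversal directions gives \<open>Y ^ n\<close>. The frequency X is tied to z by the size
  relation of a stationary point, norm z ~ X powr (2\<alpha> - 1); inserting it in Y ^ n = X powr
  (n(1 - \<alpha>)) produces exactly \<gamma>, and the Hilbert-Schmidt norm, which squares the
  kernel, produces the exponent 2\<gamma> of the hypothesis. The obstacle is that only \<epsilon>
  makes the kernel integral absolutely convergent, while the bound must not depend on \<epsilon>.
  Rotation supplies decay that comes from T instead, but it also makes the factor exp (i m s) grow
  for one sign of m. Beyond X the decay wins; below X it does not, which is why that part of the
  contour has to return to the real axis.\<close>

lemma has_vector_derivative_exp_complex:
  fixes f :: "real \<Rightarrow> complex"
  assumes "(f has_vector_derivative f') (at s within S)"
  shows "((\<lambda>s. exp (f s)) has_vector_derivative (f' * exp (f s))) (at s within S)"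
  using field_vector_diff_chain_within[OF assms, of exp "exp (f s)"]
  by (simp add: o_def has_field_derivative_at_within DERIV_exp)

text \<open>Integration by parts with the primitive \<open>cis \<phi> / (\<i> \<phi>')\<close>.
  Because \<open>\<phi>''\<close> has a sign, the remainder is dominated by the exact derivative of
  \<open>- 1 / \<phi>'\<close> and costs only boundary values; four boundary terms of size at most 1
  / \<mu> add up to the constant 4.\<close>

lemma oscillatory_first_derivative_bound:
  fixes \<phi> \<phi>' \<phi>'' :: "real \<Rightarrow> real"
  assumes lu: "l \<le> u" and \<mu>: "\<mu> > 0"
    and d1: "\<And>s. s \<in> {l..u} \<Longrightarrow> (\<phi> has_real_derivative \<phi>' s) (at s within {l..u})"
    and d2: "\<And>s. s \<in> {l..u} \<Longrightarrow> (\<phi>' has_real_derivative \<phi>'' s) (at s within {l..u})"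
    and pos: "\<And>s. s \<in> {l..u} \<Longrightarrow> \<phi>'' s \<ge> 0"
    and big: "\<And>s. s \<in> {l..u} \<Longrightarrow> \<bar>\<phi>' s\<bar> \<ge> \<mu>"
  shows "norm (integral {l..u} (\<lambda>s. cis (\<phi> s))) \<le> 4 / \<mu>"
proof -
  have nz: "\<phi>' s \<noteq> 0" if "s \<in> {l..u}" for s using big[OF that] \<mu> by auto
  define F where "F s = cis (\<phi> s) * (- \<i> * of_real (1 / \<phi>' s))" for s
  define R where "R s = cis (\<phi> s) * (\<i> * of_real (\<phi>'' s / (\<phi>' s)\<^sup>2))" for s
  have FD: "(F has_vector_derivative (cis (\<phi> s) + R s)) (at s within {l..u})" if s: "s \<in> {l..u}" for s
  proof -
    have a: "((\<lambda>s. cis (\<phi> s)) has_vector_derivative (cis (\<phi> s) * (\<i> * of_real (\<phi>' s)))) (at s within {l..u})"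
    proof -
      have "((\<lambda>s. \<i> * complex_of_real (\<phi> s)) has_vector_derivative \<i> * of_real (\<phi>' s)) (at s within {l..u})"
        using d1[OF s] by (auto simp: has_real_derivative_iff_has_vector_derivative
          intro!: has_vector_derivative_mult_right has_vector_derivative_of_real)
      from has_vector_derivative_exp_complex[OF this] show ?thesis
        by (simp add: cis_conv_exp mult_ac)
    qed
    have b: "((\<lambda>s. - \<i> * of_real (1 / \<phi>' s)) has_vector_derivative (- \<i> * of_real (- \<phi>'' s / (\<phi>' s)\<^sup>2))) (at s within {l..u})"
    proof -
      have "((\<lambda>s. 1 / \<phi>' s) has_real_derivative (- \<phi>'' s / (\<phi>' s)\<^sup>2)) (at s within {l..u})"
        using d2[OF s] nz[OF s] by (auto intro!: derivative_eq_intros simp: power2_eq_square)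
      then have "((\<lambda>s. complex_of_real (1 / \<phi>' s)) has_vector_derivative (of_real (- \<phi>'' s / (\<phi>' s)\<^sup>2))) (at s within {l..u})"
        unfolding has_real_derivative_iff_has_vector_derivative by (rule bounded_linear.has_vector_derivative[OF bounded_linear_of_real])
      then show ?thesis by (rule has_vector_derivative_mult_right)
    qed
    have "cis (\<phi> s) * (- \<i> * of_real (- \<phi>'' s / (\<phi>' s)\<^sup>2)) +
        cis (\<phi> s) * (\<i> * of_real (\<phi>' s)) * (- \<i> * of_real (1 / \<phi>' s)) = cis (\<phi> s) + R s"
      using nz[OF s] by (simp add: R_def field_simps)
    then show ?thesis
      using has_vector_derivative_mult[OF a b] unfolding F_def by simp
  qed
  have 1: "((\<lambda>s. cis (\<phi> s) + R s) has_integral (F u - F l)) {l..u}"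
    by (rule fundamental_theorem_of_calculus[OF lu FD]) auto
  have c\<phi>: "continuous_on {l..u} \<phi>"
    using d1 by (meson DERIV_continuous_on)
  have int1: "(\<lambda>s. cis (\<phi> s)) integrable_on {l..u}"
    by (intro integrable_continuous_real continuous_intros c\<phi>)
  \<comment> \<open>Nothing is known about continuity of \<open>\<phi>''\<close>; R is integrable as
    the derivative of F minus a continuous function.\<close>
  have RI: "R integrable_on {l..u}"
  proof -
    have "(\<lambda>s. (cis (\<phi> s) + R s) - cis (\<phi> s)) integrable_on {l..u}"
      by (intro integrable_diff int1) (use 1 in blast)
    then show ?thesis by simp
  qed
  have "((\<lambda>s. \<phi>'' s / (\<phi>' s)\<^sup>2) has_integral ((- 1 / \<phi>' u) - (- 1 / \<phi>' l))) {l..u}"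
  proof (rule fundamental_theorem_of_calculus[OF lu])
    fix s assume s: "s \<in> {l..u}"
    show "((\<lambda>s. - 1 / \<phi>' s) has_vector_derivative \<phi>'' s / (\<phi>' s)\<^sup>2) (at s within {l..u})"
      using d2[OF s] nz[OF s] unfolding has_real_derivative_iff_has_vector_derivative[symmetric]
      by (auto intro!: derivative_eq_intros simp: power2_eq_square)
  qed
  note RB = this
  have "norm (integral {l..u} R) \<le> integral {l..u} (\<lambda>s. \<phi>'' s / (\<phi>' s)\<^sup>2)"
  proof (rule integral_norm_bound_integral[OF RI])
    show "norm (R s) \<le> \<phi>'' s / (\<phi>' s)\<^sup>2" if "s \<in> {l..u}" for s
      unfolding R_def norm_mult norm_of_real using pos[OF that] by (simp add: abs_mult)
  qed (use RB in blast)
  then have "norm (integral {l..u} R) \<le> (- 1 / \<phi>' u) - (- 1 / \<phi>' l)"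
    unfolding integral_unique[OF RB] .
  moreover have "integral {l..u} (\<lambda>s. cis (\<phi> s)) = F u - F l - integral {l..u} R"
    using integral_unique[OF 1] integral_add[OF int1 RI] by (simp add: algebra_simps)
  moreover have "\<bar>1 / \<phi>' u\<bar> \<le> 1 / \<mu>" "\<bar>1 / \<phi>' l\<bar> \<le> 1 / \<mu>"
    using big[of u] big[of l] lu \<mu> by (auto intro!: frac_le)
  moreover have "norm (F s) = \<bar>1 / \<phi>' s\<bar>" for s
    by (simp only: F_def norm_mult norm_of_real) simp
  ultimately have "norm (integral {l..u} (\<lambda>s. cis (\<phi> s))) \<le> \<bar>1 / \<phi>' u\<bar> + \<bar>1 / \<phi>' l\<bar> + ((- 1 / \<phi>' u) - (- 1 / \<phi>' l))"
    using norm_triangle_ineq4[of "F u - F l" "integral {l..u} R"] norm_triangle_ineq4[of "F u" "F l"] by simp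
  moreover have "- 1 / \<phi>' u \<le> \<bar>1 / \<phi>' u\<bar>" "- (- 1 / \<phi>' l) \<le> \<bar>1 / \<phi>' l\<bar>" by linarith+
  moreover have "4 / \<mu> = 4 * (1 / \<mu>)" by simp
  ultimately show ?thesis
    using \<open>\<bar>1 / \<phi>' u\<bar> \<le> 1 / \<mu>\<close> \<open>\<bar>1 / \<phi>' l\<bar> \<le> 1 / \<mu>\<close> by linarith
qed

text \<open>Remove the interval of radius 1 / \<mu> around the point where \<open>\<phi>'\<close> is
  closest to zero. Its length is at most 2 / \<mu>, and outside it \<open>\<phi>'\<close> has grown
  to size \<open>\<mu>\<^sup>2 * (1 / \<mu>) = \<mu>\<close>, so each side costs 4 / \<mu>.\<close>

lemma oscillatory_second_derivative_bound_pos: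
  fixes \<phi> \<phi>' \<phi>'' :: "real \<Rightarrow> real"
  assumes lu: "l \<le> u" and \<mu>: "\<mu> > 0"
    and d1: "\<And>s. s \<in> {l..u} \<Longrightarrow> (\<phi> has_real_derivative \<phi>' s) (at s within {l..u})"
    and d2: "\<And>s. s \<in> {l..u} \<Longrightarrow> (\<phi>' has_real_derivative \<phi>'' s) (at s within {l..u})"
    and big: "\<And>s. s \<in> {l..u} \<Longrightarrow> \<phi>'' s \<ge> \<mu>\<^sup>2"
  shows "norm (integral {l..u} (\<lambda>s. cis (\<phi> s))) \<le> 10 / \<mu>"
proof -
  have grow: "\<phi>' y - \<phi>' x \<ge> \<mu>\<^sup>2 * (y - x)" if "x \<in> {l..u}" "y \<in> {l..u}" "x \<le> y" for x y
  proof -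
    have "(\<lambda>s. \<phi>' s - \<mu>\<^sup>2 * s) x \<le> (\<lambda>s. \<phi>' s - \<mu>\<^sup>2 * s) y"
    proof (rule DERIV_nonneg_imp_increasing_open[where f = "\<lambda>s. \<phi>' s - \<mu>\<^sup>2 * s"])
      show "\<exists>d. ((\<lambda>s. \<phi>' s - \<mu>\<^sup>2 * s) has_real_derivative d) (at s) \<and> d \<ge> 0"
        if "x < s" "s < y" for s
      proof -
        have "s \<in> {l<..<u}" "s \<in> {l..u}" using that \<open>x \<in> {l..u}\<close> \<open>y \<in> {l..u}\<close> by auto
        then have "(\<phi>' has_real_derivative \<phi>'' s) (at s)"
          using d2[of s] by (simp add: at_within_Icc_at)
        then show ?thesis
          using big[OF \<open>s \<in> {l..u}\<close>] by (intro exI[of _ "\<phi>'' s - \<mu>\<^sup>2"]) (auto intro!: derivative_eq_intros)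
      qed
      show "continuous_on {x..y} (\<lambda>s. \<phi>' s - \<mu>\<^sup>2 * s)"
        using that by (intro continuous_intros continuous_on_subset[OF DERIV_continuous_on[OF d2]]) auto
    qed (use that in auto)
    then show ?thesis by (simp add: algebra_simps)
  qed
  have c': "continuous_on {l..u} \<phi>'" using d2 by (meson DERIV_continuous_on)
  have c\<phi>: "continuous_on {l..u} \<phi>" using d1 by (meson DERIV_continuous_on)
  \<comment> \<open>\<open>s0\<close> is a zero of \<open>\<phi>'\<close> if there is one. Otherwise
    it is the endpoint nearest to the sign change, and the sign condition for the missing side is
    void.\<close>
  obtain s0 where s0: "s0 \<in> {l..u}" "\<And>s. s \<in> {l..u} \<Longrightarrow> s > s0 \<Longrightarrow> \<phi>' s0 \<ge> 0" "\<And>s. s \<in> {l..u} \<Longrightarrow> s < s0 \<Longrightarrow> \<phi>' s0 \<le> 0"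
  proof -
    consider "\<phi>' l \<ge> 0" | "\<phi>' u \<le> 0" | "\<phi>' l < 0" "\<phi>' u > 0" by linarith
    then show ?thesis
    proof cases
      case 1 then show ?thesis using that[of l] lu by auto
    next
      case 2 then show ?thesis using that[of u] lu by auto
    next
      case 3
      then obtain s where "l \<le> s" "s \<le> u" "\<phi>' s = 0"
        using IVT'[of \<phi>' l 0 u] lu c' by auto
      then show ?thesis using that[of s] by auto
    qed
  qed
  define p q where "p = max l (s0 - 1 / \<mu>)" and "q = min u (s0 + 1 / \<mu>)"
  have pq: "l \<le> p" "p \<le> q" "q \<le> u" "p \<le> s0" "s0 \<le> q" "q - p \<le> 2 / \<mu>" using s0(1) \<mu> zero_less_divide_1_iff[of \<mu>] by (auto simp: p_def q_def intro: order_trans[of _ s0])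
  have mu1: "\<mu>\<^sup>2 * (1 / \<mu>) = \<mu>" using \<mu> by (simp add: power2_eq_square)
  have L: "norm (integral {l..p} (\<lambda>s. cis (\<phi> s))) \<le> 4 / \<mu>"
  proof (cases "p = l")
    case True then show ?thesis using \<mu> by simp
  next
    case False
    then have p: "p = s0 - 1 / \<mu>" by (auto simp: p_def)
    show ?thesis
    proof (rule oscillatory_first_derivative_bound[where \<phi>' = \<phi>' and \<phi>'' = \<phi>''])
      fix s assume s: "s \<in> {l..p}"
      then have sl: "s \<in> {l..u}" using pq by auto
      show "\<phi>'' s \<ge> 0" using big[OF sl] by (meson order_trans zero_le_power2)
      have "s < s0" using s p \<mu> by (smt (verit) atLeastAtMost_iff zero_less_divide_1_iff)
      moreover have "\<mu>\<^sup>2 * (s0 - s) \<ge> \<mu>\<^sup>2 * (1 / \<mu>)" using s p by (intro mult_left_mono) auto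
      ultimately show "\<mu> \<le> \<bar>\<phi>' s\<bar>" using grow[OF sl s0(1)] s0(3)[OF sl] mu1 by linarith
    qed (use pq \<mu> in \<open>auto intro!: DERIV_subset[OF d1] DERIV_subset[OF d2]\<close>)
  qed
  have U: "norm (integral {q..u} (\<lambda>s. cis (\<phi> s))) \<le> 4 / \<mu>"
  proof (cases "q = u")
    case True then show ?thesis using \<mu> by simp
  next
    case False
    then have q: "q = s0 + 1 / \<mu>" by (auto simp: q_def)
    show ?thesis
    proof (rule oscillatory_first_derivative_bound[where \<phi>' = \<phi>' and \<phi>'' = \<phi>''])
      fix s assume s: "s \<in> {q..u}"
      then have sl: "s \<in> {l..u}" using pq by auto
      show "\<phi>'' s \<ge> 0" using big[OF sl] by (meson order_trans zero_le_power2)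
      have "s > s0" using s q \<mu> by (smt (verit) atLeastAtMost_iff zero_less_divide_1_iff)
      moreover have "\<mu>\<^sup>2 * (s - s0) \<ge> \<mu>\<^sup>2 * (1 / \<mu>)" using s q by (intro mult_left_mono) auto
      ultimately show "\<mu> \<le> \<bar>\<phi>' s\<bar>" using grow[OF s0(1) sl] s0(2)[OF sl] mu1 by linarith
    qed (use pq \<mu> in \<open>auto intro!: DERIV_subset[OF d1] DERIV_subset[OF d2]\<close>)
  qed
  have int: "(\<lambda>s. cis (\<phi> s)) integrable_on {x..y}" if "l \<le> x" "y \<le> u" for x y
    by (intro integrable_continuous_real continuous_intros continuous_on_subset[OF c\<phi>]) (use that in auto)
  have M: "norm (integral {p..q} (\<lambda>s. cis (\<phi> s))) \<le> q - p"
    using integral_norm_bound_integral[OF int[of p q], of "\<lambda>_. 1"] pq integrable_const_ivl[of 1 p q] by simp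
  have "integral {l..p} (\<lambda>s. cis (\<phi> s)) + integral {p..u} (\<lambda>s. cis (\<phi> s)) = integral {l..u} (\<lambda>s. cis (\<phi> s))"
    by (rule Henstock_Kurzweil_Integration.integral_combine) (use pq int in auto)
  moreover have "integral {p..q} (\<lambda>s. cis (\<phi> s)) + integral {q..u} (\<lambda>s. cis (\<phi> s)) = integral {p..u} (\<lambda>s. cis (\<phi> s))"
    by (rule Henstock_Kurzweil_Integration.integral_combine) (use pq int in auto)
  ultimately have "integral {l..u} (\<lambda>s. cis (\<phi> s)) = integral {l..p} (\<lambda>s. cis (\<phi> s)) + integral {p..q} (\<lambda>s. cis (\<phi> s)) + integral {q..u} (\<lambda>s. cis (\<phi> s))"
    by (metis add.assoc)
  then have "norm (integral {l..u} (\<lambda>s. cis (\<phi> s))) \<le> 4 / \<mu> + 2 / \<mu> + 4 / \<mu>"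
    using L U M pq norm_triangle_ineq[of "integral {l..p} (\<lambda>s. cis (\<phi> s)) + integral {p..q} (\<lambda>s. cis (\<phi> s))"]
     norm_triangle_ineq[of "integral {l..p} (\<lambda>s. cis (\<phi> s))" "integral {p..q} (\<lambda>s. cis (\<phi> s))"] by (smt (verit))
  then show ?thesis by (simp add: add_divide_distrib[symmetric])
qed

text \<open>Integration by parts against the primitive J of the oscillating factor, with
  \<open>norm (J x)\<close> at most 10 / \<mu> by the unweighted estimate for the conjugate
  integral. The variation of the amplitude enters through an explicit majorant: a function b with
  \<open>norm (a' s) \<le> b' s\<close>, whose increment can be computed without integrating
  \<open>norm (a' s)\<close>.\<close>

lemma van_der_Corput:
  fixes \<phi> \<phi>' \<phi>'' b :: "real \<Rightarrow> real" and a a' :: "real \<Rightarrow> complex"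
  assumes lu: "l \<le> u" and \<mu>: "\<mu> > 0"
    and d1: "\<And>s. s \<in> {l..u} \<Longrightarrow> (\<phi> has_real_derivative \<phi>' s) (at s within {l..u})"
    and d2: "\<And>s. s \<in> {l..u} \<Longrightarrow> (\<phi>' has_real_derivative \<phi>'' s) (at s within {l..u})"
    and big: "\<And>s. s \<in> {l..u} \<Longrightarrow> \<phi>'' s \<le> - \<mu>\<^sup>2"
    and da: "\<And>s. s \<in> {l..u} \<Longrightarrow> (a has_vector_derivative a' s) (at s within {l..u})"
    and db: "\<And>s. s \<in> {l..u} \<Longrightarrow> (b has_real_derivative b' s) (at s within {l..u})"
    and ab: "\<And>s. s \<in> {l..u} \<Longrightarrow> norm (a' s) \<le> b' s"
  shows "norm (integral {l..u} (\<lambda>s. cis (\<phi> s) * a s)) \<le> 10 / \<mu> * (norm (a u) + (b u - b l))"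
proof -
  have c\<phi>: "continuous_on {l..u} \<phi>" using d1 by (meson DERIV_continuous_on)
  have ca: "continuous_on {l..u} a" using da by (meson continuous_on_vector_derivative)
  define J where "J x = integral {l..x} (\<lambda>s. cis (\<phi> s))" for x
  have J: "norm (J x) \<le> 10 / \<mu>" if x: "x \<in> {l..u}" for x
  proof -
    have "norm (integral {l..x} (\<lambda>s. cis (- \<phi> s))) \<le> 10 / \<mu>"
      by (rule oscillatory_second_derivative_bound_pos[where \<phi>' = "\<lambda>s. - \<phi>' s" and \<phi>'' = "\<lambda>s. - \<phi>'' s"])
         (use x \<mu> big in \<open>auto intro!: derivative_eq_intros DERIV_subset[OF d1] DERIV_subset[OF d2] simp: le_minus_iff\<close>)
    moreover have "integral {l..x} (\<lambda>s. cis (- \<phi> s)) = cnj (J x)"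
      unfolding J_def cis_cnj[symmetric] by (simp add: integral_cnj)
    ultimately show ?thesis by simp
  qed
  have Jd: "(J has_vector_derivative cis (\<phi> s)) (at s within {l..u})" if "s \<in> {l..u}" for s
    unfolding J_def by (rule integral_has_vector_derivative) (use that in \<open>auto intro!: continuous_intros c\<phi>\<close>)
  have cJ: "continuous_on {l..u} J" using Jd by (meson continuous_on_vector_derivative)
  have main: "((\<lambda>s. J s * a' s + cis (\<phi> s) * a s) has_integral (J u * a u - J l * a l)) {l..u}"
    by (rule fundamental_theorem_of_calculus[OF lu has_vector_derivative_mult[OF Jd da]])
  have i1: "(\<lambda>s. cis (\<phi> s) * a s) integrable_on {l..u}"
    by (intro integrable_continuous_real continuous_intros c\<phi> ca)
  have i2: "(\<lambda>s. J s * a' s) integrable_on {l..u}"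
  proof -
    have "(\<lambda>s. (J s * a' s + cis (\<phi> s) * a s) - cis (\<phi> s) * a s) integrable_on {l..u}"
      by (intro integrable_diff i1) (use main in blast)
    then show ?thesis by simp
  qed
  have bI: "(b' has_integral (b u - b l)) {l..u}"
    by (rule fundamental_theorem_of_calculus[OF lu]) (use db in \<open>auto simp: has_real_derivative_iff_has_vector_derivative\<close>)
  have "norm (integral {l..u} (\<lambda>s. J s * a' s)) \<le> integral {l..u} (\<lambda>s. 10 / \<mu> * b' s)"
  proof (rule integral_norm_bound_integral[OF i2])
    show "norm (J s * a' s) \<le> 10 / \<mu> * b' s" if "s \<in> {l..u}" for s
      unfolding norm_mult using J[OF that] ab[OF that] \<mu> by (intro mult_mono) auto
  qed (use bI integrable_on_cmult_left[of b' "{l..u}" "10 / \<mu>"] in auto)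
  also have "\<dots> = 10 / \<mu> * (b u - b l)" using integral_unique[OF bI] by simp
  finally have "norm (integral {l..u} (\<lambda>s. J s * a' s)) \<le> 10 / \<mu> * (b u - b l)" .
  moreover have "integral {l..u} (\<lambda>s. cis (\<phi> s) * a s) = J u * a u - integral {l..u} (\<lambda>s. J s * a' s)"
    using integral_unique[OF main] integral_add[OF i2 i1] by (simp add: J_def algebra_simps)
  moreover have "norm (J u * a u) \<le> 10 / \<mu> * norm (a u)"
    unfolding norm_mult using J[of u] lu by (intro mult_right_mono) auto
  ultimately show ?thesis
    using norm_triangle_ineq4[of "J u * a u" "integral {l..u} (\<lambda>s. J s * a' s)"] by (simp add: distrib_left)
qed

section \<open>Powers in a sector\<close>

text \<open>For an angle below pi the principal logarithm is ln \<rho> + i \<theta>. The multiplied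
  angle a \<theta> is under no such restriction, since only \<open>exp\<close> is applied to
  it.\<close>

lemma powr_of_real_cis:
  assumes "\<rho> > 0" "\<bar>\<theta>\<bar> < pi"
  shows "(of_real \<rho> * cis \<theta>) powr (of_real a) = of_real (\<rho> powr a) * cis (a * \<theta>)"
proof -
  have "of_real \<rho> * cis \<theta> = exp (of_real (ln \<rho>) + \<i> * of_real \<theta>)"
    using assms(1) by (simp add: exp_add cis_conv_exp exp_of_real)
  then have "Ln (of_real \<rho> * cis \<theta>) = of_real (ln \<rho>) + \<i> * of_real \<theta>"
    using assms by (simp add: Ln_exp abs_less_iff)
  moreover have "of_real \<rho> * cis \<theta> \<noteq> 0" using assms by (simp add: cis_neq_zero)
  ultimately have "(of_real \<rho> * cis \<theta>) powr (of_real a) = exp (of_real a * (of_real (ln \<rho>) + \<i> * of_real \<theta>))"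
    by (simp add: powr_def)
  also have "\<dots> = exp (of_real (a * ln \<rho>)) * exp (\<i> * of_real (a * \<theta>))"
    by (simp add: exp_add[symmetric] distrib_left mult_ac)
  also have "\<dots> = of_real (\<rho> powr a) * cis (a * \<theta>)"
    using assms(1) by (simp add: exp_of_real powr_def cis_conv_exp mult_ac del: of_real_mult)
  finally show ?thesis .
qed

lemma norm_powr_of_real: "norm (z powr complex_of_real b) = norm z powr b"
  by (subst norm_powr_real_powr') auto

lemma sin_ge_half:
  assumes "0 \<le> x" "x \<le> pi / 4"
  shows "sin x \<ge> x / 2"
proof -
  have "(\<lambda>t. sin t - t / 2) 0 \<le> (\<lambda>t. sin t - t / 2) x"
  proof (rule DERIV_nonneg_imp_nondecreasing[OF assms(1)])
    fix t assume t: "0 \<le> t" "t \<le> x"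
    have "cos (pi / 3) \<le> cos t" using t assms by (intro cos_monotone_0_pi_le) auto
    then have "cos t - 1/2 \<ge> 0" by (simp add: cos_60)
    then show "\<exists>y. ((\<lambda>t. sin t - t / 2) has_real_derivative y) (at t) \<and> 0 \<le> y"
      by (intro exI[of _ "cos t - 1/2"]) (auto intro!: derivative_eq_intros)
  qed
  then show ?thesis by simp
qed

text \<open>Allows the modulus of a sum of two sector elements to be replaced by the sum of the
  moduli inside a power, whatever the sign of the exponent.\<close>

lemma powr_comparable:
  fixes \<rho> y b :: real
  assumes "y > 0" "y / 2 \<le> \<rho>" "\<rho> \<le> y"
  shows "\<rho> powr b \<le> 2 powr \<bar>b\<bar> * y powr b" "2 powr (-\<bar>b\<bar>) * y powr b \<le> \<rho> powr b"
proof -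
  have one: "1 \<le> 2 powr \<bar>b\<bar>" by (simp add: ge_one_powr_ge_zero)
  have inv: "2 powr (-\<bar>b\<bar>) \<le> (1::real)" using powr_mono[of "-\<bar>b\<bar>" 0 2] by simp
  have rho: "\<rho> > 0" using assms by linarith
  show "\<rho> powr b \<le> 2 powr \<bar>b\<bar> * y powr b"
  proof (cases "b \<ge> 0")
    case True
    then have "\<rho> powr b \<le> 1 * y powr b" using assms rho by (simp add: powr_mono2)
    also have "\<dots> \<le> 2 powr \<bar>b\<bar> * y powr b" using one by (intro mult_right_mono) auto
    finally show ?thesis .
  next
    case False
    then have "\<rho> powr b \<le> (y/2) powr b" using assms by (intro powr_mono2') auto
    also have "\<dots> = 2 powr \<bar>b\<bar> * y powr b" using False assms by (simp add: powr_divide powr_minus field_simps abs_if)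
    finally show ?thesis .
  qed
  show "2 powr (-\<bar>b\<bar>) * y powr b \<le> \<rho> powr b"
  proof (cases "b \<ge> 0")
    case False
    have "2 powr (-\<bar>b\<bar>) * y powr b \<le> 1 * y powr b" using inv by (intro mult_right_mono) auto
    also have "\<dots> \<le> \<rho> powr b" using False assms rho by (simp add: powr_mono2')
    finally show ?thesis .
  next
    case True
    have "2 powr (-\<bar>b\<bar>) * y powr b = (y/2) powr b" using True assms by (simp add: powr_divide powr_minus field_simps abs_if)
    also have "\<dots> \<le> \<rho> powr b" using assms True by (intro powr_mono2) auto
    finally show ?thesis .
  qed
qed

section \<open>The rotation angle and the sector of rotated squares\<close>

locale dispersive_angle =
  fixes \<alpha> T \<psi> :: real
  assumes \<alpha>: "\<alpha> > 1/2" and T: "T > 0" and \<psi>: "\<psi> = pi / (8 * (1 + \<alpha>))"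
begin

text \<open>The choice of \<psi> means \<open>8 * \<psi> + 8 * \<alpha> * \<psi> = pi\<close>. Hence
  the angle \<open>2 * \<psi>\<close> of a rotated square and the angle
  \<open>2 * \<alpha> * \<psi>\<close> of its power \<alpha> both stay within pi / 4, where sines
  are positive and cosines bounded below.\<close>

lemma angle_facts: "\<psi> > 0" "2 * \<psi> \<le> pi / 4" "2 * \<alpha> * \<psi> \<le> pi / 4" "\<psi> < pi / 4"
proof -
  show "\<psi> > 0" using \<alpha> by (simp add: \<psi>)
  have "8 * (1 + \<alpha>) * \<psi> = pi" using \<alpha> by (simp add: \<psi>)
  then have "8 * \<psi> + 8 * (\<alpha> * \<psi>) = pi" by (simp add: algebra_simps)
  moreover have "\<alpha> * \<psi> > 0" using \<alpha> \<open>\<psi> > 0\<close> by simp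
  ultimately show "2 * \<psi> \<le> pi / 4" "2 * \<alpha> * \<psi> \<le> pi / 4" "\<psi> < pi / 4"
    using \<open>\<psi> > 0\<close> by (simp_all add: mult.assoc)
qed

text \<open>The nonzero complex numbers with argument in [- 2\<psi>, 0]. The Cartesian description
  makes closure under addition immediate; \<open>sector_polar\<close> and \<open>sectorE\<close>
  translate to polar form, where powers are computed.\<close>

definition sector :: "complex set" where
  "sector = {z. Re z > 0 \<and> Im z \<le> 0 \<and> - Im z \<le> tan (2 * \<psi>) * Re z}"

lemma tan_2psi_pos: "tan (2 * \<psi>) > 0"
  using angle_facts by (intro tan_gt_zero) auto

lemma sector_add: "z \<in> sector \<Longrightarrow> w \<in> sector \<Longrightarrow> z + w \<in> sector"
  by (auto simp: sector_def distrib_left)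

lemma sector_of_real: "s > 0 \<Longrightarrow> of_real s \<in> sector"
  using tan_2psi_pos by (auto simp: sector_def)

lemma sector_polar: 
  assumes "\<rho> > 0" "0 \<le> \<theta>" "\<theta> \<le> 2 * \<psi>"
  shows "of_real \<rho> * cis (- \<theta>) \<in> sector"
proof -
  have c: "cos \<theta> > 0" using assms angle_facts by (intro cos_gt_zero_pi) auto
  moreover have "sin \<theta> \<ge> 0" using assms angle_facts by (intro sin_ge_zero) auto
  moreover have "tan \<theta> \<le> tan (2 * \<psi>)"
    using assms angle_facts by (intro tan_mono_le) auto
  then have "tan \<theta> * cos \<theta> \<le> tan (2 * \<psi>) * cos \<theta>" using c by (intro mult_right_mono) auto
  then have "sin \<theta> \<le> tan (2 * \<psi>) * cos \<theta>" using c by (simp add: tan_def)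
  then have "\<rho> * sin \<theta> \<le> tan (2 * \<psi>) * (\<rho> * cos \<theta>)"
    using assms mult_left_mono[of "sin \<theta>" "tan (2 * \<psi>) * cos \<theta>" \<rho>] by (simp add: mult_ac)
  ultimately show ?thesis using assms by (simp add: sector_def)
qed

lemma sectorE:
  assumes "z \<in> sector"
  obtains \<theta> where "0 \<le> \<theta>" "\<theta> \<le> 2 * \<psi>" "z = of_real (norm z) * cis (- \<theta>)" "norm z > 0"
proof
  have z: "Re z > 0" "Im z \<le> 0" "- Im z \<le> tan (2 * \<psi>) * Re z" using assms by (auto simp: sector_def)
  show "norm z > 0" using z by auto
  have A: "Arg z = arctan (Im z / Re z)" using z by (simp add: arg_conv_arctan)
  show "0 \<le> - Arg z" unfolding A using z by (simp add: divide_nonpos_pos)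
  have "- Arg z = arctan (- Im z / Re z)" unfolding A by (simp add: arctan_minus[symmetric])
  also have "\<dots> \<le> arctan (tan (2 * \<psi>))" using z by (simp only: arctan_le_iff pos_divide_le_eq)
  also have "\<dots> = 2 * \<psi>" using angle_facts by (intro arctan_tan) auto
  finally show "- Arg z \<le> 2 * \<psi>" .
  show "z = of_real (norm z) * cis (- (- Arg z))"
    using rcis_cmod_Arg[of z] by (simp add: rcis_def)
qed

text \<open>With z of argument - \<theta> the real part is \<open>norm z powr \<alpha> * (\<epsilon>
  * cos (\<alpha> * \<theta>) + T * sin (\<alpha> * \<theta>))\<close>. The \<epsilon> term is
  nonnegative and is dropped, so the decay is uniform in \<epsilon>: the factor
  \<open>\<i> * T\<close> converts negative imaginary part into positive real part. The sine is
  compared through \<open>sin (\<alpha> * \<theta>) \<ge> \<alpha> * \<theta> / 2 \<ge> \<alpha> / 2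
  * sin \<theta>\<close>.\<close>

lemma Re_zeta_powr_ge:
  assumes z: "z \<in> sector" and \<epsilon>: "\<epsilon> \<ge> 0"
  shows "Re (Complex \<epsilon> T * z powr of_real \<alpha>) \<ge> T * \<alpha> / 2 * norm z powr (\<alpha> - 1) * (- Im z)"
proof -
  obtain \<theta> where \<theta>: "0 \<le> \<theta>" "\<theta> \<le> 2 * \<psi>" "z = of_real (norm z) * cis (- \<theta>)" "norm z > 0"
    using sectorE[OF z] by blast
  have a\<theta>: "0 \<le> \<alpha> * \<theta>" "\<alpha> * \<theta> \<le> pi / 4"
  proof -
    show "0 \<le> \<alpha> * \<theta>" using \<alpha> \<theta> by simp
    have "\<alpha> * \<theta> \<le> \<alpha> * (2 * \<psi>)" using \<alpha> \<theta> by (intro mult_left_mono) auto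
    then show "\<alpha> * \<theta> \<le> pi / 4" using angle_facts(3) by (simp add: mult_ac)
  qed
  have "z powr of_real \<alpha> = of_real (norm z powr \<alpha>) * cis (\<alpha> * (- \<theta>))"
    using \<theta> angle_facts by (subst \<theta>(3), subst powr_of_real_cis) auto
  then have "Re (Complex \<epsilon> T * z powr of_real \<alpha>) = norm z powr \<alpha> * (\<epsilon> * cos (\<alpha> * \<theta>) + T * sin (\<alpha> * \<theta>))"
    by (simp add: algebra_simps)
  also have "\<dots> \<ge> norm z powr \<alpha> * (T * (\<alpha> / 2 * sin \<theta>))"
  proof (intro mult_left_mono)
    have "sin (\<alpha> * \<theta>) \<ge> \<alpha> * \<theta> / 2" using a\<theta> by (rule sin_ge_half)
    moreover have "\<alpha> * sin \<theta> \<le> \<alpha> * \<theta>" using \<alpha> \<theta> sin_x_le_x[of \<theta>] by (intro mult_left_mono) auto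
    ultimately have "T * (\<alpha> / 2 * sin \<theta>) \<le> T * sin (\<alpha> * \<theta>)" using T by (intro mult_left_mono) auto
    moreover have "cos (\<alpha> * \<theta>) \<ge> 0" using a\<theta> by (intro cos_ge_zero) auto
    ultimately show "T * (\<alpha> / 2 * sin \<theta>) \<le> \<epsilon> * cos (\<alpha> * \<theta>) + T * sin (\<alpha> * \<theta>)" 
      using \<epsilon> by (simp add: add_increasing)
  qed auto
  also have "norm z powr \<alpha> * (T * (\<alpha> / 2 * sin \<theta>)) = T * \<alpha> / 2 * norm z powr (\<alpha> - 1) * (norm z * sin \<theta>)"
    using \<theta>(4) by (simp add: powr_diff)
  also have "norm z * sin \<theta> = - Im z" using arg_cong[OF \<theta>(3), of Im] by simp
  finally show ?thesis .
qed

text \<open>In polar form along a line \<open>\<xi> = s e + \<eta>\<close> with \<open>\<eta>\<close> orthogonal to \<open>e\<close> of length \<open>r\<close>, rotating all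
  coordinates by \<open>cis (- \<psi>)\<close> turns \<open>(norm \<xi>)\<^sup>2\<close> into \<open>p\<^sup>2 + W r\<close> where \<open>p = s cis (- \<psi>)\<close>.\<close>

definition W :: "real \<Rightarrow> complex" where "W r = of_real (r\<^sup>2) * cis (- (2 * \<psi>))"

lemma sector_add_scaled_W: "s > 0 \<Longrightarrow> u \<ge> 0 \<Longrightarrow> of_real s + of_real u * W r \<in> sector"
proof (cases "u * r\<^sup>2 = 0")
  case True then show "s > 0 \<Longrightarrow> ?thesis" by (auto simp: W_def sector_of_real)
next
  case False
  then show "s > 0 \<Longrightarrow> u \<ge> 0 \<Longrightarrow> ?thesis"
    using sector_polar[of "u * r\<^sup>2" "2 * \<psi>"] angle_facts
    by (intro sector_add sector_of_real) (auto simp: W_def mult.assoc zero_less_mult_iff)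
qed

lemma norm_W: "norm (W r) = r\<^sup>2"
  by (simp add: W_def norm_mult norm_power)

lemma cos_2psi_ge: "cos (2 * \<psi>) \<ge> 1/2"
  using cos_monotone_0_pi_le[of "2 * \<psi>" "pi / 3"] angle_facts by (simp add: cos_60)

lemma norm_add_scaled_W:
  assumes "s \<ge> 0" "u \<ge> 0"
  shows "norm (of_real s + of_real u * W r) \<le> s + u * r\<^sup>2" "norm (of_real s + of_real u * W r) \<ge> (s + u * r\<^sup>2) / 2"
proof -
  show "norm (of_real s + of_real u * W r) \<le> s + u * r\<^sup>2"
    using norm_triangle_ineq[of "of_real s" "of_real u * W r"] assms
    by (auto simp: W_def norm_mult abs_of_nonneg norm_power)
  have "(s + u * r\<^sup>2) / 2 \<le> s + u * r\<^sup>2 * cos (2 * \<psi>)"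
    using cos_2psi_ge assms mult_left_mono[of "1/2" "cos (2*\<psi>)" "u * r\<^sup>2"] by simp
  also have "\<dots> = Re (of_real s + of_real u * W r)" by (simp add: W_def)
  also have "\<dots> \<le> norm (of_real s + of_real u * W r)" by (rule complex_Re_le_cmod)
  finally show "norm (of_real s + of_real u * W r) \<ge> (s + u * r\<^sup>2) / 2" .
qed

lemma sector_nonpos: "z \<in> sector \<Longrightarrow> z \<notin> \<real>\<^sub>\<le>\<^sub>0"
  by (auto simp: sector_def complex_nonpos_Reals_iff)

lemma powr_add_scaled_W_deriv:
  assumes "s > 0" "u \<ge> 0"
  shows "((\<lambda>u. (of_real s + of_real u * W r) powr of_real b) has_vector_derivative
     of_real b * (of_real s + of_real u * W r) powr of_real (b - 1) * W r) (at u within S)"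
proof -
  have "((\<lambda>w. (of_real s + w * W r) powr of_real b) has_field_derivative
     of_real b * (of_real s + of_real u * W r) powr of_real (b - 1) * W r) (at (of_real u))"
    using sector_nonpos[OF sector_add_scaled_W[OF assms]]
    by (auto intro!: derivative_eq_intros)
  from has_vector_derivative_real_field[OF this] show ?thesis by (simp add: has_vector_derivative_at_within)
qed

lemma real_powr_deriv:
  assumes "s > 0" "u \<ge> 0"
  shows "((\<lambda>u. (s + u * r\<^sup>2) powr b) has_real_derivative
     b * (s + u * r\<^sup>2) powr (b - 1) * r\<^sup>2) (at u within S)"
proof -
  have "s + u * r\<^sup>2 > 0" using assms by (simp add: add_pos_nonneg)
  then show ?thesis by (auto intro!: derivative_eq_intros simp: powr_diff)
qed

text \<open>The argument of \<open>z powr (\<alpha> - 1) * W r\<close> for z in the sector is -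
  \<beta> with \<beta> between \<open>2 * \<psi> * min 1 \<alpha>\<close> and pi / 4, which gives
  the sine; the power of 2 is the loss from \<open>powr_comparable\<close>.\<close>

definition \<kappa>0 :: real where "\<kappa>0 = T * sin (2 * \<psi> * min 1 \<alpha>) * 2 powr (- \<bar>\<alpha> - 1\<bar>)"

lemma sin_min_pos: "sin (2 * \<psi> * min 1 \<alpha>) > 0"
  using angle_facts \<alpha> by (intro sin_gt_zero) (auto simp: min_def mult_ac)

lemma kappa0_pos: "\<kappa>0 > 0"
  using sin_min_pos T by (simp add: \<kappa>0_def)

text \<open>Both sides vanish when W is replaced by 0, so it suffices to compare derivatives in u
  along \<open>s + u * W r\<close>. There \<open>\<alpha> * z powr (\<alpha> - 1) * W r\<close> has
  its argument in a fixed range below the real axis, so multiplication by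
  \<open>Complex \<epsilon> T\<close> makes its real part comparable to the real derivative of
  \<open>(s + u * r\<^sup>2) powr \<alpha>\<close>.\<close>

lemma Re_zeta_E_ge:
  assumes s: "s > 0" and \<epsilon>: "\<epsilon> \<ge> 0"
  shows "Re (Complex \<epsilon> T * ((of_real s + W r) powr of_real \<alpha> - of_real (s powr \<alpha>))) \<ge> \<kappa>0 * ((s + r\<^sup>2) powr \<alpha> - s powr \<alpha>)"
proof -
  define f where "f u = Re (Complex \<epsilon> T * (of_real s + of_real u * W r) powr of_real \<alpha>) - \<kappa>0 * (s + u * r\<^sup>2) powr \<alpha>" for u
  have "f 0 \<le> f 1"
  proof (rule DERIV_nonneg_imp_nondecreasing[where f = f and a = 0 and b = 1])
    fix u :: real assume u: "0 \<le> u" "u \<le> 1"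
    define z where "z = of_real s + of_real u * W r"
    have zs: "z \<in> sector" unfolding z_def using s u by (intro sector_add_scaled_W) auto
    obtain \<theta> where \<theta>: "0 \<le> \<theta>" "\<theta> \<le> 2 * \<psi>" "z = of_real (norm z) * cis (- \<theta>)" "norm z > 0"
      using sectorE[OF zs] by blast
    define \<beta> where "\<beta> = (\<alpha> - 1) * \<theta> + 2 * \<psi>"
    have b: "2 * \<psi> * min 1 \<alpha> \<le> \<beta>" "\<beta> \<le> pi / 4"
    proof -
      show "2 * \<psi> * min 1 \<alpha> \<le> \<beta>"
      proof (cases "\<alpha> \<ge> 1")
        case False
        then have "(1 - \<alpha>) * \<theta> \<le> (1 - \<alpha>) * (2 * \<psi>)" using \<theta> by (intro mult_left_mono) auto
        then show ?thesis using False by (simp add: \<beta>_def min_def algebra_simps)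
      qed (use \<theta> in \<open>simp add: \<beta>_def\<close>)
      show "\<beta> \<le> pi / 4"
      proof (cases "\<alpha> \<ge> 1")
        case True
        then have "(\<alpha> - 1) * \<theta> \<le> (\<alpha> - 1) * (2 * \<psi>)" using \<theta> by (intro mult_left_mono) auto
        then show ?thesis using angle_facts by (simp add: \<beta>_def algebra_simps)
      next
        case False
        then have "(\<alpha> - 1) * \<theta> \<le> 0" using \<theta> by (intro mult_nonpos_nonneg) auto
        then show ?thesis using angle_facts by (simp add: \<beta>_def)
      qed
    qed
    have b0: "2 * \<psi> * min 1 \<alpha> > 0" using angle_facts \<alpha> by simp
    have sb: "sin (2 * \<psi> * min 1 \<alpha>) \<le> sin \<beta>"
      using b b0 pi_gt_zero by (intro sin_monotone_2pi_le) auto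
    have cb: "cos \<beta> \<ge> 0" using b b0 by (intro cos_ge_zero) auto
    have y: "s + u * r\<^sup>2 > 0" using s u by (simp add: add_pos_nonneg)
    have nz: "2 powr (- \<bar>\<alpha> - 1\<bar>) * (s + u * r\<^sup>2) powr (\<alpha> - 1) \<le> norm z powr (\<alpha> - 1)"
      using norm_add_scaled_W[of s u r] s u y by (intro powr_comparable) (auto simp: z_def)
    have "z powr of_real (\<alpha> - 1) = of_real (norm z powr (\<alpha> - 1)) * cis ((\<alpha> - 1) * (- \<theta>))"
      using \<theta> angle_facts by (subst \<theta>(3), subst powr_of_real_cis) auto
    then have "z powr of_real (\<alpha> - 1) * W r = of_real (norm z powr (\<alpha> - 1) * r\<^sup>2) * cis (- \<beta>)"
      by (simp add: W_def \<beta>_def cis_mult mult_ac algebra_simps)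
    then have R: "Re (Complex \<epsilon> T * (of_real \<alpha> * z powr of_real (\<alpha> - 1) * W r)) = \<alpha> * (norm z powr (\<alpha> - 1) * r\<^sup>2 * (\<epsilon> * cos \<beta> + T * sin \<beta>))"
      by (simp add: mult.assoc algebra_simps)
    have "\<kappa>0 * (s + u * r\<^sup>2) powr (\<alpha> - 1) \<le> norm z powr (\<alpha> - 1) * (T * sin (2 * \<psi> * min 1 \<alpha>))"
      using mult_right_mono[OF nz, of "T * sin (2 * \<psi> * min 1 \<alpha>)"] sin_min_pos T by (simp add: \<kappa>0_def mult_ac)
    also have "\<dots> \<le> norm z powr (\<alpha> - 1) * (\<epsilon> * cos \<beta> + T * sin \<beta>)"
      using sb T cb \<epsilon> by (intro mult_left_mono add_increasing) auto
    finally have "\<alpha> * r\<^sup>2 * (\<kappa>0 * (s + u * r\<^sup>2) powr (\<alpha> - 1)) \<le> \<alpha> * r\<^sup>2 * (norm z powr (\<alpha> - 1) * (\<epsilon> * cos \<beta> + T * sin \<beta>))"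
      using \<alpha> by (intro mult_left_mono) auto
    moreover have "(f has_real_derivative
        Re (Complex \<epsilon> T * (of_real \<alpha> * z powr of_real (\<alpha> - 1) * W r)) - \<kappa>0 * (\<alpha> * (s + u * r\<^sup>2) powr (\<alpha> - 1) * r\<^sup>2)) (at u)"
      unfolding f_def z_def has_real_derivative_iff_has_vector_derivative using s u
      by (intro has_vector_derivative_diff has_vector_derivative_mult_right powr_add_scaled_W_deriv
          real_powr_deriv[unfolded has_real_derivative_iff_has_vector_derivative]
          bounded_linear.has_vector_derivative[OF bounded_linear_Re]) auto
    moreover have "0 \<le> Re (Complex \<epsilon> T * (of_real \<alpha> * z powr of_real (\<alpha> - 1) * W r)) - \<kappa>0 * (\<alpha> * (s + u * r\<^sup>2) powr (\<alpha> - 1) * r\<^sup>2)"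
      unfolding R using calculation(1) by (simp add: mult_ac)
    ultimately show "\<exists>y. (f has_real_derivative y) (at u) \<and> 0 \<le> y" by blast
  qed auto
  moreover have "of_real s powr complex_of_real \<alpha> = of_real (s powr \<alpha>)" using s by (simp add: powr_of_real)
  ultimately show ?thesis by (simp add: f_def right_diff_distrib)
qed

text \<open>The same interpolation in u, now for the exponent \<alpha> - 1. The sign \<sigma> turns
  \<open>(s + u * r\<^sup>2) powr (\<alpha> - 1)\<close> into a nondecreasing function of u, so that
  the increment of the complex power is majorised by a real increment. This controls the derivative
  of the amplitude in the oscillatory integral.\<close>

lemma norm_E'_le:
  assumes s: "s > 0"
  shows "norm ((of_real s + W r) powr of_real (\<alpha> - 1) - of_real (s powr (\<alpha> - 1)))
    \<le> 2 powr \<bar>\<alpha> - 2\<bar> * \<bar>(s + r\<^sup>2) powr (\<alpha> - 1) - s powr (\<alpha> - 1)\<bar>"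
proof -
  define \<sigma> :: real where "\<sigma> = sgn (\<alpha> - 1)"
  have "norm ((of_real s + of_real 1 * W r) powr of_real (\<alpha> - 1) - (of_real s + of_real 0 * W r) powr of_real (\<alpha> - 1))
    \<le> 2 powr \<bar>\<alpha> - 2\<bar> * \<sigma> * (s + 1 * r\<^sup>2) powr (\<alpha> - 1) - 2 powr \<bar>\<alpha> - 2\<bar> * \<sigma> * (s + 0 * r\<^sup>2) powr (\<alpha> - 1)"
  proof (rule differentiable_bound_general[of 0 1])
    show "continuous_on {0..1} (\<lambda>u. (of_real s + of_real u * W r) powr of_real (\<alpha> - 1))"
      by (rule continuous_on_vector_derivative, rule powr_add_scaled_W_deriv) (use s in auto)
    show "continuous_on {0..1} (\<lambda>u. 2 powr \<bar>\<alpha> - 2\<bar> * \<sigma> * (s + u * r\<^sup>2) powr (\<alpha> - 1))"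
      by (intro continuous_on_mult continuous_on_const, rule DERIV_continuous_on, rule real_powr_deriv) (use s in auto)
    fix u :: real assume u: "0 < u" "u < 1"
    have y: "s + u * r\<^sup>2 > 0" using s u by (simp add: add_pos_nonneg)
    show "((\<lambda>u. (of_real s + of_real u * W r) powr of_real (\<alpha> - 1)) has_vector_derivative
        of_real (\<alpha> - 1) * (of_real s + of_real u * W r) powr of_real (\<alpha> - 1 - 1) * W r) (at u)"
      using s u by (intro powr_add_scaled_W_deriv) auto
    show "((\<lambda>u. 2 powr \<bar>\<alpha> - 2\<bar> * \<sigma> * (s + u * r\<^sup>2) powr (\<alpha> - 1)) has_vector_derivative
       2 powr \<bar>\<alpha> - 2\<bar> * \<sigma> * ((\<alpha> - 1) * (s + u * r\<^sup>2) powr (\<alpha> - 1 - 1) * r\<^sup>2)) (at u)"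
      using s u by (intro has_vector_derivative_mult_right real_powr_deriv[unfolded has_real_derivative_iff_has_vector_derivative]) auto
    have "norm (of_real s + of_real u * W r) powr (\<alpha> - 2) \<le> 2 powr \<bar>\<alpha> - 2\<bar> * (s + u * r\<^sup>2) powr (\<alpha> - 2)"
      using norm_add_scaled_W[of s u r] s u y by (intro powr_comparable) auto
    then have "\<bar>\<alpha> - 1\<bar> * norm (of_real s + of_real u * W r) powr (\<alpha> - 2) * r\<^sup>2 \<le> \<bar>\<alpha> - 1\<bar> * (2 powr \<bar>\<alpha> - 2\<bar> * (s + u * r\<^sup>2) powr (\<alpha> - 2)) * r\<^sup>2"
      by (intro mult_right_mono mult_left_mono) auto
    moreover have "norm (of_real (\<alpha> - 1) * (of_real s + of_real u * W r) powr of_real (\<alpha> - 1 - 1) * W r) = 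
      \<bar>\<alpha> - 1\<bar> * norm (of_real s + of_real u * W r) powr (\<alpha> - 2) * r\<^sup>2"
      by (simp only: norm_mult norm_powr_of_real norm_W norm_of_real diff_diff_eq one_add_one)
    moreover have "\<sigma> * (\<alpha> - 1) = \<bar>\<alpha> - 1\<bar>" by (simp add: \<sigma>_def abs_sgn mult.commute)
    then have "2 powr \<bar>\<alpha> - 2\<bar> * \<sigma> * ((\<alpha> - 1) * (s + u * r\<^sup>2) powr (\<alpha> - 1 - 1) * r\<^sup>2)
       = \<bar>\<alpha> - 1\<bar> * (2 powr \<bar>\<alpha> - 2\<bar> * (s + u * r\<^sup>2) powr (\<alpha> - 2)) * r\<^sup>2"
    proof -
      assume sg: "\<sigma> * (\<alpha> - 1) = \<bar>\<alpha> - 1\<bar>"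
      have e: "\<alpha> - 1 - 1 = \<alpha> - 2" by simp
      show ?thesis unfolding e sg[symmetric] by (simp only: mult_ac)
    qed
    ultimately show "norm (of_real (\<alpha> - 1) * (of_real s + of_real u * W r) powr of_real (\<alpha> - 1 - 1) * W r)
       \<le> 2 powr \<bar>\<alpha> - 2\<bar> * \<sigma> * ((\<alpha> - 1) * (s + u * r\<^sup>2) powr (\<alpha> - 1 - 1) * r\<^sup>2)" by (simp only:)
  qed auto
  also have "\<dots> = 2 powr \<bar>\<alpha> - 2\<bar> * (\<sigma> * ((s + r\<^sup>2) powr (\<alpha> - 1) - s powr (\<alpha> - 1)))"
    by (simp add: algebra_simps)
  also have "\<dots> \<le> 2 powr \<bar>\<alpha> - 2\<bar> * \<bar>(s + r\<^sup>2) powr (\<alpha> - 1) - s powr (\<alpha> - 1)\<bar>"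
    by (intro mult_left_mono) (auto simp: \<sigma>_def sgn_if)
  finally show ?thesis using s by (simp add: powr_of_real flip: of_real_diff)
qed

end

section \<open>Stationary phase on the real axis with transversal decay\<close>

lemma powr_ge_minus1: fixes x p q :: real assumes "x \<ge> 0" "0 \<le> p" "p \<le> q" shows "x powr p - 1 \<le> x powr q"
proof (cases "x \<le> 1")
  case True
  then have "x powr p \<le> 1" using assms by (simp add: powr_le1)
  then show ?thesis using powr_ge_zero[of x q] by linarith
next
  case False
  then have "x powr p \<le> x powr q" using assms by (intro powr_mono) auto
  then show ?thesis by linarith
qed

lemma half_minus_le: "R \<le> Q \<Longrightarrow> 0 \<le> R \<Longrightarrow> (R - 1) / 2 \<le> (Q::real)"
  by simp

lemma powr_minus1_mult: fixes y a :: real assumes "y > 0" shows "y powr (a - 1) * y = y powr a"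
  using assms by (simp add: powr_diff)

lemma powr_square: fixes x a :: real assumes "x \<ge> 0" shows "(x\<^sup>2) powr a = x powr (2 * a)"
proof (cases "x = 0")
  case False
  then have "x\<^sup>2 = x powr 2" using assms by (simp add: powr_numeral)
  then show ?thesis by (simp only: powr_powr)
qed auto

context dispersive_angle begin

text \<open>The phase \<open>m * s - T * s powr (2 * \<alpha>)\<close> has second derivative
  \<open>- \<mu>0\<^sup>2 * s powr (2 * \<alpha> - 2)\<close>; positivity of the radicand is where
  \<alpha> > 1/2 enters.\<close>

definition \<mu>0 :: real where "\<mu>0 = sqrt (2 * \<alpha> * (2 * \<alpha> - 1) * T)"

lemma mu0_pos: "\<mu>0 > 0" using \<alpha> T by (simp add: \<mu>0_def)

text \<open>The width of the stationary phase region at frequency \<open>X\<close>: the second derivative of the phase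
  has size \<open>X powr (2\<alpha> - 2)\<close>.\<close>

definition growth :: "real \<Rightarrow> real" where "growth X = (if \<alpha> \<ge> 1 then 1 else X powr (1 - \<alpha>))"

lemma growth_ge1: "X \<ge> 1 \<Longrightarrow> growth X \<ge> 1"
  by (auto simp: growth_def ge_one_powr_ge_zero)

lemma transversal_power_ge:
  assumes X: "X \<ge> 1" and r: "r \<ge> 0"
  shows "(X\<^sup>2 + r\<^sup>2) powr (\<alpha> - 1) * r\<^sup>2 \<ge> ((r / growth X) powr (2 * \<alpha>) - 1) / 2"
proof (cases "r = 0")
  case False
  then have r: "r > 0" using r by simp
  have rp: "r powr (2 * (\<alpha> - 1)) * r\<^sup>2 = r powr (2 * \<alpha>)"
    using r by (simp add: powr_diff powr_numeral right_diff_distrib)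
  show ?thesis
  proof (cases "\<alpha> \<ge> 1")
    case True
    have "(r\<^sup>2) powr (\<alpha> - 1) * r\<^sup>2 \<le> (X\<^sup>2 + r\<^sup>2) powr (\<alpha> - 1) * r\<^sup>2"
      using True by (intro mult_right_mono powr_mono2) auto
    then have "r powr (2 * \<alpha>) \<le> (X\<^sup>2 + r\<^sup>2) powr (\<alpha> - 1) * r\<^sup>2"
      using powr_minus1_mult[of "r\<^sup>2" \<alpha>] powr_square[of r \<alpha>] r by simp
    moreover have "r powr (2 * \<alpha>) \<ge> 0" by simp
    ultimately have "(r powr (2 * \<alpha>) - 1) / 2 \<le> (X\<^sup>2 + r\<^sup>2) powr (\<alpha> - 1) * r\<^sup>2" by (rule half_minus_le)
    then show ?thesis using True by (simp add: growth_def)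
  next
    case False
    define Y where "Y = growth X"
    have Y1: "Y \<ge> 1" using growth_ge1[OF X] by (simp add: Y_def)
    have Y: "Y = X powr (1 - \<alpha>)" using False by (simp add: Y_def growth_def)
    have half: "(1::real) / 2 \<le> 2 powr (\<alpha> - 1)" using powr_mono[of "-1" "\<alpha> - 1" 2] \<alpha> by (simp add: powr_minus)
    show ?thesis unfolding Y_def[symmetric]
    proof (cases "r \<le> X")
      case True
      have "X\<^sup>2 + r\<^sup>2 \<le> 2 * X\<^sup>2" using True r by (simp add: power_mono)
      then have "(2 * X\<^sup>2) powr (\<alpha> - 1) \<le> (X\<^sup>2 + r\<^sup>2) powr (\<alpha> - 1)"
        using False X by (intro powr_mono2') (auto intro!: add_pos_nonneg)
      moreover have "(2 * X\<^sup>2) powr (\<alpha> - 1) = 2 powr (\<alpha> - 1) * (1 / Y\<^sup>2)"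
        using X by (simp add: powr_mult powr_square Y powr_minus[symmetric] inverse_eq_divide[symmetric] powr_power)
      ultimately have "1/2 * (1 / Y\<^sup>2) \<le> (X\<^sup>2 + r\<^sup>2) powr (\<alpha> - 1)"
        using half mult_right_mono[OF half, of "1 / Y\<^sup>2"] by simp
      then have "1/2 * (1 / Y\<^sup>2) * r\<^sup>2 \<le> (X\<^sup>2 + r\<^sup>2) powr (\<alpha> - 1) * r\<^sup>2" by (intro mult_right_mono) auto
      moreover have "1/2 * (1 / Y\<^sup>2) * r\<^sup>2 = (r / Y) powr 2 / 2" using r Y1 by (simp add: powr_numeral power_divide)
      moreover have "(r / Y) powr (2 * \<alpha>) - 1 \<le> (r / Y) powr 2" using r Y1 False \<alpha> by (intro powr_ge_minus1) auto
      ultimately show "((r / Y) powr (2 * \<alpha>) - 1) / 2 \<le> (X\<^sup>2 + r\<^sup>2) powr (\<alpha> - 1) * r\<^sup>2" by simp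
    next
      case rX: False
      have "X\<^sup>2 + r\<^sup>2 \<le> 2 * r\<^sup>2" using rX X by (simp add: power_mono)
      then have "(2 * r\<^sup>2) powr (\<alpha> - 1) \<le> (X\<^sup>2 + r\<^sup>2) powr (\<alpha> - 1)"
        using False X by (intro powr_mono2') (auto intro!: add_pos_nonneg)
      moreover have "(2 * r\<^sup>2) powr (\<alpha> - 1) = 2 powr (\<alpha> - 1) * r powr (2 * (\<alpha> - 1))"
        using r by (simp add: powr_mult powr_square)
      ultimately have "1/2 * r powr (2 * (\<alpha> - 1)) \<le> (X\<^sup>2 + r\<^sup>2) powr (\<alpha> - 1)"
        using mult_right_mono[OF half, of "r powr (2 * (\<alpha> - 1))"] by simp
      then have "1/2 * r powr (2 * (\<alpha> - 1)) * r\<^sup>2 \<le> (X\<^sup>2 + r\<^sup>2) powr (\<alpha> - 1) * r\<^sup>2" by (intro mult_right_mono) auto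
      then have "r powr (2 * \<alpha>) / 2 \<le> (X\<^sup>2 + r\<^sup>2) powr (\<alpha> - 1) * r\<^sup>2" using rp by simp
      moreover have "r / Y \<le> r / 1" using r Y1 by (intro divide_left_mono) auto
      then have "(r / Y) powr (2 * \<alpha>) \<le> r powr (2 * \<alpha>)" using r Y1 \<alpha> by (intro powr_mono2) auto
      ultimately show "((r / Y) powr (2 * \<alpha>) - 1) / 2 \<le> (X\<^sup>2 + r\<^sup>2) powr (\<alpha> - 1) * r\<^sup>2" by simp
    qed
  qed
qed (use \<alpha> in simp)

text \<open>The amount by which a transversal displacement r raises the exponent, uniformly over
  frequencies up to X. It is negative for small r, which later costs only a constant factor.\<close>

definition gain :: "real \<Rightarrow> real \<Rightarrow> real" where
  "gain X r = min 1 \<alpha> * ((r / growth X) powr (2 * \<alpha>) - 1) / 2"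

text \<open>For \<alpha> \<ge> 1 the power \<alpha> is superadditive. For \<alpha> < 1 it is
  concave, so its slope between \<open>s\<^sup>2\<close> and \<open>s\<^sup>2 + r\<^sup>2\<close> is
  at least the slope at \<open>X\<^sup>2 + r\<^sup>2\<close>, and
  \<open>transversal_power_ge\<close> applies there.\<close>

lemma gain_le:
  assumes s: "0 < s" "s \<le> X" and X: "X \<ge> 1" and r: "r \<ge> 0"
  shows "(s\<^sup>2 + r\<^sup>2) powr \<alpha> - (s\<^sup>2) powr \<alpha> \<ge> gain X r"
proof (cases "r = 0")
  case True
  then show ?thesis using \<alpha> by (simp add: gain_def)
next
  case False
  then have r: "r > 0" using r by simp
  have s2: "s\<^sup>2 > 0" using s by simp
  show ?thesis
  proof (cases "\<alpha> \<ge> 1")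
    case True
    have "(s\<^sup>2 + r\<^sup>2) powr \<alpha> = (s\<^sup>2 + r\<^sup>2) powr (\<alpha> - 1) * s\<^sup>2 + (s\<^sup>2 + r\<^sup>2) powr (\<alpha> - 1) * r\<^sup>2"
      using powr_minus1_mult[of "s\<^sup>2 + r\<^sup>2" \<alpha>] s2 by (simp add: distrib_left add_pos_nonneg)
    moreover have "(s\<^sup>2 + r\<^sup>2) powr (\<alpha> - 1) * s\<^sup>2 \<ge> (s\<^sup>2) powr (\<alpha> - 1) * s\<^sup>2"
      using True by (intro mult_right_mono powr_mono2) auto
    moreover have "(s\<^sup>2) powr (\<alpha> - 1) * s\<^sup>2 = (s\<^sup>2) powr \<alpha>" using s2 by (simp add: powr_diff)
    moreover have "(s\<^sup>2 + r\<^sup>2) powr (\<alpha> - 1) * r\<^sup>2 \<ge> (r\<^sup>2) powr (\<alpha> - 1) * r\<^sup>2"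
      using True by (intro mult_right_mono powr_mono2) auto
    moreover have "(r\<^sup>2) powr (\<alpha> - 1) * r\<^sup>2 = r powr (2 * \<alpha>)" using r by (simp add: powr_diff powr_square)
    ultimately have "r powr (2 * \<alpha>) \<le> (s\<^sup>2 + r\<^sup>2) powr \<alpha> - (s\<^sup>2) powr \<alpha>" by simp
    then have "(r powr (2 * \<alpha>) - 1) / 2 \<le> (s\<^sup>2 + r\<^sup>2) powr \<alpha> - (s\<^sup>2) powr \<alpha>" by (rule half_minus_le) simp
    moreover have "gain X r = (r powr (2 * \<alpha>) - 1) / 2" using True by (simp add: gain_def growth_def)
    ultimately show ?thesis by simp
  next
    case False
    obtain y where y: "s\<^sup>2 < y" "y < s\<^sup>2 + r\<^sup>2" "(s\<^sup>2 + r\<^sup>2) powr \<alpha> - (s\<^sup>2) powr \<alpha> = (s\<^sup>2 + r\<^sup>2 - s\<^sup>2) * (\<alpha> * y powr (\<alpha> - 1))"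
    proof -
      have D: "((\<lambda>y. y powr \<alpha>) has_real_derivative \<alpha> * x powr (\<alpha> - 1)) (at x)" if "s\<^sup>2 \<le> x" for x
      proof -
        have "x > 0" using that s2 by linarith
        then show ?thesis by (rule has_real_derivative_powr)
      qed
      show thesis
        using MVT2[of "s\<^sup>2" "s\<^sup>2 + r\<^sup>2" "\<lambda>y. y powr \<alpha>" "\<lambda>y. \<alpha> * y powr (\<alpha> - 1)", OF _ D] r that by auto
    qed
    have "s\<^sup>2 \<le> X\<^sup>2" using s by (intro power_mono) auto
    then have "(X\<^sup>2 + r\<^sup>2) powr (\<alpha> - 1) \<le> y powr (\<alpha> - 1)" using False y s2 less_trans[OF s2 y(1)] by (intro powr_mono2') (auto simp del: zero_less_power2)
    then have "\<alpha> * ((X\<^sup>2 + r\<^sup>2) powr (\<alpha> - 1) * r\<^sup>2) \<le> \<alpha> * (y powr (\<alpha> - 1) * r\<^sup>2)"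
      using \<alpha> by (intro mult_left_mono mult_right_mono) auto
    also have "\<dots> = (s\<^sup>2 + r\<^sup>2) powr \<alpha> - (s\<^sup>2) powr \<alpha>" using y by simp
    finally have "\<alpha> * ((X\<^sup>2 + r\<^sup>2) powr (\<alpha> - 1) * r\<^sup>2) \<le> (s\<^sup>2 + r\<^sup>2) powr \<alpha> - (s\<^sup>2) powr \<alpha>" .
    moreover have "\<alpha> * (((r / growth X) powr (2 * \<alpha>) - 1) / 2) \<le> \<alpha> * ((X\<^sup>2 + r\<^sup>2) powr (\<alpha> - 1) * r\<^sup>2)"
      using transversal_power_ge[OF X, of r] r \<alpha> by (intro mult_left_mono) auto
    ultimately show ?thesis using False by (simp add: gain_def min_def)
  qed
qed

text \<open>The integrand on one slice, continued analytically in the coordinate p along z: on the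
  ray p = s cis (- \<psi>) it is the fully rotated integrand, on the real axis only the transversal
  part \<open>W r\<close> remains rotated. Here m is the signed length of z.\<close>

definition \<Phi> :: "real \<Rightarrow> real \<Rightarrow> real \<Rightarrow> complex \<Rightarrow> complex" where
  "\<Phi> \<epsilon> m r p = exp (\<i> * of_real m * p - Complex \<epsilon> T * (p\<^sup>2 + W r) powr of_real \<alpha>)"

text \<open>On the real axis \<open>\<i> * m * s\<close> and the longitudinal power contribute only
  oscillation from T and damping from \<epsilon>; all uniform decay comes from the increment of the
  power caused by \<open>W r\<close>.\<close>

lemma norm_Phi_real:
  assumes s: "0 < s" "s \<le> X" and X: "X \<ge> 1" and r: "r \<ge> 0" and \<epsilon>: "\<epsilon> \<ge> 0"
  shows "norm (\<Phi> \<epsilon> m r (of_real s)) \<le> exp (- \<kappa>0 * gain X r)"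
proof -
  have s2: "s\<^sup>2 > 0" using s by simp
  have "\<kappa>0 * gain X r \<le> \<kappa>0 * ((s\<^sup>2 + r\<^sup>2) powr \<alpha> - (s\<^sup>2) powr \<alpha>)"
    using kappa0_pos gain_le[OF s X r] by (intro mult_left_mono) auto
  also have "\<dots> \<le> Re (Complex \<epsilon> T * ((of_real (s\<^sup>2) + W r) powr of_real \<alpha> - of_real ((s\<^sup>2) powr \<alpha>)))"
    by (rule Re_zeta_E_ge[OF s2 \<epsilon>])
  also have "\<dots> = Re (Complex \<epsilon> T * (of_real (s\<^sup>2) + W r) powr of_real \<alpha>) - \<epsilon> * (s\<^sup>2) powr \<alpha>"
    by (simp only: right_diff_distrib minus_complex.simps times_complex.simps complex.sel Re_complex_of_real Im_complex_of_real mult_zero_right diff_zero)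
  also have "\<dots> \<le> Re (Complex \<epsilon> T * (of_real (s\<^sup>2) + W r) powr of_real \<alpha>)" using \<epsilon> by simp
  finally show ?thesis by (simp add: \<Phi>_def of_real_power)
qed

text \<open>The integrand is \<open>cis (\<phi> s) * a s\<close>: the pure longitudinal phase goes
  into \<phi>, which is independent of r and \<epsilon>, and everything caused by \<open>W r\<close>
  or \<epsilon> goes into the amplitude. The bound is uniform in m, because the second derivative of
  \<phi> does not involve m.\<close>

lemma oscillatory_part_bound:
  assumes X: "X \<ge> 1" and r: "r \<ge> 0" and \<epsilon>: "0 \<le> \<epsilon>" "\<epsilon> \<le> 1"
  shows "norm (integral {1..X} (\<lambda>s. \<Phi> \<epsilon> m r (of_real s)))
    \<le> 10 / \<mu>0 * growth X * (2 + (1 + T) * 2 powr \<bar>\<alpha> - 2\<bar> / \<kappa>0) * exp (- \<kappa>0 * gain X r)"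
proof -
  define \<zeta> where "\<zeta> = Complex \<epsilon> T"
  define G where "G = exp (- \<kappa>0 * gain X r)"
  define C1 :: real where "C1 = 2 powr \<bar>\<alpha> - 2\<bar>"
  define \<sigma> :: real where "\<sigma> = sgn (\<alpha> - 1)"
  define g where "g s = (s\<^sup>2 + r\<^sup>2) powr \<alpha> - (s\<^sup>2) powr \<alpha>" for s
  define dg where "dg s = 2 * \<alpha> * s * ((s\<^sup>2 + r\<^sup>2) powr (\<alpha> - 1) - (s\<^sup>2) powr (\<alpha> - 1))" for s
  define \<phi> where "\<phi> s = m * s - T * (s\<^sup>2) powr \<alpha>" for s
  define \<phi>' where "\<phi>' s = m - 2 * \<alpha> * T * s * (s\<^sup>2) powr (\<alpha> - 1)" for s
  define \<phi>'' where "\<phi>'' s = - (2 * \<alpha> * T * (2 * \<alpha> - 1) * (s\<^sup>2) powr (\<alpha> - 1))" for s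
  define E where "E s = (of_real (s\<^sup>2) + W r) powr of_real \<alpha> - of_real ((s\<^sup>2) powr \<alpha>)" for s
  define dE where "dE s = of_real (2 * \<alpha> * s) * ((of_real (s\<^sup>2) + W r) powr of_real (\<alpha> - 1) - of_real ((s\<^sup>2) powr (\<alpha> - 1)))" for s
  define a where "a s = exp (- \<zeta> * E s - of_real (\<epsilon> * (s\<^sup>2) powr \<alpha>))" for s
  define df where "df s = - \<zeta> * dE s - of_real (\<epsilon> * (2 * \<alpha> * s * (s\<^sup>2) powr (\<alpha> - 1)))" for s
  \<comment> \<open>A primitive of the bound \<open>db\<close> for the amplitude's derivative. Both
    parts are monotone exponentials, in \<open>g s\<close> (with orientation \<sigma>, the sign of
    the derivative of g) and in the \<epsilon> damping, so the increment of b is at most a constant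
    times G, independently of X and \<epsilon>. The division by \<kappa>0 undoes the inner
    derivative.\<close>
  define b where "b s = (1 + T) * C1 / \<kappa>0 * (- \<sigma> * exp (- \<kappa>0 * g s)) - G * exp (- \<epsilon> * (s\<^sup>2) powr \<alpha>)" for s
  define db where "db s = (1 + T) * C1 * (\<sigma> * dg s) * exp (- \<kappa>0 * g s) + G * \<epsilon> * (2 * \<alpha> * s * (s\<^sup>2) powr (\<alpha> - 1)) * exp (- \<epsilon> * (s\<^sup>2) powr \<alpha>)" for s
  have gD: "(g has_real_derivative dg s) (at s within S)" if "s \<ge> 1" for s S
  proof -
    have "s\<^sup>2 + r\<^sup>2 > 0" using that by (simp add: add_pos_nonneg)
    then show ?thesis unfolding g_def dg_def using that
      by (auto intro!: derivative_eq_intros simp: algebra_simps)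
  qed
  have sD: "((\<lambda>s. (s\<^sup>2) powr \<alpha>) has_real_derivative 2 * \<alpha> * s * (s\<^sup>2) powr (\<alpha> - 1)) (at s within S)" if "s \<ge> 1" for s :: real and S
    using that by (auto intro!: derivative_eq_intros simp: algebra_simps)
  have sD2: "((\<lambda>s. 2 * \<alpha> * T * s * (s\<^sup>2) powr (\<alpha> - 1)) has_real_derivative 2 * \<alpha> * T * (2 * \<alpha> - 1) * (s\<^sup>2) powr (\<alpha> - 1)) (at s within S)" if "s \<ge> 1" for s :: real and S
  proof -
    have "(s\<^sup>2) powr (\<alpha> - 1 - 1) * s\<^sup>2 = (s\<^sup>2) powr (\<alpha> - 1)" using that by (intro powr_minus1_mult) auto
    then have *: "s * s * (s * s) powr (\<alpha> - 1 - 1) = (s * s) powr (\<alpha> - 1)" by (simp add: power2_eq_square mult_ac)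
    have "((\<lambda>s. 2 * \<alpha> * T * (s * (s * s) powr (\<alpha> - 1))) has_real_derivative 2 * \<alpha> * T * ((s * s) powr (\<alpha> - 1) + s * ((\<alpha> - 1) * (2 * s) * (s * s) powr (\<alpha> - 1 - 1)))) (at s within S)"
      using that by (auto intro!: derivative_eq_intros)
    moreover have "(s * s) powr (\<alpha> - 1) + s * ((\<alpha> - 1) * (2 * s) * (s * s) powr (\<alpha> - 1 - 1)) = (2 * \<alpha> - 1) * (s * s) powr (\<alpha> - 1)"
      unfolding *[symmetric] by (simp add: algebra_simps)
    ultimately show ?thesis by (simp add: power2_eq_square mult.assoc)
  qed
  have zD: "((\<lambda>s. (of_real (s\<^sup>2) + W r) powr of_real \<alpha>) has_vector_derivative of_real (2 * \<alpha> * s) * (of_real (s\<^sup>2) + W r) powr of_real (\<alpha> - 1)) (at s within S)" if "s \<ge> 1" for s S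
  proof -
    have "of_real (s\<^sup>2) + W r \<notin> \<real>\<^sub>\<le>\<^sub>0"
      using sector_add_scaled_W[of "s\<^sup>2" 1 r] that by (auto dest!: sector_nonpos)
    then have "((\<lambda>w. (w\<^sup>2 + W r) powr of_real \<alpha>) has_field_derivative
     of_real (2 * \<alpha> * s) * (of_real (s\<^sup>2) + W r) powr of_real (\<alpha> - 1)) (at (of_real s))"
      by (auto intro!: derivative_eq_intros)
    from has_vector_derivative_real_field[OF this] show ?thesis
      by (simp add: has_vector_derivative_at_within of_real_power)
  qed
  have of_real_D: "((\<lambda>s. complex_of_real (f s)) has_vector_derivative of_real f') (at s within S)"
    if "(f has_real_derivative f') (at s within S)" for f f' s S
    using that unfolding has_real_derivative_iff_has_vector_derivative
    by (rule bounded_linear.has_vector_derivative[OF bounded_linear_of_real])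
  have ED: "(E has_vector_derivative dE s) (at s within S)" if "s \<ge> 1" for s S
    unfolding E_def dE_def right_diff_distrib of_real_mult[symmetric]
    by (intro has_vector_derivative_diff zD of_real_D sD that)
  have aD: "(a has_vector_derivative (df s * a s)) (at s within S)" if "s \<ge> 1" for s S
    unfolding a_def df_def
    by (intro has_vector_derivative_exp_complex has_vector_derivative_diff has_vector_derivative_mult_right ED of_real_D
        DERIV_cmult sD that)
  have gG: "exp (- \<kappa>0 * g s) \<le> G" if "s \<in> {1..X}" for s
  proof -
    have "gain X r \<le> g s" unfolding g_def using that by (intro gain_le X r) auto
    then show ?thesis using kappa0_pos by (simp add: G_def)
  qed
  have na: "norm (a s) \<le> exp (- \<kappa>0 * g s) * exp (- \<epsilon> * (s\<^sup>2) powr \<alpha>)" if "s \<in> {1..X}" for s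
  proof -
    have "\<kappa>0 * g s \<le> Re (\<zeta> * E s)"
      unfolding g_def E_def \<zeta>_def using that by (intro Re_zeta_E_ge \<epsilon>) auto
    then show ?thesis by (simp add: a_def exp_add[symmetric])
  qed
  have bD: "(b has_real_derivative db s) (at s within S)" if "s \<ge> 1" for s S
  proof -
    have 1: "((\<lambda>s. exp (- \<kappa>0 * g s)) has_real_derivative exp (- \<kappa>0 * g s) * (- \<kappa>0 * dg s)) (at s within S)"
      by (intro DERIV_chain2[OF DERIV_exp] DERIV_cmult gD that)
    have 2: "((\<lambda>s. exp (- \<epsilon> * (s\<^sup>2) powr \<alpha>)) has_real_derivative exp (- \<epsilon> * (s\<^sup>2) powr \<alpha>) * (- \<epsilon> * (2 * \<alpha> * s * (s\<^sup>2) powr (\<alpha> - 1)))) (at s within S)"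
      by (intro DERIV_chain2[OF DERIV_exp] DERIV_cmult sD that)
    have "(b has_real_derivative (1 + T) * C1 / \<kappa>0 * (- \<sigma> * (exp (- \<kappa>0 * g s) * (- \<kappa>0 * dg s)))
       - G * (exp (- \<epsilon> * (s\<^sup>2) powr \<alpha>) * (- \<epsilon> * (2 * \<alpha> * s * (s\<^sup>2) powr (\<alpha> - 1))))) (at s within S)"
      unfolding b_def by (intro DERIV_diff DERIV_cmult 1 2)
    moreover have "(1 + T) * C1 / \<kappa>0 * (- \<sigma> * (exp (- \<kappa>0 * g s) * (- \<kappa>0 * dg s)))
       - G * (exp (- \<epsilon> * (s\<^sup>2) powr \<alpha>) * (- \<epsilon> * (2 * \<alpha> * s * (s\<^sup>2) powr (\<alpha> - 1)))) = db s"
      using kappa0_pos by (simp add: db_def field_simps)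
    ultimately show ?thesis by simp
  qed
  have \<sigma>dg: "\<sigma> * dg s = \<bar>dg s\<bar>" if s: "s \<in> {1..X}" for s
  proof -
    have p: "2 * \<alpha> * s \<ge> 0" "s\<^sup>2 > 0" using s \<alpha> by auto
    define d where "d = (s\<^sup>2 + r\<^sup>2) powr (\<alpha> - 1) - (s\<^sup>2) powr (\<alpha> - 1)"
    have "\<sigma> * d = \<bar>d\<bar>"
    proof (cases \<alpha> "1::real" rule: linorder_cases)
      case less
      then have "d \<le> 0" unfolding d_def using p powr_mono2'[of "\<alpha> - 1" "s\<^sup>2" "s\<^sup>2 + r\<^sup>2"] by simp
      then show ?thesis using less by (simp add: \<sigma>_def)
    next
      case equal
      then show ?thesis using p by (simp add: \<sigma>_def d_def add_pos_nonneg)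
    next
      case greater
      then have "d \<ge> 0" unfolding d_def using p powr_mono2[of "\<alpha> - 1" "s\<^sup>2" "s\<^sup>2 + r\<^sup>2"] by simp
      then show ?thesis using greater by (simp add: \<sigma>_def)
    qed
    moreover have "\<bar>dg s\<bar> = 2 * \<alpha> * s * \<bar>d\<bar>" "\<sigma> * dg s = 2 * \<alpha> * s * (\<sigma> * d)"
      using p(1) unfolding dg_def d_def[symmetric] abs_mult[of "2 * \<alpha> * s"] by simp_all
    ultimately show ?thesis by simp
  qed
  have n\<zeta>: "norm \<zeta> \<le> 1 + T"
    using cmod_le[of \<zeta>] \<epsilon> T by (simp add: \<zeta>_def)
  have ab: "norm (df s * a s) \<le> db s" if s: "s \<in> {1..X}" for s
  proof -
    have p: "2 * \<alpha> * s > 0" "s\<^sup>2 > 0" using s \<alpha> by auto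
    have "norm (dE s) \<le> 2 * \<alpha> * s * (C1 * \<bar>(s\<^sup>2 + r\<^sup>2) powr (\<alpha> - 1) - (s\<^sup>2) powr (\<alpha> - 1)\<bar>)"
      unfolding dE_def norm_mult norm_of_real C1_def using p norm_E'_le[OF p(2), of r] by (intro mult_mono) auto
    also have "\<dots> = C1 * \<bar>dg s\<bar>" using p(1) unfolding dg_def abs_mult[of "2 * \<alpha> * s"] by simp
    finally have dE: "norm (dE s) \<le> C1 * \<bar>dg s\<bar>" .
    have "norm (df s) \<le> norm (\<zeta> * dE s) + norm (complex_of_real (\<epsilon> * (2 * \<alpha> * s * (s\<^sup>2) powr (\<alpha> - 1))))"
      unfolding df_def using norm_triangle_ineq4[of "- \<zeta> * dE s"] by (metis minus_mult_left norm_minus_cancel)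
    also have "norm (complex_of_real (\<epsilon> * (2 * \<alpha> * s * (s\<^sup>2) powr (\<alpha> - 1)))) = \<epsilon> * (2 * \<alpha> * s * (s\<^sup>2) powr (\<alpha> - 1))"
      unfolding norm_of_real using p \<epsilon> s \<alpha> by (intro abs_of_nonneg mult_nonneg_nonneg) auto
    also have "norm (\<zeta> * dE s) \<le> (1 + T) * (C1 * \<bar>dg s\<bar>)"
      unfolding norm_mult using n\<zeta> dE T by (intro mult_mono) auto
    finally have df: "norm (df s) \<le> (1 + T) * (C1 * \<bar>dg s\<bar>) + \<epsilon> * (2 * \<alpha> * s * (s\<^sup>2) powr (\<alpha> - 1))" by simp
    define A B eg ee where "A = (1 + T) * (C1 * \<bar>dg s\<bar>)" and "B = \<epsilon> * (2 * \<alpha> * s * (s\<^sup>2) powr (\<alpha> - 1))"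
      and "eg = exp (- \<kappa>0 * g s)" and "ee = exp (- \<epsilon> * (s\<^sup>2) powr \<alpha>)"
    have AB: "A \<ge> 0" "B \<ge> 0" using p \<epsilon> T s \<alpha> by (auto simp: A_def B_def C1_def intro!: mult_nonneg_nonneg)
    have e: "0 \<le> eg" "eg \<le> G" "0 \<le> ee" "ee \<le> 1" using gG[OF s] \<epsilon> by (auto simp: eg_def ee_def)
    have "norm (df s * a s) \<le> (A + B) * (eg * ee)"
      unfolding norm_mult using df na[OF s] order_trans[OF norm_ge_zero df] by (intro mult_mono) (auto simp: A_def B_def eg_def ee_def)
    also have "\<dots> = A * eg * ee + B * eg * ee" by (simp add: algebra_simps)
    \<comment> \<open>In each summand the exponential matching its own derivative is kept, so that
      the sum is an exact derivative, and the other exponential is replaced by its upper bound 1 or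
      G.\<close>
    also have "A * eg * ee \<le> A * eg * 1" using AB e by (intro mult_left_mono) auto
    also have "B * eg * ee \<le> B * G * ee" using AB e by (intro mult_left_mono mult_right_mono) auto
    finally have "norm (df s * a s) \<le> A * eg * 1 + B * G * ee" by simp
    also have "\<dots> = db s" by (simp add: db_def \<sigma>dg[OF s] A_def B_def eg_def ee_def mult_ac)
    finally show ?thesis .
  qed
  have \<mu>: "\<mu>0 / growth X > 0" using mu0_pos growth_ge1[OF X] by simp
  have eq: "\<Phi> \<epsilon> m r (of_real s) = cis (\<phi> s) * a s" if "s \<in> {1..X}" for s
  proof -
    have "\<i> * of_real (\<phi> s) + (- \<zeta> * E s - of_real (\<epsilon> * (s\<^sup>2) powr \<alpha>)) = \<i> * of_real m * of_real s - \<zeta> * (of_real (s\<^sup>2) + W r) powr of_real \<alpha>"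
      by (simp add: \<phi>_def E_def \<zeta>_def complex_eq_iff algebra_simps)
    then show ?thesis by (simp only: \<Phi>_def a_def cis_conv_exp exp_add[symmetric] \<zeta>_def of_real_power)
  qed
  have "norm (integral {1..X} (\<lambda>s. cis (\<phi> s) * a s)) \<le> 10 / (\<mu>0 / growth X) * (norm (a X) + (b X - b 1))"
  proof (rule van_der_Corput[OF X \<mu>])
    show "(\<phi> has_real_derivative \<phi>' s) (at s within {1..X})" if "s \<in> {1..X}" for s
      unfolding \<phi>_def \<phi>'_def using that
      by (auto intro!: derivative_eq_intros sD[THEN DERIV_cong] simp: mult_ac)
    show "(\<phi>' has_real_derivative \<phi>'' s) (at s within {1..X})" if "s \<in> {1..X}" for s
      unfolding \<phi>'_def[abs_def] \<phi>''_def using that DERIV_diff[OF DERIV_const sD2[of s "{1..X}"], of m] by simp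
    \<comment> \<open>The second derivative is smallest in modulus at s = 1 if \<alpha> \<ge> 1 and
      at s = X if \<alpha> < 1. This is the origin of \<open>growth\<close>, and starting at 1 keeps
      the first case away from the degenerate point 0.\<close>
    show "\<phi>'' s \<le> - (\<mu>0 / growth X)\<^sup>2" if s: "s \<in> {1..X}" for s
    proof -
      have "1 / (growth X)\<^sup>2 \<le> (s\<^sup>2) powr (\<alpha> - 1)"
      proof (cases "\<alpha> \<ge> 1")
        case True
        then show ?thesis using s by (auto simp: growth_def intro!: ge_one_powr_ge_zero)
      next
        case False
        have "1 / (growth X)\<^sup>2 = X powr (2 * (\<alpha> - 1))"
          using X False by (simp add: growth_def powr_power powr_minus[symmetric] inverse_eq_divide[symmetric] algebra_simps)
        also have "\<dots> \<le> s powr (2 * (\<alpha> - 1))" using False s by (intro powr_mono2') auto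
        also have "\<dots> = (s\<^sup>2) powr (\<alpha> - 1)" using s by (simp add: powr_square)
        finally show ?thesis .
      qed
      then have "2 * \<alpha> * T * (2 * \<alpha> - 1) * (1 / (growth X)\<^sup>2) \<le> 2 * \<alpha> * T * (2 * \<alpha> - 1) * (s\<^sup>2) powr (\<alpha> - 1)"
        using \<alpha> T by (intro mult_left_mono) auto
      moreover have "(\<mu>0 / growth X)\<^sup>2 = 2 * \<alpha> * T * (2 * \<alpha> - 1) * (1 / (growth X)\<^sup>2)"
        using \<alpha> T by (simp add: \<mu>0_def power_divide)
      ultimately show ?thesis by (simp add: \<phi>''_def)
    qed
  qed (use aD bD ab in auto)
  also have "10 / (\<mu>0 / growth X) = 10 / \<mu>0 * growth X" by simp
  finally have V: "norm (integral {1..X} (\<lambda>s. cis (\<phi> s) * a s)) \<le> 10 / \<mu>0 * growth X * (norm (a X) + (b X - b 1))" .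
  \<comment> \<open>One G for the final amplitude, one for the increment of the \<epsilon> part of
    b, and the quotient with \<kappa>0 for the increment of its transversal part.\<close>
  have "norm (a X) + (b X - b 1) \<le> G * (2 + (1 + T) * C1 / \<kappa>0)"
  proof -
    have "exp (- \<kappa>0 * g X) * exp (- \<epsilon> * (X\<^sup>2) powr \<alpha>) \<le> G * 1"
      using gG[of X] X \<epsilon> by (intro mult_mono) (auto simp: G_def)
    then have 1: "norm (a X) \<le> G" using na[of X] X by auto
    have eg: "0 \<le> exp (- \<kappa>0 * g s)" "exp (- \<kappa>0 * g s) \<le> G" if "s \<in> {1..X}" for s using gG[OF that] by auto
    have "- \<sigma> * exp (- \<kappa>0 * g X) - (- \<sigma> * exp (- \<kappa>0 * g 1)) \<le> G"
    proof -
      have "- \<sigma> * x - (- \<sigma> * y) \<le> G" if "0 \<le> x" "x \<le> G" "0 \<le> y" "y \<le> G" for x y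
        using that by (auto simp: \<sigma>_def sgn_if)
      then show ?thesis using eg[of X] eg[of 1] X by simp
    qed
    moreover have "(1 + T) * C1 / \<kappa>0 \<ge> 0" using T kappa0_pos by (simp add: C1_def)
    ultimately have "(1 + T) * C1 / \<kappa>0 * (- \<sigma> * exp (- \<kappa>0 * g X) - (- \<sigma> * exp (- \<kappa>0 * g 1))) \<le> (1 + T) * C1 / \<kappa>0 * G"
      by (intro mult_left_mono)
    then have 2: "(1 + T) * C1 / \<kappa>0 * (- \<sigma> * exp (- \<kappa>0 * g X)) - (1 + T) * C1 / \<kappa>0 * (- \<sigma> * exp (- \<kappa>0 * g 1)) \<le> (1 + T) * C1 / \<kappa>0 * G"
      by (simp only: right_diff_distrib)
    have G0: "G \<ge> 0" by (simp add: G_def)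
    have 3: "G * exp (- \<epsilon> * (1\<^sup>2) powr \<alpha>) \<le> G * 1" "G * exp (- \<epsilon> * (X\<^sup>2) powr \<alpha>) \<ge> 0"
      by (rule mult_left_mono, use \<epsilon> G0 in simp_all)
    show ?thesis using 1 2 3 unfolding b_def by (simp only: distrib_left mult.commute[of G "(1 + T) * C1 / \<kappa>0"])
  qed
  then have "norm (integral {1..X} (\<lambda>s. cis (\<phi> s) * a s)) \<le> 10 / \<mu>0 * growth X * (G * (2 + (1 + T) * C1 / \<kappa>0))"
    using mu0_pos growth_ge1[OF X] by (intro order_trans[OF V mult_left_mono]) auto
  moreover have "integral {1..X} (\<lambda>s. \<Phi> \<epsilon> m r (of_real s)) = integral {1..X} (\<lambda>s. cis (\<phi> s) * a s)"
    using eq by (intro integral_cong) auto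
  ultimately show ?thesis by (simp add: G_def C1_def mult_ac)
qed

end

section \<open>Rotation of the radial contour\<close>

text \<open>Beyond the threshold S the factor \<open>k * s powr (\<beta> - 1)\<close> exceeds A, so
  the difference is nonpositive there.\<close>

lemma superlinear_bound:
  fixes k \<beta> A :: real
  assumes "k > 0" "\<beta> > 1"
  obtains C where "\<And>s. s \<ge> 0 \<Longrightarrow> A * s - k * s powr \<beta> \<le> C"
proof -
  define S where "S = (max A 0 / k) powr (1 / (\<beta> - 1))"
  have "A * s - k * s powr \<beta> \<le> max A 0 * S" if s: "s \<ge> 0" for s
  proof (cases "s \<le> S")
    case True
    have "A * s \<le> max A 0 * s" using s by (intro mult_right_mono) auto
    also have "\<dots> \<le> max A 0 * S" using True by (intro mult_left_mono) auto
    finally show ?thesis using assms powr_ge_zero[of s \<beta>] by (smt (verit) mult_nonneg_nonneg)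
  next
    case False
    moreover have "S \<ge> 0" by (simp add: S_def)
    ultimately have s0: "s > 0" and Ss: "S \<le> s" by linarith+
    have "S powr (\<beta> - 1) = max A 0 / k" using assms by (simp add: S_def powr_powr)
    moreover have "S powr (\<beta> - 1) \<le> s powr (\<beta> - 1)" using Ss assms by (intro powr_mono2) (auto simp: S_def)
    ultimately have "max A 0 \<le> k * s powr (\<beta> - 1)" using assms by (simp add: divide_le_eq mult.commute)
    then have "max A 0 * s \<le> k * s powr (\<beta> - 1) * s" using s by (intro mult_right_mono) auto
    also have "\<dots> = k * s powr \<beta>" using powr_minus1_mult[OF s0, of \<beta>] by simp
    finally have "max A 0 * s \<le> k * s powr \<beta>" .
    moreover have "A * s \<le> max A 0 * s" using s by (intro mult_right_mono) auto
    moreover have "max A 0 * S \<ge> 0" by (auto simp: S_def)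
    ultimately show ?thesis by linarith
  qed
  then show thesis using that by blast
qed

section \<open>Decay on the rotated ray and on the vertical side of the contour\<close>

context dispersive_angle begin

text \<open>Decay rates of the two complex pieces of the contour. \<kappa>1 comes from the exact
  argument \<open>- 2 * \<alpha> * \<psi>\<close> of the power on the ray. \<kappa>2 is the constant
  of \<open>Re_zeta_powr_ge\<close>, times one comparison factor for \<open>norm z\<close> against y
  and one for y against \<open>X\<^sup>2 + r\<^sup>2\<close>, times the sine contained in
  \<open>Im (W r)\<close>.\<close>

definition \<kappa>1 :: real where "\<kappa>1 = T * sin (2 * \<alpha> * \<psi>)"
definition \<kappa>2 :: real where "\<kappa>2 = T * \<alpha> / 2 * (2 powr (-\<bar>\<alpha> - 1\<bar>))\<^sup>2 * sin (2 * \<psi>)"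

\<comment> \<open>frequencies beyond \<open>X\<close> are not stationary as long as \<open>\<bar>m\<bar> \<le> c2 * X powr (2\<alpha> - 1)\<close>\<close>
definition c2 :: real where "c2 = min (\<kappa>1 / 4) (\<kappa>2 / 8)"

lemma kappa1_pos: "\<kappa>1 > 0"
  using T \<alpha> angle_facts by (auto simp: \<kappa>1_def intro!: mult_pos_pos sin_gt_zero)

lemma sin_2psi: "0 < sin (2 * \<psi>)" "sin (2 * \<psi>) \<le> 1"
  using angle_facts by (auto intro!: sin_gt_zero)

lemma kappa2_pos: "\<kappa>2 > 0"
  using T \<alpha> sin_2psi by (simp add: \<kappa>2_def)

lemma c2_pos: "c2 > 0" using kappa1_pos kappa2_pos by (simp add: c2_def)

lemma tan_psi: "0 < tan \<psi>" "tan \<psi> \<le> 1" "cos \<psi> > 0"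
proof -
  show "0 < tan \<psi>" "cos \<psi> > 0" using angle_facts by (auto intro!: tan_gt_zero cos_gt_zero)
  have "tan \<psi> \<le> tan (pi / 4)" using angle_facts by (intro tan_mono_le) auto
  then show "tan \<psi> \<le> 1" by (simp add: tan_45)
qed

lemma Re_zeta_ray_ge:
  assumes "y \<ge> 0" "\<epsilon> \<ge> 0"
  shows "Re (Complex \<epsilon> T * (of_real y * cis (- (2 * \<psi>))) powr of_real \<alpha>) \<ge> \<kappa>1 * y powr \<alpha>"
proof (cases "y = 0")
  case False
  then have "(of_real y * cis (- (2 * \<psi>))) powr of_real \<alpha> = of_real (y powr \<alpha>) * cis (\<alpha> * (- (2 * \<psi>)))"
    using assms angle_facts by (intro powr_of_real_cis) auto
  then have "Re (Complex \<epsilon> T * (of_real y * cis (- (2 * \<psi>))) powr of_real \<alpha>) = \<epsilon> * (y powr \<alpha> * cos (2 * \<alpha> * \<psi>)) + \<kappa>1 * y powr \<alpha>"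
    by (simp add: \<kappa>1_def algebra_simps)
  moreover have "cos (2 * \<alpha> * \<psi>) \<ge> 0" using angle_facts \<alpha> by (intro cos_ge_zero) (auto simp: mult.assoc intro: order_trans[of _ 0])
  ultimately show ?thesis using assms by simp
qed (use assms in simp)

lemma cis_square: "(cis x)\<^sup>2 = cis (2 * x)"
  by (simp add: power2_eq_square cis_mult)

lemma ray_square: "(of_real s * cis (- \<psi>))\<^sup>2 + W r = of_real (s\<^sup>2 + r\<^sup>2) * cis (- (2 * \<psi>))"
  by (simp add: W_def power_mult_distrib cis_square algebra_simps)

text \<open>The ray enters the lower half plane, the right direction for the power but the wrong one
  for \<open>exp (\<i> * m * p)\<close> with m > 0. This explains the growing term in the exponent,
  which the power must beat.\<close>

lemma norm_Phi_ray:
  assumes s: "s \<ge> 0" and \<epsilon>: "\<epsilon> \<ge> 0"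
  shows "norm (\<Phi> \<epsilon> m r (of_real s * cis (- \<psi>))) \<le> exp (\<bar>m\<bar> * s - \<kappa>1 * (s\<^sup>2 + r\<^sup>2) powr \<alpha>)"
proof -
  have "m * s * sin \<psi> \<le> \<bar>m * s * sin \<psi>\<bar>" by simp
  also have "\<dots> = \<bar>m\<bar> * s * \<bar>sin \<psi>\<bar>" using s by (simp add: abs_mult)
  also have "\<dots> \<le> \<bar>m\<bar> * s * 1" using s by (intro mult_left_mono) auto
  finally have "m * s * sin \<psi> \<le> \<bar>m\<bar> * s" by simp
  moreover have "Re (Complex \<epsilon> T * (of_real (s\<^sup>2 + r\<^sup>2) * cis (- (2 * \<psi>))) powr of_real \<alpha>) \<ge> \<kappa>1 * (s\<^sup>2 + r\<^sup>2) powr \<alpha>"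
    by (intro Re_zeta_ray_ge \<epsilon>) auto
  moreover have "Re (\<i> * of_real m * (of_real s * cis (- \<psi>))) = m * s * sin \<psi>" by simp
  ultimately show ?thesis unfolding \<Phi>_def ray_square norm_exp_eq_Re exp_le_cancel_iff minus_complex.simps by linarith
qed

lemma square_sector:
  assumes p: "Re p > 0" "Im p \<le> 0" "- Im p \<le> tan \<psi> * Re p"
  shows "p\<^sup>2 \<in> sector" "Re (p\<^sup>2) \<ge> (norm p)\<^sup>2 / 2"
proof -
  define \<theta> where "\<theta> = arctan (- Im p / Re p)"
  have \<theta>0: "\<theta> \<ge> 0" using p by (simp add: \<theta>_def divide_nonpos_pos)
  have "\<theta> \<le> arctan (tan \<psi>)" unfolding \<theta>_def using p by (simp only: arctan_le_iff pos_divide_le_eq)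
  also have "\<dots> = \<psi>" using angle_facts by (intro arctan_tan) auto
  finally have \<theta>1: "\<theta> \<le> \<psi>" .
  have "Arg p = - \<theta>" unfolding \<theta>_def using p by (simp add: arg_conv_arctan arctan_minus[symmetric])
  then have pp: "p = of_real (norm p) * cis (- \<theta>)" using rcis_cmod_Arg[of p] by (simp add: rcis_def)
  have p2: "p\<^sup>2 = of_real ((norm p)\<^sup>2) * cis (- (2 * \<theta>))"
    by (subst pp) (simp add: power_mult_distrib cis_square)
  have "norm p > 0" using p by auto
  then show "p\<^sup>2 \<in> sector" unfolding p2 using \<theta>0 \<theta>1 by (intro sector_polar) auto
  have "cos (2 * \<psi>) \<le> cos (2 * \<theta>)" using \<theta>0 \<theta>1 angle_facts by (intro cos_monotone_0_pi_le) auto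
  then have "(norm p)\<^sup>2 * (1/2) \<le> (norm p)\<^sup>2 * cos (2 * \<theta>)" using cos_2psi_ge by (intro mult_left_mono) auto
  moreover have "Re (p\<^sup>2) = (norm p)\<^sup>2 * cos (2 * \<theta>)" unfolding p2 by simp
  ultimately show "Re (p\<^sup>2) \<ge> (norm p)\<^sup>2 / 2" by simp
qed

lemma W_sector: "W r = 0 \<or> W r \<in> sector"
  using sector_polar[of "r\<^sup>2" "2 * \<psi>"] angle_facts by (cases "r = 0") (auto simp: W_def)

text \<open>Descending by u costs at most \<open>\<bar>m\<bar> * u\<close> and gains
  \<open>\<kappa>2 * (Q * (X * u) + Q * r\<^sup>2)\<close> with
  \<open>Q = (X\<^sup>2 + r\<^sup>2) powr (\<alpha> - 1)\<close>. If \<alpha> \<ge> 1 or r \<le> X,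
  then Q * X is at least half of X powr (2\<alpha> - 1) and the term in u pays. If \<alpha> < 1 and
  r > X, then Q is too small for that, but \<open>Q * r\<^sup>2\<close> is at least half of r powr
  (2\<alpha>), which dominates X powr (2\<alpha>) and hence the cost, since u \<le> X. The additive
  \<kappa>2 in the exponent absorbs the constant lost in
  \<open>transversal_power_ge\<close>.\<close>

lemma vertical_exponent:
  assumes X: "X \<ge> 1" and r: "r \<ge> 0" and \<epsilon>: "\<epsilon> \<ge> 0" and m: "\<bar>m\<bar> \<le> c2 * X powr (2 * \<alpha> - 1)"
    and u: "0 \<le> u" "u \<le> X * tan \<psi>"
  shows "norm (\<Phi> \<epsilon> m r (Complex X (- u))) \<le> exp (\<kappa>2 - \<kappa>2 / 8 * u - \<kappa>2 / 4 * (r / growth X) powr (2 * \<alpha>))"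
proof -
  define p where "p = Complex X (- u)"
  define z where "z = p\<^sup>2 + W r"
  define h :: real where "h = 2 powr (-\<bar>\<alpha> - 1\<bar>)"
  define Q where "Q = (X\<^sup>2 + r\<^sup>2) powr (\<alpha> - 1)"
  define R where "R = (r / growth X) powr (2 * \<alpha>)"
  have h: "0 < h" "h \<le> 1" unfolding h_def using powr_mono[of "-\<bar>\<alpha> - 1\<bar>" 0 2] by auto
  have uX: "u \<le> X" using u tan_psi X mult_left_mono[of "tan \<psi>" 1 X] by linarith
  have p2: "p\<^sup>2 \<in> sector" "Re (p\<^sup>2) \<ge> (norm p)\<^sup>2 / 2"
    using square_sector[of p] X u by (auto simp: p_def mult.commute)
  have zs: "z \<in> sector" unfolding z_def using p2 W_sector[of r] by (auto intro: sector_add)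
  have np: "(norm p)\<^sup>2 = X\<^sup>2 + u\<^sup>2" by (simp add: p_def cmod_power2)
  define y where "y = X\<^sup>2 + u\<^sup>2 + r\<^sup>2"
  have yp: "y > 0" using X by (auto simp: y_def intro!: add_pos_nonneg)
  have y1: "norm z \<le> y" unfolding z_def y_def using norm_triangle_ineq[of "p\<^sup>2" "W r"] by (simp add: norm_W norm_power np)
  have "Re z \<ge> y / 2" using p2(2) np cos_2psi_ge mult_left_mono[of "1/2" "cos (2 * \<psi>)" "r\<^sup>2"]
    by (simp add: z_def y_def W_def)
  then have y2: "y / 2 \<le> norm z" using complex_Re_le_cmod[of z] by linarith
  have a: "h * y powr (\<alpha> - 1) \<le> norm z powr (\<alpha> - 1)" unfolding h_def using yp y1 y2 by (intro powr_comparable) auto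
  have b: "h * Q \<le> y powr (\<alpha> - 1)"
  proof -
    have X2: "X\<^sup>2 + r\<^sup>2 > 0" using X by (auto intro!: add_pos_nonneg)
    have y3: "X\<^sup>2 + r\<^sup>2 \<le> y" by (simp add: y_def)
    have "u\<^sup>2 \<le> X\<^sup>2" using u uX by (intro power_mono) auto
    then have y4: "y / 2 \<le> X\<^sup>2 + r\<^sup>2" 
      by (simp add: y_def add_increasing)
    show ?thesis
    proof (cases "\<alpha> \<ge> 1")
      case True
      then have "Q \<le> y powr (\<alpha> - 1)" unfolding Q_def using y3 X2 by (intro powr_mono2) auto
      moreover have "h * Q \<le> 1 * Q" using h by (intro mult_right_mono) (auto simp: Q_def)
      ultimately show ?thesis by simp
    next
      case False
      have "Q \<le> (y / 2) powr (\<alpha> - 1)" unfolding Q_def using False y4 yp by (intro powr_mono2') auto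
      also have "\<dots> = y powr (\<alpha> - 1) / 2 powr (\<alpha> - 1)" using yp by (simp add: powr_divide)
      also have "\<dots> = y powr (\<alpha> - 1) / h" using False by (simp add: h_def)
      finally show ?thesis using h by (simp add: pos_le_divide_eq mult.commute)
    qed
  qed
  have Imz: "- Im z = 2 * X * u + r\<^sup>2 * sin (2 * \<psi>)" by (simp add: z_def p_def W_def power2_eq_square)
  have Q0: "Q \<ge> 0" by (simp add: Q_def)
  have "h\<^sup>2 * Q \<le> norm z powr (\<alpha> - 1)"
    using order_trans[OF mult_left_mono[OF b, of h] a] h by (simp add: power2_eq_square mult.assoc)
  moreover have "sin (2 * \<psi>) * (X * u + r\<^sup>2) \<le> - Im z"
  proof -
    have "sin (2 * \<psi>) * (X * u) \<le> 1 * (X * u)" using sin_2psi X u by (intro mult_right_mono) auto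
    moreover have "X * u \<ge> 0" using X u by simp
    ultimately show ?thesis unfolding Imz by (simp add: algebra_simps)
  qed
  moreover have "X * u + r\<^sup>2 \<ge> 0" using X u by simp
  ultimately have "h\<^sup>2 * Q * (sin (2 * \<psi>) * (X * u + r\<^sup>2)) \<le> norm z powr (\<alpha> - 1) * (- Im z)"
    using sin_2psi Q0 by (intro mult_mono) auto
  then have "T * \<alpha> / 2 * (h\<^sup>2 * Q * (sin (2 * \<psi>) * (X * u + r\<^sup>2))) \<le> T * \<alpha> / 2 * (norm z powr (\<alpha> - 1) * (- Im z))"
    using T \<alpha> by (intro mult_left_mono) auto
  also have "\<dots> \<le> Re (Complex \<epsilon> T * z powr of_real \<alpha>)" using Re_zeta_powr_ge[OF zs \<epsilon>] by (simp add: mult.assoc)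
  also have "T * \<alpha> / 2 * (h\<^sup>2 * Q * (sin (2 * \<psi>) * (X * u + r\<^sup>2))) = \<kappa>2 * (Q * (X * u) + Q * r\<^sup>2)"
    unfolding \<kappa>2_def h_def[symmetric] by (simp add: field_simps)
  finally have main: "\<kappa>2 * (Q * (X * u) + Q * r\<^sup>2) \<le> Re (Complex \<epsilon> T * z powr of_real \<alpha>)" .
  have k: "\<kappa>2 > 0" by (rule kappa2_pos)
  have Qr: "Q * r\<^sup>2 \<ge> (R - 1) / 2" unfolding Q_def R_def by (rule transversal_power_ge[OF X r])
  have mu: "\<bar>m\<bar> * u \<le> \<kappa>2 / 8 * X powr (2 * \<alpha> - 1) * u"
    using order_trans[OF m mult_right_mono[of c2 "\<kappa>2 / 8" "X powr (2 * \<alpha> - 1)"]] u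
    by (intro mult_right_mono) (auto simp: c2_def)
  have X1: "u \<le> X powr (2 * \<alpha> - 1) * u"
    using X \<alpha> u mult_right_mono[of 1 "X powr (2 * \<alpha> - 1)" u] by (auto simp: ge_one_powr_ge_zero)
  have X2: "(X\<^sup>2) powr (\<alpha> - 1) * X = X powr (2 * \<alpha> - 1)"
    using powr_minus1_mult[of X "2 * \<alpha> - 1"] X by (simp add: powr_square algebra_simps)
  have R0: "R \<ge> 0" by (simp add: R_def)
  have "\<bar>m\<bar> * u - \<kappa>2 * (Q * (X * u) + Q * r\<^sup>2) \<le> \<kappa>2 - \<kappa>2 / 8 * u - \<kappa>2 / 4 * R"
  proof (cases "\<alpha> \<ge> 1 \<or> r \<le> X")
    case True
    have "Q * X \<ge> X powr (2 * \<alpha> - 1) / 2"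
    proof (cases "\<alpha> \<ge> 1")
      case True
      have "(X\<^sup>2) powr (\<alpha> - 1) * X \<le> Q * X" unfolding Q_def using True X by (intro mult_right_mono powr_mono2) auto
      moreover have "X powr (2 * \<alpha> - 1) \<ge> 0" by simp
      ultimately show ?thesis using X2 by linarith
    next
      case False
      with True have "r \<le> X" by simp
      then have "X\<^sup>2 + r\<^sup>2 \<le> 2 * X\<^sup>2" using r by (simp add: power_mono)
      then have "(2 * X\<^sup>2) powr (\<alpha> - 1) \<le> Q" unfolding Q_def
        using False X by (intro powr_mono2') (auto intro!: add_pos_nonneg)
      moreover have "(1::real) / 2 \<le> 2 powr (\<alpha> - 1)" using powr_mono[of "-1" "\<alpha> - 1" 2] \<alpha> by (simp add: powr_minus)
      then have "1/2 * (X\<^sup>2) powr (\<alpha> - 1) \<le> 2 powr (\<alpha> - 1) * (X\<^sup>2) powr (\<alpha> - 1)" by (intro mult_right_mono) auto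
      then have "1/2 * (X\<^sup>2) powr (\<alpha> - 1) \<le> (2 * X\<^sup>2) powr (\<alpha> - 1)" by (simp add: powr_mult)
      ultimately have "1/2 * (X\<^sup>2) powr (\<alpha> - 1) \<le> Q" by linarith
      then have "1/2 * (X\<^sup>2) powr (\<alpha> - 1) * X \<le> Q * X" using X by (intro mult_right_mono) auto
      then show ?thesis using X2 by simp
    qed
    then have "X powr (2 * \<alpha> - 1) / 2 * u \<le> Q * X * u" using u by (intro mult_right_mono) auto
    then have "\<kappa>2 * (X powr (2 * \<alpha> - 1) / 2 * u + (R - 1) / 2) \<le> \<kappa>2 * (Q * (X * u) + Q * r\<^sup>2)"
      using k Qr by (intro mult_left_mono add_mono) (auto simp: mult.assoc)
    moreover have "\<kappa>2 / 4 * u \<le> \<kappa>2 / 4 * (X powr (2 * \<alpha> - 1) * u)" using k X1 by (intro mult_left_mono) auto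
    moreover have "\<kappa>2 * R \<ge> 0" "\<kappa>2 * u \<ge> 0" using k R0 u by auto
    moreover define P q S where "P = \<kappa>2 * (X powr (2 * \<alpha> - 1) * u)" and "q = \<kappa>2 * u" and "S = \<kappa>2 * R"
    moreover define D where "D = \<kappa>2 * (Q * (X * u) + Q * r\<^sup>2)"
    moreover have "\<kappa>2 * (X powr (2 * \<alpha> - 1) / 2 * u + (R - 1) / 2) = P / 2 + S / 2 - \<kappa>2 / 2"
      by (simp add: P_def S_def field_simps)
    moreover have "\<kappa>2 / 4 * u = q / 4" "\<kappa>2 / 4 * (X powr (2 * \<alpha> - 1) * u) = P / 4" "\<kappa>2 / 8 * X powr (2 * \<alpha> - 1) * u = P / 8"
      "\<kappa>2 / 8 * u = q / 8" "\<kappa>2 / 4 * R = S / 4"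
      by (simp_all add: P_def q_def S_def)
    ultimately have "P / 2 + S / 2 - \<kappa>2 / 2 \<le> D" "q / 4 \<le> P / 4" "S \<ge> 0" "q \<ge> 0" "\<bar>m\<bar> * u \<le> P / 8"
      "\<kappa>2 - \<kappa>2 / 8 * u - \<kappa>2 / 4 * R = \<kappa>2 - q / 8 - S / 4"
      using mu by simp_all
    then show ?thesis unfolding D_def[symmetric] using k by linarith
  next
    case False
    then have F: "\<alpha> < 1" "r > X" by auto
    have rp: "r > 0" using F X by simp
    have "X\<^sup>2 + r\<^sup>2 \<le> 2 * r\<^sup>2" using F X by (simp add: power_mono)
    then have "(2 * r\<^sup>2) powr (\<alpha> - 1) \<le> Q" unfolding Q_def
      using F X by (intro powr_mono2') (auto intro!: add_pos_nonneg)
    moreover have "(1::real) / 2 \<le> 2 powr (\<alpha> - 1)" using powr_mono[of "-1" "\<alpha> - 1" 2] \<alpha> by (simp add: powr_minus)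
    then have "1/2 * (r\<^sup>2) powr (\<alpha> - 1) \<le> 2 powr (\<alpha> - 1) * (r\<^sup>2) powr (\<alpha> - 1)" by (intro mult_right_mono) auto
    then have "1/2 * (r\<^sup>2) powr (\<alpha> - 1) \<le> (2 * r\<^sup>2) powr (\<alpha> - 1)" by (simp add: powr_mult)
    ultimately have "1/2 * (r\<^sup>2) powr (\<alpha> - 1) \<le> Q" by linarith
    then have "1/2 * (r\<^sup>2) powr (\<alpha> - 1) * r\<^sup>2 \<le> Q * r\<^sup>2" by (intro mult_right_mono) auto
    then have "1/2 * ((r\<^sup>2) powr (\<alpha> - 1) * r\<^sup>2) \<le> Q * r\<^sup>2" by (simp only: mult.assoc)
    moreover have "(r\<^sup>2) powr (\<alpha> - 1) * r\<^sup>2 = r powr (2 * \<alpha>)" using powr_minus1_mult[of "r\<^sup>2" \<alpha>] rp by (simp add: powr_square)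
    ultimately have q: "r powr (2 * \<alpha>) / 2 \<le> Q * r\<^sup>2" by simp
    have "r / growth X \<le> r / 1" using r growth_ge1[OF X] by (intro divide_left_mono) auto
    then have Rr: "R \<le> r powr (2 * \<alpha>)" unfolding R_def using r growth_ge1[OF X] \<alpha> by (intro powr_mono2) auto
    have Xr: "X powr (2 * \<alpha>) \<le> r powr (2 * \<alpha>)" using F X \<alpha> by (intro powr_mono2) auto
    have "X powr (2 * \<alpha> - 1) * u \<le> X powr (2 * \<alpha> - 1) * X" using uX by (intro mult_left_mono) auto
    then have uX2: "X powr (2 * \<alpha> - 1) * u \<le> X powr (2 * \<alpha>)" using powr_minus1_mult[of X "2 * \<alpha>"] X by simp
    define P q' S where "P = \<kappa>2 * (X powr (2 * \<alpha> - 1) * u)" and "q' = \<kappa>2 * u" and "S = \<kappa>2 * R"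
    define D A B where "D = \<kappa>2 * (Q * (X * u) + Q * r\<^sup>2)" and "A = \<kappa>2 * r powr (2 * \<alpha>)" and "B = \<kappa>2 * X powr (2 * \<alpha>)"
    have "\<kappa>2 * (r powr (2 * \<alpha>) / 2) \<le> D" unfolding D_def
      using k q Q0 X u by (intro mult_left_mono) (auto intro: add_increasing)
    then have "A / 2 \<le> D" by (simp add: A_def)
    moreover have "S \<le> A" "B \<le> A" "P \<le> B" "q' \<le> P"
      using k Rr Xr uX2 X1 by (auto intro!: mult_left_mono simp: S_def A_def B_def P_def q'_def)
    moreover have "\<kappa>2 / 8 * X powr (2 * \<alpha> - 1) * u = P / 8" "\<kappa>2 / 8 * u = q' / 8" "\<kappa>2 / 4 * R = S / 4"
      by (simp_all add: P_def q'_def S_def)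
    moreover note mu
    ultimately show ?thesis unfolding D_def[symmetric] using k by simp
  qed
  moreover have "Re (\<i> * of_real m * p) \<le> \<bar>m\<bar> * u"
    using u mult_right_mono[of m "\<bar>m\<bar>" u] by (simp add: p_def)
  ultimately show ?thesis
    unfolding \<Phi>_def p_def[symmetric] z_def[symmetric] R_def[symmetric] norm_exp_eq_Re exp_le_cancel_iff minus_complex.simps
    using main by linarith
qed

end

section \<open>The contour shift and the bound on one rotated ray\<close>

context dispersive_angle begin

text \<open>The region swept when the ray is moved to the real axis. Unlike \<open>sector\<close> it
  contains 0, the common endpoint of both rays, and its opening angle is \<psi>, so that squares
  land in the sector.\<close>

definition wedge :: "complex set" where
  "wedge = {p. 0 \<le> Re p \<and> Im p \<le> 0 \<and> - Im p \<le> tan \<psi> * Re p}"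

lemma convex_wedge: "convex wedge"
proof (rule convexI)
  fix x y :: complex and u v :: real
  assume xy: "x \<in> wedge" "y \<in> wedge" and uv: "0 \<le> u" "0 \<le> v"
  have "u * (- Im x) \<le> u * (tan \<psi> * Re x)" "v * (- Im y) \<le> v * (tan \<psi> * Re y)"
    using xy uv mult_left_mono[of "- Im x" "tan \<psi> * Re x" u] mult_left_mono[of "- Im y" "tan \<psi> * Re y" v]
    by (simp_all add: wedge_def)
  moreover have "u * Re x \<ge> 0" "v * Re y \<ge> 0" "u * Im x \<le> 0" "v * Im y \<le> 0"
    using xy uv by (auto simp: wedge_def mult_nonneg_nonpos)
  ultimately show "u *\<^sub>R x + v *\<^sub>R y \<in> wedge" by (simp add: wedge_def algebra_simps)
qed

lemma wedge_zero_cases: "p \<in> wedge \<Longrightarrow> p = 0 \<or> Re p > 0"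
  by (auto simp: wedge_def complex_eq_iff)

lemma wedge_square: "p \<in> wedge \<Longrightarrow> p\<^sup>2 + W r \<in> insert 0 sector"
  using wedge_zero_cases[of p] square_sector(1)[of p] W_sector[of r]
  by (auto simp: wedge_def intro: sector_add)

lemma wedge_square_nz: "p \<in> wedge \<Longrightarrow> p \<noteq> 0 \<Longrightarrow> p\<^sup>2 + W r \<in> sector"
  using wedge_zero_cases[of p] square_sector(1)[of p] W_sector[of r]
  by (auto simp: wedge_def intro: sector_add)

text \<open>At 0 the complex power is not analytic, but its modulus tends to 0 because \<alpha> > 0.
  Continuity up to this vertex is what Cauchy's theorem on the triangle requires.\<close>

lemma continuous_on_powr_sector: "continuous_on (insert 0 sector) (\<lambda>z. z powr complex_of_real \<alpha>)"
  unfolding continuous_on_def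
proof
  fix z :: complex assume z: "z \<in> insert 0 sector"
  show "((\<lambda>z. z powr complex_of_real \<alpha>) \<longlongrightarrow> z powr complex_of_real \<alpha>) (at z within insert 0 sector)"
  proof (cases "z = 0")
    case True
    have "((\<lambda>w. norm w powr \<alpha>) \<longlongrightarrow> 0 powr \<alpha>) (at (0::complex) within insert 0 sector)"
      using \<alpha> by (intro tendsto_powr' tendsto_norm_zero tendsto_ident_at tendsto_const) auto
    then have "((\<lambda>w. norm (w powr complex_of_real \<alpha>)) \<longlongrightarrow> 0) (at 0 within insert 0 sector)"
      by (simp add: norm_powr_of_real)
    then show ?thesis using True by (simp add: tendsto_norm_zero_iff)
  next
    case False
    then have "z \<notin> \<real>\<^sub>\<le>\<^sub>0" using z sector_nonpos by auto
    then show ?thesis by (intro tendsto_powr_complex tendsto_ident_at tendsto_const)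
  qed
qed

lemma continuous_on_Phi: "continuous_on wedge (\<Phi> \<epsilon> m r)"
  unfolding \<Phi>_def
  by (intro continuous_intros continuous_on_compose2[OF continuous_on_powr_sector]) (auto dest: wedge_square)

lemma ray_in_wedge: "s \<ge> 0 \<Longrightarrow> of_real s * cis (- \<psi>) \<in> wedge"
  using tan_psi angle_facts by (auto simp: wedge_def tan_def intro!: mult_nonneg_nonneg sin_ge_zero)

lemma of_real_in_wedge: "s \<ge> 0 \<Longrightarrow> of_real s \<in> wedge"
  using tan_psi by (auto simp: wedge_def)

text \<open>Cauchy's theorem on the triangle with vertices 0, X and X - i X tan \<psi>;
  \<open>s1\<close> is the parameter at which the ray has real part X. The point 0, where for r = 0
  only continuity is available, is listed as an exceptional point.\<close>

lemma ray_contour: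
  assumes X: "X > 0"
  defines "s1 \<equiv> X / cos \<psi>"
  shows "integral {0..s1} (\<lambda>s. cis (- \<psi>) * \<Phi> \<epsilon> m r (of_real s * cis (- \<psi>)))
    = integral {0..X} (\<lambda>s. \<Phi> \<epsilon> m r (of_real s)) + integral {0..1} (\<lambda>x. \<Phi> \<epsilon> m r (Complex X (- (X * tan \<psi> * x))) * (- \<i> * of_real (X * tan \<psi>)))"
proof -
  define f where "f = \<Phi> \<epsilon> m r"
  define a b c :: complex where "a = 0" and "b = of_real X" and "c = of_real s1 * cis (- \<psi>)"
  have s1: "s1 > 0" using X tan_psi by (simp add: s1_def)
  have c: "c = Complex X (- (X * tan \<psi>))" using tan_psi by (simp add: c_def s1_def complex_eq_iff tan_def)
  have abc: "a \<in> wedge" "b \<in> wedge" "c \<in> wedge"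
    using X s1 of_real_in_wedge[of 0] of_real_in_wedge[of X] ray_in_wedge[of s1] by (auto simp: a_def b_def c_def)
  have hull: "convex hull {a, b, c} \<subseteq> wedge" using abc by (intro hull_minimal convex_wedge) auto
  have "(f has_contour_integral 0) (linepath a b +++ linepath b c +++ linepath c a)"
  proof (rule Cauchy_theorem_triangle_cofinite[of _ _ _ _ "{0}"])
    show "continuous_on (convex hull {a, b, c}) f"
      unfolding f_def using continuous_on_Phi hull by (rule continuous_on_subset)
    fix p assume "p \<in> interior (convex hull {a, b, c}) - {0}"
    then have "p \<in> wedge" "p \<noteq> 0" using hull interior_subset by blast+
    then have "p\<^sup>2 + W r \<notin> \<real>\<^sub>\<le>\<^sub>0" by (intro sector_nonpos wedge_square_nz)
    then have D: "((\<lambda>p. (p\<^sup>2 + W r) powr of_real \<alpha>) has_field_derivative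
        of_real \<alpha> * (p\<^sup>2 + W r) powr (of_real \<alpha> - 1) * (2 * p)) (at p)"
      by (auto intro!: derivative_eq_intros)
    show "f field_differentiable at p" unfolding field_differentiable_def f_def \<Phi>_def
      by (rule exI) (rule DERIV_chain2[OF DERIV_exp] DERIV_diff DERIV_cmult DERIV_ident D)+
  qed auto
  moreover have seg: "f contour_integrable_on linepath u v" if "u \<in> wedge" "v \<in> wedge" for u v
    unfolding f_def by (intro contour_integrable_continuous_linepath continuous_on_subset[OF continuous_on_Phi])
      (use that convex_wedge in \<open>simp add: closed_segment_subset\<close>)
  ultimately have sum0: "contour_integral (linepath a b) f + (contour_integral (linepath b c) f + contour_integral (linepath c a) f) = 0"
    using abc by (auto dest!: contour_integral_unique simp: contour_integral_join seg)
  have "contour_integral (linepath c a) f = - contour_integral (linepath a c) f"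
    using contour_integral_reversepath[of "linepath a c" f] by simp
  with sum0 have eq: "contour_integral (linepath a c) f = contour_integral (linepath a b) f + contour_integral (linepath b c) f"
    by (simp add: algebra_simps add_eq_0_iff)
  have 1: "contour_integral (linepath a b) f = integral {0..X} (\<lambda>s. \<Phi> \<epsilon> m r (of_real s))"
    using contour_integral_linepath_Reals_eq[of a b f] X by (simp add: a_def b_def f_def)
  have 2: "contour_integral (linepath b c) f = integral {0..1} (\<lambda>x. \<Phi> \<epsilon> m r (Complex X (- (X * tan \<psi> * x))) * (- \<i> * of_real (X * tan \<psi>)))"
  proof -
    have "linepath b c x = Complex X (- (X * tan \<psi> * x))" for x
      by (simp add: linepath_def b_def c complex_eq_iff algebra_simps)
    moreover have "c - b = - \<i> * of_real (X * tan \<psi>)" by (simp add: b_def c complex_eq_iff)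
    ultimately show ?thesis by (simp add: contour_integral_integral f_def)
  qed
  have 3: "contour_integral (linepath a c) f = integral {0..s1} (\<lambda>s. cis (- \<psi>) * \<Phi> \<epsilon> m r (of_real s * cis (- \<psi>)))"
  proof -
    define g where "g z = cis (- \<psi>) * f (z * cis (- \<psi>))" for z
    have "contour_integral (linepath 0 (of_real s1)) g = integral {0..s1} (\<lambda>s. g (of_real s))"
      using contour_integral_linepath_Reals_eq[of 0 "of_real s1" g] s1 by simp
    moreover have "contour_integral (linepath 0 (of_real s1)) g = contour_integral (linepath a c) f"
      unfolding contour_integral_integral
      by (intro integral_cong) (simp add: g_def linepath_def a_def c_def mult_ac scaleR_conv_of_real)
    ultimately show ?thesis by (simp add: g_def f_def)
  qed
  show ?thesis using eq unfolding 1 2 3 .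
qed

text \<open>\<open>c0\<close> is the worst decay rate among the real segment, the vertical side and
  the tail of the ray. \<open>C0\<close> adds their constants: 1 for [0, 1], the second derivative
  test on [1, X], the vertical side and the tail; the leading exponential pays for the subtracted 1
  in \<open>gain\<close>.\<close>

definition c0 :: real where "c0 = min (\<kappa>0 * min 1 \<alpha> / 2) (min (\<kappa>2 / 4) (\<kappa>1 / 2))"
definition C0 :: real where
  "C0 = exp (\<kappa>0 * min 1 \<alpha> / 2) * (1 + 10 / \<mu>0 * (2 + (1 + T) * 2 powr \<bar>\<alpha> - 2\<bar> / \<kappa>0)) + 8 / \<kappa>2 * exp \<kappa>2 + 4 / \<kappa>1"

lemma c0_pos: "c0 > 0" using kappa0_pos kappa1_pos kappa2_pos \<alpha> by (auto simp: c0_def min_def)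

lemma C0_nonneg: "C0 \<ge> 0"
  unfolding C0_def using kappa0_pos kappa1_pos kappa2_pos mu0_pos T
  by (intro add_nonneg_nonneg mult_nonneg_nonneg divide_nonneg_nonneg) auto

text \<open>A qualitative bound with a constant depending on m; it serves only to make the ray
  integral absolutely convergent.\<close>

lemma norm_Phi_ray_linear: 
  "\<exists>C. \<forall>s\<ge>0. \<forall>\<epsilon>\<ge>0. norm (\<Phi> \<epsilon> m r (of_real s * cis (- \<psi>))) \<le> exp C * exp (- 1 * s)"
proof -
  obtain C where C: "\<And>s. s \<ge> 0 \<Longrightarrow> (\<bar>m\<bar> + 1) * s - \<kappa>1 * s powr (2 * \<alpha>) \<le> C"
    using superlinear_bound[of \<kappa>1 "2 * \<alpha>" "\<bar>m\<bar> + 1"] kappa1_pos \<alpha> by auto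
  have "norm (\<Phi> \<epsilon> m r (of_real s * cis (- \<psi>))) \<le> exp C * exp (- 1 * s)" if "s \<ge> 0" "\<epsilon> \<ge> 0" for s \<epsilon>
  proof -
    have "(s\<^sup>2) powr \<alpha> \<le> (s\<^sup>2 + r\<^sup>2) powr \<alpha>" using \<alpha> by (intro powr_mono2) auto
    then have "\<kappa>1 * s powr (2 * \<alpha>) \<le> \<kappa>1 * (s\<^sup>2 + r\<^sup>2) powr \<alpha>"
      using kappa1_pos that by (simp add: powr_square)
    then have "\<bar>m\<bar> * s - \<kappa>1 * (s\<^sup>2 + r\<^sup>2) powr \<alpha> \<le> C + (- 1 * s)" using C[OF that(1)] by (simp add: algebra_simps)
    then have "exp (\<bar>m\<bar> * s - \<kappa>1 * (s\<^sup>2 + r\<^sup>2) powr \<alpha>) \<le> exp C * exp (- 1 * s)"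
      unfolding exp_add[symmetric] by simp
    then show ?thesis using norm_Phi_ray[OF that, of m r] by linarith
  qed
  then show ?thesis by blast
qed

lemma ray_abs_integrable:
  assumes "\<epsilon> \<ge> 0"
  shows "(\<lambda>s. cis (- \<psi>) * \<Phi> \<epsilon> m r (of_real s * cis (- \<psi>))) absolutely_integrable_on {0..}"
proof -
  obtain C where C: "\<And>s. s \<ge> 0 \<Longrightarrow> norm (\<Phi> \<epsilon> m r (of_real s * cis (- \<psi>))) \<le> exp C * exp (- 1 * s)"
    using norm_Phi_ray_linear[of m r] assms by blast
  show ?thesis
  proof (rule measurable_bounded_by_integrable_imp_absolutely_integrable)
    have "continuous_on {0..} (\<lambda>s. cis (- \<psi>) * \<Phi> \<epsilon> m r (of_real s * cis (- \<psi>)))"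
      by (intro continuous_intros continuous_on_compose2[OF continuous_on_Phi]) (auto simp: ray_in_wedge)
    then show "(\<lambda>s. cis (- \<psi>) * \<Phi> \<epsilon> m r (of_real s * cis (- \<psi>))) \<in> borel_measurable (lebesgue_on {0..})"
      by (rule continuous_imp_measurable_on_sets_lebesgue) auto
    show "(\<lambda>s. exp C * exp (- 1 * s)) integrable_on {0..}"
      by (intro integrable_on_mult_right integrable_on_exp_minus_to_infinity) auto
    show "norm (cis (- \<psi>) * \<Phi> \<epsilon> m r (of_real s * cis (- \<psi>))) \<le> exp C * exp (- 1 * s)" if "s \<in> {0..}" for s
      using C[of s] that by (simp add: norm_mult)
  qed auto
qed

text \<open>The ray is cut at its point of real part X. The inner part becomes the real segment plus
  a vertical side, where stationary frequencies are handled; on the outer part the size condition on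
  m lets the power dominate. Every piece carries the same factor \<open>exp (- c0 * R)\<close>, and
  only the segment [1, X] costs \<open>growth X\<close>.\<close>

lemma inner_ray_bound:
  assumes X: "X \<ge> 1" and r: "r \<ge> 0" and \<epsilon>: "0 \<le> \<epsilon>" "\<epsilon> \<le> 1" and m: "\<bar>m\<bar> \<le> c2 * X powr (2 * \<alpha> - 1)"
  shows "norm (integral {0..} (\<lambda>s. cis (- \<psi>) * \<Phi> \<epsilon> m r (of_real s * cis (- \<psi>))))
    \<le> C0 * growth X * exp (- c0 * (r / growth X) powr (2 * \<alpha>))"
proof -
  define R where "R = (r / growth X) powr (2 * \<alpha>)"
  define Y where "Y = growth X"
  define F where "F s = cis (- \<psi>) * \<Phi> \<epsilon> m r (of_real s * cis (- \<psi>))" for s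
  define s1 where "s1 = X / cos \<psi>"
  define G where "G = exp (- c0 * R)"
  have Y1: "Y \<ge> 1" using growth_ge1[OF X] by (simp add: Y_def)
  have R0: "R \<ge> 0" by (simp add: R_def)
  have s1X: "s1 \<ge> X" using X tan_psi cos_le_one[of \<psi>] by (simp add: s1_def pos_le_divide_eq mult_left_le)
  have G: "exp (- k * R) \<le> G" if "c0 \<le> k" for k using that R0 by (simp add: G_def mult_right_mono)
  have iF: "F integrable_on {0..}" unfolding F_def[abs_def] by (rule set_lebesgue_integral_eq_integral(1)[OF ray_abs_integrable[OF \<epsilon>(1)]])
  have iF1: "F integrable_on {0..s1}" by (rule integrable_on_subinterval[OF iF]) auto
  have iF2: "F integrable_on {s1..}"
  proof -
    have "F absolutely_integrable_on {s1..}"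
      using ray_abs_integrable[OF \<epsilon>(1), of m r] s1X X unfolding F_def[abs_def]
      by (rule_tac set_integrable_subset) auto
    then show ?thesis by (rule set_lebesgue_integral_eq_integral)
  qed
  have split: "integral {0..} F = integral {0..s1} F + integral {s1..} F"
  proof -
    have "negligible ({0..s1} \<inter> {s1..})" using s1X X by (subst negligible_subset[of "{s1}"]) auto
    moreover have "{0..s1} \<union> {s1..} = {0..}" using s1X X by auto
    ultimately show ?thesis using integral_Un[OF iF1 iF2] by simp
  qed
  have c0s: "c0 \<le> \<kappa>0 * min 1 \<alpha> / 2" "c0 \<le> \<kappa>2 / 4" "c0 \<le> \<kappa>1 / 2" by (auto simp: c0_def)
  \<comment> \<open>Of the rate \<kappa>1, one half is kept for the decay in r, one quarter is spent
    on the growth from m, and the last quarter gives integrability in s.\<close>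
  have tail: "norm (integral {s1..} F) \<le> 4 / \<kappa>1 * G"
  proof -
    have k1: "\<kappa>1 > 0" by (rule kappa1_pos)
    have "norm (F s) \<le> G * exp (- (\<kappa>1 / 4) * s)" if s: "s \<in> {s1..}" for s
    proof -
      have sX: "s \<ge> X" "s \<ge> 1" using s s1X X by auto
      have "c2 * X powr (2 * \<alpha> - 1) \<le> \<kappa>1 / 4 * s powr (2 * \<alpha> - 1)"
        using sX X \<alpha> k1 c2_pos by (intro mult_mono powr_mono2) (auto simp: c2_def)
      then have "\<bar>m\<bar> * s \<le> \<kappa>1 / 4 * s powr (2 * \<alpha> - 1) * s" using m sX by (intro mult_right_mono) auto
      also have "\<dots> = \<kappa>1 / 4 * s powr (2 * \<alpha>)" using powr_minus1_mult[of s "2 * \<alpha>"] sX by simp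
      finally have a: "\<bar>m\<bar> * s \<le> \<kappa>1 / 4 * s powr (2 * \<alpha>)" .
      have "(s\<^sup>2) powr \<alpha> \<le> (s\<^sup>2 + r\<^sup>2) powr \<alpha>" "(r\<^sup>2) powr \<alpha> \<le> (s\<^sup>2 + r\<^sup>2) powr \<alpha>" using \<alpha> by (auto intro!: powr_mono2)
      then have b: "s powr (2 * \<alpha>) \<le> (s\<^sup>2 + r\<^sup>2) powr \<alpha>" "r powr (2 * \<alpha>) \<le> (s\<^sup>2 + r\<^sup>2) powr \<alpha>"
        using sX r by (auto simp: powr_square)
      have "r / Y \<le> r / 1" using r Y1 by (intro divide_left_mono) auto
      then have d: "R \<le> r powr (2 * \<alpha>)" unfolding R_def Y_def[symmetric] using r Y1 \<alpha> by (intro powr_mono2) auto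
      have e: "s \<le> s powr (2 * \<alpha>)" using powr_mono[of 1 "2 * \<alpha>" s] sX \<alpha> by simp
      have "\<kappa>1 / 2 * R \<le> \<kappa>1 / 2 * (s\<^sup>2 + r\<^sup>2) powr \<alpha>" "\<kappa>1 / 2 * s powr (2 * \<alpha>) \<le> \<kappa>1 / 2 * (s\<^sup>2 + r\<^sup>2) powr \<alpha>"
        "\<kappa>1 / 4 * s \<le> \<kappa>1 / 4 * s powr (2 * \<alpha>)"
        using k1 b d e by (auto intro!: mult_left_mono)
      then have "\<bar>m\<bar> * s - \<kappa>1 * (s\<^sup>2 + r\<^sup>2) powr \<alpha> \<le> - (\<kappa>1 / 2) * R + - (\<kappa>1 / 4) * s" using a by (simp add: algebra_simps)
      then have "exp (\<bar>m\<bar> * s - \<kappa>1 * (s\<^sup>2 + r\<^sup>2) powr \<alpha>) \<le> exp (- (\<kappa>1 / 2) * R) * exp (- (\<kappa>1 / 4) * s)"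
        unfolding exp_add[symmetric] by simp
      also have "\<dots> \<le> G * exp (- (\<kappa>1 / 4) * s)" using G[OF c0s(3)] by (intro mult_right_mono) auto
      finally show ?thesis using norm_Phi_ray[of s \<epsilon> m r] sX \<epsilon> by (simp add: F_def norm_mult)
    qed
    then have "norm (integral {s1..} F) \<le> integral {s1..} (\<lambda>s. G * exp (- (\<kappa>1 / 4) * s))"
      using k1 by (intro integral_norm_bound_integral iF2 integrable_on_mult_right integrable_on_exp_minus_to_infinity) auto
    also have "\<dots> = G * (exp (- (\<kappa>1 / 4) * s1) / (\<kappa>1 / 4))"
      using has_integral_mult_right[OF has_integral_exp_minus_to_infinity[of "\<kappa>1 / 4" s1], of G] k1 by (intro integral_unique) auto
    also have "\<dots> \<le> G * (1 / (\<kappa>1 / 4))"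
      using k1 s1X X by (intro mult_left_mono divide_right_mono) (auto simp: G_def)
    finally show ?thesis by (simp add: mult.commute)
  qed
  define V where "V = integral {0..1} (\<lambda>x. \<Phi> \<epsilon> m r (Complex X (- (X * tan \<psi> * x))) * (- \<i> * of_real (X * tan \<psi>)))"
  have vert: "norm V \<le> 8 / \<kappa>2 * exp \<kappa>2 * G"
  proof -
    define L where "L = X * tan \<psi>"
    have L: "L > 0" using X tan_psi by (simp add: L_def)
    have k2: "\<kappa>2 > 0" by (rule kappa2_pos)
    \<comment> \<open>The length L of the vertical side grows with X; integrating the exponential
      decay in \<open>L * x\<close> exactly makes the result independent of L.\<close>
    have hI: "((\<lambda>x. exp \<kappa>2 * G * (L * exp (- \<kappa>2 / 8 * L * x))) has_integral
        (exp \<kappa>2 * G * (- 8 / \<kappa>2 * exp (- \<kappa>2 / 8 * L * 1) - (- 8 / \<kappa>2 * exp (- \<kappa>2 / 8 * L * 0))))) {0..1}"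
    proof (intro has_integral_mult_right fundamental_theorem_of_calculus)
      show "((\<lambda>x. - 8 / \<kappa>2 * exp (- \<kappa>2 / 8 * L * x)) has_vector_derivative L * exp (- \<kappa>2 / 8 * L * x)) (at x within {0..1})" for x
        unfolding has_real_derivative_iff_has_vector_derivative[symmetric] using k2
        by (auto intro!: derivative_eq_intros)
    qed auto
    have "norm V \<le> integral {0..1} (\<lambda>x. exp \<kappa>2 * G * (L * exp (- \<kappa>2 / 8 * L * x)))" unfolding V_def
    proof (rule integral_norm_bound_integral)
      have "continuous_on {0..1} (\<lambda>x. \<Phi> \<epsilon> m r (Complex X (- (X * tan \<psi> * x))))"
      proof (rule continuous_on_compose2[OF continuous_on_Phi])
        have *: "Complex X (- (X * tan \<psi> * x)) = of_real X - \<i> * of_real (X * tan \<psi> * x)" for x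
          by (simp add: complex_eq_iff)
        show "continuous_on {0..1} (\<lambda>x. Complex X (- (X * tan \<psi> * x)))" unfolding * by (intro continuous_intros)
        show "(\<lambda>x. Complex X (- (X * tan \<psi> * x))) ` {0..1} \<subseteq> wedge"
          using X tan_psi by (auto simp: wedge_def mult_ac intro!: mult_left_le)
      qed
      then show "(\<lambda>x. \<Phi> \<epsilon> m r (Complex X (- (X * tan \<psi> * x))) * (- \<i> * of_real (X * tan \<psi>))) integrable_on {0..1}"
        by (intro integrable_continuous_real continuous_intros)
      show "norm (\<Phi> \<epsilon> m r (Complex X (- (X * tan \<psi> * x))) * (- \<i> * of_real (X * tan \<psi>))) \<le> exp \<kappa>2 * G * (L * exp (- \<kappa>2 / 8 * L * x))"
        if x: "x \<in> {0..1}" for x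
      proof -
        have "norm (\<Phi> \<epsilon> m r (Complex X (- (X * tan \<psi> * x)))) \<le> exp (\<kappa>2 - \<kappa>2 / 8 * (X * tan \<psi> * x) - \<kappa>2 / 4 * (r / growth X) powr (2 * \<alpha>))"
          using X x tan_psi by (intro vertical_exponent r \<epsilon> m) (auto intro!: mult_left_le)
        also have "\<dots> = exp \<kappa>2 * exp (- \<kappa>2 / 8 * L * x) * exp (- (\<kappa>2 / 4) * R)"
          unfolding exp_add[symmetric] by (simp add: L_def R_def algebra_simps)
        also have "\<dots> \<le> exp \<kappa>2 * exp (- \<kappa>2 / 8 * L * x) * G" by (intro mult_left_mono G c0s) auto
        finally have "norm (\<Phi> \<epsilon> m r (Complex X (- (X * tan \<psi> * x)))) * L \<le> exp \<kappa>2 * exp (- \<kappa>2 / 8 * L * x) * G * L"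
          using L by (intro mult_right_mono) auto
        moreover have "norm (- \<i> * complex_of_real (X * tan \<psi>)) = L" using L unfolding L_def[symmetric] by (simp add: norm_mult)
        ultimately show ?thesis unfolding norm_mult by (simp add: mult_ac)
      qed
    qed (use hI in blast)
    also have "\<dots> = exp \<kappa>2 * G * (8 / \<kappa>2 * (1 - exp (- \<kappa>2 / 8 * L)))"
      unfolding integral_unique[OF hI] by (simp add: algebra_simps)
    also have "\<dots> \<le> exp \<kappa>2 * G * (8 / \<kappa>2 * 1)" using k2 by (intro mult_left_mono) (auto simp: G_def)
    finally show ?thesis by (simp add: mult_ac)
  qed
  define e where "e = exp (\<kappa>0 * min 1 \<alpha> / 2)"
  have gmG: "exp (- \<kappa>0 * gain X r) \<le> e * G"
  proof -
    have "- \<kappa>0 * gain X r = \<kappa>0 * min 1 \<alpha> / 2 + - (\<kappa>0 * min 1 \<alpha> / 2) * R"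
      by (simp add: gain_def R_def field_simps)
    then have "exp (- \<kappa>0 * gain X r) = e * exp (- (\<kappa>0 * min 1 \<alpha> / 2) * R)" unfolding e_def exp_add[symmetric] by simp
    also have "\<dots> \<le> e * G" by (intro mult_left_mono G c0s) (auto simp: e_def)
    finally show ?thesis .
  qed
  have cR: "continuous_on {0..X} (\<lambda>s. \<Phi> \<epsilon> m r (of_real s))"
    by (intro continuous_on_compose2[OF continuous_on_Phi] continuous_intros) (auto simp: of_real_in_wedge)
  have first: "norm (integral {0..1} (\<lambda>s. \<Phi> \<epsilon> m r (of_real s))) \<le> e * G"
  proof -
    \<comment> \<open>The pointwise bound on the real axis requires s > 0, so the value at the
      single point 0 is replaced.\<close>
    define h where "h s = (if s = 0 then 0 else \<Phi> \<epsilon> m r (of_real s))" for s :: real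
    have "(\<lambda>s. \<Phi> \<epsilon> m r (of_real s)) integrable_on {0..1}"
      by (intro integrable_continuous_real continuous_on_subset[OF cR]) (use X in auto)
    then have "h integrable_on {0..1}" by (rule integrable_spike[of _ _ "{0}"]) (auto simp: h_def)
    moreover have "norm (h s) \<le> exp (- \<kappa>0 * gain X r)" if "s \<in> {0..1}" for s
      using that norm_Phi_real[of s X r \<epsilon> m] X r \<epsilon> by (auto simp: h_def)
    ultimately have "norm (integral {0..1} h) \<le> integral {0..1::real} (\<lambda>_. exp (- \<kappa>0 * gain X r))"
      by (intro integral_norm_bound_integral) (auto intro: integrable_const_ivl)
    moreover have "integral {0..1} h = integral {0..1} (\<lambda>s. \<Phi> \<epsilon> m r (of_real s))"
      by (rule integral_spike[of "{0}"]) (auto simp: h_def)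
    ultimately show ?thesis using gmG by simp
  qed
  have second: "norm (integral {1..X} (\<lambda>s. \<Phi> \<epsilon> m r (of_real s))) \<le> 10 / \<mu>0 * Y * (2 + (1 + T) * 2 powr \<bar>\<alpha> - 2\<bar> / \<kappa>0) * (e * G)"
    using kappa0_pos T mu0_pos Y1
    by (intro order_trans[OF oscillatory_part_bound[OF X r \<epsilon>] mult_mono] gmG) (auto simp: Y_def intro!: mult_nonneg_nonneg add_nonneg_nonneg)
  have real: "integral {0..X} (\<lambda>s. \<Phi> \<epsilon> m r (of_real s)) = integral {0..1} (\<lambda>s. \<Phi> \<epsilon> m r (of_real s)) + integral {1..X} (\<lambda>s. \<Phi> \<epsilon> m r (of_real s))"
    by (rule Henstock_Kurzweil_Integration.integral_combine[symmetric]) (use X cR in \<open>auto intro: integrable_continuous_real\<close>)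
  have body: "integral {0..s1} F = integral {0..X} (\<lambda>s. \<Phi> \<epsilon> m r (of_real s)) + V"
    unfolding F_def s1_def V_def by (rule ray_contour) (use X in simp)
  have G0: "G \<ge> 0" "e \<ge> 0" by (auto simp: G_def e_def)
  define K where "K = 10 / \<mu>0 * (2 + (1 + T) * 2 powr \<bar>\<alpha> - 2\<bar> / \<kappa>0)"
  define A1 A2 where "A1 = 8 / \<kappa>2 * exp \<kappa>2" and "A2 = 4 / \<kappa>1"
  have A: "A1 \<ge> 0" "A2 \<ge> 0" using kappa1_pos kappa2_pos by (auto simp: A1_def A2_def)
  have "norm (integral {0..} F) \<le> e * G + K * Y * (e * G) + A1 * G + A2 * G"
    unfolding split body real
    using first second vert tail
    by (intro order_trans[OF norm_triangle_ineq] add_mono) (auto simp: K_def A1_def A2_def mult_ac)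
  also have "\<dots> \<le> e * G * Y + K * Y * (e * G) + A1 * G * Y + A2 * G * Y"
    using G0 A Y1 mult_left_mono[of 1 Y "e * G"] mult_left_mono[of 1 Y "A1 * G"] mult_left_mono[of 1 Y "A2 * G"] by simp
  also have "\<dots> = (e * (1 + K) + A1 + A2) * Y * G" by (simp add: algebra_simps)
  also have "e * (1 + K) + A1 + A2 = C0" by (simp only: C0_def e_def K_def A1_def A2_def)
  finally show ?thesis by (simp add: F_def[abs_def] Y_def G_def R_def)
qed

end

section \<open>Integration over Euclidean spaces\<close>

text \<open>On a convex domain the bound on the derivative is also a bound on the difference
  quotients, by the mean value inequality, and dominated convergence applies along
  sequences.\<close>

lemma has_field_derivative_integral_dominated:
  fixes g g' :: "complex \<Rightarrow> 'b \<Rightarrow> complex" and B :: "'b \<Rightarrow> real"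
  assumes D: "convex D" and w0: "w0 \<in> D"
    and der: "\<And>w x. w \<in> D \<Longrightarrow> ((\<lambda>w. g w x) has_field_derivative g' w x) (at w within D)"
    and bnd: "\<And>w x. w \<in> D \<Longrightarrow> norm (g' w x) \<le> B x"
    and B: "integrable M B"
    and g: "\<And>w. w \<in> D \<Longrightarrow> integrable M (g w)"
    and g': "g' w0 \<in> borel_measurable M"
  shows "((\<lambda>w. \<integral>x. g w x \<partial>M) has_field_derivative (\<integral>x. g' w0 x \<partial>M)) (at w0 within D)"
  unfolding has_field_derivative_iff tendsto_at_iff_sequentially
proof (intro allI impI)
  fix X :: "nat \<Rightarrow> complex" assume X: "\<forall>i. X i \<in> D - {w0}" "X \<longlonglongrightarrow> w0"
  have "(\<lambda>i. \<integral>x. (g (X i) x - g w0 x) / (X i - w0) \<partial>M) \<longlonglongrightarrow> (\<integral>x. g' w0 x \<partial>M)"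
  proof (rule integral_dominated_convergence[where w = B])
    show "g' w0 \<in> borel_measurable M" by (rule g')
    show "(\<lambda>x. (g (X i) x - g w0 x) / (X i - w0)) \<in> borel_measurable M" for i
      using g[of "X i"] g[OF w0] X(1) by (intro borel_measurable_divide borel_measurable_diff) auto
    show "integrable M B" by (rule B)
    show "AE x in M. (\<lambda>i. (g (X i) x - g w0 x) / (X i - w0)) \<longlonglongrightarrow> g' w0 x"
    proof (rule AE_I2)
      fix x
      show "(\<lambda>i. (g (X i) x - g w0 x) / (X i - w0)) \<longlonglongrightarrow> g' w0 x"
        using der[OF w0, of x] X unfolding has_field_derivative_iff tendsto_at_iff_sequentially o_def by blast
    qed
    show "AE x in M. norm ((g (X i) x - g w0 x) / (X i - w0)) \<le> B x" for i
    proof (rule AE_I2)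
      fix x
      have "norm (g (X i) x - g w0 x) \<le> B x * norm (X i - w0)"
        by (rule field_differentiable_bound[OF D der bnd]) (use X w0 in auto)
      moreover have "X i \<noteq> w0" using X by auto
      ultimately show "norm ((g (X i) x - g w0 x) / (X i - w0)) \<le> B x"
        by (simp add: norm_divide pos_divide_le_eq)
    qed
  qed
  moreover have "(\<integral>x. (g (X i) x - g w0 x) / (X i - w0) \<partial>M) = ((\<integral>x. g (X i) x \<partial>M) - (\<integral>x. g w0 x \<partial>M)) / (X i - w0)" for i
    using g[of "X i"] g[OF w0] X(1) by simp
  ultimately show "((\<lambda>y. ((\<integral>x. g y x \<partial>M) - (\<integral>x. g w0 x \<partial>M)) / (y - w0)) \<circ> X) \<longlonglongrightarrow> (\<integral>x. g' w0 x \<partial>M)"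
    unfolding o_def by (simp only:)
qed

lemma integrable_scaleR_right_nonzero_iff:
  assumes "(a::real) \<noteq> 0"
  shows "integrable M (\<lambda>x. a *\<^sub>R h x) \<longleftrightarrow> integrable M h"
proof
  assume "integrable M (\<lambda>x. a *\<^sub>R h x)"
  then have "integrable M (\<lambda>x. (1 / a) *\<^sub>R a *\<^sub>R h x)" by (rule integrable_scaleR_right)
  then show "integrable M h" using assms by simp
qed auto

text \<open>The affine image formula for Lebesgue measure. If f is not Borel measurable, neither is
  its dilation, and both integrals have the default value 0.\<close>

lemma lborel_integral_scale:
  fixes f :: "'a::euclidean_space \<Rightarrow> 'b::{banach, second_countable_topology}" and c :: real
  assumes c: "c \<noteq> 0" 
  shows "integrable lborel (\<lambda>x. f (c *\<^sub>R x)) \<longleftrightarrow> integrable lborel f"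
    and "\<bar>c\<bar> ^ DIM('a) *\<^sub>R (\<integral>x. f (c *\<^sub>R x) \<partial>lborel) = (\<integral>x. f x \<partial>lborel)"
proof -
  have lb: "(lborel :: 'a measure) = density (distr lborel borel (\<lambda>x. 0 + c *\<^sub>R x)) (\<lambda>_. \<bar>c\<bar> ^ DIM('a))"
    using lborel_affine[OF c, of 0] by simp
  have m: "(\<lambda>x::'a. f (c *\<^sub>R x)) \<in> borel_measurable borel \<longleftrightarrow> f \<in> borel_measurable borel"
  proof
    assume "(\<lambda>x::'a. f (c *\<^sub>R x)) \<in> borel_measurable borel"
    then have "(\<lambda>x. f (c *\<^sub>R x)) \<circ> (\<lambda>x. (1/c) *\<^sub>R x) \<in> borel_measurable borel" by (intro measurable_comp[of _ borel borel]) auto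
    then show "f \<in> borel_measurable borel" using c by (simp add: o_def)
  next
    assume "f \<in> borel_measurable borel"
    then show "(\<lambda>x::'a. f (c *\<^sub>R x)) \<in> borel_measurable borel" by measurable
  qed
  show eq: "integrable lborel (\<lambda>x. f (c *\<^sub>R x)) \<longleftrightarrow> integrable lborel f"
  proof (cases "f \<in> borel_measurable borel")
    case True
    note [measurable] = this
    have "integrable lborel f \<longleftrightarrow> integrable (distr lborel borel (\<lambda>x::'a. 0 + c *\<^sub>R x)) (\<lambda>x. \<bar>c\<bar> ^ DIM('a) *\<^sub>R f x)"
      by (subst lb, subst integrable_density) auto
    also have "\<dots> \<longleftrightarrow> integrable lborel (\<lambda>x. \<bar>c\<bar> ^ DIM('a) *\<^sub>R f (c *\<^sub>R x))"
      by (subst integrable_distr_eq) auto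
    also have "\<dots> \<longleftrightarrow> integrable lborel (\<lambda>x. f (c *\<^sub>R x))"
      using c by (intro integrable_scaleR_right_nonzero_iff) simp
    finally show ?thesis ..
  next
    case False
    then show ?thesis using m by (auto dest!: borel_measurable_integrable)
  qed
  show "\<bar>c\<bar> ^ DIM('a) *\<^sub>R (\<integral>x. f (c *\<^sub>R x) \<partial>lborel) = (\<integral>x. f x \<partial>lborel)"
  proof (cases "f \<in> borel_measurable borel")
    case True
    note [measurable] = this
    have "(\<integral>x. f x \<partial>lborel) = (\<integral>x. \<bar>c\<bar> ^ DIM('a) *\<^sub>R f x \<partial>distr lborel borel (\<lambda>x::'a. 0 + c *\<^sub>R x))"
      by (subst lb, subst integral_density) auto
    also have "\<dots> = (\<integral>x. \<bar>c\<bar> ^ DIM('a) *\<^sub>R f (c *\<^sub>R x) \<partial>lborel)"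
      by (subst integral_distr) auto
    finally show ?thesis by simp
  next
    case False
    then have "\<not> integrable lborel f" "\<not> integrable lborel (\<lambda>x. f (c *\<^sub>R x))"
      using m by (auto dest!: borel_measurable_integrable)
    then show ?thesis by (simp add: not_integrable_integral_eq)
  qed
qed

text \<open>Each coordinate is at most the norm, so with k = c / n the exponential is dominated by
  the product of one-dimensional exponentials in the coordinates.\<close>

lemma integrable_exp_neg_norm:
  assumes "c > 0"
  shows "integrable lborel (\<lambda>x::'a::euclidean_space. exp (- c * norm x))"
proof -
  define k where "k = c / DIM('a)"
  have k: "k > 0" using assms by (simp add: k_def)
  have fin: "(\<integral>\<^sup>+t. ennreal (exp (- k * \<bar>t\<bar>)) \<partial>lborel) < \<infinity>"
  proof -
    have ab: "(\<lambda>t. exp (- k * \<bar>t\<bar>)) absolutely_integrable_on {0..}"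
    proof (rule nonnegative_absolutely_integrable_1)
      show "(\<lambda>t. exp (- k * \<bar>t\<bar>)) integrable_on {0..}"
        using integrable_on_exp_minus_to_infinity[OF k, of 0]
        by (rule integrable_eq) auto
    qed auto
    have "integrable lebesgue (\<lambda>t. indicator {0..} t *\<^sub>R exp (- k * \<bar>t\<bar>))"
      using ab by (simp add: set_integrable_def)
    then have p: "integrable lborel (\<lambda>t. indicator {0..} t *\<^sub>R exp (- k * \<bar>t\<bar>))"
      by (subst (asm) integrable_completion) auto
    then have q: "integrable lborel (\<lambda>t. indicator {0..} (-1 *\<^sub>R t) *\<^sub>R exp (- k * \<bar>-1 *\<^sub>R t\<bar>))"
      using lborel_integral_scale(1)[of "-1" "\<lambda>t. indicator {0..} t *\<^sub>R exp (- k * \<bar>t\<bar>)"] by auto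
    have "integrable lborel (\<lambda>t. exp (- k * \<bar>t\<bar>))"
    proof (rule Bochner_Integration.integrable_bound[OF Bochner_Integration.integrable_add[OF p q]])
      show "AE t in lborel. norm (exp (- k * \<bar>t\<bar>)) \<le> norm (indicator {0..} t *\<^sub>R exp (- k * \<bar>t\<bar>) + indicator {0..} (-1 *\<^sub>R t) *\<^sub>R exp (- k * \<bar>-1 *\<^sub>R t\<bar>))"
        by (auto simp: indicator_def)
    qed auto
    then show ?thesis by (simp add: integrable_iff_bounded)
  qed
  have "(\<integral>\<^sup>+x. ennreal (exp (- c * norm x)) \<partial>(lborel :: 'a measure)) \<le> (\<integral>\<^sup>+x. (\<Prod>b\<in>Basis. ennreal (exp (- k * \<bar>x \<bullet> b\<bar>))) \<partial>(lborel :: 'a measure))"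
  proof (rule nn_integral_mono)
    fix x :: 'a
    have "(\<Sum>b\<in>Basis. \<bar>x \<bullet> b\<bar>) \<le> (\<Sum>b\<in>(Basis::'a set). norm x)" by (intro sum_mono Basis_le_norm)
    then have "k * (\<Sum>b\<in>Basis. \<bar>x \<bullet> b\<bar>) \<le> k * (DIM('a) * norm x)" using k by (intro mult_left_mono) auto
    also have "\<dots> = c * norm x" by (simp add: k_def)
    finally have "exp (- c * norm x) \<le> exp (\<Sum>b\<in>Basis. - k * \<bar>x \<bullet> b\<bar>)" by (simp add: sum_negf sum_distrib_left)
    then show "ennreal (exp (- c * norm x)) \<le> (\<Prod>b\<in>Basis. ennreal (exp (- k * \<bar>x \<bullet> b\<bar>)))"
      by (simp add: exp_sum prod_ennreal ennreal_leI)
  qed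
  also have "\<dots> = (\<Prod>b\<in>(Basis::'a set). (\<integral>\<^sup>+t. ennreal (exp (- k * \<bar>t\<bar>)) \<partial>lborel))"
    by (intro nn_integral_lborel_prod) auto
  also have "\<dots> < \<infinity>"
  proof -
    have "x ^ m < \<infinity>" if "x < \<infinity>" for x :: ennreal and m
      using that by (induction m) (auto simp: ennreal_mult_less_top)
    then show ?thesis using fin by simp
  qed
  finally show ?thesis by (intro integrableI_bounded) auto
qed

lemma integrable_exp_neg_norm_powr:
  fixes A c \<beta> :: real
  assumes c: "c > 0" and \<beta>: "\<beta> > 1"
  shows "integrable lborel (\<lambda>x::'a::euclidean_space. exp (A * norm x - c * norm x powr \<beta>))"
proof -
  obtain C where C: "\<And>s. s \<ge> 0 \<Longrightarrow> (A + 1) * s - c * s powr \<beta> \<le> C"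
    using superlinear_bound[OF c \<beta>] by blast
  show ?thesis
  proof (rule Bochner_Integration.integrable_bound)
    show "integrable lborel (\<lambda>x::'a. exp C * exp (- 1 * norm x))"
      by (intro integrable_mult_right integrable_exp_neg_norm) auto
    show "AE x in lborel. norm (exp (A * norm x - c * norm (x::'a) powr \<beta>)) \<le> norm (exp C * exp (- 1 * norm x))"
    proof (rule AE_I2)
      fix x :: 'a
      show "norm (exp (A * norm x - c * norm (x::'a) powr \<beta>)) \<le> norm (exp C * exp (- 1 * norm x))"
        using C[of "norm x"] unfolding exp_add[symmetric] by (simp add: algebra_simps)
    qed
  qed auto
qed

lemma lborel_integral_translation:
  fixes f :: "'a::euclidean_space \<Rightarrow> 'b::{banach, second_countable_topology}"
  shows "(\<integral>x. f (a + x) \<partial>lborel) = (\<integral>x. f x \<partial>lborel)"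
proof (cases "f \<in> borel_measurable borel")
  case True
  note [measurable] = this
  have "(\<integral>x. f x \<partial>lborel) = (\<integral>x. f x \<partial>distr lborel borel ((+) a))" by (simp add: lborel_distr_plus)
  also have "\<dots> = (\<integral>x. f (a + x) \<partial>lborel)" by (subst integral_distr) auto
  finally show ?thesis by simp
next
  case False
  have "f \<in> borel_measurable borel" if "(\<lambda>x. f (a + x)) \<in> borel_measurable borel"
  proof -
    have "(\<lambda>x. f (a + x)) \<circ> (\<lambda>x. - a + x) \<in> borel_measurable borel" by (rule measurable_comp[OF _ that]) auto
    then show ?thesis by (simp add: o_def)
  qed
  then have "\<not> integrable lborel f" "\<not> integrable lborel (\<lambda>x. f (a + x))"
    using False by (auto dest!: borel_measurable_integrable)
  then show ?thesis by (simp add: not_integrable_integral_eq)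
qed

lemma nn_integral_lborel_translation:
  fixes f :: "'a::euclidean_space \<Rightarrow> ennreal"
  assumes [measurable]: "f \<in> borel_measurable borel"
  shows "(\<integral>\<^sup>+x. f (a + x) \<partial>lborel) = (\<integral>\<^sup>+x. f x \<partial>lborel)"
proof -
  have "(\<integral>\<^sup>+x. f x \<partial>lborel) = (\<integral>\<^sup>+x. f x \<partial>distr lborel borel ((+) a))" by (simp add: lborel_distr_plus)
  also have "\<dots> = (\<integral>\<^sup>+x. f (a + x) \<partial>lborel)" by (subst nn_integral_distr) auto
  finally show ?thesis by simp
qed

text \<open>Averaging over translates along \<open>e\<close> slices the integral into lines without splitting the
  space as a product.\<close>

lemma integral_slices:
  fixes f :: "'a::euclidean_space \<Rightarrow> complex" and w :: "real \<Rightarrow> real" and e :: 'a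
  assumes f: "integrable lborel f" and w: "integrable lborel w" and w0: "\<And>t. w t \<ge> 0" and w1: "(\<integral>t. w t \<partial>lborel) = 1"
    and e: "norm e = 1"
  shows "(\<integral>\<xi>. f \<xi> \<partial>lborel) = (\<integral>\<xi>. w (e \<bullet> \<xi>) *\<^sub>R (\<integral>s. f (\<xi> + s *\<^sub>R e) \<partial>lborel) \<partial>lborel)"
    and "integrable lborel (\<lambda>\<xi>. w (e \<bullet> \<xi>) *\<^sub>R (\<integral>s. f (\<xi> + s *\<^sub>R e) \<partial>lborel))"
proof -
  have [measurable]: "f \<in> borel_measurable borel" "w \<in> borel_measurable borel" using f w by auto
  have w1': "(\<integral>\<^sup>+t. ennreal (w t) \<partial>lborel) = 1"
    using w w0 w1 nn_integral_eq_integral[of lborel w] by simp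
  define F where "F = (\<lambda>(\<xi>, s). w (e \<bullet> \<xi>) *\<^sub>R f (\<xi> + s *\<^sub>R e))"
  have Fm [measurable]: "F \<in> borel_measurable (lborel \<Otimes>\<^sub>M lborel)" unfolding F_def by measurable
  \<comment> \<open>A shear: translating \<xi> by s along the unit vector e moves the s-dependence
    from f to the weight, whose integral over s is then 1 for every \<xi>.\<close>
  have shift: "w (e \<bullet> \<xi>) *\<^sub>R f (\<xi> + s *\<^sub>R e) = (\<lambda>\<xi>. w (e \<bullet> \<xi> - s) *\<^sub>R f \<xi>) (s *\<^sub>R e + \<xi>)" for \<xi> s
    using e by (simp add: inner_add_right dot_square_norm add.commute)
  have wint: "(\<integral>\<^sup>+s. ennreal (w (a - s)) \<partial>lborel) = 1" for a
  proof -
    have "(\<integral>\<^sup>+s. ennreal (w (a - s)) \<partial>lborel) = (\<integral>\<^sup>+s. ennreal (w s) \<partial>distr lborel borel (\<lambda>s. a + (-1) * s))"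
      by (subst nn_integral_distr) auto
    also have "distr lborel borel (\<lambda>s. a + (-1) * s) = (lborel :: real measure)"
      using lborel_real_affine[of "-1" a] by (simp add: density_1)
    finally show ?thesis using w1' by simp
  qed
  have "(\<integral>\<^sup>+z. norm (F z) \<partial>(lborel \<Otimes>\<^sub>M lborel)) = (\<integral>\<^sup>+s. \<integral>\<^sup>+\<xi>. norm (F (\<xi>, s)) \<partial>lborel \<partial>lborel)"
    by (subst lborel.nn_integral_fst[symmetric], simp, rule lborel_pair.Fubini[symmetric]) simp
  also have "\<dots> = (\<integral>\<^sup>+s. \<integral>\<^sup>+\<xi>. norm (w (e \<bullet> \<xi> - s) *\<^sub>R f \<xi>) \<partial>lborel \<partial>lborel)"
  proof (rule nn_integral_cong)
    fix s :: real
    show "(\<integral>\<^sup>+\<xi>. norm (F (\<xi>, s)) \<partial>lborel) = (\<integral>\<^sup>+\<xi>. norm (w (e \<bullet> \<xi> - s) *\<^sub>R f \<xi>) \<partial>lborel)"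
      unfolding F_def prod.case shift by (rule nn_integral_lborel_translation) measurable
  qed
  also have "\<dots> = (\<integral>\<^sup>+\<xi>. \<integral>\<^sup>+s. norm (w (e \<bullet> \<xi> - s) *\<^sub>R f \<xi>) \<partial>lborel \<partial>lborel)"
    by (rule lborel_pair.Fubini') measurable
  also have "\<dots> = (\<integral>\<^sup>+\<xi>. norm (f \<xi>) \<partial>lborel)"
  proof (intro nn_integral_cong)
    fix \<xi> :: 'a
    have "(\<integral>\<^sup>+s. norm (w (e \<bullet> \<xi> - s) *\<^sub>R f \<xi>) \<partial>lborel) = (\<integral>\<^sup>+s. ennreal (w (e \<bullet> \<xi> - s)) * norm (f \<xi>) \<partial>lborel)"
      using w0 by (intro nn_integral_cong) (simp add: ennreal_mult)
    also have "\<dots> = norm (f \<xi>)" by (subst nn_integral_multc) (auto simp: wint)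
    finally show "(\<integral>\<^sup>+s. norm (w (e \<bullet> \<xi> - s) *\<^sub>R f \<xi>) \<partial>lborel) = norm (f \<xi>)" .
  qed
  also have "\<dots> < \<infinity>" using f by (simp add: integrable_iff_bounded)
  finally have FI: "integrable (lborel \<Otimes>\<^sub>M lborel) F" by (intro integrableI_bounded) auto
  have eq: "(\<integral>s. F (\<xi>, s) \<partial>lborel) = w (e \<bullet> \<xi>) *\<^sub>R (\<integral>s. f (\<xi> + s *\<^sub>R e) \<partial>lborel)" for \<xi>
    by (simp add: F_def)
  show "integrable lborel (\<lambda>\<xi>. w (e \<bullet> \<xi>) *\<^sub>R (\<integral>s. f (\<xi> + s *\<^sub>R e) \<partial>lborel))"
    using lborel_pair.integrable_fst[of "\<lambda>\<xi> s. F (\<xi>, s)"] FI eq by simp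
  define F3 where "F3 = (\<lambda>(\<xi>, s). w (e \<bullet> \<xi> - s) *\<^sub>R f \<xi>)"
  have F3m [measurable]: "F3 \<in> borel_measurable (lborel \<Otimes>\<^sub>M lborel)" unfolding F3_def by measurable
  have F3I: "integrable (lborel \<Otimes>\<^sub>M lborel) F3"
  proof (intro integrableI_bounded)
    have "(\<integral>\<^sup>+z. norm (F3 z) \<partial>(lborel \<Otimes>\<^sub>M lborel)) = (\<integral>\<^sup>+\<xi>. \<integral>\<^sup>+s. norm (F3 (\<xi>, s)) \<partial>lborel \<partial>lborel)"
      by (subst lborel.nn_integral_fst[symmetric]) auto
    also have "\<dots> = (\<integral>\<^sup>+\<xi>. norm (f \<xi>) \<partial>lborel)"
    proof (intro nn_integral_cong)
      fix \<xi> :: 'a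
      have "(\<integral>\<^sup>+s. norm (F3 (\<xi>, s)) \<partial>lborel) = (\<integral>\<^sup>+s. ennreal (w (e \<bullet> \<xi> - s)) * norm (f \<xi>) \<partial>lborel)"
        using w0 by (intro nn_integral_cong) (simp add: ennreal_mult F3_def)
      also have "\<dots> = norm (f \<xi>)" by (subst nn_integral_multc) (auto simp: wint)
      finally show "(\<integral>\<^sup>+s. norm (F3 (\<xi>, s)) \<partial>lborel) = norm (f \<xi>)" .
    qed
    also have "\<dots> < \<infinity>" using f by (simp add: integrable_iff_bounded)
    finally show "(\<integral>\<^sup>+z. norm (F3 z) \<partial>(lborel \<Otimes>\<^sub>M lborel)) < \<infinity>" .
  qed auto
  have "(\<integral>\<xi>. w (e \<bullet> \<xi>) *\<^sub>R (\<integral>s. f (\<xi> + s *\<^sub>R e) \<partial>lborel) \<partial>lborel) = (\<integral>\<xi>. (\<integral>s. F (\<xi>, s) \<partial>lborel) \<partial>lborel)"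
    by (simp add: eq)
  also have "\<dots> = (\<integral>s. (\<integral>\<xi>. F (\<xi>, s) \<partial>lborel) \<partial>lborel)"
    using lborel_pair.Fubini_integral[of "\<lambda>\<xi> s. F (\<xi>, s)"] FI by simp
  also have "\<dots> = (\<integral>s. (\<integral>\<xi>. F3 (\<xi>, s) \<partial>lborel) \<partial>lborel)"
    unfolding F_def F3_def prod.case shift by (subst lborel_integral_translation) simp
  also have "\<dots> = (\<integral>\<xi>. (\<integral>s. F3 (\<xi>, s) \<partial>lborel) \<partial>lborel)"
    using lborel_pair.Fubini_integral[of "\<lambda>\<xi> s. F3 (\<xi>, s)"] F3I by simp
  also have "\<dots> = (\<integral>\<xi>. f \<xi> \<partial>lborel)"
  proof (intro Bochner_Integration.integral_cong refl)
    fix \<xi> :: 'a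
    have "(\<integral>s. w (e \<bullet> \<xi> - s) \<partial>lborel) = 1"
      using wint[of "e \<bullet> \<xi>"] w0 by (subst integral_eq_nn_integral) auto
    moreover have "integrable lborel (\<lambda>s. w (e \<bullet> \<xi> - s))"
      using wint[of "e \<bullet> \<xi>"] w0 by (intro integrableI_bounded) auto
    ultimately show "(\<integral>s. F3 (\<xi>, s) \<partial>lborel) = f \<xi>" by (simp add: F3_def)
  qed
  finally show "(\<integral>\<xi>. f \<xi> \<partial>lborel) = (\<integral>\<xi>. w (e \<bullet> \<xi>) *\<^sub>R (\<integral>s. f (\<xi> + s *\<^sub>R e) \<partial>lborel) \<partial>lborel)" by simp
qed

section \<open>The dispersive kernel\<close>

context dispersive_angle begin

text \<open>Left unnormalised: the factor (2 pi) powr (- n) enters only when the multiplier is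
  written as an integral operator, as the square of \<open>fourier_const\<close>.\<close>

definition dispersive_kernel :: "real \<Rightarrow> 'a::euclidean_space \<Rightarrow> complex" where
  "dispersive_kernel \<epsilon> z = (\<integral>\<xi>. exp (\<i> * of_real (z \<bullet> \<xi>) - Complex \<epsilon> T * of_real (norm \<xi> powr (2 * \<alpha>))) \<partial>lborel)"

text \<open>The integrand of \<open>dispersive_kernel\<close> after the substitution \<open>\<xi> \<mapsto> exp w \<xi>\<close>, Jacobian included.\<close>

definition dilated :: "real \<Rightarrow> 'a::euclidean_space \<Rightarrow> complex \<Rightarrow> 'a \<Rightarrow> complex" where
  "dilated \<epsilon> z w \<xi> = exp (\<i> * exp w * of_real (z \<bullet> \<xi>) - Complex \<epsilon> T * exp (of_real (2 * \<alpha>) * w) * of_real (norm \<xi> powr (2 * \<alpha>)) + of_nat DIM('a) * w)"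

text \<open>The rotation runs down the left edge, from 0 to - i \<psi>. The unit width to the right
  leaves room for real difference quotients at every point of this edge.\<close>

definition strip :: "complex set" where
  "strip = {w. 0 \<le> Re w \<and> Re w \<le> 1 \<and> - \<psi> \<le> Im w \<and> Im w \<le> 0}"

lemma convex_strip: "convex strip"
proof -
  have "strip = cbox (Complex 0 (- \<psi>)) (Complex 1 0)"
    by (auto simp: strip_def in_cbox_complex_iff)
  then show ?thesis by (simp add: convex_box)
qed

text \<open>On the strip the angle \<open>2 * \<alpha> * Im w\<close> lies in [- pi / 4, 0], so T
  and \<epsilon> both contribute positively and the real part of the rotated coefficient is at least
  \<epsilon> / 2. Half of this decay, together with one more unit of linear growth, is spent on the
  factors \<open>norm \<xi>\<close> and \<open>norm \<xi> powr (2 * \<alpha>)\<close> of the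
  w-derivative, so that one B serves both bounds. B depends on \<epsilon>, which is harmless, since
  the rotation is an exact identity for each fixed \<epsilon>.\<close>

lemma dilated_integrable_and_bound:
  fixes z :: "'a::euclidean_space"
  assumes \<epsilon>: "\<epsilon> > 0"
  obtains B :: "'a \<Rightarrow> real" where "integrable lborel B"
    and "\<And>w \<xi>. w \<in> strip \<Longrightarrow> norm (dilated \<epsilon> z w \<xi>) \<le> B \<xi>"
    and "\<And>w \<xi>. w \<in> strip \<Longrightarrow> norm (dilated \<epsilon> z w \<xi> * (\<i> * exp w * of_real (z \<bullet> \<xi>)
      - Complex \<epsilon> T * (of_real (2 * \<alpha>) * exp (of_real (2 * \<alpha>) * w)) * of_real (norm \<xi> powr (2 * \<alpha>)) + of_nat DIM('a))) \<le> B \<xi>"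
proof
  define n where "n = real DIM('a)"
  define c1 c3 where "c1 = exp 1 * norm z" and "c3 = norm (Complex \<epsilon> T) * (2 * \<alpha> * exp (2 * \<alpha>))"
  define C where "C = exp n * (c1 + c3 * (4 / \<epsilon>) + n + 1)"
  define B where "B \<xi> = C * exp ((c1 + 1) * norm \<xi> - \<epsilon> / 4 * norm \<xi> powr (2 * \<alpha>))" for \<xi> :: 'a
  show "integrable lborel B" unfolding B_def
    by (intro integrable_mult_right integrable_exp_neg_norm_powr) (use \<epsilon> \<alpha> in auto)
  have pos: "c1 \<ge> 0" "c3 \<ge> 0" "n \<ge> 0" using \<alpha> by (auto simp: c1_def c3_def n_def)
  fix w :: complex and \<xi> :: 'a assume w: "w \<in> strip"
  define x y where "x = norm \<xi>" and "y = norm \<xi> powr (2 * \<alpha>)"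
  have xy: "x \<ge> 0" "y \<ge> 0" by (auto simp: x_def y_def)
  have ew: "norm (exp w) \<le> exp 1" "norm (exp (of_real (2 * \<alpha>) * w)) \<le> exp (2 * \<alpha>)"
    using w \<alpha> by (auto simp: strip_def intro!: mult_left_le)
  have zx: "\<bar>z \<bullet> \<xi>\<bar> \<le> norm z * x" unfolding x_def by (rule Cauchy_Schwarz_ineq2)
  have f1: "norm (\<i> * exp w * of_real (z \<bullet> \<xi>)) \<le> c1 * x"
  proof -
    have "norm (exp w) * \<bar>z \<bullet> \<xi>\<bar> \<le> exp 1 * (norm z * x)" using ew zx by (intro mult_mono) auto
    then show ?thesis unfolding c1_def norm_mult norm_of_real by (simp add: mult_ac)
  qed
  have f3: "norm (Complex \<epsilon> T * (of_real (2 * \<alpha>) * exp (of_real (2 * \<alpha>) * w)) * of_real (norm \<xi> powr (2 * \<alpha>))) \<le> c3 * y"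
  proof -
    have "norm (complex_of_real (2 * \<alpha>)) = 2 * \<alpha>" using \<alpha> by (simp only: norm_of_real)
    then show ?thesis
      unfolding c3_def y_def norm_mult using ew \<alpha> by (intro mult_mono) auto
  qed
  have a: "2 * \<alpha> * Im w \<le> 0" "- (pi / 4) \<le> 2 * \<alpha> * Im w"
  proof -
    show "2 * \<alpha> * Im w \<le> 0" using w \<alpha> by (auto simp: strip_def mult_nonneg_nonpos)
    have "2 * \<alpha> * (- \<psi>) \<le> 2 * \<alpha> * Im w" using w \<alpha> by (intro mult_left_mono) (auto simp: strip_def)
    then show "- (pi / 4) \<le> 2 * \<alpha> * Im w" using angle_facts by simp
  qed
  have re: "Re (Complex \<epsilon> T * exp (of_real (2 * \<alpha>) * w)) \<ge> \<epsilon> / 2"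
  proof -
    have "cos (pi / 3) \<le> cos (- (2 * \<alpha> * Im w))" using a by (intro cos_monotone_0_pi_le) auto
    then have c: "cos (2 * \<alpha> * Im w) \<ge> 1/2" by (simp add: cos_60)
    have s: "sin (2 * \<alpha> * Im w) \<le> 0" using a sin_ge_zero[of "- (2 * \<alpha> * Im w)"] by simp
    have e1: "exp (2 * \<alpha> * Re w) \<ge> 1" using w \<alpha> by (auto simp: strip_def)
    have "\<epsilon> * (1/2) \<le> \<epsilon> * cos (2 * \<alpha> * Im w)" using \<epsilon> c by (intro mult_left_mono) auto
    moreover have "T * sin (2 * \<alpha> * Im w) \<le> 0" using T s by (simp add: mult_nonneg_nonpos)
    ultimately have k: "\<epsilon> / 2 \<le> \<epsilon> * cos (2 * \<alpha> * Im w) - T * sin (2 * \<alpha> * Im w)" by simp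
    then have "1 * (\<epsilon> / 2) \<le> exp (2 * \<alpha> * Re w) * (\<epsilon> * cos (2 * \<alpha> * Im w) - T * sin (2 * \<alpha> * Im w))"
      using e1 \<epsilon> by (intro mult_mono) auto
    also have "\<dots> = Re (Complex \<epsilon> T * exp (of_real (2 * \<alpha>) * w))"
      by (simp add: Re_exp Im_exp algebra_simps)
    finally show ?thesis by simp
  qed
  have nd: "norm (dilated \<epsilon> z w \<xi>) \<le> exp n * exp (c1 * x - \<epsilon> / 2 * y)"
  proof -
    have "Re (\<i> * exp w * of_real (z \<bullet> \<xi>)) \<le> c1 * x" using f1 complex_Re_le_cmod order_trans by blast
    moreover have "\<epsilon> / 2 * y \<le> Re (Complex \<epsilon> T * exp (of_real (2 * \<alpha>) * w)) * y" using re xy by (intro mult_right_mono)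
    moreover have "Re (Complex \<epsilon> T * exp (of_real (2 * \<alpha>) * w)) * y = Re (Complex \<epsilon> T * exp (of_real (2 * \<alpha>) * w) * of_real (norm \<xi> powr (2 * \<alpha>)))"
      by (simp add: y_def)
    moreover have "Re (of_nat DIM('a) * w) \<le> n" using w by (auto simp: strip_def n_def intro!: mult_left_le)
    ultimately show ?thesis unfolding dilated_def norm_exp_eq_Re exp_add[symmetric] exp_le_cancel_iff
      plus_complex.simps minus_complex.simps by linarith
  qed
  have ex: "1 \<le> exp (x + \<epsilon> / 4 * y)" "x \<le> exp (x + \<epsilon> / 4 * y)" "y \<le> 4 / \<epsilon> * exp (x + \<epsilon> / 4 * y)"
  proof -
    have e: "\<epsilon> / 4 * y \<ge> 0" using \<epsilon> xy by simp
    show "1 \<le> exp (x + \<epsilon> / 4 * y)" using e xy by simp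
    show "x \<le> exp (x + \<epsilon> / 4 * y)" using e exp_ge_add_one_self[of "x + \<epsilon> / 4 * y"] by linarith
    have "\<epsilon> / 4 * y \<le> exp (x + \<epsilon> / 4 * y)" using xy exp_ge_add_one_self[of "x + \<epsilon> / 4 * y"] by linarith
    then show "y \<le> 4 / \<epsilon> * exp (x + \<epsilon> / 4 * y)" using \<epsilon> by (simp add: field_simps)
  qed
  have comb: "exp n * exp (c1 * x - \<epsilon> / 2 * y) * (K * exp (x + \<epsilon> / 4 * y)) = exp n * K * exp ((c1 + 1) * x - \<epsilon> / 4 * y)" for K
  proof -
    have "exp (c1 * x - \<epsilon> / 2 * y) * exp (x + \<epsilon> / 4 * y) = exp ((c1 + 1) * x - \<epsilon> / 4 * y)"
      unfolding exp_add[symmetric] by (simp add: algebra_simps)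
    then show ?thesis by (metis mult.assoc mult.left_commute)
  qed
  have K1: "c1 + c3 * (4 / \<epsilon>) + n + 1 \<ge> 1" using pos \<epsilon> by simp
  show "norm (dilated \<epsilon> z w \<xi>) \<le> B \<xi>"
  proof -
    have "1 * 1 \<le> (c1 + c3 * (4 / \<epsilon>) + n + 1) * exp (x + \<epsilon> / 4 * y)" using K1 ex by (intro mult_mono) auto
    then have "exp n * exp (c1 * x - \<epsilon> / 2 * y) * 1 \<le> exp n * exp (c1 * x - \<epsilon> / 2 * y) * ((c1 + c3 * (4 / \<epsilon>) + n + 1) * exp (x + \<epsilon> / 4 * y))"
      by (intro mult_left_mono) auto
    then show ?thesis using nd unfolding comb B_def C_def y_def[symmetric] unfolding x_def[symmetric] by linarith
  qed
  show "norm (dilated \<epsilon> z w \<xi> * (\<i> * exp w * of_real (z \<bullet> \<xi>)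
      - Complex \<epsilon> T * (of_real (2 * \<alpha>) * exp (of_real (2 * \<alpha>) * w)) * of_real (norm \<xi> powr (2 * \<alpha>)) + of_nat DIM('a))) \<le> B \<xi>"
  proof -
    have "norm (\<i> * exp w * of_real (z \<bullet> \<xi>)
      - Complex \<epsilon> T * (of_real (2 * \<alpha>) * exp (of_real (2 * \<alpha>) * w)) * of_real (norm \<xi> powr (2 * \<alpha>)) + of_nat DIM('a)) \<le> c1 * x + c3 * y + n"
      by (intro order_trans[OF norm_triangle_ineq] order_trans[OF norm_triangle_ineq4] add_mono f1 f3) (auto simp: n_def)
    also have "\<dots> \<le> c1 * exp (x + \<epsilon> / 4 * y) + c3 * (4 / \<epsilon> * exp (x + \<epsilon> / 4 * y)) + n * exp (x + \<epsilon> / 4 * y)"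
      using ex pos mult_left_mono[OF ex(1), of n] by (intro add_mono mult_left_mono) auto
    also have "\<dots> \<le> (c1 + c3 * (4 / \<epsilon>) + n + 1) * exp (x + \<epsilon> / 4 * y)" by (simp add: algebra_simps)
    finally have "norm (dilated \<epsilon> z w \<xi> * (\<i> * exp w * of_real (z \<bullet> \<xi>)
      - Complex \<epsilon> T * (of_real (2 * \<alpha>) * exp (of_real (2 * \<alpha>) * w)) * of_real (norm \<xi> powr (2 * \<alpha>)) + of_nat DIM('a))) 
       \<le> exp n * exp (c1 * x - \<epsilon> / 2 * y) * ((c1 + c3 * (4 / \<epsilon>) + n + 1) * exp (x + \<epsilon> / 4 * y))"
      unfolding norm_mult[of "dilated \<epsilon> z w \<xi>"] using nd by (intro mult_mono) auto
    then show ?thesis unfolding comb B_def C_def y_def[symmetric] unfolding x_def[symmetric] .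
  qed
qed

lemma borel_measurable_dilated [measurable]: "dilated \<epsilon> z w \<in> borel_measurable borel"
  unfolding dilated_def[abs_def] by measurable

lemma dilated_integrable:
  assumes "\<epsilon> > 0" "w \<in> strip"
  shows "integrable lborel (dilated \<epsilon> z w)"
proof -
  obtain B where B: "integrable lborel B" "\<And>w \<xi>. w \<in> strip \<Longrightarrow> norm (dilated \<epsilon> z w \<xi>) \<le> B \<xi>"
    using dilated_integrable_and_bound[OF assms(1), of z] by metis
  show ?thesis
    by (rule Bochner_Integration.integrable_bound[OF B(1)])
       (use B(2)[OF assms(2)] in \<open>auto intro!: AE_I2 order_trans[OF _ abs_ge_self]\<close>)
qed

text \<open>The integral of \<open>dilated\<close> is analytic in \<open>w\<close> and, by a real change of variables, does not
  change in the real direction; hence it is constant.\<close>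

lemma rotate_kernel:
  fixes z :: "'a::euclidean_space"
  assumes \<epsilon>: "\<epsilon> > 0"
  shows "dispersive_kernel \<epsilon> z = (\<integral>\<xi>. dilated \<epsilon> z (- \<i> * of_real \<psi>) \<xi> \<partial>lborel)"
proof -
  define G where "G w = (\<integral>\<xi>. dilated \<epsilon> z w \<xi> \<partial>lborel)" for w
  obtain B where B: "integrable lborel B" "\<And>w \<xi>. w \<in> strip \<Longrightarrow> norm (dilated \<epsilon> z w \<xi>) \<le> B \<xi>"
    "\<And>w \<xi>. w \<in> strip \<Longrightarrow> norm (dilated \<epsilon> z w \<xi> * (\<i> * exp w * of_real (z \<bullet> \<xi>)
      - Complex \<epsilon> T * (of_real (2 * \<alpha>) * exp (of_real (2 * \<alpha>) * w)) * of_real (norm \<xi> powr (2 * \<alpha>)) + of_nat DIM('a))) \<le> B \<xi>"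
    using dilated_integrable_and_bound[OF \<epsilon>, of z] by metis
  have shift: "G (w + of_real t) = G w" for w and t :: real
  proof -
    have "dilated \<epsilon> z (w + of_real t) \<xi> = exp t ^ DIM('a) *\<^sub>R dilated \<epsilon> z w (exp t *\<^sub>R \<xi>)" for \<xi> :: 'a
    proof -
      have "norm (exp t *\<^sub>R \<xi>) powr (2 * \<alpha>) = exp (2 * \<alpha> * t) * norm \<xi> powr (2 * \<alpha>)"
        by (simp add: powr_mult exp_powr_real mult_ac)
      moreover have "exp (of_real (2 * \<alpha>) * (w + of_real t)) = exp (of_real (2 * \<alpha>) * w) * of_real (exp (2 * \<alpha> * t))"
        by (simp add: distrib_left exp_add exp_of_real flip: of_real_mult)
      moreover have "exp (w + of_real t) = exp w * of_real (exp t)" by (simp add: exp_add exp_of_real)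
      moreover have "exp (of_nat DIM('a) * (w + of_real t)) = exp (of_nat DIM('a) * w) * of_real (exp t ^ DIM('a))"
        by (simp add: distrib_left exp_add exp_of_nat_mult exp_of_real)
      ultimately show ?thesis unfolding dilated_def exp_add[of _ "of_nat DIM('a) * _"]
        by (simp add: scaleR_conv_of_real mult_ac)
    qed
    then have "G (w + of_real t) = \<bar>exp t\<bar> ^ DIM('a) *\<^sub>R (\<integral>\<xi>. dilated \<epsilon> z w (exp t *\<^sub>R \<xi>) \<partial>lborel)"
      by (simp add: G_def)
    also have "\<dots> = G w" unfolding G_def by (rule lborel_integral_scale(2)) simp
    finally show ?thesis .
  qed
  define S where "S = closed_segment 0 (- \<i> * of_real \<psi>)"
  have S_strip: "S \<subseteq> strip" unfolding S_def using angle_facts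
    by (intro closed_segment_subset convex_strip) (auto simp: S_def strip_def)
  have S0: "Re w = 0" if "w \<in> S" for w using that by (auto simp: S_def in_segment)
  have "(G has_field_derivative 0) (at w0 within S)" if w0: "w0 \<in> S" for w0
  proof -
    have w0s: "w0 \<in> strip" using w0 S_strip by blast
    define g' where "g' w \<xi> = dilated \<epsilon> z w \<xi> * (\<i> * exp w * of_real (z \<bullet> \<xi>)
      - Complex \<epsilon> T * (of_real (2 * \<alpha>) * exp (of_real (2 * \<alpha>) * w)) * of_real (norm \<xi> powr (2 * \<alpha>)) + of_nat DIM('a))" for w and \<xi> :: 'a
    have D: "(G has_field_derivative (\<integral>\<xi>. g' w0 \<xi> \<partial>lborel)) (at w0 within strip)"
      unfolding G_def
    proof (rule has_field_derivative_integral_dominated[OF convex_strip w0s _ _ B(1)])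
      show "((\<lambda>w. dilated \<epsilon> z w \<xi>) has_field_derivative g' w \<xi>) (at w within strip)" for w \<xi>
        unfolding dilated_def g'_def by (auto intro!: derivative_eq_intros simp: algebra_simps)
      show "norm (g' w \<xi>) \<le> B \<xi>" if "w \<in> strip" for w \<xi> unfolding g'_def by (rule B(3)[OF that])
      show "g' w0 \<in> borel_measurable lborel" unfolding g'_def[abs_def] by measurable
    qed (rule dilated_integrable[OF \<epsilon>])
    \<comment> \<open>Real steps of size at most 1 stay in the strip because
      \<open>Re w0 = 0\<close>. Along them G is constant, so the complex derivative, which exists by
      domination, must be 0.\<close>
    define X where "X i = w0 + of_real (1 / real (Suc i))" for i
    have X: "X i \<in> strip - {w0}" for i
    proof -
      have "Re (X i) = 1 / real (Suc i)" "Im (X i) = Im w0" using S0[OF w0] by (simp_all add: X_def)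
      moreover from this have "X i \<noteq> w0" using S0[OF w0] by auto
      ultimately show ?thesis using w0s by (auto simp: strip_def)
    qed
    have "X \<longlonglongrightarrow> w0 + of_real 0" unfolding X_def by (intro tendsto_intros LIMSEQ_Suc lim_1_over_n)
    then have "(\<lambda>i. (G (X i) - G w0) / (X i - w0)) \<longlonglongrightarrow> (\<integral>\<xi>. g' w0 \<xi> \<partial>lborel)"
      using D X unfolding has_field_derivative_iff tendsto_at_iff_sequentially o_def by auto
    moreover have "(G (X i) - G w0) / (X i - w0) = 0" for i unfolding X_def shift by simp
    ultimately have "(\<integral>\<xi>. g' w0 \<xi> \<partial>lborel) = 0" by (simp add: LIMSEQ_const_iff)
    then show ?thesis using DERIV_subset[OF D S_strip] by simp
  qed
  moreover have "convex S" by (simp add: S_def)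
  ultimately obtain c where "\<And>w. w \<in> S \<Longrightarrow> G w = c" using has_field_derivative_zero_constant by metis
  then have "G 0 = G (- \<i> * of_real \<psi>)" by (metis S_def ends_in_segment)
  then show ?thesis by (simp add: G_def dispersive_kernel_def dilated_def)
qed

text \<open>The line is split at 0. Reflecting the negative half leaves the square of p unchanged
  and reverses the sign of M, so the ray bound is used for both signs and yields the factor
  2.\<close>

lemma line_integral_bound:
  assumes \<epsilon>: "0 < \<epsilon>" "\<epsilon> \<le> 1" and r: "r \<ge> 0" and X: "X \<ge> 1" and M: "0 \<le> M" "M \<le> c2 * X powr (2 * \<alpha> - 1)"
  shows "norm (\<integral>s. \<Phi> \<epsilon> M r (of_real s * cis (- \<psi>)) \<partial>lborel) \<le> 2 * C0 * growth X * exp (- c0 * (r / growth X) powr (2 * \<alpha>))"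
proof -
  define k where "k m s = cis (- \<psi>) * \<Phi> \<epsilon> m r (of_real s * cis (- \<psi>))" for m s
  define P where "P m s = indicator {0..} s *\<^sub>R k m s" for m s :: real
  have km: "k m \<in> borel_measurable borel" for m
    unfolding k_def[abs_def] \<Phi>_def ray_square by measurable
  have Pm [measurable]: "P m \<in> borel_measurable borel" for m unfolding P_def[abs_def] using km by measurable
  have PI: "integrable lborel (P m)" "(\<integral>s. P m s \<partial>lborel) = integral {0..} (k m)" for m
  proof -
    have a: "k m absolutely_integrable_on {0..}" unfolding k_def[abs_def] using \<epsilon> by (intro ray_abs_integrable) auto
    then have "integrable lebesgue (P m)" by (simp add: set_integrable_def P_def[abs_def])
    then show "integrable lborel (P m)" by (subst (asm) integrable_completion) auto
    have "integral {0..} (k m) = (\<integral>s. P m s \<partial>lebesgue)"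
      using set_lebesgue_integral_eq_integral(2)[OF a] by (simp add: set_lebesgue_integral_def P_def[abs_def])
    then show "(\<integral>s. P m s \<partial>lborel) = integral {0..} (k m)" by (subst (asm) integral_completion) auto
  qed
  have bd: "norm (integral {0..} (k m)) \<le> C0 * growth X * exp (- c0 * (r / growth X) powr (2 * \<alpha>))" if "\<bar>m\<bar> = M" for m
    unfolding k_def[abs_def] using \<epsilon> M that by (intro inner_ray_bound X r) auto
  have neg: "k M (- s) = k (- M) s" for s
    by (simp add: k_def \<Phi>_def)
  have PI2: "integrable lborel (\<lambda>s. P (- M) (-1 *\<^sub>R s))" using lborel_integral_scale(1)[of "-1" "P (- M)"] PI by auto
  have P2: "(\<integral>s. P (- M) (-1 *\<^sub>R s) \<partial>lborel) = (\<integral>s. P (- M) s \<partial>lborel)"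
    using lborel_integral_scale(2)[of "-1" "P (- M)"] by simp
  have "(\<integral>s. k M s \<partial>lborel) = (\<integral>s. P M s + P (- M) (-1 *\<^sub>R s) \<partial>lborel)"
  proof (rule integral_cong_AE)
    have "AE s in lborel. s \<noteq> (0::real)" by (rule AE_lborel_singleton)
    then show "AE s in lborel. k M s = P M s + P (- M) (-1 *\<^sub>R s)"
    proof eventually_elim
      case (elim s)
      then show ?case using neg[of "- s"] by (cases "s > 0") (auto simp: P_def)
    qed
  qed (use km in measurable)
  also have "\<dots> = integral {0..} (k M) + integral {0..} (k (- M))"
    using P2 by (subst Bochner_Integration.integral_add[OF PI(1) PI2]) (simp add: PI)
  finally have eq: "(\<integral>s. k M s \<partial>lborel) = integral {0..} (k M) + integral {0..} (k (- M))" .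
  have "norm (\<integral>s. k M s \<partial>lborel) \<le> 2 * C0 * growth X * exp (- c0 * (r / growth X) powr (2 * \<alpha>))"
    unfolding eq using bd[of M] bd[of "- M"] M norm_triangle_ineq[of "integral {0..} (k M)" "integral {0..} (k (- M))"]
    by simp
  moreover have "(\<integral>s. k M s \<partial>lborel) = cis (- \<psi>) * (\<integral>s. \<Phi> \<epsilon> M r (of_real s * cis (- \<psi>)) \<partial>lborel)"
    by (simp add: k_def[abs_def])
  ultimately show ?thesis by (simp add: norm_mult)
qed

end

section \<open>From slices to the kernel bound\<close>

context dispersive_angle begin

text \<open>The factor \<open>growth X\<close> of a slice cancels against the normalisation of the
  slicing weight, and what remains is dominated by a radial profile of \<xi> / (2 Y). Scaling its
  integral gives \<open>(2 * Y) ^ n\<close>, with all other constants independent of \<epsilon>, X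
  and z.\<close>

lemma kernel_bound_growth:
  obtains C where "C \<ge> 0" and "\<And>\<epsilon> X (z::'a::euclidean_space). 0 < \<epsilon> \<Longrightarrow> \<epsilon> \<le> 1 \<Longrightarrow> X \<ge> 1 \<Longrightarrow>
    norm z \<le> c2 * X powr (2 * \<alpha> - 1) \<Longrightarrow> norm (dispersive_kernel \<epsilon> z) \<le> C * growth X ^ DIM('a)"
proof -
  have a1: "2 * \<alpha> > 1" using \<alpha> by simp
  \<comment> \<open>The vanishing term \<open>0 * norm t\<close> keeps the shape of
    \<open>integrable_exp_neg_norm_powr\<close> with A = 0.\<close>
  define J where "J = (\<integral>t. exp (0 * norm t - c0 * norm (t::real) powr (2 * \<alpha>)) \<partial>lborel)"
  define I0 where "I0 = (\<integral>\<xi>. exp (0 * norm \<xi> - c0 * norm (\<xi>::'a) powr (2 * \<alpha>)) \<partial>lborel)"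
  have Ji: "integrable lborel (\<lambda>t::real. exp (0 * norm t - c0 * norm t powr (2 * \<alpha>)))"
    and Ii: "integrable lborel (\<lambda>\<xi>::'a. exp (0 * norm \<xi> - c0 * norm \<xi> powr (2 * \<alpha>)))"
    using c0_pos a1 by (intro integrable_exp_neg_norm_powr; simp)+
  have Jpos: "J > 0"
  proof -
    have "J \<ge> 0" unfolding J_def by (intro Bochner_Integration.integral_nonneg) auto
    moreover have "J \<noteq> 0"
    proof
      assume "J = 0"
      then have "AE t in lborel. exp (0 * norm t - c0 * norm (t::real) powr (2 * \<alpha>)) = 0"
        unfolding J_def by (subst (asm) integral_nonneg_eq_0_iff_AE[OF Ji]) auto
      then show False by (simp add: eventually_False ae_filter_eq_bot_iff)
    qed
    ultimately show ?thesis by simp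
  qed
  have I0: "I0 \<ge> 0" unfolding I0_def by (intro Bochner_Integration.integral_nonneg) auto
  define C where "C = 2 * C0 / J * (2 ^ DIM('a) * I0)"
  have C: "C \<ge> 0" using C0_nonneg Jpos I0 by (auto simp: C_def)
  have main: "norm (dispersive_kernel \<epsilon> z) \<le> C * growth X ^ DIM('a)"
    if \<epsilon>: "0 < \<epsilon>" "\<epsilon> \<le> 1" and X: "X \<ge> 1" and zX: "norm z \<le> c2 * X powr (2 * \<alpha> - 1)" for \<epsilon> X and z :: 'a
  proof -
    define Y where "Y = growth X"
    have Y: "Y \<ge> 1" using growth_ge1[OF X] by (simp add: Y_def)
    obtain e :: 'a where e: "norm e = 1" "z = norm z *\<^sub>R e"
    proof (cases "z = 0")
      case True
      obtain b :: 'a where "b \<in> Basis" using nonempty_Basis by blast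
      then show ?thesis using True that[of b] by simp
    next
      case False
      then show ?thesis using that[of "z /\<^sub>R norm z"] by simp
    qed
    define M where "M = norm z"
    define f where "f = dilated \<epsilon> z (- \<i> * of_real \<psi>)"
    have fI: "integrable lborel f" unfolding f_def using angle_facts \<epsilon>
      by (intro dilated_integrable) (auto simp: strip_def)
    \<comment> \<open>The weight along e gets the same profile and the same width Y as the
      transversal decay of the slices, so that the product of the two is comparable to a radial
      function.\<close>
    define w where "w t = exp (0 * norm (t / Y) - c0 * norm (t / Y) powr (2 * \<alpha>)) / (J * Y)" for t :: real
    have wI: "integrable lborel w" 
      unfolding w_def using lborel_integral_scale(1)[of "1 / Y" "\<lambda>t. exp (0 * norm t - c0 * norm (t::real) powr (2 * \<alpha>))"] Ji Y
      by (intro integrable_divide) simp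
    have wJ: "(\<integral>t. exp (0 * norm (t / Y) - c0 * norm (t / Y) powr (2 * \<alpha>)) \<partial>lborel) = Y * J"
      using lborel_integral_scale(2)[of "1 / Y" "\<lambda>t. exp (0 * norm t - c0 * norm (t::real) powr (2 * \<alpha>))"] Y
      by (simp add: J_def field_simps)
    have "(\<integral>t. w t \<partial>lborel) = (\<integral>t. exp (0 * norm (t / Y) - c0 * norm (t / Y) powr (2 * \<alpha>)) \<partial>lborel) / (J * Y)"
      unfolding w_def by (rule integral_divide_zero)
    then have w1: "(\<integral>t. w t \<partial>lborel) = 1" unfolding wJ using Y Jpos by simp
    have w0: "w t \<ge> 0" for t using Jpos Y by (simp add: w_def)
    define B where "B \<xi> = 2 * C0 / J * exp (0 * norm ((1 / (2 * Y)) *\<^sub>R \<xi>) - c0 * norm ((1 / (2 * Y)) *\<^sub>R \<xi>) powr (2 * \<alpha>))" for \<xi> :: 'a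
    have BI: "integrable lborel B" unfolding B_def
      using lborel_integral_scale(1)[of "1 / (2 * Y)" "\<lambda>\<xi>::'a. exp (0 * norm \<xi> - c0 * norm \<xi> powr (2 * \<alpha>))"] Ii Y
      by (intro integrable_mult_right) simp
    have Bint: "(\<integral>\<xi>. B \<xi> \<partial>lborel) = C * Y ^ DIM('a)"
    proof -
      have "(1 / (2 * Y)) ^ DIM('a) * (\<integral>\<xi>. exp (0 * norm ((1 / (2 * Y)) *\<^sub>R \<xi>) - c0 * norm ((1 / (2 * Y)) *\<^sub>R \<xi>) powr (2 * \<alpha>)) \<partial>(lborel::'a measure)) = I0"
        unfolding I0_def using lborel_integral_scale(2)[of "1 / (2 * Y)" "\<lambda>\<xi>::'a. exp (0 * norm \<xi> - c0 * norm \<xi> powr (2 * \<alpha>))"] Y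
        by simp
      then have "(\<integral>\<xi>. exp (0 * norm ((1 / (2 * Y)) *\<^sub>R \<xi>) - c0 * norm ((1 / (2 * Y)) *\<^sub>R \<xi>) powr (2 * \<alpha>)) \<partial>(lborel::'a measure)) = (2 * Y) ^ DIM('a) * I0"
        using Y by (simp add: power_divide field_simps)
      then show ?thesis unfolding B_def by (simp add: C_def power_mult_distrib)
    qed
    have line: "norm (\<integral>s. f (\<xi> + s *\<^sub>R e) \<partial>lborel) \<le> 2 * C0 * Y * exp (- c0 * (norm (\<xi> - (e \<bullet> \<xi>) *\<^sub>R e) / Y) powr (2 * \<alpha>))" for \<xi>
    proof -
      define p where "p = \<xi> - (e \<bullet> \<xi>) *\<^sub>R e"
      define r where "r = norm p"
      have ee: "e \<bullet> e = 1" using e(1) by (simp add: dot_square_norm)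
      then have pe: "p \<bullet> e = 0" "e \<bullet> p = 0"
        by (simp_all add: p_def inner_diff_left inner_diff_right inner_commute[of \<xi> e])
      \<comment> \<open>On the line through p, orthogonal to e, the rotated integrand is \<Phi> up
        to the rotated Jacobian, a constant of modulus 1.\<close>
      have eq: "f (p + s *\<^sub>R e) = exp (- \<i> * of_real (real DIM('a) * \<psi>)) * \<Phi> \<epsilon> M r (of_real s * cis (- \<psi>))" for s
      proof -
        have n2: "(norm (p + s *\<^sub>R e))\<^sup>2 = s\<^sup>2 + r\<^sup>2"
        proof -
          have "(p + s *\<^sub>R e) \<bullet> (p + s *\<^sub>R e) = s * s + p \<bullet> p"
            using ee pe by (simp add: inner_add_left inner_add_right)
          then show ?thesis unfolding power2_norm_eq_inner r_def by (simp add: power2_eq_square)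
        qed
        have "norm (p + s *\<^sub>R e) powr (2 * \<alpha>) = (s\<^sup>2 + r\<^sup>2) powr \<alpha>"
          unfolding n2[symmetric] by (simp add: powr_square)
        moreover have "(of_real (s\<^sup>2 + r\<^sup>2) * cis (- (2 * \<psi>))) powr of_real \<alpha> = of_real ((s\<^sup>2 + r\<^sup>2) powr \<alpha>) * cis (- (2 * \<alpha> * \<psi>))"
        proof (cases "s\<^sup>2 + r\<^sup>2 = 0")
          case False
          then have "s\<^sup>2 + r\<^sup>2 > 0" by (simp add: sum_power2_gt_zero_iff sum_power2_eq_zero_iff)
          then show ?thesis using angle_facts by (subst powr_of_real_cis) (auto simp: mult_ac)
        qed simp
        moreover have "z \<bullet> (p + s *\<^sub>R e) = M * s"
          using pe ee by (subst e(2)) (simp add: M_def inner_add_right)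
        moreover have "exp (- \<i> * of_real \<psi>) = cis (- \<psi>)" "exp (of_real (2 * \<alpha>) * (- \<i> * of_real \<psi>)) = cis (- (2 * \<alpha> * \<psi>))"
          by (simp_all add: cis_conv_exp mult_ac)
        ultimately show ?thesis
          unfolding f_def dilated_def \<Phi>_def ray_square exp_add[of _ "of_nat DIM('a) * _"] by (simp add: mult_ac)
      qed
      have "(\<integral>s. f (\<xi> + s *\<^sub>R e) \<partial>lborel) = (\<integral>s. (\<lambda>s. f (p + s *\<^sub>R e)) (e \<bullet> \<xi> + s) \<partial>lborel)"
        by (simp add: p_def algebra_simps)
      also have "\<dots> = (\<integral>s. f (p + s *\<^sub>R e) \<partial>lborel)" by (rule lborel_integral_translation)
      also have "\<dots> = exp (- \<i> * of_real (real DIM('a) * \<psi>)) * (\<integral>s. \<Phi> \<epsilon> M r (of_real s * cis (- \<psi>)) \<partial>lborel)"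
        unfolding eq by simp
      finally have "norm (\<integral>s. f (\<xi> + s *\<^sub>R e) \<partial>lborel) = norm (\<integral>s. \<Phi> \<epsilon> M r (of_real s * cis (- \<psi>)) \<partial>lborel)"
        by (simp add: norm_mult)
      also have "\<dots> \<le> 2 * C0 * growth X * exp (- c0 * (r / growth X) powr (2 * \<alpha>))"
        using \<epsilon> X zX by (intro line_integral_bound) (auto simp: r_def M_def)
      finally show ?thesis by (simp add: r_def p_def Y_def)
    qed
    \<comment> \<open>With p and t the transversal and longitudinal parts of \<xi> in units of Y,
      \<open>norm \<xi> \<le> 2 * Y * max p t\<close>, and the power of the maximum is at most the
      sum of the powers. The two exponentials thus combine into one in
      \<open>norm \<xi>\<close>.\<close>
    have pt: "norm (w (e \<bullet> \<xi>) *\<^sub>R (\<integral>s. f (\<xi> + s *\<^sub>R e) \<partial>lborel)) \<le> B \<xi>" for \<xi>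
    proof -
      define p where "p = norm (\<xi> - (e \<bullet> \<xi>) *\<^sub>R e) / Y"
      define t where "t = \<bar>e \<bullet> \<xi>\<bar> / Y"
      have pt0: "p \<ge> 0" "t \<ge> 0" using Y by (auto simp: p_def t_def)
      have "norm \<xi> \<le> norm (\<xi> - (e \<bullet> \<xi>) *\<^sub>R e) + norm ((e \<bullet> \<xi>) *\<^sub>R e)"
        using norm_triangle_ineq[of "\<xi> - (e \<bullet> \<xi>) *\<^sub>R e" "(e \<bullet> \<xi>) *\<^sub>R e"] by simp
      also have "\<dots> = Y * (p + t)" using Y e(1) by (simp add: p_def t_def field_simps)
      also have "\<dots> \<le> Y * (2 * max p t)" using Y by (intro mult_left_mono) auto
      finally have x: "norm ((1 / (2 * Y)) *\<^sub>R \<xi>) \<le> max p t" using Y by (simp add: divide_le_eq mult_ac)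
      then have "norm ((1 / (2 * Y)) *\<^sub>R \<xi>) powr (2 * \<alpha>) \<le> max p t powr (2 * \<alpha>)" using \<alpha> by (intro powr_mono2) auto
      also have "\<dots> \<le> p powr (2 * \<alpha>) + t powr (2 * \<alpha>)" by (simp add: max_def)
      finally have "c0 * norm ((1 / (2 * Y)) *\<^sub>R \<xi>) powr (2 * \<alpha>) \<le> c0 * (p powr (2 * \<alpha>) + t powr (2 * \<alpha>))"
        using c0_pos by (intro mult_left_mono) auto
      then have ex: "exp (- c0 * t powr (2 * \<alpha>)) * exp (- c0 * p powr (2 * \<alpha>)) \<le> exp (- c0 * norm ((1 / (2 * Y)) *\<^sub>R \<xi>) powr (2 * \<alpha>))"
        unfolding exp_add[symmetric] by (simp add: algebra_simps)
      have wt: "w (e \<bullet> \<xi>) = exp (- c0 * t powr (2 * \<alpha>)) / (J * Y)" using Y by (simp add: w_def t_def)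
      have "norm (w (e \<bullet> \<xi>) *\<^sub>R (\<integral>s. f (\<xi> + s *\<^sub>R e) \<partial>lborel)) \<le> w (e \<bullet> \<xi>) * (2 * C0 * Y * exp (- c0 * p powr (2 * \<alpha>)))"
        using line[of \<xi>] w0[of "e \<bullet> \<xi>"] by (simp add: p_def mult_left_mono)
      also have "\<dots> = 2 * C0 / J * (exp (- c0 * t powr (2 * \<alpha>)) * exp (- c0 * p powr (2 * \<alpha>)))"
        using Y Jpos by (simp add: wt field_simps)
      also have "\<dots> \<le> 2 * C0 / J * exp (- c0 * norm ((1 / (2 * Y)) *\<^sub>R \<xi>) powr (2 * \<alpha>))"
        using ex C0_nonneg Jpos by (intro mult_left_mono) auto
      finally show ?thesis by (simp add: B_def)
    qed
    have "dispersive_kernel \<epsilon> z = (\<integral>\<xi>. w (e \<bullet> \<xi>) *\<^sub>R (\<integral>s. f (\<xi> + s *\<^sub>R e) \<partial>lborel) \<partial>lborel)"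
      unfolding rotate_kernel[OF \<epsilon>(1)] f_def[symmetric] by (rule integral_slices(1)[OF fI wI w0 w1 e(1)])
    also have "norm \<dots> \<le> (\<integral>\<xi>. B \<xi> \<partial>lborel)"
      using BI pt integral_slices(2)[OF fI wI w0 w1 e(1)]
      by (intro order_trans[OF integral_norm_bound Bochner_Integration.integral_mono] integrable_norm) auto
    finally show ?thesis by (simp add: Bint Y_def)
  qed
  show thesis using C main that by blast
qed

text \<open>Optimisation in X. The bound grows with X, so X is taken as small as the constraint
  \<open>norm z \<le> c2 * X powr (2 * \<alpha> - 1)\<close> permits, but at least 1. Then X powr
  ((1 - \<alpha>) n) is a constant times norm z powr \<gamma>; the summand 1 covers small z.\<close>

lemma kernel_bound:
  obtains C where "C \<ge> 0" and "\<And>\<epsilon> (z::'a::euclidean_space). 0 < \<epsilon> \<Longrightarrow> \<epsilon> \<le> 1 \<Longrightarrow>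
    norm (dispersive_kernel \<epsilon> z) \<le> C * (if \<alpha> \<ge> 1 then 1 else 1 + norm z powr (real DIM('a) * (1 - \<alpha>) / (2 * \<alpha> - 1)))"
proof -
  define n where "n = real DIM('a)"
  define \<gamma> where "\<gamma> = n * (1 - \<alpha>) / (2 * \<alpha> - 1)"
  obtain C where C: "C \<ge> 0" and b: "\<And>\<epsilon> X (z::'a). 0 < \<epsilon> \<Longrightarrow> \<epsilon> \<le> 1 \<Longrightarrow> X \<ge> 1 \<Longrightarrow>
    norm z \<le> c2 * X powr (2 * \<alpha> - 1) \<Longrightarrow> norm (dispersive_kernel \<epsilon> z) \<le> C * growth X ^ DIM('a)"
    using kernel_bound_growth by blast
  define D where "D = max 1 ((1 / c2) powr \<gamma>)"
  have D: "D \<ge> 1" "(1 / c2) powr \<gamma> \<le> D" by (auto simp: D_def)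
  have "norm (dispersive_kernel \<epsilon> z) \<le> C * D * (if \<alpha> \<ge> 1 then 1 else 1 + norm z powr \<gamma>)"
    if \<epsilon>: "0 < \<epsilon>" "\<epsilon> \<le> 1" for \<epsilon> and z :: 'a
  proof -
    define X where "X = max 1 ((norm z / c2) powr (1 / (2 * \<alpha> - 1)))"
    have X: "X \<ge> 1" by (simp add: X_def)
    have "norm z / c2 = ((norm z / c2) powr (1 / (2 * \<alpha> - 1))) powr (2 * \<alpha> - 1)"
      using \<alpha> c2_pos by (simp add: powr_powr)
    also have "\<dots> \<le> X powr (2 * \<alpha> - 1)" using \<alpha> by (intro powr_mono2) (auto simp: X_def)
    finally have zX: "norm z \<le> c2 * X powr (2 * \<alpha> - 1)" using c2_pos by (simp add: field_simps)
    have "growth X ^ DIM('a) \<le> D * (if \<alpha> \<ge> 1 then 1 else 1 + norm z powr \<gamma>)"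
    proof (cases "\<alpha> \<ge> 1")
      case True
      then show ?thesis using D by (simp add: growth_def)
    next
      case False
      have g: "growth X ^ DIM('a) = X powr ((1 - \<alpha>) * n)"
        using False X by (simp add: growth_def powr_power n_def mult.commute)
      have z0: "norm z powr \<gamma> \<ge> 0" by simp
      show ?thesis
      proof (cases "X = 1")
        case True
        have "1 * 1 \<le> D * (1 + norm z powr \<gamma>)" using D z0 by (intro mult_mono) auto
        then show ?thesis using False True g by simp
      next
        case X1: False
        then have "X = (norm z / c2) powr (1 / (2 * \<alpha> - 1))" unfolding X_def by (metis max_def)
        then have "X powr ((1 - \<alpha>) * n) = (norm z / c2) powr \<gamma>"
          by (simp add: powr_powr \<gamma>_def mult_ac)
        also have "\<dots> = (1 / c2) powr \<gamma> * norm z powr \<gamma>"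
          using c2_pos by (simp add: powr_mult[symmetric])
        also have "\<dots> \<le> D * (1 + norm z powr \<gamma>)" using D z0 by (intro mult_mono) auto
        finally show ?thesis using False g by simp
      qed
    qed
    then have "C * growth X ^ DIM('a) \<le> C * (D * (if \<alpha> \<ge> 1 then 1 else 1 + norm z powr \<gamma>))"
      using C by (rule mult_left_mono)
    then show ?thesis using b[OF \<epsilon> X zX] by (simp add: mult.assoc)
  qed
  moreover have "C * D \<ge> 0" using C D by simp
  ultimately show thesis using that unfolding \<gamma>_def n_def by blast
qed

end

text \<open>For negative T, conjugation of the integrand reverses both T and z, and the bound
  depends on z only through its norm. The opposite sign of the exponent's notation is absorbed by
  \<open>cis\<close>.\<close>

lemma dispersive_multiplier_kernel_bound:
  fixes \<alpha> T :: real
  assumes \<alpha>: "\<alpha> > 1 / 2" and T: "T \<noteq> 0"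
  obtains C where "C \<ge> 0" and "\<And>\<epsilon> (z::'a::euclidean_space). 0 < \<epsilon> \<Longrightarrow> \<epsilon> \<le> 1 \<Longrightarrow>
    norm (\<integral>\<xi>. cis (z \<bullet> \<xi>) * exp (- (Complex \<epsilon> T * of_real (norm \<xi> powr (2 * \<alpha>)))) \<partial>lborel)
      \<le> C * (if \<alpha> \<ge> 1 then 1 else 1 + norm z powr (real DIM('a) * (1 - \<alpha>) / (2 * \<alpha> - 1)))"
proof -
  interpret D: dispersive_angle \<alpha> "\<bar>T\<bar>" "pi / (8 * (1 + \<alpha>))"
    using \<alpha> T by unfold_locales auto
  obtain C where C: "C \<ge> 0" and b: "\<And>\<epsilon> (z::'a). 0 < \<epsilon> \<Longrightarrow> \<epsilon> \<le> 1 \<Longrightarrow>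
    norm (D.dispersive_kernel \<epsilon> z) \<le> C * (if \<alpha> \<ge> 1 then 1 else 1 + norm z powr (real DIM('a) * (1 - \<alpha>) / (2 * \<alpha> - 1)))"
    using D.kernel_bound by blast
  have eq: "norm (\<integral>\<xi>. cis (z \<bullet> \<xi>) * exp (- (Complex \<epsilon> T * of_real (norm \<xi> powr (2 * \<alpha>)))) \<partial>lborel)
    = norm (D.dispersive_kernel \<epsilon> (sgn T *\<^sub>R z))" for \<epsilon> and z :: 'a
  proof (cases "T > 0")
    case True
    then show ?thesis unfolding D.dispersive_kernel_def by (simp add: cis_conv_exp mult_exp_exp)
  next
    case False
    with T have T0: "T < 0" by simp
    have "cnj (cis (z \<bullet> \<xi>) * exp (- (Complex \<epsilon> T * of_real (norm \<xi> powr (2 * \<alpha>)))))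
        = exp (\<i> * of_real (sgn T *\<^sub>R z \<bullet> \<xi>) - Complex \<epsilon> \<bar>T\<bar> * of_real (norm \<xi> powr (2 * \<alpha>)))" for \<xi>
      using T0 by (simp add: cis_cnj cis_conv_exp mult_exp_exp exp_cnj complex_cnj)
    then have "D.dispersive_kernel \<epsilon> (sgn T *\<^sub>R z) = cnj (\<integral>\<xi>. cis (z \<bullet> \<xi>) * exp (- (Complex \<epsilon> T * of_real (norm \<xi> powr (2 * \<alpha>)))) \<partial>lborel)"
      unfolding D.dispersive_kernel_def by (subst Bochner_Integration.integral_cnj[symmetric]) simp
    then show ?thesis by simp
  qed
  have n: "norm (sgn T *\<^sub>R z) = norm z" for z :: 'a using T by (simp add: sgn_real_def)
  show thesis
  proof (rule that[OF C])
    fix \<epsilon> :: real and z :: 'a assume "0 < \<epsilon>" "\<epsilon> \<le> 1"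
    from b[OF this, of "sgn T *\<^sub>R z"] show "norm (\<integral>\<xi>. cis (z \<bullet> \<xi>) * exp (- (Complex \<epsilon> T * of_real (norm \<xi> powr (2 * \<alpha>)))) \<partial>lborel)
      \<le> C * (if \<alpha> \<ge> 1 then 1 else 1 + norm z powr (real DIM('a) * (1 - \<alpha>) / (2 * \<alpha> - 1)))"
      unfolding eq n .
  qed
qed

section \<open>The Hilbert space of square integrable functions\<close>

lemma square_integrable_rep_L2: "square_integrable (rep_L2 f)"
  using Quotient3_rep_reflp[OF Quotient3_L2, of f] by simp

lemma rep_L2_measurable [measurable]: "rep_L2 f \<in> borel_measurable lebesgue"
  using square_integrable_rep_L2[of f] by (simp add: square_integrable_def)

lemma abs_rep_L2 [simp]: "abs_L2 (rep_L2 f) = f"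
  by (rule Quotient3_abs_rep[OF Quotient3_L2])

lemma rep_abs_L2: "square_integrable f \<Longrightarrow> AE x in lebesgue. rep_L2 (abs_L2 f) x = f x"
  using Quotient3_rep_abs[OF Quotient3_L2, of f] by simp

lemma L2_eq_iff: "f = g \<longleftrightarrow> (AE x in lebesgue. rep_L2 f x = rep_L2 g x)"
  using Quotient3_rel_rep[OF Quotient3_L2, of f g] square_integrable_rep_L2 by blast

lemma abs_L2_eqI:
  assumes "square_integrable f" "square_integrable g" "AE x in lebesgue. f x = g x"
  shows "abs_L2 f = abs_L2 g"
  using Quotient3_rel_abs[OF Quotient3_L2, of f g] assms by simp

lemma square_integrable_cong:
  assumes "square_integrable f" "g \<in> borel_measurable lebesgue" "AE x in lebesgue. f x = g x"
  shows "square_integrable g"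
proof -
  have [measurable]: "f \<in> borel_measurable lebesgue" "g \<in> borel_measurable lebesgue"
    using assms by (auto simp: square_integrable_def)
  have "integrable lebesgue (\<lambda>x. (norm (f x))\<^sup>2) \<longleftrightarrow> integrable lebesgue (\<lambda>x. (norm (g x))\<^sup>2)"
    by (rule integrable_cong_AE) (use assms(3) in auto)
  then show ?thesis using assms by (simp add: square_integrable_def)
qed

lemma square_integrable_bound:
  assumes "square_integrable f" "g \<in> borel_measurable lebesgue" "AE x in lebesgue. norm (g x) \<le> norm (f x)"
  shows "square_integrable g"
proof -
  have [measurable]: "f \<in> borel_measurable lebesgue" "g \<in> borel_measurable lebesgue"
    using assms by (auto simp: square_integrable_def)
  have "integrable lebesgue (\<lambda>x. (norm (g x))\<^sup>2)"
  proof (rule Bochner_Integration.integrable_bound)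
    show "integrable lebesgue (\<lambda>x. (norm (f x))\<^sup>2)" using assms by (simp add: square_integrable_def)
    show "AE x in lebesgue. norm ((norm (g x))\<^sup>2) \<le> norm ((norm (f x))\<^sup>2)"
      using assms(3) by eventually_elim (simp add: power_mono)
  qed measurable
  then show ?thesis using assms by (simp add: square_integrable_def)
qed

lemma square_integrable_uminus: "square_integrable f \<Longrightarrow> square_integrable (\<lambda>x. - f x)"
  by (auto simp: square_integrable_def)

lemma square_integrable_diff:
  assumes "square_integrable f" "square_integrable g"
  shows "square_integrable (\<lambda>x. f x - g x)"
  unfolding diff_conv_add_uminus
  by (intro square_integrable_add square_integrable_uminus assms)

lemma rep_plus_L2: "AE x in lebesgue. rep_L2 (f + g) x = rep_L2 f x + rep_L2 g x"
  unfolding plus_L2_def map_fun_def o_def id_def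
  by (intro rep_abs_L2 square_integrable_add square_integrable_rep_L2)

lemma rep_uminus_L2: "AE x in lebesgue. rep_L2 (- f) x = - rep_L2 f x"
  unfolding uminus_L2_def map_fun_def o_def id_def
  by (rule rep_abs_L2[OF square_integrable_uminus[OF square_integrable_rep_L2]])

lemma rep_minus_L2: "AE x in lebesgue. rep_L2 (f - g) x = rep_L2 f x - rep_L2 g x"
  unfolding minus_L2_def using rep_plus_L2[of f "- g"] rep_uminus_L2[of g] by eventually_elim simp

lemma rep_scaleC_L2: "AE x in lebesgue. rep_L2 (c *\<^sub>C f) x = c * rep_L2 f x"
  unfolding scaleC_L2_def map_fun_def o_def id_def
  by (intro rep_abs_L2 square_integrable_mult square_integrable_rep_L2)

lemma rep_scaleR_L2: "AE x in lebesgue. rep_L2 (c *\<^sub>R f) x = of_real c * rep_L2 f x"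
  unfolding scaleR_L2_def map_fun_def o_def id_def
  by (intro rep_abs_L2 square_integrable_mult square_integrable_rep_L2)

lemma scaleC_of_real: "of_real r *\<^sub>C f = r *\<^sub>R f"
  unfolding L2_eq_iff using rep_scaleC_L2[of "of_real r" f] rep_scaleR_L2[of r f] by eventually_elim simp

lemma inner_L2_rep: "f \<bullet> g = (\<integral>x. rep_L2 f x \<bullet> rep_L2 g x \<partial>lebesgue)"
  by (simp add: inner_L2_def)

lemma norm_L2_rep: "(norm f)\<^sup>2 = (\<integral>x. (norm (rep_L2 f x))\<^sup>2 \<partial>lebesgue)"
  by (simp add: power2_norm_eq_inner inner_L2_rep)

lemma norm_abs_L2: "square_integrable f \<Longrightarrow> (norm (abs_L2 f))\<^sup>2 = (\<integral>x. (norm (f x))\<^sup>2 \<partial>lebesgue)"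
  unfolding norm_L2_rep
proof (rule integral_cong_AE)
  assume f: "square_integrable f"
  then have [measurable]: "f \<in> borel_measurable lebesgue" by (simp add: square_integrable_def)
  show "(\<lambda>x. (norm (rep_L2 (abs_L2 f) x))\<^sup>2) \<in> borel_measurable lebesgue" "(\<lambda>x. (norm (f x))\<^sup>2) \<in> borel_measurable lebesgue"
    by measurable
  show "AE x in lebesgue. (norm (rep_L2 (abs_L2 f) x))\<^sup>2 = (norm (f x))\<^sup>2"
    using rep_abs_L2[OF f] by eventually_elim simp
qed

lemma norm_L2_eqI:
  assumes "AE x in lebesgue. norm (rep_L2 f x) = norm (rep_L2 g x)"
  shows "norm f = norm g"
proof -
  have "(norm f)\<^sup>2 = (norm g)\<^sup>2" unfolding norm_L2_rep
    by (rule integral_cong_AE) (use assms in auto)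
  then show ?thesis by simp
qed

lemma norm_L2_leI:
  assumes "AE x in lebesgue. norm (rep_L2 f x) \<le> norm (rep_L2 g x)"
  shows "norm f \<le> norm g"
proof -
  have "(norm f)\<^sup>2 \<le> (norm g)\<^sup>2" unfolding norm_L2_rep
    by (rule integral_mono_AE) (use assms square_integrable_rep_L2 in \<open>auto simp: square_integrable_def intro: power_mono\<close>)
  then show ?thesis by (rule power2_le_imp_le) simp
qed

text \<open>The abstract inequality of the real inner product space, applied to the classes of the
  moduli, for which the real inner product is the integral of the product of the moduli.\<close>

lemma Cauchy_Schwarz_square_integrable:
  assumes f: "square_integrable f" and g: "square_integrable g"
  shows "integrable lebesgue (\<lambda>x. norm (f x) * norm (g x))"
    and "(\<integral>x. norm (f x) * norm (g x) \<partial>lebesgue) \<le> sqrt (\<integral>x. (norm (f x))\<^sup>2 \<partial>lebesgue) * sqrt (\<integral>x. (norm (g x))\<^sup>2 \<partial>lebesgue)"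
proof -
  have s: "square_integrable (\<lambda>x. complex_of_real (norm (h x)))" if "square_integrable h" for h :: "'a \<Rightarrow> complex"
    using that by (auto simp: square_integrable_def intro: borel_measurable_of_real)
  have i: "(\<lambda>x. complex_of_real (norm (f x)) \<bullet> complex_of_real (norm (g x))) = (\<lambda>x. norm (f x) * norm (g x))"
    by (simp add: inner_complex_def)
  show "integrable lebesgue (\<lambda>x. norm (f x) * norm (g x))"
    using square_integrable_inner[OF s[OF f] s[OF g]] unfolding i .
  have "abs_L2 (\<lambda>x. of_real (norm (f x))) \<bullet> abs_L2 (\<lambda>x. of_real (norm (g x))) = (\<integral>x. norm (f x) * norm (g x) \<partial>lebesgue)"
    unfolding inner_L2_rep i[symmetric]
  proof (rule integral_cong_AE)
    show "AE x in lebesgue. rep_L2 (abs_L2 (\<lambda>x. of_real (norm (f x)))) x \<bullet> rep_L2 (abs_L2 (\<lambda>x. of_real (norm (g x)))) x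
       = complex_of_real (norm (f x)) \<bullet> complex_of_real (norm (g x))"
      using rep_abs_L2[OF s[OF f]] rep_abs_L2[OF s[OF g]] by eventually_elim simp
  qed (use s[OF f] s[OF g] in \<open>auto simp: square_integrable_def\<close>)
  moreover have "norm (abs_L2 (\<lambda>x. complex_of_real (norm (h x)))) = sqrt (\<integral>x. (norm (h x))\<^sup>2 \<partial>lebesgue)" if "square_integrable h" for h :: "'a \<Rightarrow> complex"
  proof -
    have "(norm (abs_L2 (\<lambda>x. complex_of_real (norm (h x)))))\<^sup>2 = (\<integral>x. (norm (h x))\<^sup>2 \<partial>lebesgue)"
      using norm_abs_L2[OF s[OF that]] by simp
    then show ?thesis by (intro real_sqrt_unique[symmetric]) auto
  qed
  ultimately show "(\<integral>x. norm (f x) * norm (g x) \<partial>lebesgue) \<le> sqrt (\<integral>x. (norm (f x))\<^sup>2 \<partial>lebesgue) * sqrt (\<integral>x. (norm (g x))\<^sup>2 \<partial>lebesgue)"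
    using norm_cauchy_schwarz[of "abs_L2 (\<lambda>x. complex_of_real (norm (f x)))" "abs_L2 (\<lambda>x. complex_of_real (norm (g x)))"] f g by simp
qed

lemma tendsto_abs_L2:
  fixes h :: "nat \<Rightarrow> 'a::euclidean_space \<Rightarrow> complex"
  assumes "\<And>k. square_integrable (h k)" "square_integrable f" "(\<lambda>k. \<integral>x. (norm (h k x - f x))\<^sup>2 \<partial>lebesgue) \<longlonglongrightarrow> 0"
  shows "(\<lambda>k. abs_L2 (h k)) \<longlonglongrightarrow> abs_L2 f"
proof -
  have "(norm (abs_L2 (h k) - abs_L2 f))\<^sup>2 = (\<integral>x. (norm (h k x - f x))\<^sup>2 \<partial>lebesgue)" for k
    unfolding norm_L2_rep
  proof (rule integral_cong_AE)
    show "AE x in lebesgue. (norm (rep_L2 (abs_L2 (h k) - abs_L2 f) x))\<^sup>2 = (norm (h k x - f x))\<^sup>2"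
      using rep_minus_L2[of "abs_L2 (h k)" "abs_L2 f"] rep_abs_L2[OF assms(1)[of k]] rep_abs_L2[OF assms(2)] by eventually_elim simp
  qed (use assms(1)[of k] assms(2) in \<open>auto simp: square_integrable_def\<close>)
  then have "(\<lambda>k. sqrt ((norm (abs_L2 (h k) - abs_L2 f))\<^sup>2)) \<longlonglongrightarrow> sqrt 0"
    using assms(3) by (intro tendsto_real_sqrt) simp
  then show ?thesis by (simp add: tendsto_norm_zero_iff LIM_zero_iff)
qed

text \<open>Riesz-Fischer. Multiplying by a square integrable function w without zeros turns the
  sequence into an L1 Cauchy sequence, although the measure is infinite; a subsequence then
  converges almost everywhere, and dividing by w recovers the candidate limit. Fatou's lemma along
  the subsequence gives norm convergence of the full sequence.\<close>

lemma Cauchy_L2_convergent: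
  fixes F :: "nat \<Rightarrow> 'a::euclidean_space L2"
  assumes F: "Cauchy F"
  shows "convergent F"
proof -
  define w :: "'a \<Rightarrow> complex" where "w x = of_real (exp (- 1 * norm x))" for x
  have wsq: "square_integrable w"
  proof -
    have "integrable lborel (\<lambda>x::'a. exp (- 2 * norm x))" by (rule integrable_exp_neg_norm) simp
    then have "integrable lebesgue (\<lambda>x::'a. exp (- 2 * norm x))" by (subst integrable_completion) auto
    moreover have "(norm (w x))\<^sup>2 = exp (- 2 * norm x)" for x by (simp add: w_def exp_double[symmetric])
    moreover have "w \<in> borel_measurable lebesgue" unfolding w_def by (intro borel_measurable_of_real measurable_completion) simp
    ultimately show ?thesis by (simp add: square_integrable_def)
  qed
  have [measurable]: "w \<in> borel_measurable lebesgue" using wsq by (simp add: square_integrable_def)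
  define s where "s n x = w x * rep_L2 (F n) x" for n x
  have wF: "square_integrable (\<lambda>x. rep_L2 (F i) x - rep_L2 (F j) x)" for i j
    by (intro square_integrable_diff square_integrable_rep_L2)
  have nF: "(norm (F i - F j))\<^sup>2 = (\<integral>x. (norm (rep_L2 (F i) x - rep_L2 (F j) x))\<^sup>2 \<partial>lebesgue)" for i j
    unfolding norm_L2_rep by (rule integral_cong_AE) (use rep_minus_L2[of "F i" "F j"] in auto)
  define Kw where "Kw = sqrt (\<integral>x. (norm (w x))\<^sup>2 \<partial>lebesgue)"
  have Kw: "Kw \<ge> 0" by (simp add: Kw_def)
  have sij: "(\<integral>x. norm (s i x - s j x) \<partial>lebesgue) \<le> Kw * norm (F i - F j)" for i j
  proof -
    have "(\<integral>x. norm (w x) * norm (rep_L2 (F i) x - rep_L2 (F j) x) \<partial>lebesgue) \<le> Kw * sqrt (\<integral>x. (norm (rep_L2 (F i) x - rep_L2 (F j) x))\<^sup>2 \<partial>lebesgue)"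
      unfolding Kw_def by (rule Cauchy_Schwarz_square_integrable(2)[OF wsq wF])
    then show ?thesis unfolding nF[symmetric] by (simp add: s_def norm_mult[symmetric] right_diff_distrib)
  qed
  have sI: "integrable lebesgue (s n)" for n
  proof (rule Bochner_Integration.integrable_bound[OF Cauchy_Schwarz_square_integrable(1)[OF wsq square_integrable_rep_L2[of "F n"]]])
    show "s n \<in> borel_measurable lebesgue" unfolding s_def[abs_def] by measurable
  qed (simp add: s_def norm_mult)
  obtain r :: "nat \<Rightarrow> nat" where r: "strict_mono r" and rC: "AE x in lebesgue. Cauchy (\<lambda>i. s (r i) x)"
  proof (rule cauchy_L1_AE_cauchy_subseq[OF sI])
    fix e :: real assume e: "e > 0"
    obtain N where N: "\<And>i j. i \<ge> N \<Longrightarrow> j \<ge> N \<Longrightarrow> norm (F i - F j) < e / (Kw + 1)"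
      using F e Kw unfolding Cauchy_def dist_norm by (drule_tac spec[of _ "e / (Kw + 1)"]) auto
    show "\<exists>N. \<forall>i\<ge>N. \<forall>j\<ge>N. (LINT x|lebesgue. norm (s i x - s j x)) < e"
    proof (intro exI allI impI)
      fix i j assume "N \<le> i" "N \<le> j"
      then have "norm (F i - F j) < e / (Kw + 1)" by (rule N)
      then have "Kw * norm (F i - F j) \<le> Kw * (e / (Kw + 1))" using Kw by (intro mult_left_mono) auto
      also have "\<dots> < e" using Kw e by (simp add: field_simps)
      finally show "(LINT x|lebesgue. norm (s i x - s j x)) < e" using sij[of i j] by linarith
    qed
  qed auto
  define f where "f x = lim (\<lambda>i. rep_L2 (F (r i)) x)" for x
  have fm [measurable]: "f \<in> borel_measurable lebesgue" unfolding f_def by measurable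
  have lim: "AE x in lebesgue. (\<lambda>i. rep_L2 (F (r i)) x) \<longlonglongrightarrow> f x"
    using rC
  proof eventually_elim
    case (elim x)
    then obtain l where "(\<lambda>i. s (r i) x) \<longlonglongrightarrow> l" using Cauchy_convergent convergent_def by blast
    then have "(\<lambda>i. s (r i) x / w x) \<longlonglongrightarrow> l / w x" by (intro tendsto_divide tendsto_const) (auto simp: w_def)
    moreover have "s (r i) x / w x = rep_L2 (F (r i)) x" for i by (simp add: s_def w_def)
    ultimately show ?case by (simp add: f_def convergent_LIMSEQ_iff[symmetric] convergentI)
  qed
  have main: "\<exists>N. \<forall>i\<ge>N. square_integrable (\<lambda>x. f x - rep_L2 (F i) x) \<and> (\<integral>x. (norm (f x - rep_L2 (F i) x))\<^sup>2 \<partial>lebesgue) \<le> e\<^sup>2" if e: "e > 0" for e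
  proof -
    obtain N where N: "\<And>i j. i \<ge> N \<Longrightarrow> j \<ge> N \<Longrightarrow> norm (F i - F j) < e"
      using F e unfolding Cauchy_def dist_norm by blast
    have "square_integrable (\<lambda>x. f x - rep_L2 (F i) x) \<and> (\<integral>x. (norm (f x - rep_L2 (F i) x))\<^sup>2 \<partial>lebesgue) \<le> e\<^sup>2" if i: "i \<ge> N" for i
    proof -
      have "(\<integral>\<^sup>+x. (norm (f x - rep_L2 (F i) x))\<^sup>2 \<partial>lebesgue) \<le> (\<integral>\<^sup>+x. liminf (\<lambda>j. ennreal ((norm (rep_L2 (F (r j)) x - rep_L2 (F i) x))\<^sup>2)) \<partial>lebesgue)"
      proof (rule nn_integral_mono_AE)
        show "AE x in lebesgue. ennreal ((norm (f x - rep_L2 (F i) x))\<^sup>2) \<le> liminf (\<lambda>j. ennreal ((norm (rep_L2 (F (r j)) x - rep_L2 (F i) x))\<^sup>2))"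
          using lim
        proof eventually_elim
          case (elim x)
          then have "(\<lambda>j. ennreal ((norm (rep_L2 (F (r j)) x - rep_L2 (F i) x))\<^sup>2)) \<longlonglongrightarrow> ennreal ((norm (f x - rep_L2 (F i) x))\<^sup>2)"
            by (intro tendsto_intros)
          from lim_imp_Liminf[OF trivial_limit_sequentially this] show ?case by simp
        qed
      qed
      also have "\<dots> \<le> liminf (\<lambda>j. \<integral>\<^sup>+x. ennreal ((norm (rep_L2 (F (r j)) x - rep_L2 (F i) x))\<^sup>2) \<partial>lebesgue)"
        by (rule nn_integral_liminf) measurable
      also have "\<dots> \<le> ennreal (e\<^sup>2)"
      proof (rule Liminf_le)
        show "\<forall>\<^sub>F j in sequentially. (\<integral>\<^sup>+x. ennreal ((norm (rep_L2 (F (r j)) x - rep_L2 (F i) x))\<^sup>2) \<partial>lebesgue) \<le> ennreal (e\<^sup>2)"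
        proof (rule eventually_sequentiallyI)
          fix j assume j: "N \<le> j"
          then have "r j \<ge> N" using seq_suble[OF r, of j] by linarith
          then have "(norm (F (r j) - F i))\<^sup>2 \<le> e\<^sup>2" using N[of "r j" i] i by (intro power_mono) auto
          moreover have "(\<integral>\<^sup>+x. ennreal ((norm (rep_L2 (F (r j)) x - rep_L2 (F i) x))\<^sup>2) \<partial>lebesgue) = ennreal ((norm (F (r j) - F i))\<^sup>2)"
            unfolding nF using wF[of "r j" i] by (intro nn_integral_eq_integral) (auto simp: square_integrable_def)
          ultimately show "(\<integral>\<^sup>+x. ennreal ((norm (rep_L2 (F (r j)) x - rep_L2 (F i) x))\<^sup>2) \<partial>lebesgue) \<le> ennreal (e\<^sup>2)"
            by (simp add: ennreal_leI)
        qed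
      qed simp
      finally have le: "(\<integral>\<^sup>+x. (norm (f x - rep_L2 (F i) x))\<^sup>2 \<partial>lebesgue) \<le> ennreal (e\<^sup>2)" .
      then have I: "integrable lebesgue (\<lambda>x. (norm (f x - rep_L2 (F i) x))\<^sup>2)"
        by (intro integrableI_bounded) (auto simp: le_less_trans)
      moreover have "(\<integral>x. (norm (f x - rep_L2 (F i) x))\<^sup>2 \<partial>lebesgue) \<le> e\<^sup>2"
        using le by (subst (asm) nn_integral_eq_integral[OF I]) (auto simp: ennreal_le_iff)
      ultimately show ?thesis by (simp add: square_integrable_def)
    qed
    then show ?thesis by blast
  qed
  obtain N0 where "square_integrable (\<lambda>x. f x - rep_L2 (F N0) x)" using main[of 1] by auto
  from square_integrable_add[OF this square_integrable_rep_L2[of "F N0"]] have fsq: "square_integrable f" by simp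
  have "F \<longlonglongrightarrow> abs_L2 f"
  proof (rule LIMSEQ_I)
    fix e :: real assume e: "e > 0"
    obtain N where N: "\<And>i. i \<ge> N \<Longrightarrow> (\<integral>x. (norm (f x - rep_L2 (F i) x))\<^sup>2 \<partial>lebesgue) \<le> (e/2)\<^sup>2" using main[of "e/2"] e by auto
    show "\<exists>N. \<forall>i\<ge>N. norm (F i - abs_L2 f) < e"
    proof (intro exI allI impI)
      fix i assume i: "N \<le> i"
      have "(norm (F i - abs_L2 f))\<^sup>2 = (\<integral>x. (norm (f x - rep_L2 (F i) x))\<^sup>2 \<partial>lebesgue)"
        unfolding norm_L2_rep
      proof (rule integral_cong_AE)
        show "AE x in lebesgue. (norm (rep_L2 (F i - abs_L2 f) x))\<^sup>2 = (norm (f x - rep_L2 (F i) x))\<^sup>2"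
          using rep_minus_L2[of "F i" "abs_L2 f"] rep_abs_L2[OF fsq] by eventually_elim (simp add: norm_minus_commute)
      qed auto
      then have "(norm (F i - abs_L2 f))\<^sup>2 \<le> (e/2)\<^sup>2" using N[OF i] by simp
      then have "norm (F i - abs_L2 f) \<le> e / 2" using e by (simp add: power2_le_iff_abs_le)
      then show "norm (F i - abs_L2 f) < e" using e by linarith
    qed
  qed
  then show "convergent F" by (rule convergentI)
qed

instance L2 :: (euclidean_space) complete_space
  by standard (rule Cauchy_L2_convergent)

section \<open>The Plancherel transform\<close>

lemma borel_measurable_cis [measurable]:
  assumes [measurable]: "f \<in> borel_measurable M"
  shows "(\<lambda>x. cis (f x)) \<in> borel_measurable M"
  unfolding cis_conv_exp by measurable

lemma borel_measurable_cnj [measurable]: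
  assumes [measurable]: "f \<in> borel_measurable M"
  shows "(\<lambda>x. cnj (f x)) \<in> borel_measurable M"
proof -
  have "cnj \<in> borel_measurable borel" by (intro borel_measurable_continuous_onI continuous_intros)
  then show ?thesis by measurable
qed

lemma integrable_cis_mult:
  assumes "integrable lborel f"
  shows "integrable lborel (\<lambda>x::'a::euclidean_space. cis (x \<bullet> \<xi>) * f x)"
proof (rule Bochner_Integration.integrable_bound[OF assms])
  have [measurable]: "f \<in> borel_measurable borel" using assms by auto
  show "(\<lambda>x. cis (x \<bullet> \<xi>) * f x) \<in> borel_measurable lborel"
    unfolding cis_conv_exp by measurable
qed (simp add: norm_mult)

definition fourier_const :: "'a::euclidean_space itself \<Rightarrow> real" where
  "fourier_const _ = (2 * pi) powr (- real DIM('a) / 2)"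

lemma fourier_const_pos: "fourier_const TYPE('a::euclidean_space) > 0"
  by (simp add: fourier_const_def)

lemma fourier_integral_lborel:
  assumes "f \<in> borel_measurable borel"
  shows "fourier_integral f \<xi> = of_real (fourier_const TYPE('a)) * (\<integral>x. cis (x \<bullet> - \<xi>) * f (x :: 'a::euclidean_space) \<partial>lborel)"
proof -
  have "(\<lambda>x. cis (x \<bullet> - \<xi>) * f x) \<in> borel_measurable borel"
    unfolding cis_conv_exp using assms by measurable
  then show ?thesis
    by (simp add: fourier_integral_def fourier_const_def integral_completion)
qed

lemma norm_fourier_integral_le:
  fixes f :: "'a::euclidean_space \<Rightarrow> complex"
  assumes "integrable lborel f"
  shows "norm (fourier_integral f \<xi>) \<le> fourier_const TYPE('a) * (\<integral>x. norm (f x) \<partial>lborel)"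
proof -
  have "norm (\<integral>x. cis (x \<bullet> - \<xi>) * f x \<partial>lborel) \<le> (\<integral>x. norm (cis (x \<bullet> - \<xi>) * f x) \<partial>lborel)"
    by (rule integral_norm_bound)
  also have "\<dots> = (\<integral>x. norm (f x) \<partial>lborel)" by (simp add: norm_mult)
  finally show ?thesis
    using assms fourier_const_pos[where 'a = 'a] by (subst fourier_integral_lborel) (auto simp: norm_mult)
qed

lemma continuous_fourier_integral:
  fixes f :: "'a::euclidean_space \<Rightarrow> complex"
  assumes f: "integrable lborel f"
  shows "continuous_on UNIV (fourier_integral f)"
proof -
  have [measurable]: "f \<in> borel_measurable borel" using f by auto
  have "isCont (\<lambda>\<xi>. \<integral>x. cis (x \<bullet> - \<xi>) * f x \<partial>lborel) \<xi>" for \<xi>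
    unfolding continuous_at_sequentially o_def
  proof (intro allI impI)
    fix X assume X: "X \<longlonglongrightarrow> \<xi>"
    show "(\<lambda>n. \<integral>x. cis (x \<bullet> - X n) * f x \<partial>lborel) \<longlonglongrightarrow> (\<integral>x. cis (x \<bullet> - \<xi>) * f x \<partial>lborel)"
    proof (rule integral_dominated_convergence[where w = "\<lambda>x. norm (f x)"])
      show "AE x in lborel. (\<lambda>n. cis (x \<bullet> - X n) * f x) \<longlonglongrightarrow> cis (x \<bullet> - \<xi>) * f x"
        unfolding cis_conv_exp by (intro AE_I2 tendsto_intros X)
    qed (use f in \<open>auto simp: norm_mult\<close>)
  qed
  then have "continuous_on UNIV (\<lambda>\<xi>. \<integral>x. cis (x \<bullet> - \<xi>) * f x \<partial>lborel)"
    by (simp add: continuous_on_eq_continuous_at)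
  then have "continuous_on UNIV (\<lambda>\<xi>. of_real (fourier_const TYPE('a)) * (\<integral>x. cis (x \<bullet> - \<xi>) * f x \<partial>lborel))"
    by (intro continuous_intros)
  moreover have "fourier_integral f = (\<lambda>\<xi>. of_real (fourier_const TYPE('a)) * (\<integral>x. cis (x \<bullet> - \<xi>) * f x \<partial>lborel))"
    by (intro ext fourier_integral_lborel) measurable
  ultimately show ?thesis by simp
qed

lemma borel_measurable_fourier_integral:
  "integrable lborel f \<Longrightarrow> fourier_integral f \<in> borel_measurable borel"
  by (intro borel_measurable_continuous_onI continuous_fourier_integral)

section \<open>Gaussian regularisation and Plancherel's identity\<close>

definition gauss :: "'a::euclidean_space \<Rightarrow> real" where
  "gauss v = (\<Prod>b\<in>Basis. std_normal_density (v \<bullet> b))"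

lemma gauss_nonneg: "gauss v \<ge> 0"
  by (auto simp: gauss_def intro!: prod_nonneg)

lemma borel_measurable_gauss [measurable]: "gauss \<in> borel_measurable borel"
  unfolding gauss_def[abs_def] by measurable

lemma integral_lborel_prod:
  fixes f :: "'a::euclidean_space \<Rightarrow> real \<Rightarrow> complex"
  assumes f: "\<And>b. b \<in> Basis \<Longrightarrow> integrable lborel (f b)"
  shows "(\<integral>x. (\<Prod>b\<in>Basis. f b (x \<bullet> b)) \<partial>lborel) = (\<Prod>b\<in>Basis. \<integral>t. f b t \<partial>lborel)"
    and "integrable lborel (\<lambda>x. \<Prod>b\<in>Basis. f b (x \<bullet> b))"
proof -
  interpret product_sigma_finite "\<lambda>_::'a. lborel :: real measure" by unfold_locales
  have [measurable]: "(\<lambda>x. f b (x \<bullet> b)) \<in> borel_measurable borel" if "b \<in> Basis" for b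
    using f[OF that] by measurable
  have m: "(\<lambda>x. \<Prod>b\<in>Basis. f b (x \<bullet> b)) \<in> borel_measurable borel" by measurable
  have g: "(\<lambda>g. \<Sum>b\<in>Basis. g b *\<^sub>R b) \<in> (\<Pi>\<^sub>M b\<in>(Basis::'a set). lborel) \<rightarrow>\<^sub>M borel"
    by measurable
  have eq: "(\<Sum>b\<in>Basis. g b *\<^sub>R b) \<bullet> c = g c" if "c \<in> (Basis::'a set)" for g c
    using that by (simp add: inner_sum_left inner_Basis if_distrib sum.If_cases cong: if_cong)
  show "(\<integral>x. (\<Prod>b\<in>Basis. f b (x \<bullet> b)) \<partial>lborel) = (\<Prod>b\<in>Basis. \<integral>t. f b t \<partial>lborel)"
    by (subst lborel_eq, subst integral_distr[OF g m]) (simp add: eq product_integral_prod f)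
  show "integrable lborel (\<lambda>x. \<Prod>b\<in>Basis. f b (x \<bullet> b))"
    by (subst lborel_eq, subst integrable_distr_eq[OF g m]) (simp add: eq product_integrable_prod f)
qed

text \<open>The product form of \<open>gauss\<close> reduces the transform to the characteristic
  function of the standard normal distribution in each coordinate.\<close>

lemma fourier_gauss:
  fixes \<xi> :: "'a::euclidean_space"
  shows "(\<integral>v. cis (v \<bullet> \<xi>) * of_real (gauss v) \<partial>lborel) = of_real (exp (- (norm \<xi>)\<^sup>2 / 2))"
    and "integrable lborel (\<lambda>v. cis (v \<bullet> \<xi>) * of_real (gauss v))"
proof -
  define f where "f b t = cis (t * (\<xi> \<bullet> b)) * of_real (std_normal_density t)" for b :: 'a and t
  have eq: "cis (v \<bullet> \<xi>) * of_real (gauss v) = (\<Prod>b\<in>Basis. f b (v \<bullet> b))" for v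
    unfolding f_def prod.distrib gauss_def of_real_prod cis_conv_exp
    by (simp add: exp_sum[symmetric] sum_distrib_left[symmetric] euclidean_inner[of v \<xi>])
  have fI: "integrable lborel (f b)" for b
  proof (rule Bochner_Integration.integrable_bound[OF integrable_normal_density[of 1 0]])
    show "f b \<in> borel_measurable lborel" unfolding f_def[abs_def] cis_conv_exp by measurable
  qed (auto simp: f_def norm_mult)
  have fint: "(\<integral>t. f b t \<partial>lborel) = of_real (exp (- (\<xi> \<bullet> b)\<^sup>2 / 2))" for b
  proof -
    have "char std_normal_distribution (\<xi> \<bullet> b) = (\<integral>t. std_normal_density t *\<^sub>R iexp ((\<xi> \<bullet> b) * t) \<partial>lborel)"
      unfolding char_def by (subst integral_density) auto
    then have "(\<integral>t. std_normal_density t *\<^sub>R iexp ((\<xi> \<bullet> b) * t) \<partial>lborel) = of_real (exp (- (\<xi> \<bullet> b)\<^sup>2 / 2))"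
      by (simp only: char_std_normal_distribution)
    then show ?thesis by (simp add: f_def cis_conv_exp scaleR_conv_of_real mult_ac)
  qed
  show "(\<integral>v. cis (v \<bullet> \<xi>) * of_real (gauss v) \<partial>lborel) = of_real (exp (- (norm \<xi>)\<^sup>2 / 2))"
    unfolding eq integral_lborel_prod(1)[OF fI] fint
    by (simp add: of_real_prod[symmetric] exp_sum[symmetric] sum_negf sum_divide_distrib[symmetric]
       norm_eq_sqrt_inner euclidean_inner[of \<xi> \<xi>] power2_eq_square sum_nonneg)
  show "integrable lborel (\<lambda>v. cis (v \<bullet> \<xi>) * of_real (gauss v))"
    unfolding eq by (rule integral_lborel_prod(2)[OF fI])
qed

lemma gauss_integral: "integrable lborel (gauss :: 'a::euclidean_space \<Rightarrow> real)" "(\<integral>v. gauss (v::'a) \<partial>lborel) = 1"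
proof -
  have i: "integrable lborel (\<lambda>v::'a. complex_of_real (gauss v))"
    using fourier_gauss(2)[of 0] by simp
  show "integrable lborel (gauss :: 'a \<Rightarrow> real)"
    using integrable_bounded_linear[OF bounded_linear_Re i] by simp
  have "complex_of_real (\<integral>v. gauss (v::'a) \<partial>lborel) = 1"
    using fourier_gauss(1)[of 0] by (simp add: integral_complex_of_real)
  then show "(\<integral>v. gauss (v::'a) \<partial>lborel) = 1" by simp
qed

lemma gauss_eq: "gauss (v::'a::euclidean_space) = fourier_const TYPE('a) * exp (- (norm v)\<^sup>2 / 2)"
proof -
  have "gauss v = (\<Prod>b\<in>(Basis::'a set). 1 / sqrt (2 * pi)) * (\<Prod>b\<in>Basis. exp (- (v \<bullet> b)\<^sup>2 / 2))"
    by (simp add: gauss_def std_normal_density_def prod_dividef power_divide)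
  also have "(\<Prod>b\<in>(Basis::'a set). 1 / sqrt (2 * pi)) = fourier_const TYPE('a)"
  proof -
    have "1 / sqrt (2 * pi) = (2 * pi) powr (- 1 / 2)" by (simp add: powr_minus powr_half_sqrt inverse_eq_divide)
    then show ?thesis by (simp add: fourier_const_def powr_power)
  qed
  also have "(\<Prod>b\<in>Basis. exp (- (v \<bullet> b)\<^sup>2 / 2)) = exp (- (norm v)\<^sup>2 / 2)"
    by (simp add: exp_sum[symmetric] sum_negf sum_divide_distrib[symmetric]
       norm_eq_sqrt_inner euclidean_inner[of v v] power2_eq_square sum_nonneg)
  finally show ?thesis .
qed

lemma integrable_exp_norm_square:
  assumes "\<epsilon> > 0"
  shows "integrable lborel (\<lambda>\<xi>::'a::euclidean_space. exp (- (\<epsilon> * norm \<xi>)\<^sup>2 / 2))"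
proof -
  have "integrable lborel (\<lambda>\<xi>::'a. gauss (\<epsilon> *\<^sub>R \<xi>))"
    using lborel_integral_scale(1)[of \<epsilon> "gauss :: 'a \<Rightarrow> real"] assms gauss_integral(1) by simp
  then show ?thesis using assms fourier_const_pos[where 'a='a] by (simp add: gauss_eq)
qed

text \<open>The Gaussian cutoff at frequency 1 / \<epsilon> transforms into a Gaussian of width
  \<epsilon> and total mass one, an approximate identity. The square of the normalising constant
  belongs to the two transforms in Plancherel's identity.\<close>

lemma fourier_gauss_scaled:
  fixes u :: "'a::euclidean_space"
  assumes \<epsilon>: "\<epsilon> > 0"
  shows "of_real ((fourier_const TYPE('a))\<^sup>2) * (\<integral>\<xi>. cis (u \<bullet> \<xi>) * of_real (exp (- (\<epsilon> * norm \<xi>)\<^sup>2 / 2)) \<partial>lborel)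
    = of_real (gauss ((1 / \<epsilon>) *\<^sub>R u) / \<epsilon> ^ DIM('a))"
proof -
  define c where "c = fourier_const TYPE('a)"
  have c: "c > 0" by (simp add: c_def fourier_const_pos)
  have "of_real (c\<^sup>2) * (cis (u \<bullet> \<xi>) * complex_of_real (exp (- (\<epsilon> * norm \<xi>)\<^sup>2 / 2)))
     = of_real c * ((\<lambda>v. cis (v \<bullet> ((1/\<epsilon>) *\<^sub>R u)) * of_real (gauss v)) (\<epsilon> *\<^sub>R \<xi>))" for \<xi> :: 'a
    using \<epsilon> by (simp add: gauss_eq c_def[symmetric] power2_eq_square inner_commute)
  then have "of_real (c\<^sup>2) * (\<integral>\<xi>. cis (u \<bullet> \<xi>) * of_real (exp (- (\<epsilon> * norm \<xi>)\<^sup>2 / 2)) \<partial>lborel)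
     = of_real c * (\<integral>\<xi>. (\<lambda>v. cis (v \<bullet> ((1/\<epsilon>) *\<^sub>R u)) * complex_of_real (gauss v)) (\<epsilon> *\<^sub>R \<xi>) \<partial>(lborel :: 'a measure))"
    unfolding integral_mult_right_zero[symmetric] by simp
  also have "(\<integral>\<xi>. (\<lambda>v. cis (v \<bullet> ((1/\<epsilon>) *\<^sub>R u)) * complex_of_real (gauss v)) (\<epsilon> *\<^sub>R \<xi>) \<partial>(lborel :: 'a measure))
     = (1 / \<epsilon> ^ DIM('a)) *\<^sub>R (\<integral>v. cis (v \<bullet> ((1/\<epsilon>) *\<^sub>R u)) * complex_of_real (gauss v) \<partial>lborel)"
    using lborel_integral_scale(2)[of \<epsilon> "\<lambda>v. cis (v \<bullet> ((1/\<epsilon>) *\<^sub>R u)) * complex_of_real (gauss v)"] \<epsilon>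
    by (simp add: field_simps scaleR_conv_of_real)
  also have "\<dots> = of_real (exp (- (norm ((1/\<epsilon>) *\<^sub>R u))\<^sup>2 / 2) / \<epsilon> ^ DIM('a))"
    unfolding fourier_gauss by (simp add: scaleR_conv_of_real)
  finally show ?thesis by (simp add: c_def gauss_eq)
qed

lemma integrable_pair_mult:
  fixes f :: "'a \<Rightarrow> complex" and g :: "'b \<Rightarrow> complex"
  assumes M: "sigma_finite_measure M" and N: "sigma_finite_measure N" and f: "integrable M f" and g: "integrable N g"
  shows "integrable (M \<Otimes>\<^sub>M N) (\<lambda>z. f (fst z) * g (snd z))"
proof (rule integrableI_bounded)
  interpret N: sigma_finite_measure N by (rule N)
  have [measurable]: "f \<in> borel_measurable M" "g \<in> borel_measurable N" using f g by auto
  show "(\<lambda>z. f (fst z) * g (snd z)) \<in> borel_measurable (M \<Otimes>\<^sub>M N)" by measurable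
  have "(\<integral>\<^sup>+z. norm (f (fst z) * g (snd z)) \<partial>(M \<Otimes>\<^sub>M N)) = (\<integral>\<^sup>+x. \<integral>\<^sup>+y. ennreal (norm (f x)) * ennreal (norm (g y)) \<partial>N \<partial>M)"
    by (subst N.nn_integral_fst[symmetric]) (auto simp: norm_mult ennreal_mult)
  also have "\<dots> = (\<integral>\<^sup>+x. norm (f x) \<partial>M) * (\<integral>\<^sup>+y. norm (g y) \<partial>N)"
    by (simp add: nn_integral_cmult nn_integral_multc)
  also have "\<dots> < \<infinity>" using f g by (simp add: integrable_iff_bounded ennreal_mult_less_top)
  finally show "(\<integral>\<^sup>+z. norm (f (fst z) * g (snd z)) \<partial>(M \<Otimes>\<^sub>M N)) < \<infinity>" .
qed

text \<open>Expanding the square of the modulus gives a triple integral over x, y and \<xi>. The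
  cutoff makes it absolutely convergent for integrable f, so the \<xi>-integral may be done first
  and becomes the Gaussian of the difference.\<close>

lemma plancherel_regularized:
  fixes f :: "'a::euclidean_space \<Rightarrow> complex"
  assumes f: "integrable lborel f" and \<epsilon>: "\<epsilon> > 0"
  defines "G u \<equiv> gauss ((1 / \<epsilon>) *\<^sub>R u) / \<epsilon> ^ DIM('a)"
  shows "complex_of_real (\<integral>\<xi>. (norm (fourier_integral f \<xi>))\<^sup>2 * exp (- (\<epsilon> * norm \<xi>)\<^sup>2 / 2) \<partial>lborel)
     = (\<integral>z. f (fst z) * cnj (f (snd z)) * of_real (G (snd z - fst z)) \<partial>(lborel \<Otimes>\<^sub>M lborel))"
proof -
  define c where "c = fourier_const TYPE('a)"
  define e where "e \<xi> = complex_of_real (exp (- (\<epsilon> * norm \<xi>)\<^sup>2 / 2))" for \<xi> :: 'a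
  have fm [measurable]: "f \<in> borel_measurable borel" using f by auto
  have em [measurable]: "e \<in> borel_measurable borel" unfolding e_def[abs_def] by measurable
  have eI: "integrable lborel e" unfolding e_def using integrable_exp_norm_square[OF \<epsilon>, where 'a='a] by simp
  have cf: "integrable lborel (\<lambda>x. cnj (f x))" using f by simp
  define \<Psi> where "\<Psi> z \<xi> = (f (fst z) * cnj (f (snd z))) * (cis ((snd z - fst z) \<bullet> \<xi>) * e \<xi>)" for z \<xi>
  interpret Q: pair_sigma_finite "lborel \<Otimes>\<^sub>M lborel :: ('a \<times> 'a) measure" "lborel :: 'a measure"
    unfolding lborel_prod by unfold_locales
  have ff: "integrable (lborel \<Otimes>\<^sub>M lborel) (\<lambda>z. f (fst z) * cnj (f (snd z)))"
    by (rule integrable_pair_mult[OF _ _ f cf]) unfold_locales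
  have \<Psi>I: "integrable ((lborel \<Otimes>\<^sub>M lborel) \<Otimes>\<^sub>M lborel) (\<lambda>(z, \<xi>). \<Psi> z \<xi>)"
  proof (rule Bochner_Integration.integrable_bound)
    show "integrable ((lborel \<Otimes>\<^sub>M lborel) \<Otimes>\<^sub>M lborel) (\<lambda>z. (f (fst (fst z)) * cnj (f (snd (fst z)))) * e (snd z))"
      by (rule integrable_pair_mult[OF _ _ ff eI]) (unfold lborel_prod, unfold_locales)
    show "(\<lambda>(z, \<xi>). \<Psi> z \<xi>) \<in> borel_measurable ((lborel \<Otimes>\<^sub>M lborel) \<Otimes>\<^sub>M lborel)"
      unfolding \<Psi>_def by measurable
  qed (auto simp: \<Psi>_def norm_mult)
  have F: "of_real ((norm (fourier_integral f \<xi>))\<^sup>2 * exp (- (\<epsilon> * norm \<xi>)\<^sup>2 / 2)) = of_real (c\<^sup>2) * (\<integral>z. \<Psi> z \<xi> \<partial>(lborel \<Otimes>\<^sub>M lborel))" for \<xi>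
  proof -
    have 1: "integrable lborel (\<lambda>x. cis (x \<bullet> - \<xi>) * f x)" by (rule integrable_cis_mult[OF f])
    have 2: "integrable lborel (\<lambda>y. cis (y \<bullet> \<xi>) * cnj (f y))" by (rule integrable_cis_mult[OF cf])
    have 12: "integrable (lborel \<Otimes>\<^sub>M lborel) (\<lambda>z. (cis (fst z \<bullet> - \<xi>) * f (fst z)) * (cis (snd z \<bullet> \<xi>) * cnj (f (snd z))))"
      by (rule integrable_pair_mult[OF _ _ 1 2]) unfold_locales
    have "(\<integral>z. \<Psi> z \<xi> \<partial>(lborel \<Otimes>\<^sub>M lborel)) = (\<integral>z. ((cis (fst z \<bullet> - \<xi>) * f (fst z)) * (cis (snd z \<bullet> \<xi>) * cnj (f (snd z)))) * e \<xi> \<partial>(lborel \<Otimes>\<^sub>M lborel))"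
    proof (intro Bochner_Integration.integral_cong refl)
      fix z :: "'a \<times> 'a"
      have "cis ((snd z - fst z) \<bullet> \<xi>) = cis (fst z \<bullet> - \<xi>) * cis (snd z \<bullet> \<xi>)"
        by (simp add: cis_mult inner_diff_left)
      then show "\<Psi> z \<xi> = ((cis (fst z \<bullet> - \<xi>) * f (fst z)) * (cis (snd z \<bullet> \<xi>) * cnj (f (snd z)))) * e \<xi>"
        by (simp add: \<Psi>_def mult_ac)
    qed
    also have "\<dots> = (\<integral>z. (cis (fst z \<bullet> - \<xi>) * f (fst z)) * (cis (snd z \<bullet> \<xi>) * cnj (f (snd z))) \<partial>(lborel \<Otimes>\<^sub>M lborel)) * e \<xi>"
      by simp
    also have "(\<integral>z. (cis (fst z \<bullet> - \<xi>) * f (fst z)) * (cis (snd z \<bullet> \<xi>) * cnj (f (snd z))) \<partial>(lborel \<Otimes>\<^sub>M lborel))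
        = (\<integral>x. \<integral>y. (cis (x \<bullet> - \<xi>) * f x) * (cis (y \<bullet> \<xi>) * cnj (f y)) \<partial>lborel \<partial>lborel)"
      using lborel_pair.integral_fst'[OF 12] by simp
    also have "\<dots> = (\<integral>x. cis (x \<bullet> - \<xi>) * f x \<partial>lborel) * (\<integral>y. cis (y \<bullet> \<xi>) * cnj (f y) \<partial>lborel)" by simp
    also have "(\<integral>y. cis (y \<bullet> \<xi>) * cnj (f y) \<partial>lborel) = cnj (\<integral>x. cis (x \<bullet> - \<xi>) * f x \<partial>lborel)"
      by (subst Bochner_Integration.integral_cnj[symmetric]) (simp add: cis_cnj)
    finally have "(\<integral>z. \<Psi> z \<xi> \<partial>(lborel \<Otimes>\<^sub>M lborel)) = of_real ((norm (\<integral>x. cis (x \<bullet> - \<xi>) * f x \<partial>lborel))\<^sup>2) * e \<xi>"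
      by (simp only: complex_norm_square)
    then show ?thesis
      by (simp add: fourier_integral_lborel norm_mult power_mult_distrib c_def e_def)
  qed
  have "complex_of_real (\<integral>\<xi>. (norm (fourier_integral f \<xi>))\<^sup>2 * exp (- (\<epsilon> * norm \<xi>)\<^sup>2 / 2) \<partial>lborel)
     = (\<integral>\<xi>. of_real ((norm (fourier_integral f \<xi>))\<^sup>2 * exp (- (\<epsilon> * norm \<xi>)\<^sup>2 / 2)) \<partial>lborel)"
    by (rule integral_complex_of_real[symmetric])
  also have "\<dots> = of_real (c\<^sup>2) * (\<integral>\<xi>. \<integral>z. \<Psi> z \<xi> \<partial>(lborel \<Otimes>\<^sub>M lborel) \<partial>lborel)" unfolding F by simp
  also have "(\<integral>\<xi>. \<integral>z. \<Psi> z \<xi> \<partial>(lborel \<Otimes>\<^sub>M lborel) \<partial>lborel) = (\<integral>z. \<integral>\<xi>. \<Psi> z \<xi> \<partial>lborel \<partial>(lborel \<Otimes>\<^sub>M lborel))"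
    by (rule Q.Fubini_integral[OF \<Psi>I])
  also have "of_real (c\<^sup>2) * \<dots> = (\<integral>z. f (fst z) * cnj (f (snd z)) * (of_real (c\<^sup>2) * (\<integral>\<xi>. cis ((snd z - fst z) \<bullet> \<xi>) * e \<xi> \<partial>lborel)) \<partial>(lborel \<Otimes>\<^sub>M lborel))"
    unfolding \<Psi>_def integral_mult_right_zero[symmetric] by (simp add: mult_ac)
  also have "\<dots> = (\<integral>z. f (fst z) * cnj (f (snd z)) * of_real (G (snd z - fst z)) \<partial>(lborel \<Otimes>\<^sub>M lborel))"
    unfolding c_def e_def fourier_gauss_scaled[OF \<epsilon>] G_def ..
  finally show ?thesis .
qed

lemma gauss_minus: "gauss (- v) = gauss (v::'a::euclidean_space)"
  by (simp add: gauss_eq)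

lemma gauss_scaled_nn_integral:
  assumes "\<epsilon> > 0"
  shows "(\<integral>\<^sup>+u. ennreal (gauss ((1 / \<epsilon>) *\<^sub>R u) / \<epsilon> ^ DIM('a)) \<partial>(lborel :: 'a::euclidean_space measure)) = 1"
proof -
  have I: "integrable lborel (\<lambda>u::'a. gauss ((1 / \<epsilon>) *\<^sub>R u) / \<epsilon> ^ DIM('a))"
    using lborel_integral_scale(1)[of "1/\<epsilon>" "gauss :: 'a \<Rightarrow> real"] assms gauss_integral(1) by (intro integrable_divide) simp
  have "(1 / \<epsilon>) ^ DIM('a) * (\<integral>u. gauss ((1 / \<epsilon>) *\<^sub>R u) \<partial>(lborel :: 'a measure)) = 1"
    using lborel_integral_scale(2)[of "1/\<epsilon>" "gauss :: 'a \<Rightarrow> real"] assms gauss_integral(2) by simp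
  then have "(\<integral>u. gauss ((1 / \<epsilon>) *\<^sub>R u) \<partial>(lborel :: 'a measure)) = \<epsilon> ^ DIM('a)"
    using assms by (simp add: power_divide field_simps)
  then have "(\<integral>u. gauss ((1 / \<epsilon>) *\<^sub>R u) / \<epsilon> ^ DIM('a) \<partial>(lborel :: 'a measure)) = 1"
    using assms by simp
  then show ?thesis
    using assms by (subst nn_integral_eq_integral[OF I]) (auto simp: gauss_nonneg)
qed

lemma ennreal_half_sum:
  assumes "0 \<le> a" "0 \<le> b"
  shows "ennreal (1/2 * a + 1/2 * b) = ennreal (1/2) * ennreal a + ennreal (1/2) * ennreal b"
proof -
  have "ennreal (1/2 * a + 1/2 * b) = ennreal (1/2 * a) + ennreal (1/2 * b)"
    by (rule ennreal_plus) (use assms in auto)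
  also have "ennreal (1/2 * a) = ennreal (1/2) * ennreal a" by (rule ennreal_mult) (use assms in auto)
  also have "ennreal (1/2 * b) = ennreal (1/2) * ennreal b" by (rule ennreal_mult) (use assms in auto)
  finally show ?thesis .
qed

text \<open>The product of the two moduli is at most half the sum of their squares, and the Gaussian
  kernel is symmetric with mass one in each variable. The right-hand side may be infinite, hence the
  nonnegative integrals.\<close>

lemma plancherel_regularized_le:
  fixes f :: "'a::euclidean_space \<Rightarrow> complex"
  assumes f: "integrable lborel f" and \<epsilon>: "\<epsilon> > 0"
  shows "(\<integral>\<^sup>+\<xi>. ennreal ((norm (fourier_integral f \<xi>))\<^sup>2 * exp (- (\<epsilon> * norm \<xi>)\<^sup>2 / 2)) \<partial>lborel)
     \<le> (\<integral>\<^sup>+x. ennreal ((norm (f x))\<^sup>2) \<partial>lborel)"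
proof -
  define G where "G u = gauss ((1 / \<epsilon>) *\<^sub>R u) / \<epsilon> ^ DIM('a)" for u :: 'a
  have fm [measurable]: "f \<in> borel_measurable borel" using f by auto
  have Gm [measurable]: "G \<in> borel_measurable borel" unfolding G_def[abs_def] by measurable
  have G0: "G u \<ge> 0" for u using \<epsilon> by (simp add: G_def gauss_nonneg)
  have Gsym: "G (- u) = G u" for u by (simp add: G_def gauss_minus)
  have G1: "(\<integral>\<^sup>+u. ennreal (G u) \<partial>lborel) = 1" unfolding G_def by (rule gauss_scaled_nn_integral[OF \<epsilon>])
  have G1': "(\<integral>\<^sup>+y. ennreal (G (y - x)) \<partial>lborel) = 1" for x
    using nn_integral_lborel_translation[of "\<lambda>u. ennreal (G u)" "- x"] G1 by simp
  have [measurable]: "fourier_integral f \<in> borel_measurable borel" by (rule borel_measurable_fourier_integral[OF f])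
  define N where "N = (\<integral>\<^sup>+x. ennreal ((norm (f x))\<^sup>2) \<partial>lborel)"
  have I: "integrable lborel (\<lambda>\<xi>. (norm (fourier_integral f \<xi>))\<^sup>2 * exp (- (\<epsilon> * norm \<xi>)\<^sup>2 / 2))"
  proof (rule Bochner_Integration.integrable_bound)
    define K where "K = fourier_const TYPE('a) * (\<integral>x. norm (f x) \<partial>lborel)"
    show "integrable lborel (\<lambda>\<xi>::'a. K\<^sup>2 * exp (- (\<epsilon> * norm \<xi>)\<^sup>2 / 2))"
      by (intro integrable_mult_right integrable_exp_norm_square \<epsilon>)
    show "AE \<xi> in lborel. norm ((norm (fourier_integral f \<xi>))\<^sup>2 * exp (- (\<epsilon> * norm \<xi>)\<^sup>2 / 2)) \<le> norm (K\<^sup>2 * exp (- (\<epsilon> * norm \<xi>)\<^sup>2 / 2))"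
      using norm_fourier_integral_le[OF f] by (auto intro!: AE_I2 power_mono simp: K_def abs_mult)
  qed measurable
  have 1: "(\<integral>\<^sup>+z. ennreal ((norm (f (fst z)))\<^sup>2 * G (snd z - fst z)) \<partial>(lborel \<Otimes>\<^sub>M lborel)) = N"
  proof -
    have "(\<integral>\<^sup>+z. ennreal ((norm (f (fst z)))\<^sup>2 * G (snd z - fst z)) \<partial>(lborel \<Otimes>\<^sub>M lborel))
       = (\<integral>\<^sup>+x. \<integral>\<^sup>+y. ennreal ((norm (f x))\<^sup>2) * ennreal (G (y - x)) \<partial>lborel \<partial>lborel)"
      by (subst lborel.nn_integral_fst[symmetric]) (auto simp: ennreal_mult G0)
    then show ?thesis by (simp add: nn_integral_cmult G1' N_def)
  qed
  have 2: "(\<integral>\<^sup>+z. ennreal ((norm (f (snd z)))\<^sup>2 * G (snd z - fst z)) \<partial>(lborel \<Otimes>\<^sub>M lborel)) = N"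
  proof -
    have "(\<integral>\<^sup>+z. ennreal ((norm (f (snd z)))\<^sup>2 * G (snd z - fst z)) \<partial>(lborel \<Otimes>\<^sub>M lborel))
       = (\<integral>\<^sup>+x. \<integral>\<^sup>+y. ennreal ((norm (f y))\<^sup>2 * G (y - x)) \<partial>lborel \<partial>lborel)"
      by (subst lborel.nn_integral_fst[symmetric]) auto
    also have "\<dots> = (\<integral>\<^sup>+y. \<integral>\<^sup>+x. ennreal ((norm (f y))\<^sup>2 * G (y - x)) \<partial>lborel \<partial>lborel)"
      by (rule lborel_pair.Fubini') measurable
    also have "\<dots> = (\<integral>\<^sup>+y. \<integral>\<^sup>+x. ennreal ((norm (f y))\<^sup>2) * ennreal (G (x - y)) \<partial>lborel \<partial>lborel)"
      using Gsym[of "_ - _"] by (simp add: ennreal_mult G0)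
    finally show ?thesis by (simp add: nn_integral_cmult G1' N_def)
  qed
  have "(\<integral>\<^sup>+\<xi>. ennreal ((norm (fourier_integral f \<xi>))\<^sup>2 * exp (- (\<epsilon> * norm \<xi>)\<^sup>2 / 2)) \<partial>lborel)
     = ennreal (\<integral>\<xi>. (norm (fourier_integral f \<xi>))\<^sup>2 * exp (- (\<epsilon> * norm \<xi>)\<^sup>2 / 2) \<partial>lborel)"
    by (rule nn_integral_eq_integral[OF I]) auto
  also have "(\<integral>\<xi>. (norm (fourier_integral f \<xi>))\<^sup>2 * exp (- (\<epsilon> * norm \<xi>)\<^sup>2 / 2) \<partial>lborel)
     \<le> norm (complex_of_real (\<integral>\<xi>. (norm (fourier_integral f \<xi>))\<^sup>2 * exp (- (\<epsilon> * norm \<xi>)\<^sup>2 / 2) \<partial>lborel))"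
    unfolding norm_of_real by (rule abs_ge_self)
  also have "\<dots> = norm (\<integral>z. f (fst z) * cnj (f (snd z)) * of_real (G (snd z - fst z)) \<partial>(lborel \<Otimes>\<^sub>M lborel))"
    unfolding plancherel_regularized[OF f \<epsilon>] G_def ..
  also have "ennreal \<dots> \<le> (\<integral>\<^sup>+z. norm (f (fst z) * cnj (f (snd z)) * of_real (G (snd z - fst z))) \<partial>(lborel \<Otimes>\<^sub>M lborel))"
  proof (cases "integrable (lborel \<Otimes>\<^sub>M lborel) (\<lambda>z. f (fst z) * cnj (f (snd z)) * complex_of_real (G (snd z - fst z)))")
    case True then show ?thesis by (rule integral_norm_bound_ennreal)
  next
    case False then show ?thesis by (simp add: not_integrable_integral_eq)
  qed
  also have "\<dots> \<le> (\<integral>\<^sup>+z. ennreal (1/2) * ennreal ((norm (f (fst z)))\<^sup>2 * G (snd z - fst z)) + ennreal (1/2) * ennreal ((norm (f (snd z)))\<^sup>2 * G (snd z - fst z)) \<partial>(lborel \<Otimes>\<^sub>M lborel))"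
  proof (rule nn_integral_mono)
    fix z :: "'a \<times> 'a"
    have "norm (f (fst z)) * norm (f (snd z)) \<le> 1/2 * (norm (f (fst z)))\<^sup>2 + 1/2 * (norm (f (snd z)))\<^sup>2"
      using sum_squares_bound[of "norm (f (fst z))" "norm (f (snd z))"] by simp
    then have "norm (f (fst z)) * norm (f (snd z)) * G (snd z - fst z) \<le> (1/2 * (norm (f (fst z)))\<^sup>2 + 1/2 * (norm (f (snd z)))\<^sup>2) * G (snd z - fst z)"
      using G0 by (intro mult_right_mono)
    then have "norm (f (fst z) * cnj (f (snd z)) * of_real (G (snd z - fst z))) \<le> 1/2 * ((norm (f (fst z)))\<^sup>2 * G (snd z - fst z)) + 1/2 * ((norm (f (snd z)))\<^sup>2 * G (snd z - fst z))"
      using G0[of "snd z - fst z"] by (simp add: norm_mult algebra_simps)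
    then have "ennreal (norm (f (fst z) * cnj (f (snd z)) * of_real (G (snd z - fst z)))) \<le> ennreal (1/2 * ((norm (f (fst z)))\<^sup>2 * G (snd z - fst z)) + 1/2 * ((norm (f (snd z)))\<^sup>2 * G (snd z - fst z)))"
      by (rule ennreal_leI)
    also have "\<dots> = ennreal (1/2) * ennreal ((norm (f (fst z)))\<^sup>2 * G (snd z - fst z)) + ennreal (1/2) * ennreal ((norm (f (snd z)))\<^sup>2 * G (snd z - fst z))"
      by (rule ennreal_half_sum) (simp_all add: G0)
    finally show "ennreal (norm (f (fst z) * cnj (f (snd z)) * of_real (G (snd z - fst z)))) \<le> \<dots>" .
  qed
  also have "\<dots> = ennreal (1/2) * N + ennreal (1/2) * N"
    by (subst nn_integral_add) (auto simp: nn_integral_cmult 1 2)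
  also have "\<dots> = N"
  proof -
    have "ennreal (1/2) + ennreal (1/2) = 1" by (subst ennreal_plus[symmetric]) auto
    then show ?thesis by (simp only: distrib_right[symmetric] mult_1)
  qed
  finally show ?thesis by (simp add: N_def ennreal_leI)
qed

text \<open>Fatou's lemma as the cutoff tends to 1. Besides the inequality it shows that the
  transform is square integrable, which supplies the dominating function for the equality
  below.\<close>

lemma plancherel_le:
  fixes f :: "'a::euclidean_space \<Rightarrow> complex"
  assumes f: "integrable lborel f" and f2: "integrable lborel (\<lambda>x. (norm (f x))\<^sup>2)"
  shows "integrable lborel (\<lambda>\<xi>. (norm (fourier_integral f \<xi>))\<^sup>2)"
    and "(\<integral>\<xi>. (norm (fourier_integral f \<xi>))\<^sup>2 \<partial>lborel) \<le> (\<integral>x. (norm (f x))\<^sup>2 \<partial>lborel)"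
proof -
  have [measurable]: "fourier_integral f \<in> borel_measurable borel" by (rule borel_measurable_fourier_integral[OF f])
  define h where "h k \<xi> = ennreal ((norm (fourier_integral f \<xi>))\<^sup>2 * exp (- ((1 / real (Suc k)) * norm \<xi>)\<^sup>2 / 2))" for k \<xi>
  have hm: "h k \<in> borel_measurable lborel" for k unfolding h_def[abs_def] by measurable
  have "(\<integral>\<^sup>+\<xi>. ennreal ((norm (fourier_integral f \<xi>))\<^sup>2) \<partial>lborel) = (\<integral>\<^sup>+\<xi>. liminf (\<lambda>k. h k \<xi>) \<partial>lborel)"
  proof (intro nn_integral_cong)
    fix \<xi> :: 'a
    have "(\<lambda>k. 1 / real (Suc k)) \<longlonglongrightarrow> 0" by (intro LIMSEQ_Suc lim_1_over_n)
    then have "(\<lambda>k. (norm (fourier_integral f \<xi>))\<^sup>2 * exp (- ((1 / real (Suc k)) * norm \<xi>)\<^sup>2 / 2)) \<longlonglongrightarrow> (norm (fourier_integral f \<xi>))\<^sup>2 * exp (- (0 * norm \<xi>)\<^sup>2 / 2)"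
      by (intro tendsto_intros) auto
    then have "(\<lambda>k. h k \<xi>) \<longlonglongrightarrow> ennreal ((norm (fourier_integral f \<xi>))\<^sup>2)" unfolding h_def by (intro tendsto_ennrealI) simp
    from lim_imp_Liminf[OF trivial_limit_sequentially this] show "ennreal ((norm (fourier_integral f \<xi>))\<^sup>2) = liminf (\<lambda>k. h k \<xi>)" by simp
  qed
  also have "\<dots> \<le> liminf (\<lambda>k. \<integral>\<^sup>+\<xi>. h k \<xi> \<partial>lborel)" by (rule nn_integral_liminf[OF hm])
  also have "\<dots> \<le> (\<integral>\<^sup>+x. ennreal ((norm (f x))\<^sup>2) \<partial>lborel)"
  proof (rule Liminf_le)
    show "\<forall>\<^sub>F k in sequentially. (\<integral>\<^sup>+\<xi>. h k \<xi> \<partial>lborel) \<le> (\<integral>\<^sup>+x. ennreal ((norm (f x))\<^sup>2) \<partial>lborel)"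
      unfolding h_def by (intro always_eventually allI plancherel_regularized_le[OF f]) simp
  qed simp
  also have "\<dots> = ennreal (\<integral>x. (norm (f x))\<^sup>2 \<partial>lborel)" by (rule nn_integral_eq_integral[OF f2]) auto
  finally have le: "(\<integral>\<^sup>+\<xi>. ennreal ((norm (fourier_integral f \<xi>))\<^sup>2) \<partial>lborel) \<le> ennreal (\<integral>x. (norm (f x))\<^sup>2 \<partial>lborel)" .
  then show I: "integrable lborel (\<lambda>\<xi>. (norm (fourier_integral f \<xi>))\<^sup>2)"
    by (intro integrableI_bounded) (auto simp: le_less_trans)
  show "(\<integral>\<xi>. (norm (fourier_integral f \<xi>))\<^sup>2 \<partial>lborel) \<le> (\<integral>x. (norm (f x))\<^sup>2 \<partial>lborel)"
    using le by (subst (asm) nn_integral_eq_integral[OF I]) (auto simp: ennreal_le_iff)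
qed

text \<open>After rescaling, the double integral pairs f with averages of its conjugate over
  Gaussians of width \<open>\<epsilon> k\<close>. Continuity makes the averages converge pointwise,
  boundedness dominates them, and both sides of the regularised identity pass to the limit.\<close>

lemma plancherel_continuous:
  fixes f :: "'a::euclidean_space \<Rightarrow> complex"
  assumes f: "integrable lborel f" and f2: "integrable lborel (\<lambda>x. (norm (f x))\<^sup>2)"
    and cf: "continuous_on UNIV f" and bf: "\<And>x. norm (f x) \<le> K"
  shows "(\<integral>\<xi>. (norm (fourier_integral f \<xi>))\<^sup>2 \<partial>lborel) = (\<integral>x. (norm (f x))\<^sup>2 \<partial>lborel)"
proof -
  have fm [measurable]: "f \<in> borel_measurable borel" using f by auto
  have [measurable]: "fourier_integral f \<in> borel_measurable borel" by (rule borel_measurable_fourier_integral[OF f])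
  define \<epsilon> where "\<epsilon> k = 1 / real (Suc k)" for k
  have \<epsilon>: "\<epsilon> k > 0" for k by (simp add: \<epsilon>_def)
  have \<epsilon>0: "\<epsilon> \<longlonglongrightarrow> 0" unfolding \<epsilon>_def[abs_def] by (intro LIMSEQ_Suc lim_1_over_n)
  have "(\<lambda>k. \<integral>\<xi>. (norm (fourier_integral f \<xi>))\<^sup>2 * exp (- (\<epsilon> k * norm \<xi>)\<^sup>2 / 2) \<partial>lborel) \<longlonglongrightarrow> (\<integral>\<xi>. (norm (fourier_integral f \<xi>))\<^sup>2 \<partial>lborel)"
  proof (rule integral_dominated_convergence[OF _ _ plancherel_le(1)[OF f f2]])
    show "AE \<xi> in lborel. (\<lambda>k. (norm (fourier_integral f \<xi>))\<^sup>2 * exp (- (\<epsilon> k * norm \<xi>)\<^sup>2 / 2)) \<longlonglongrightarrow> (norm (fourier_integral f \<xi>))\<^sup>2"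
    proof (rule AE_I2)
      fix \<xi> :: 'a
      have "(\<lambda>k. (norm (fourier_integral f \<xi>))\<^sup>2 * exp (- (\<epsilon> k * norm \<xi>)\<^sup>2 / 2)) \<longlonglongrightarrow> (norm (fourier_integral f \<xi>))\<^sup>2 * exp (- (0 * norm \<xi>)\<^sup>2 / 2)"
        by (intro tendsto_intros \<epsilon>0) auto
      then show "(\<lambda>k. (norm (fourier_integral f \<xi>))\<^sup>2 * exp (- (\<epsilon> k * norm \<xi>)\<^sup>2 / 2)) \<longlonglongrightarrow> (norm (fourier_integral f \<xi>))\<^sup>2" by simp
    qed
    show "AE \<xi> in lborel. norm ((norm (fourier_integral f \<xi>))\<^sup>2 * exp (- (\<epsilon> k * norm \<xi>)\<^sup>2 / 2)) \<le> (norm (fourier_integral f \<xi>))\<^sup>2" for k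
      by (auto simp: abs_mult intro!: mult_left_le)
  qed measurable
  then have L: "(\<lambda>k. complex_of_real (\<integral>\<xi>. (norm (fourier_integral f \<xi>))\<^sup>2 * exp (- (\<epsilon> k * norm \<xi>)\<^sup>2 / 2) \<partial>lborel)) \<longlonglongrightarrow> of_real (\<integral>\<xi>. (norm (fourier_integral f \<xi>))\<^sup>2 \<partial>lborel)"
    by (rule tendsto_of_real)
  define I where "I k x = (\<integral>v. cnj (f (x + \<epsilon> k *\<^sub>R v)) * of_real (gauss v) \<partial>lborel)" for k x
  have eq: "complex_of_real (\<integral>\<xi>. (norm (fourier_integral f \<xi>))\<^sup>2 * exp (- (\<epsilon> k * norm \<xi>)\<^sup>2 / 2) \<partial>lborel) = (\<integral>x. f x * I k x \<partial>lborel)" for k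
  proof -
    define G where "G u = gauss ((1 / \<epsilon> k) *\<^sub>R u) / \<epsilon> k ^ DIM('a)" for u :: 'a
    have Gm [measurable]: "G \<in> borel_measurable borel" unfolding G_def[abs_def] by measurable
    have cfI: "integrable lborel (\<lambda>x. cnj (f x))" using f by simp
    have ff: "integrable (lborel \<Otimes>\<^sub>M lborel) (\<lambda>z. f (fst z) * cnj (f (snd z)))"
      by (rule integrable_pair_mult[OF _ _ f cfI]) unfold_locales
    have Gb: "\<bar>G u\<bar> \<le> fourier_const TYPE('a) / \<epsilon> k ^ DIM('a)" for u
      using \<epsilon>[of k] fourier_const_pos[where 'a='a] by (auto simp: G_def gauss_eq abs_mult intro!: divide_right_mono mult_left_le)
    have H: "integrable (lborel \<Otimes>\<^sub>M lborel) (\<lambda>z. f (fst z) * cnj (f (snd z)) * of_real (G (snd z - fst z)))"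
    proof (rule Bochner_Integration.integrable_bound[OF integrable_mult_right[OF ff, of "of_real (fourier_const TYPE('a) / \<epsilon> k ^ DIM('a))"]])
      show "AE z in lborel \<Otimes>\<^sub>M lborel. norm (f (fst z) * cnj (f (snd z)) * of_real (G (snd z - fst z))) \<le> norm (of_real (fourier_const TYPE('a) / \<epsilon> k ^ DIM('a)) * (f (fst z) * cnj (f (snd z))))"
      proof (rule AE_I2)
        fix z :: "'a \<times> 'a"
        have "\<bar>G (snd z - fst z)\<bar> \<le> \<bar>fourier_const TYPE('a) / \<epsilon> k ^ DIM('a)\<bar>" using Gb[of "snd z - fst z"] by linarith
        then have "norm (f (fst z) * cnj (f (snd z))) * \<bar>G (snd z - fst z)\<bar> \<le> norm (f (fst z) * cnj (f (snd z))) * \<bar>fourier_const TYPE('a) / \<epsilon> k ^ DIM('a)\<bar>"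
          by (rule mult_left_mono) simp
        then show "norm (f (fst z) * cnj (f (snd z)) * of_real (G (snd z - fst z))) \<le> norm (of_real (fourier_const TYPE('a) / \<epsilon> k ^ DIM('a)) * (f (fst z) * cnj (f (snd z))))"
          unfolding norm_mult[of _ "of_real _"] norm_mult[of "of_real _" _] norm_of_real by (simp only: mult.commute)
      qed
    qed measurable
    have "(\<integral>y. f x * cnj (f y) * of_real (G (y - x)) \<partial>lborel) = f x * I k x" for x
    proof -
      have "(\<integral>y. cnj (f y) * of_real (G (y - x)) \<partial>lborel) = (\<integral>u. cnj (f (x + u)) * of_real (G u) \<partial>lborel)"
        using lborel_integral_translation[of "\<lambda>y. cnj (f y) * of_real (G (y - x))" x] by simp
      also have "\<dots> = \<epsilon> k ^ DIM('a) *\<^sub>R (\<integral>v. cnj (f (x + \<epsilon> k *\<^sub>R v)) * of_real (G (\<epsilon> k *\<^sub>R v)) \<partial>lborel)"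
        using lborel_integral_scale(2)[of "\<epsilon> k" "\<lambda>u. cnj (f (x + u)) * of_real (G u)"] \<epsilon>[of k] by simp
      also have "\<dots> = (\<integral>v. \<epsilon> k ^ DIM('a) *\<^sub>R (cnj (f (x + \<epsilon> k *\<^sub>R v)) * of_real (G (\<epsilon> k *\<^sub>R v))) \<partial>lborel)"
        by simp
      also have "\<dots> = I k x" unfolding I_def using \<epsilon>[of k]
        by (intro Bochner_Integration.integral_cong refl) (simp add: G_def scaleR_conv_of_real)
      finally have "f x * (\<integral>y. cnj (f y) * of_real (G (y - x)) \<partial>lborel) = f x * I k x" by simp
      then show ?thesis by (simp add: mult.assoc)
    qed
    then show ?thesis
      unfolding plancherel_regularized[OF f \<epsilon>] G_def[symmetric]
      using lborel_pair.integral_fst'[OF H] by simp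
  qed
  have K: "K \<ge> 0" using bf[of undefined] norm_ge_zero order_trans by blast
  have gI: "integrable lborel (\<lambda>v::'a. K * gauss v)" by (intro integrable_mult_right gauss_integral(1))
  have Ib: "norm (I k x) \<le> K" for k x
  proof -
    have "norm (I k x) \<le> (\<integral>v. norm (cnj (f (x + \<epsilon> k *\<^sub>R v)) * complex_of_real (gauss v)) \<partial>lborel)"
      unfolding I_def by (rule integral_norm_bound)
    also have "\<dots> \<le> (\<integral>v. K * gauss (v::'a) \<partial>lborel)"
      by (rule Bochner_Integration.integral_mono')
        (use gI K bf gauss_nonneg in \<open>auto simp: norm_mult abs_of_nonneg[OF gauss_nonneg] intro!: mult_right_mono mult_nonneg_nonneg\<close>)
    also have "\<dots> = K" using gauss_integral(2)[where 'a='a] by simp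
    finally show ?thesis .
  qed
  have Il: "(\<lambda>k. I k x) \<longlonglongrightarrow> cnj (f x)" for x
  proof -
    have "(\<lambda>k. I k x) \<longlonglongrightarrow> (\<integral>v. cnj (f x) * of_real (gauss (v::'a)) \<partial>lborel)" unfolding I_def
    proof (rule integral_dominated_convergence[OF _ _ gI])
      show "AE v in lborel. (\<lambda>k. cnj (f (x + \<epsilon> k *\<^sub>R v)) * complex_of_real (gauss v)) \<longlonglongrightarrow> cnj (f x) * of_real (gauss v)"
      proof (rule AE_I2)
        fix v :: 'a
        have "(\<lambda>k. x + \<epsilon> k *\<^sub>R v) \<longlonglongrightarrow> x + 0 *\<^sub>R v" by (intro tendsto_intros \<epsilon>0)
        then have "(\<lambda>k. f (x + \<epsilon> k *\<^sub>R v)) \<longlonglongrightarrow> f x"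
          using cf by (intro continuous_on_tendsto_compose[OF cf]) auto
        then show "(\<lambda>k. cnj (f (x + \<epsilon> k *\<^sub>R v)) * complex_of_real (gauss v)) \<longlonglongrightarrow> cnj (f x) * of_real (gauss v)"
          by (intro tendsto_intros)
      qed
      show "AE v in lborel. norm (cnj (f (x + \<epsilon> k *\<^sub>R v)) * complex_of_real (gauss v)) \<le> K * gauss v" for k
        using bf gauss_nonneg by (auto simp: norm_mult abs_of_nonneg[OF gauss_nonneg] intro!: mult_right_mono)
    qed measurable
    then show ?thesis by (simp add: gauss_integral(2))
  qed
  have Im: "I k \<in> borel_measurable borel" for k unfolding I_def[abs_def] by measurable
  have "(\<lambda>k. \<integral>x. f x * I k x \<partial>lborel) \<longlonglongrightarrow> (\<integral>x. f x * cnj (f x) \<partial>lborel)"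
  proof (rule integral_dominated_convergence[where w = "\<lambda>x. K * norm (f x)"])
    show "AE x in lborel. (\<lambda>k. f x * I k x) \<longlonglongrightarrow> f x * cnj (f x)" by (intro AE_I2 tendsto_intros Il)
    show "AE x in lborel. norm (f x * I k x) \<le> K * norm (f x)" for k
      using Ib by (auto simp: norm_mult mult.commute[of K] intro!: mult_left_mono)
    show "integrable lborel (\<lambda>x. K * norm (f x))" using f by simp
  qed (use Im in measurable)
  also have "(\<integral>x. f x * cnj (f x) \<partial>lborel) = of_real (\<integral>x. (norm (f x))\<^sup>2 \<partial>lborel)"
    unfolding integral_complex_of_real[symmetric] complex_norm_square ..
  finally have "complex_of_real (\<integral>\<xi>. (norm (fourier_integral f \<xi>))\<^sup>2 \<partial>lborel) = of_real (\<integral>x. (norm (f x))\<^sup>2 \<partial>lborel)"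
    using LIMSEQ_unique L unfolding eq by blast
  then show ?thesis by (simp only: of_real_eq_iff)
qed

section \<open>Borel representatives and density\<close>

lemma lebesgue_ex_borel_complex:
  fixes f :: "'a::euclidean_space \<Rightarrow> complex"
  assumes [measurable]: "f \<in> borel_measurable lebesgue"
  obtains g where "g \<in> borel_measurable borel" "AE x in lebesgue. f x = g x"
proof -
  obtain a b where a [measurable]: "a \<in> borel_measurable lborel" "AE x in lborel. Re (f x) = a x"
    and b [measurable]: "b \<in> borel_measurable lborel" "AE x in lborel. Im (f x) = b x"
    using completion_ex_borel_measurable_real[of "\<lambda>x. Re (f x)" lborel] completion_ex_borel_measurable_real[of "\<lambda>x. Im (f x)" lborel]
    by auto
  have "(\<lambda>x. of_real (a x) + \<i> * of_real (b x)) \<in> borel_measurable borel" using a b by measurable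
  moreover have "AE x in lebesgue. f x = of_real (a x) + \<i> * of_real (b x)"
    using AE_completion[OF a(2)] AE_completion[OF b(2)] by eventually_elim (simp add: complex_eq_iff)
  ultimately show thesis using that by blast
qed

lemma fourier_integral_cong_AE:
  fixes f g :: "'a::euclidean_space \<Rightarrow> complex"
  assumes "AE x in lebesgue. f x = g x" "f \<in> borel_measurable lebesgue" "g \<in> borel_measurable lebesgue"
  shows "fourier_integral f = fourier_integral g"
proof
  fix \<xi> :: 'a
  note [measurable] = assms(2,3)
  have m: "(\<lambda>x. cis (- (x \<bullet> \<xi>))) \<in> borel_measurable lebesgue" by (intro measurable_completion) measurable
  have "(\<integral>x. cis (- (x \<bullet> \<xi>)) * f x \<partial>lebesgue) = (\<integral>x. cis (- (x \<bullet> \<xi>)) * g x \<partial>lebesgue)"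
    using m by (intro integral_cong_AE) (use assms(1) in auto)
  then show "fourier_integral f \<xi> = fourier_integral g \<xi>" by (simp add: fourier_integral_def)
qed

lemma square_integrable_borel_iff:
  assumes "f \<in> borel_measurable borel"
  shows "square_integrable f \<longleftrightarrow> integrable lborel (\<lambda>x. (norm (f x))\<^sup>2)"
  using assms by (simp add: square_integrable_def integrable_completion measurable_completion)

lemma norm_abs_L2_borel:
  assumes "f \<in> borel_measurable borel" "square_integrable f"
  shows "(norm (abs_L2 f))\<^sup>2 = (\<integral>x. (norm (f x))\<^sup>2 \<partial>lborel)"
  using assms by (simp add: norm_abs_L2 integral_completion)

text \<open>Elements of L2 are represented by Lebesgue measurable functions, while translation,
  scaling and Fubini are used on \<open>lborel\<close>; passing to a Borel representative connects
  the two.\<close>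

lemma L2_borel_representative:
  obtains f where "f \<in> borel_measurable borel" "square_integrable f" "AE x in lebesgue. rep_L2 u x = f x" "u = abs_L2 f"
proof -
  obtain f where f: "f \<in> borel_measurable borel" "AE x in lebesgue. rep_L2 u x = f x"
    using lebesgue_ex_borel_complex[of "rep_L2 u"] by auto
  have "f \<in> borel_measurable lebesgue" using f(1) by (intro measurable_completion) simp
  then have s: "square_integrable f" using square_integrable_cong[OF square_integrable_rep_L2 _ f(2)] by blast
  have "u = abs_L2 f" using abs_L2_eqI[OF square_integrable_rep_L2 s f(2)] by simp
  then show thesis using that f s by blast
qed

lemma integrable_lebesgue_borel:
  assumes "AE x in lebesgue. g x = f x" "f \<in> borel_measurable borel" "g \<in> borel_measurable lebesgue"
  shows "integrable lebesgue g \<longleftrightarrow> integrable lborel (f :: 'a::euclidean_space \<Rightarrow> complex)"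
proof -
  have "integrable lebesgue g \<longleftrightarrow> integrable lebesgue f"
    using assms by (intro integrable_cong_AE) (auto intro: measurable_completion)
  then show ?thesis using assms by (simp add: integrable_completion)
qed

text \<open>Approximation by bounded, integrable, continuous functions: clamp the modulus and cut off
  a sequence of continuous functions converging almost everywhere.\<close>

lemma L2_approx_continuous:
  fixes u :: "'a::euclidean_space L2"
  obtains h :: "nat \<Rightarrow> 'a \<Rightarrow> complex" and K :: "nat \<Rightarrow> real"
  where "\<And>k. continuous_on UNIV (h k)" "\<And>k x. norm (h k x) \<le> K k" "\<And>k. integrable lborel (h k)"
    "\<And>k. square_integrable (h k)" "(\<lambda>k. abs_L2 (h k)) \<longlonglongrightarrow> u"
proof -
  obtain f where fm [measurable]: "f \<in> borel_measurable borel" and fs: "square_integrable f" and u: "u = abs_L2 f"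
    using L2_borel_representative[of u] by metis
  have f2: "integrable lborel (\<lambda>x. (norm (f x))\<^sup>2)" using fs square_integrable_borel_iff[OF fm] by simp
  have ex: "\<exists>h K. continuous_on UNIV h \<and> (\<forall>x. norm (h x) \<le> K) \<and> integrable lborel h \<and> square_integrable h \<and> norm (abs_L2 h - u) < e"
    if e: "e > 0" for e
  proof -
    define fr where "fr R x = (if norm x \<le> real R \<and> norm (f x) \<le> real R then f x else 0)" for R x
    have frm [measurable]: "fr R \<in> borel_measurable borel" for R unfolding fr_def[abs_def] by measurable
    have frs: "square_integrable (fr R)" for R
      by (rule square_integrable_bound[OF fs]) (auto simp: fr_def intro: measurable_completion)
    have "(\<lambda>R. \<integral>x. (norm (fr R x - f x))\<^sup>2 \<partial>lborel) \<longlonglongrightarrow> (\<integral>x. 0 \<partial>(lborel :: 'a measure))"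
    proof (rule integral_dominated_convergence[OF _ _ f2])
      show "AE x in lborel. (\<lambda>R. (norm (fr R x - f x))\<^sup>2) \<longlonglongrightarrow> 0"
      proof (rule AE_I2, rule tendsto_eventually, rule eventually_sequentiallyI)
        fix x R assume "nat \<lceil>max (norm x) (norm (f x))\<rceil> \<le> R"
        then have "norm x \<le> real R" "norm (f x) \<le> real R" by linarith+
        then show "(norm (fr R x - f x))\<^sup>2 = 0" by (simp add: fr_def)
      qed
    qed (auto simp: fr_def)
    then have "(\<lambda>R. abs_L2 (fr R)) \<longlonglongrightarrow> abs_L2 f"
      by (intro tendsto_abs_L2 frs fs) (simp add: integral_completion)
    then obtain R where "dist (abs_L2 (fr R)) u < e / 2"
      using e u by (metis (no_types, lifting) LIMSEQ_def half_gt_zero order_refl)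
    then have R: "norm (abs_L2 (fr R) - u) < e / 2" by (simp add: dist_norm)
    have frl: "fr R \<in> borel_measurable lebesgue" by (intro measurable_completion) simp
    obtain N g where N: "negligible N" and cg: "\<And>n. continuous_on UNIV (g n)" and gl: "\<And>x. x \<notin> N \<Longrightarrow> (\<lambda>n. g n x) \<longlonglongrightarrow> fr R x"
      using lebesgue_measurable_imp_measurable_on[of "fr R" UNIV] frl by (auto simp: measurable_on_def)
    \<comment> \<open>\<open>cut\<close> is 1 on the ball of radius R, where \<open>fr R\<close>
      lives, and 0 beyond R + 1. The retraction \<open>cl\<close> to the disc of radius K = R + 1 is
      continuous and fixes the values of \<open>fr R\<close>. Neither therefore changes the
      pointwise limit.\<close>
    define cut where "cut x = max 0 (min 1 (real R + 1 - norm x))" for x :: 'a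
    define K where "K = real R + 1"
    define cl where "cl z = z / complex_of_real (max 1 (norm z / K))" for z :: complex
    define h where "h n x = of_real (cut x) * cl (g n x)" for n x
    have K: "K > 0" by (simp add: K_def)
    have ncl: "norm (cl z) \<le> K" for z
      using K by (auto simp: cl_def norm_divide max_def field_simps)
    have ccl: "continuous_on UNIV cl" unfolding cl_def using K by (intro continuous_intros) (auto simp: max_def)
    have cut01: "0 \<le> cut x" "cut x \<le> 1" for x by (auto simp: cut_def)
    have cut0: "cut x = 0" if "x \<notin> cball 0 (real R + 1)" for x using that by (simp add: cut_def)
    have ch: "continuous_on UNIV (h n)" for n
      unfolding h_def cut_def by (intro continuous_intros continuous_on_compose2[OF ccl cg]) auto
    have [measurable]: "h n \<in> borel_measurable borel" for n by (intro borel_measurable_continuous_onI ch)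
    have hb: "norm (h n x) \<le> K * indicator (cball 0 (real R + 1)) x" for n x
    proof (cases "x \<in> cball 0 (real R + 1)")
      case True
      then show ?thesis using mult_mono[OF cut01(2)[of x] ncl[of "g n x"]] cut01 by (simp add: h_def norm_mult)
    qed (simp add: h_def cut0)
    have indI: "integrable lborel (\<lambda>x::'a. k * indicator (cball 0 (real R + 1)) x :: real)" for k
      by (intro integrable_mult_right integrable_real_indicator) (auto intro: emeasure_bounded_finite[unfolded infinity_ennreal_def])
    have hI: "integrable lborel (h n)" for n
      by (rule Bochner_Integration.integrable_bound[OF indI[of K]]) (use hb K in \<open>auto intro: order_trans[OF _ abs_ge_self]\<close>)
    have h2: "(norm (h n x))\<^sup>2 \<le> K\<^sup>2 * indicator (cball 0 (real R + 1)) x" for n x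
      using power_mono[OF hb[of n x], of 2] by (auto simp: indicator_def split: if_splits)
    have hs: "square_integrable (h n)" for n
      unfolding square_integrable_borel_iff[OF \<open>h n \<in> borel_measurable borel\<close>]
      by (rule Bochner_Integration.integrable_bound[OF indI[of "K\<^sup>2"]]) (use h2 in \<open>auto intro: order_trans[OF _ abs_ge_self]\<close>)
    have frb: "norm (fr R x) \<le> K" "norm (fr R x) \<le> K * indicator (cball 0 (real R + 1)) x" for x
      by (auto simp: fr_def K_def indicator_def)
    have "(\<lambda>n. \<integral>x. (norm (h n x - fr R x))\<^sup>2 \<partial>lebesgue) \<longlonglongrightarrow> (\<integral>x. 0 \<partial>(lebesgue :: 'a measure))"
    proof (rule integral_dominated_convergence[where w = "\<lambda>x. (2 * K)\<^sup>2 * indicator (cball 0 (real R + 1)) x"])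
      show "integrable lebesgue (\<lambda>x::'a. (2 * K)\<^sup>2 * indicator (cball 0 (real R + 1)) x :: real)"
        using indI[of "(2 * K)\<^sup>2"] by (subst integrable_completion) auto
      have "AE x in lebesgue. x \<notin> N" using N by (simp add: AE_not_in negligible_iff_null_sets)
      then show "AE x in lebesgue. (\<lambda>n. (norm (h n x - fr R x))\<^sup>2) \<longlonglongrightarrow> 0"
      proof eventually_elim
        case (elim x)
        have "(\<lambda>n. cl (g n x)) \<longlonglongrightarrow> cl (fr R x)"
          using gl[OF elim] by (intro continuous_on_tendsto_compose[OF ccl]) auto
        moreover have "cl (fr R x) = fr R x" using frb(1)[of x] K by (simp add: cl_def max_def divide_le_eq)
        ultimately have "(\<lambda>n. h n x) \<longlonglongrightarrow> of_real (cut x) * fr R x" unfolding h_def by (intro tendsto_intros) auto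
        moreover have "of_real (cut x) * fr R x = fr R x" by (auto simp: fr_def cut_def)
        ultimately have "(\<lambda>n. (norm (h n x - fr R x))\<^sup>2) \<longlonglongrightarrow> (norm (fr R x - fr R x))\<^sup>2" by (intro tendsto_intros) simp
        then show ?case by simp
      qed
      show "AE x in lebesgue. norm ((norm (h n x - fr R x))\<^sup>2) \<le> (2 * K)\<^sup>2 * indicator (cball 0 (real R + 1)) x" for n
      proof (rule AE_I2)
        fix x :: 'a
        have "norm (h n x - fr R x) \<le> 2 * K * indicator (cball 0 (real R + 1)) x"
          using norm_triangle_ineq4[of "h n x" "fr R x"] hb[of n x] frb(2)[of x] by (auto simp: indicator_def)
        then have "(norm (h n x - fr R x))\<^sup>2 \<le> (2 * K * indicator (cball 0 (real R + 1)) x)\<^sup>2" by (intro power_mono) auto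
        then show "norm ((norm (h n x - fr R x))\<^sup>2) \<le> (2 * K)\<^sup>2 * indicator (cball 0 (real R + 1)) x"
          by (auto simp: indicator_def split: if_splits)
      qed
    qed (auto intro!: measurable_completion)
    then have "(\<lambda>n. abs_L2 (h n)) \<longlonglongrightarrow> abs_L2 (fr R)"
      by (intro tendsto_abs_L2 hs frs) simp
    then obtain n where "dist (abs_L2 (h n)) (abs_L2 (fr R)) < e / 2"
      using e by (metis (no_types, lifting) LIMSEQ_def half_gt_zero order_refl)
    then have "norm (abs_L2 (h n) - abs_L2 (fr R)) < e / 2" by (simp add: dist_norm)
    then have "norm (abs_L2 (h n) - u) < e"
      using R norm_triangle_ineq[of "abs_L2 (h n) - abs_L2 (fr R)" "abs_L2 (fr R) - u"] by simp
    moreover have "norm (h n x) \<le> K" for x using hb[of n x] K by (cases "x \<in> cball 0 (real R + 1)") auto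
    ultimately show ?thesis using ch hI hs by blast
  qed
  have "\<forall>k. \<exists>hK. continuous_on UNIV (fst hK) \<and> (\<forall>x. norm (fst hK x) \<le> snd hK) \<and> integrable lborel (fst hK) \<and> square_integrable (fst hK) \<and> norm (abs_L2 (fst hK) - u) < 1 / real (Suc k)"
    using ex by (metis fst_conv snd_conv of_nat_0_less_iff zero_less_Suc zero_less_divide_1_iff)
  then obtain hK where hK: "\<And>k. continuous_on UNIV (fst (hK k)) \<and> (\<forall>x. norm (fst (hK k) x) \<le> snd (hK k)) \<and> integrable lborel (fst (hK k)) \<and> square_integrable (fst (hK k)) \<and> norm (abs_L2 (fst (hK k)) - u) < 1 / real (Suc k)"
    by metis
  have "(\<lambda>k. abs_L2 (fst (hK k)) - u) \<longlonglongrightarrow> 0"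
  proof (rule Lim_null_comparison)
    show "\<forall>\<^sub>F k in sequentially. norm (abs_L2 (fst (hK k)) - u) \<le> 1 / real (Suc k)"
      using hK by (intro always_eventually allI less_imp_le) auto
    show "(\<lambda>k. 1 / real (Suc k)) \<longlonglongrightarrow> 0" by (intro LIMSEQ_Suc lim_1_over_n)
  qed
  then have "(\<lambda>k. abs_L2 (fst (hK k))) \<longlonglongrightarrow> u" by (simp add: LIM_zero_iff)
  then show thesis using that[of "\<lambda>k. fst (hK k)" "\<lambda>k. snd (hK k)"] hK by auto
qed

section \<open>Extension of the transform to L2 and its inverse\<close>

definition in_L1 :: "'a::euclidean_space L2 \<Rightarrow> bool" where
  "in_L1 u \<longleftrightarrow> integrable lebesgue (rep_L2 u)"

text \<open>Used only under \<open>in_L1\<close>, where the integral converges and, by Plancherel,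
  defines a square integrable function.\<close>

definition fourier_L1 :: "'a::euclidean_space L2 \<Rightarrow> 'a L2" where
  "fourier_L1 u = abs_L2 (fourier_integral (rep_L2 u))"

lemma in_L1_representative:
  assumes "in_L1 u"
  obtains f where "f \<in> borel_measurable borel" "square_integrable f" "AE x in lebesgue. rep_L2 u x = f x" "u = abs_L2 f"
    "integrable lborel f" "fourier_integral (rep_L2 u) = fourier_integral f"
proof -
  obtain f where f: "f \<in> borel_measurable borel" "square_integrable f" "AE x in lebesgue. rep_L2 u x = f x" "u = abs_L2 f"
    using L2_borel_representative by blast
  have "integrable lborel f" using assms integrable_lebesgue_borel[OF f(3) f(1)] by (simp add: in_L1_def)
  moreover have "fourier_integral (rep_L2 u) = fourier_integral f"
    using f(1) by (intro fourier_integral_cong_AE f(3)) (auto intro: measurable_completion)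
  ultimately show thesis using that f by blast
qed

lemma in_L1_abs:
  assumes "f \<in> borel_measurable borel" "square_integrable f"
  shows "in_L1 (abs_L2 f) \<longleftrightarrow> integrable lborel f" "fourier_integral (rep_L2 (abs_L2 f)) = fourier_integral f"
  using integrable_lebesgue_borel[OF rep_abs_L2[OF assms(2)] assms(1)] assms(1)
  by (auto simp: in_L1_def intro!: fourier_integral_cong_AE rep_abs_L2 assms(2) intro: measurable_completion)

lemma fourier_L1_square_integrable:
  assumes "in_L1 u"
  shows "fourier_integral (rep_L2 u) \<in> borel_measurable borel" "square_integrable (fourier_integral (rep_L2 u))"
    "norm (fourier_L1 u) \<le> norm u"
proof -
  obtain f where f: "f \<in> borel_measurable borel" "square_integrable f" "u = abs_L2 f"
    "integrable lborel f" "fourier_integral (rep_L2 u) = fourier_integral f"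
    using in_L1_representative[OF assms] by metis
  have f2: "integrable lborel (\<lambda>x. (norm (f x))\<^sup>2)" using f(2) square_integrable_borel_iff[OF f(1)] by simp
  have m: "fourier_integral f \<in> borel_measurable borel" by (rule borel_measurable_fourier_integral[OF f(4)])
  show "fourier_integral (rep_L2 u) \<in> borel_measurable borel" using m f by simp
  have s: "square_integrable (fourier_integral f)"
    unfolding square_integrable_borel_iff[OF m] by (rule plancherel_le(1)[OF f(4) f2])
  then show "square_integrable (fourier_integral (rep_L2 u))" using f by simp
  have "(norm (fourier_L1 u))\<^sup>2 \<le> (norm u)\<^sup>2"
    unfolding fourier_L1_def f(5) norm_abs_L2_borel[OF m s] unfolding f(3) norm_abs_L2_borel[OF f(1,2)]
    by (rule plancherel_le(2)[OF f(4) f2])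
  then show "norm (fourier_L1 u) \<le> norm u" by (rule power2_le_imp_le) simp
qed

lemma rep_fourier_L1: "in_L1 u \<Longrightarrow> AE \<xi> in lebesgue. rep_L2 (fourier_L1 u) \<xi> = fourier_integral (rep_L2 u) \<xi>"
  unfolding fourier_L1_def by (intro rep_abs_L2 fourier_L1_square_integrable)

lemma integrable_lebesgue_cis_mult:
  assumes f: "integrable lebesgue (f :: 'a::euclidean_space \<Rightarrow> complex)"
  shows "integrable lebesgue (\<lambda>x. cis (- (x \<bullet> \<xi>)) * f x)"
proof (rule Bochner_Integration.integrable_bound[OF f])
  have [measurable]: "f \<in> borel_measurable lebesgue" using f by auto
  have [measurable]: "(\<lambda>x. cis (- (x \<bullet> \<xi>))) \<in> borel_measurable lebesgue" by (intro measurable_completion) measurable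
  show "(\<lambda>x. cis (- (x \<bullet> \<xi>)) * f x) \<in> borel_measurable lebesgue" by measurable
qed (simp add: norm_mult)

lemma in_L1_add: 
  assumes "in_L1 u" "in_L1 v"
  shows "in_L1 (u + v)" "fourier_L1 (u + v) = fourier_L1 u + fourier_L1 v"
proof -
  have uv: "integrable lebesgue (\<lambda>x. rep_L2 u x + rep_L2 v x)" using assms by (simp add: in_L1_def)
  then show *: "in_L1 (u + v)"
    unfolding in_L1_def using rep_plus_L2[of u v]
    by (subst integrable_cong_AE[where g = "\<lambda>x. rep_L2 u x + rep_L2 v x"]) auto
  have "fourier_integral (rep_L2 (u + v)) = fourier_integral (\<lambda>x. rep_L2 u x + rep_L2 v x)"
    by (rule fourier_integral_cong_AE[OF rep_plus_L2]) auto
  also have "\<dots> = (\<lambda>\<xi>. fourier_integral (rep_L2 u) \<xi> + fourier_integral (rep_L2 v) \<xi>)"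
    using assms by (auto simp: fourier_integral_def distrib_left in_L1_def integrable_lebesgue_cis_mult fun_eq_iff)
  finally have eq: "fourier_integral (rep_L2 (u + v)) \<xi> = fourier_integral (rep_L2 u) \<xi> + fourier_integral (rep_L2 v) \<xi>" for \<xi>
    by simp
  show "fourier_L1 (u + v) = fourier_L1 u + fourier_L1 v"
    unfolding L2_eq_iff using rep_fourier_L1[OF *] rep_plus_L2[of "fourier_L1 u" "fourier_L1 v"] rep_fourier_L1[OF assms(1)] rep_fourier_L1[OF assms(2)]
    by eventually_elim (simp add: eq)
qed

lemma in_L1_scaleC:
  assumes "in_L1 u"
  shows "in_L1 (c *\<^sub>C u)" "fourier_L1 (c *\<^sub>C u) = c *\<^sub>C fourier_L1 u"
proof -
  have uv: "integrable lebesgue (\<lambda>x. c * rep_L2 u x)" using assms by (simp add: in_L1_def)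
  then show *: "in_L1 (c *\<^sub>C u)"
    unfolding in_L1_def using rep_scaleC_L2[of c u]
    by (subst integrable_cong_AE[where g = "\<lambda>x. c * rep_L2 u x"]) auto
  have "fourier_integral (rep_L2 (c *\<^sub>C u)) = fourier_integral (\<lambda>x. c * rep_L2 u x)"
    by (rule fourier_integral_cong_AE[OF rep_scaleC_L2]) auto
  also have "\<dots> = (\<lambda>\<xi>. c * fourier_integral (rep_L2 u) \<xi>)"
    unfolding fourier_integral_def mult.left_commute[of _ c] by (simp add: fun_eq_iff)
  finally have eq: "fourier_integral (rep_L2 (c *\<^sub>C u)) \<xi> = c * fourier_integral (rep_L2 u) \<xi>" for \<xi>
    by simp
  show "fourier_L1 (c *\<^sub>C u) = c *\<^sub>C fourier_L1 u"
    unfolding L2_eq_iff using rep_fourier_L1[OF *] rep_scaleC_L2[of c "fourier_L1 u"] rep_fourier_L1[OF assms(1)]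
    by eventually_elim (simp add: eq)
qed

lemma scaleC_minus_one: "(-1) *\<^sub>C u = - u"
  unfolding L2_eq_iff using rep_scaleC_L2[of "-1" u] rep_uminus_L2[of u] by eventually_elim simp

lemma in_L1_diff: 
  assumes "in_L1 u" "in_L1 v"
  shows "in_L1 (u - v)" "fourier_L1 (u - v) = fourier_L1 u - fourier_L1 v"
  using in_L1_add[OF assms(1) in_L1_scaleC(1)[OF assms(2), of "-1"]] in_L1_scaleC(2)[OF assms(2), of "-1"]
  by (simp_all add: scaleC_minus_one)

lemma L2_approx_in_L1:
  obtains h where "\<And>k::nat. in_L1 (h k)" "\<And>k. norm (fourier_L1 (h k)) = norm (h k)" "h \<longlonglongrightarrow> u"
proof -
  obtain h K where h: "\<And>k. continuous_on UNIV (h k)" "\<And>k x. norm (h k x) \<le> K k" "\<And>k. integrable lborel (h k)"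
    "\<And>k. square_integrable (h k)" "(\<lambda>k::nat. abs_L2 (h k)) \<longlonglongrightarrow> u"
    using L2_approx_continuous[of u] by blast
  have m: "h k \<in> borel_measurable borel" for k by (intro borel_measurable_continuous_onI h)
  have h2: "integrable lborel (\<lambda>x. (norm (h k x))\<^sup>2)" for k using h(4) square_integrable_borel_iff[OF m] by simp
  have i: "in_L1 (abs_L2 (h k))" for k using in_L1_abs[OF m h(4)] h(3) by simp
  have "(norm (fourier_L1 (abs_L2 (h k))))\<^sup>2 = (norm (abs_L2 (h k)))\<^sup>2" for k
  proof -
    have mf: "fourier_integral (h k) \<in> borel_measurable borel" by (rule borel_measurable_fourier_integral[OF h(3)])
    have "square_integrable (fourier_integral (h k))" using fourier_L1_square_integrable(2)[OF i[of k]] in_L1_abs[OF m h(4)] by simp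
    then show ?thesis
      unfolding fourier_L1_def in_L1_abs(2)[OF m h(4)] norm_abs_L2_borel[OF m h(4)] norm_abs_L2_borel[OF mf \<open>square_integrable (fourier_integral (h k))\<close>]
      by (intro plancherel_continuous[OF h(3) h2 h(1) h(2)])
  qed
  then have "norm (fourier_L1 (abs_L2 (h k))) = norm (abs_L2 (h k))" for k by (simp add: power2_eq_iff_nonneg)
  then show thesis using that[of "\<lambda>k. abs_L2 (h k)"] i h(5) by blast
qed

text \<open>The inequality for all integrable u makes the transform continuous; the equality for
  bounded continuous approximants then passes to the limit.\<close>

lemma norm_fourier_L1:
  assumes u: "in_L1 u"
  shows "norm (fourier_L1 u) = norm u"
proof -
  obtain h where h: "\<And>k::nat. in_L1 (h k)" "\<And>k. norm (fourier_L1 (h k)) = norm (h k)" "h \<longlonglongrightarrow> u"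
    using L2_approx_in_L1[of u] by blast
  have "(\<lambda>k. fourier_L1 (h k) - fourier_L1 u) \<longlonglongrightarrow> 0"
  proof (rule Lim_null_comparison)
    show "\<forall>\<^sub>F k in sequentially. norm (fourier_L1 (h k) - fourier_L1 u) \<le> norm (h k - u)"
      using fourier_L1_square_integrable(3)[OF in_L1_diff(1)[OF h(1) u]] by (simp add: in_L1_diff(2)[OF h(1) u])
    show "(\<lambda>k. norm (h k - u)) \<longlonglongrightarrow> 0" using h(3) by (simp add: LIM_zero_iff tendsto_norm_zero_iff)
  qed
  then have "(\<lambda>k. norm (fourier_L1 (h k))) \<longlonglongrightarrow> norm (fourier_L1 u)" by (intro tendsto_norm) (simp add: LIM_zero_iff)
  moreover have "(\<lambda>k. norm (fourier_L1 (h k))) \<longlonglongrightarrow> norm u" unfolding h(2) by (intro tendsto_norm h(3))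
  ultimately show ?thesis by (rule LIMSEQ_unique)
qed

lemma fourier_graph:
  "{(u, v). integrable lebesgue (rep_L2 u) \<and> (AE \<xi> in lebesgue. rep_L2 v \<xi> = fourier_integral (rep_L2 u) \<xi>)}
    = {(u, fourier_L1 u) | u. in_L1 u}"
proof -
  have "(AE \<xi> in lebesgue. rep_L2 v \<xi> = fourier_integral (rep_L2 u) \<xi>) \<longleftrightarrow> v = fourier_L1 u" if "in_L1 u" for u v :: "'a L2"
  proof
    assume "AE \<xi> in lebesgue. rep_L2 v \<xi> = fourier_integral (rep_L2 u) \<xi>"
    then show "v = fourier_L1 u" unfolding L2_eq_iff using rep_fourier_L1[OF that] by eventually_elim simp
  qed (use rep_fourier_L1[OF that] in simp)
  then show ?thesis by (auto simp: in_L1_def)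
qed

text \<open>The closure of the graph is again a graph: if two sequences approximate f, their
  transforms differ by the same norms as the sequences do, so the limits agree. This justifies the
  definite description in \<open>fourier_L2_def\<close>.\<close>

lemma fourier_L2_eqI:
  assumes u: "\<And>k::nat. in_L1 (u k)" "u \<longlonglongrightarrow> f" "(\<lambda>k. fourier_L1 (u k)) \<longlonglongrightarrow> g"
  shows "fourier_L2 f = g"
  unfolding fourier_L2_def fourier_graph
proof (rule the_equality)
  show "(f, g) \<in> closure {(u, fourier_L1 u) |u. in_L1 u}"
    unfolding closure_sequential using u
    by (intro exI[of _ "\<lambda>k. (u k, fourier_L1 (u k))"]) (auto intro: tendsto_Pair)
  fix g' assume "(f, g') \<in> closure {(u, fourier_L1 u) |u. in_L1 u}"
  then obtain X where X: "\<And>k::nat. X k \<in> {(u, fourier_L1 u) |u. in_L1 u}" "X \<longlonglongrightarrow> (f, g')"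
    unfolding closure_sequential by blast
  define v where "v k = fst (X k)" for k
  have v: "in_L1 (v k)" "snd (X k) = fourier_L1 (v k)" for k using X(1)[of k] by (auto simp: v_def)
  have vf: "v \<longlonglongrightarrow> f" unfolding v_def using tendsto_fst[OF X(2)] by simp
  have vg: "(\<lambda>k. fourier_L1 (v k)) \<longlonglongrightarrow> g'" using tendsto_snd[OF X(2)] by (simp add: v)
  have "(\<lambda>k. norm (u k - v k)) \<longlonglongrightarrow> norm (f - f)" by (intro tendsto_intros u vf)
  moreover have "norm (u k - v k) = norm (fourier_L1 (u k) - fourier_L1 (v k))" for k
    using norm_fourier_L1[OF in_L1_diff(1)[OF u(1) v(1)]] in_L1_diff(2)[OF u(1) v(1)] by simp
  ultimately have "(\<lambda>k. norm (fourier_L1 (u k) - fourier_L1 (v k))) \<longlonglongrightarrow> norm (f - f)" by simp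
  moreover have "(\<lambda>k. norm (fourier_L1 (u k) - fourier_L1 (v k))) \<longlonglongrightarrow> norm (g - g')" by (intro tendsto_intros u vg)
  ultimately have "norm (g - g') = norm (f - f)" using LIMSEQ_unique by blast
  then show "g' = g" by simp
qed

lemma fourier_L2_tendsto:
  assumes u: "\<And>k::nat. in_L1 (u k)" "u \<longlonglongrightarrow> f"
  shows "(\<lambda>k. fourier_L1 (u k)) \<longlonglongrightarrow> fourier_L2 f"
proof -
  have "Cauchy u" using u(2) by (rule LIMSEQ_imp_Cauchy)
  moreover have "dist (fourier_L1 (u i)) (fourier_L1 (u j)) = dist (u i) (u j)" for i j
    unfolding dist_norm using norm_fourier_L1[OF in_L1_diff(1)[OF u(1) u(1)]] in_L1_diff(2)[OF u(1) u(1)] by simp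
  ultimately have "Cauchy (\<lambda>k. fourier_L1 (u k))" by (simp add: Cauchy_def)
  then obtain g where g: "(\<lambda>k. fourier_L1 (u k)) \<longlonglongrightarrow> g" using Cauchy_convergent convergent_def by blast
  then show ?thesis using fourier_L2_eqI[OF u g] by simp
qed

lemma fourier_L2_in_L1: "in_L1 u \<Longrightarrow> fourier_L2 u = fourier_L1 u"
  by (rule fourier_L2_eqI[of "\<lambda>_. u"]) auto

lemma scaleC_add_right: "c *\<^sub>C (u + v) = c *\<^sub>C u + c *\<^sub>C v"
  unfolding L2_eq_iff using rep_scaleC_L2[of c "u + v"] rep_plus_L2[of u v] rep_plus_L2[of "c *\<^sub>C u" "c *\<^sub>C v"] rep_scaleC_L2[of c u] rep_scaleC_L2[of c v]
  by eventually_elim (simp add: distrib_left)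

lemma scaleC_diff_right: "c *\<^sub>C (u - v) = c *\<^sub>C u - c *\<^sub>C v"
  using scaleC_add_right[of c "u - v" v] by (simp add: algebra_simps)

lemma norm_scaleC: "norm (c *\<^sub>C u) = norm c * norm u"
proof -
  have "norm (c *\<^sub>C u) = norm (norm c *\<^sub>R u)"
    by (rule norm_L2_eqI) (use rep_scaleC_L2[of c u] rep_scaleR_L2[of "norm c" u] in \<open>eventually_elim, simp add: norm_mult\<close>)
  then show ?thesis by simp
qed

lemma tendsto_scaleC:
  assumes "(f \<longlongrightarrow> l) F"
  shows "((\<lambda>x. c *\<^sub>C f x) \<longlongrightarrow> c *\<^sub>C l) F"
proof -
  have "((\<lambda>x. norm c * norm (f x - l)) \<longlongrightarrow> norm c * norm (l - l)) F" by (intro tendsto_intros assms)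
  then have "((\<lambda>x. norm (c *\<^sub>C f x - c *\<^sub>C l)) \<longlongrightarrow> 0) F" by (simp add: scaleC_diff_right[symmetric] norm_scaleC)
  then show ?thesis by (simp add: tendsto_norm_zero_iff LIM_zero_iff)
qed

lemma linear_L2_diff: "linear_L2 K \<Longrightarrow> K (u - v) = K u - K v"
proof -
  assume K: "linear_L2 K"
  have "K ((-1) *\<^sub>C v) = (-1) *\<^sub>C K v" using K unfolding linear_L2_def by blast
  moreover have "K (u + (-1) *\<^sub>C v) = K u + K ((-1) *\<^sub>C v)" using K unfolding linear_L2_def by blast
  ultimately show ?thesis by (simp add: scaleC_minus_one)
qed

lemma linear_L2_scaleR: "linear_L2 K \<Longrightarrow> K (r *\<^sub>R u) = r *\<^sub>R K u"
  unfolding linear_L2_def scaleC_of_real[symmetric] by blast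

lemma linear_fourier_L2: "linear_L2 fourier_L2"
  unfolding linear_L2_def
proof (intro conjI allI)
  fix f g :: "'a L2" and c :: complex
  obtain u where u: "\<And>k::nat. in_L1 (u k)" "u \<longlonglongrightarrow> f" by (rule L2_approx_in_L1[of f]) (rule that)
  obtain v where v: "\<And>k::nat. in_L1 (v k)" "v \<longlonglongrightarrow> g" by (rule L2_approx_in_L1[of g]) (rule that)
  show "fourier_L2 (f + g) = fourier_L2 f + fourier_L2 g"
  proof (rule fourier_L2_eqI)
    show "in_L1 (u k + v k)" for k by (intro in_L1_add u v)
    show "(\<lambda>k. u k + v k) \<longlonglongrightarrow> f + g" by (intro tendsto_intros u v)
    show "(\<lambda>k. fourier_L1 (u k + v k)) \<longlonglongrightarrow> fourier_L2 f + fourier_L2 g"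
      unfolding in_L1_add(2)[OF u(1) v(1)] by (intro tendsto_intros fourier_L2_tendsto u v)
  qed
  show "fourier_L2 (c *\<^sub>C f) = c *\<^sub>C fourier_L2 f"
  proof (rule fourier_L2_eqI)
    show "in_L1 (c *\<^sub>C u k)" for k by (intro in_L1_scaleC u)
    show "(\<lambda>k. c *\<^sub>C u k) \<longlonglongrightarrow> c *\<^sub>C f" by (intro tendsto_scaleC u)
    show "(\<lambda>k. fourier_L1 (c *\<^sub>C u k)) \<longlonglongrightarrow> c *\<^sub>C fourier_L2 f"
      unfolding in_L1_scaleC(2)[OF u(1)] by (intro tendsto_scaleC fourier_L2_tendsto u)
  qed
qed

lemma norm_fourier_L2: "norm (fourier_L2 f) = norm f"
proof -
  obtain u where u: "\<And>k::nat. in_L1 (u k)" "u \<longlonglongrightarrow> f" by (rule L2_approx_in_L1[of f]) (rule that)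
  have "(\<lambda>k. norm (fourier_L1 (u k))) \<longlonglongrightarrow> norm (fourier_L2 f)" by (intro tendsto_norm fourier_L2_tendsto u)
  then have "(\<lambda>k. norm (u k)) \<longlonglongrightarrow> norm (fourier_L2 f)" by (simp add: norm_fourier_L1 u)
  then show ?thesis using tendsto_norm[OF u(2)] LIMSEQ_unique by blast
qed

definition conj_L2 :: "'a::euclidean_space L2 \<Rightarrow> 'a L2" where
  "conj_L2 u = abs_L2 (\<lambda>x. cnj (rep_L2 u x))"

lemma rep_conj_L2: "AE x in lebesgue. rep_L2 (conj_L2 u) x = cnj (rep_L2 u x)"
  unfolding conj_L2_def
  by (intro rep_abs_L2 square_integrable_bound[OF square_integrable_rep_L2[of u]]) auto

lemma conj_L2_add: "conj_L2 (u + v) = conj_L2 u + conj_L2 v"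
  unfolding L2_eq_iff using rep_conj_L2[of "u + v"] rep_plus_L2[of u v] rep_plus_L2[of "conj_L2 u" "conj_L2 v"] rep_conj_L2[of u] rep_conj_L2[of v]
  by eventually_elim simp

lemma conj_L2_scaleC: "conj_L2 (c *\<^sub>C u) = cnj c *\<^sub>C conj_L2 u"
  unfolding L2_eq_iff using rep_conj_L2[of "c *\<^sub>C u"] rep_scaleC_L2[of c u] rep_scaleC_L2[of "cnj c" "conj_L2 u"] rep_conj_L2[of u]
  by eventually_elim simp

lemma norm_conj_L2: "norm (conj_L2 u) = norm u"
  by (rule norm_L2_eqI) (use rep_conj_L2[of u] in \<open>eventually_elim, simp\<close>)

text \<open>The integral with the opposite sign in the exponent, written as conjugation around the
  transform, so that linearity, isometry and continuity are inherited.\<close>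

definition fourier_inv :: "'a::euclidean_space L2 \<Rightarrow> 'a L2" where
  "fourier_inv u = conj_L2 (fourier_L2 (conj_L2 u))"

lemma linear_fourier_inv: "linear_L2 fourier_inv"
  using linear_fourier_L2[where 'a='a] unfolding linear_L2_def fourier_inv_def
  by (simp add: conj_L2_add conj_L2_scaleC)

lemma norm_fourier_inv: "norm (fourier_inv u) = norm u"
  by (simp add: fourier_inv_def norm_conj_L2 norm_fourier_L2)

lemma isometry_tendsto:
  assumes K: "linear_L2 K" "\<And>u. norm (K u) = norm u" and u: "(u \<longlongrightarrow> f) F"
  shows "((\<lambda>k. K (u k)) \<longlongrightarrow> K f) F"
proof -
  have "((\<lambda>k. norm (u k - f)) \<longlongrightarrow> norm (f - f)) F" by (intro tendsto_intros u)
  then have "((\<lambda>k. norm (K (u k) - K f)) \<longlongrightarrow> 0) F" by (simp add: linear_L2_diff[OF K(1), symmetric] K(2))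
  then show ?thesis by (simp add: tendsto_norm_zero_iff LIM_zero_iff)
qed

lemma fourier_inv_in_L1:
  fixes v :: "'a::euclidean_space L2"
  assumes f: "f \<in> borel_measurable borel" "square_integrable f" "integrable lborel f" and v: "v = abs_L2 f"
  shows "AE x in lebesgue. rep_L2 (fourier_inv v) x = of_real (fourier_const TYPE('a)) * (\<integral>\<xi>. cis (x \<bullet> \<xi>) * f \<xi> \<partial>lborel)"
proof -
  have cv: "conj_L2 v = abs_L2 (\<lambda>x. cnj (f x))"
    unfolding conj_L2_def v
    using rep_abs_L2[OF f(2)] f(1)
    by (intro abs_L2_eqI square_integrable_bound[OF f(2)] square_integrable_bound[OF square_integrable_rep_L2[of "abs_L2 f"]])
       (auto intro: measurable_completion)
  have cm: "(\<lambda>x. cnj (f x)) \<in> borel_measurable borel" using f(1) by measurable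
  have cs: "square_integrable (\<lambda>x. cnj (f x))"
    using f(2) cm by (intro square_integrable_bound[OF f(2)]) (auto intro: measurable_completion)
  have i: "in_L1 (conj_L2 v)" unfolding cv in_L1_abs(1)[OF cm cs] using f(3) by simp
  have F: "fourier_integral (rep_L2 (conj_L2 v)) x = cnj (of_real (fourier_const TYPE('a)) * (\<integral>\<xi>. cis (x \<bullet> \<xi>) * f \<xi> \<partial>lborel))" for x
  proof -
    have "(\<integral>\<xi>. cis (\<xi> \<bullet> - x) * cnj (f \<xi>) \<partial>lborel) = cnj (\<integral>\<xi>. cis (x \<bullet> \<xi>) * f \<xi> \<partial>lborel)"
      by (subst Bochner_Integration.integral_cnj[symmetric]) (simp add: cis_cnj inner_commute)
    then show ?thesis unfolding cv in_L1_abs(2)[OF cm cs] fourier_integral_lborel[OF cm] by simp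
  qed
  show ?thesis
    unfolding fourier_inv_def fourier_L2_in_L1[OF i]
    using rep_conj_L2[of "fourier_L1 (conj_L2 v)"] rep_fourier_L1[OF i] by eventually_elim (simp add: F)
qed

text \<open>Fubini for integrable representatives, followed by density. The inner product is the
  real part of the Hermitian one, so moving \<open>cis\<close> to the other factor conjugates it,
  which exchanges the two signs of the exponent.\<close>

lemma fourier_adjoint: "fourier_inv g \<bullet> u = g \<bullet> fourier_L2 u"
proof -
  have L1: "fourier_inv g \<bullet> u = g \<bullet> fourier_L2 u" if gu: "in_L1 g" "in_L1 u" for g u :: "'a L2"
  proof -
    obtain a where a: "a \<in> borel_measurable borel" "square_integrable a" "AE x in lebesgue. rep_L2 g x = a x" "g = abs_L2 a" "integrable lborel a"
      using in_L1_representative[OF gu(1)] by metis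
    obtain b where b: "b \<in> borel_measurable borel" "square_integrable b" "AE x in lebesgue. rep_L2 u x = b x" "u = abs_L2 b" "integrable lborel b"
      "fourier_integral (rep_L2 u) = fourier_integral b"
      using in_L1_representative[OF gu(2)] by metis
    note [measurable] = a(1) b(1)
    define c where "c = fourier_const TYPE('a)"
    define Ia where "Ia x = (\<integral>\<xi>. cis (x \<bullet> \<xi>) * a \<xi> \<partial>lborel)" for x
    have Iam [measurable]: "Ia \<in> borel_measurable borel" unfolding Ia_def[abs_def] by measurable
    have Fbm [measurable]: "fourier_integral b \<in> borel_measurable borel" by (rule borel_measurable_fourier_integral[OF b(5)])
    have H: "integrable (lborel \<Otimes>\<^sub>M lborel) (\<lambda>(x, \<xi>). (cis (x \<bullet> \<xi>) * a \<xi>) \<bullet> b x)"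
    proof (rule Bochner_Integration.integrable_bound)
      show "integrable (lborel \<Otimes>\<^sub>M lborel) (\<lambda>z. b (fst z) * a (snd z))"
        by (rule integrable_pair_mult[OF _ _ b(5) a(5)]) unfold_locales
      show "AE z in lborel \<Otimes>\<^sub>M lborel. norm (case z of (x, \<xi>) \<Rightarrow> (cis (x \<bullet> \<xi>) * a \<xi>) \<bullet> b x) \<le> norm (b (fst z) * a (snd z))"
      proof (rule AE_I2, clarify)
        fix x \<xi> :: 'a
        show "norm ((cis (x \<bullet> \<xi>) * a \<xi>) \<bullet> b x) \<le> norm (b (fst (x, \<xi>)) * a (snd (x, \<xi>)))"
          using Cauchy_Schwarz_ineq2[of "cis (x \<bullet> \<xi>) * a \<xi>" "b x"] by (simp add: norm_mult mult.commute)
      qed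
    qed measurable
    have "fourier_inv g \<bullet> u = (\<integral>x. (of_real c * Ia x) \<bullet> b x \<partial>lebesgue)"
      unfolding inner_L2_rep
    proof (rule integral_cong_AE)
      show "AE x in lebesgue. rep_L2 (fourier_inv g) x \<bullet> rep_L2 u x = (of_real c * Ia x) \<bullet> b x"
        using fourier_inv_in_L1[OF a(1,2,5,4)] b(3) by eventually_elim (simp add: c_def Ia_def)
      have "(\<lambda>x. (of_real c * Ia x) \<bullet> b x) \<in> borel_measurable lborel" by measurable
      then show "(\<lambda>x. (of_real c * Ia x) \<bullet> b x) \<in> borel_measurable lebesgue" by (rule measurable_completion)
    qed measurable
    also have "\<dots> = (\<integral>x. (of_real c * Ia x) \<bullet> b x \<partial>lborel)" by (subst integral_completion) auto
    also have "\<dots> = c * (\<integral>x. Ia x \<bullet> b x \<partial>lborel)"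
      by (simp add: scaleR_conv_of_real[symmetric])
    also have "(\<integral>x. Ia x \<bullet> b x \<partial>lborel) = (\<integral>x. (\<integral>\<xi>. (cis (x \<bullet> \<xi>) * a \<xi>) \<bullet> b x \<partial>lborel) \<partial>lborel)"
    proof (intro Bochner_Integration.integral_cong refl)
      fix x :: 'a
      have "integrable lborel (\<lambda>\<xi>. cis (x \<bullet> \<xi>) * a \<xi>)" using integrable_cis_mult[OF a(5), of x] by (simp add: inner_commute)
      then show "Ia x \<bullet> b x = (\<integral>\<xi>. (cis (x \<bullet> \<xi>) * a \<xi>) \<bullet> b x \<partial>lborel)" by (simp add: Ia_def)
    qed
    also have "\<dots> = (\<integral>\<xi>. (\<integral>x. (cis (x \<bullet> \<xi>) * a \<xi>) \<bullet> b x \<partial>lborel) \<partial>lborel)"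
      using lborel_pair.Fubini_integral[of "\<lambda>x \<xi>. (cis (x \<bullet> \<xi>) * a \<xi>) \<bullet> b x"] H by simp
    also have "\<dots> = (\<integral>\<xi>. a \<xi> \<bullet> (\<integral>x. cis (x \<bullet> - \<xi>) * b x \<partial>lborel) \<partial>lborel)"
    proof (intro Bochner_Integration.integral_cong refl)
      fix \<xi> :: 'a
      have "(cis (x \<bullet> \<xi>) * a \<xi>) \<bullet> b x = a \<xi> \<bullet> (cis (x \<bullet> - \<xi>) * b x)" for x
        by (simp add: inner_complex_def algebra_simps)
      then show "(\<integral>x. (cis (x \<bullet> \<xi>) * a \<xi>) \<bullet> b x \<partial>lborel) = a \<xi> \<bullet> (\<integral>x. cis (x \<bullet> - \<xi>) * b x \<partial>lborel)"
        using integrable_cis_mult[OF b(5), of "- \<xi>"] by simp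
    qed
    also have "c * \<dots> = (\<integral>\<xi>. a \<xi> \<bullet> fourier_integral b \<xi> \<partial>lborel)"
      unfolding fourier_integral_lborel[OF b(1)] c_def[symmetric] by (simp add: scaleR_conv_of_real[symmetric])
    also have "\<dots> = (\<integral>\<xi>. a \<xi> \<bullet> fourier_integral b \<xi> \<partial>lebesgue)" by (subst integral_completion) auto
    also have "\<dots> = g \<bullet> fourier_L2 u"
      unfolding inner_L2_rep
    proof (rule integral_cong_AE)
      show "AE x in lebesgue. a x \<bullet> fourier_integral b x = rep_L2 g x \<bullet> rep_L2 (fourier_L2 u) x"
        using a(3) rep_fourier_L1[OF gu(2)] by eventually_elim (simp add: b(6) fourier_L2_in_L1[OF gu(2)])
      have "(\<lambda>x. a x \<bullet> fourier_integral b x) \<in> borel_measurable lborel" by measurable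
      then show "(\<lambda>x. a x \<bullet> fourier_integral b x) \<in> borel_measurable lebesgue" by (rule measurable_completion)
    qed measurable
    finally show ?thesis .
  qed
  obtain v where v: "\<And>k::nat. in_L1 (v k)" "v \<longlonglongrightarrow> u" by (rule L2_approx_in_L1[of u]) (rule that)
  obtain h where h: "\<And>k::nat. in_L1 (h k)" "h \<longlonglongrightarrow> g" by (rule L2_approx_in_L1[of g]) (rule that)
  have "(\<lambda>k. fourier_inv (h k) \<bullet> v k) \<longlonglongrightarrow> fourier_inv g \<bullet> u"
    by (rule tendsto_inner[OF isometry_tendsto[OF linear_fourier_inv norm_fourier_inv h(2)] v(2)])
  moreover have "(\<lambda>k. h k \<bullet> fourier_L2 (v k)) \<longlonglongrightarrow> g \<bullet> fourier_L2 u"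
    by (rule tendsto_inner[OF h(2) isometry_tendsto[OF linear_fourier_L2 norm_fourier_L2 v(2)]])
  ultimately show ?thesis using L1[OF h(1) v(1)] LIMSEQ_unique by simp
qed

lemma isometry_inner:
  assumes "linear_L2 K" "\<And>u. norm (K u) = norm u"
  shows "K u \<bullet> K v = u \<bullet> v"
proof -
  have "K u \<bullet> K v = ((norm (K (u + v)))\<^sup>2 - (norm (K u))\<^sup>2 - (norm (K v))\<^sup>2) / 2"
    using assms(1) by (simp add: linear_L2_def power2_norm_eq_inner inner_add_left inner_add_right inner_commute)
  then show ?thesis by (simp add: assms(2) power2_norm_eq_inner inner_add_left inner_add_right inner_commute)
qed

lemma inner_eqI: "(\<And>w. u \<bullet> w = v \<bullet> w) \<Longrightarrow> u = v"
  by (metis inner_eq_zero_iff inner_diff_left right_minus_eq)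

lemma fourier_inv_fourier [simp]: "fourier_inv (fourier_L2 u) = u"
  by (rule inner_eqI) (simp add: fourier_adjoint isometry_inner[OF linear_fourier_L2 norm_fourier_L2])

text \<open>Surjectivity of the transform: the inverse is also an isometry, and the adjoint of an
  isometry is a left inverse of it.\<close>

lemma fourier_fourier_inv [simp]: "fourier_L2 (fourier_inv u) = u"
proof (rule inner_eqI)
  fix w
  have "fourier_L2 (fourier_inv u) \<bullet> w = fourier_inv w \<bullet> fourier_inv u"
    using fourier_adjoint[of w "fourier_inv u"] by (simp add: inner_commute)
  then show "fourier_L2 (fourier_inv u) \<bullet> w = u \<bullet> w"
    by (simp add: isometry_inner[OF linear_fourier_inv norm_fourier_inv] inner_commute)
qed

section \<open>Fourier multipliers and the unitary group\<close>

definition bounded_symbol :: "('a::euclidean_space \<Rightarrow> complex) \<Rightarrow> bool" where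
  "bounded_symbol m \<longleftrightarrow> m \<in> borel_measurable borel \<and> (\<exists>C. \<forall>\<xi>. norm (m \<xi>) \<le> C)"

definition mult_L2 :: "('a::euclidean_space \<Rightarrow> complex) \<Rightarrow> 'a L2 \<Rightarrow> 'a L2" where
  "mult_L2 m u = abs_L2 (\<lambda>\<xi>. m \<xi> * rep_L2 u \<xi>)"

lemma bounded_symbolI: "m \<in> borel_measurable borel \<Longrightarrow> (\<And>\<xi>. norm (m \<xi>) \<le> C) \<Longrightarrow> bounded_symbol m"
  by (auto simp: bounded_symbol_def)

lemma square_integrable_symbol:
  assumes "bounded_symbol m"
  shows "square_integrable (\<lambda>\<xi>. m \<xi> * rep_L2 u \<xi>)"
proof -
  obtain C where C: "m \<in> borel_measurable borel" "\<And>\<xi>. norm (m \<xi>) \<le> C" using assms by (auto simp: bounded_symbol_def)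
  have [measurable]: "m \<in> borel_measurable lebesgue" using C(1) by (simp add: measurable_completion)
  have "norm (m \<xi>) \<le> \<bar>C\<bar>" for \<xi> using C(2)[of \<xi>] by linarith
  then show ?thesis
    by (intro square_integrable_bound[OF square_integrable_mult[OF square_integrable_rep_L2[of u], of "of_real C"]])
      (auto simp: norm_mult intro!: AE_I2 mult_right_mono)
qed

lemma rep_mult_L2: "bounded_symbol m \<Longrightarrow> AE \<xi> in lebesgue. rep_L2 (mult_L2 m u) \<xi> = m \<xi> * rep_L2 u \<xi>"
  unfolding mult_L2_def by (intro rep_abs_L2 square_integrable_symbol)

lemma linear_mult_L2: "bounded_symbol m \<Longrightarrow> linear_L2 (mult_L2 m)"
  unfolding linear_L2_def
proof (intro conjI allI)
  assume m: "bounded_symbol m"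
  fix f g and c
  show "mult_L2 m (f + g) = mult_L2 m f + mult_L2 m g"
    unfolding L2_eq_iff using rep_mult_L2[OF m, of "f + g"] rep_plus_L2[of f g] rep_plus_L2[of "mult_L2 m f" "mult_L2 m g"] rep_mult_L2[OF m, of f] rep_mult_L2[OF m, of g]
    by eventually_elim (simp add: distrib_left)
  show "mult_L2 m (c *\<^sub>C f) = c *\<^sub>C mult_L2 m f"
    unfolding L2_eq_iff using rep_mult_L2[OF m, of "c *\<^sub>C f"] rep_scaleC_L2[of c f] rep_scaleC_L2[of c "mult_L2 m f"] rep_mult_L2[OF m, of f]
    by eventually_elim simp
qed

lemma norm_mult_L2_le:
  assumes "bounded_symbol m" "\<And>\<xi>. norm (m \<xi>) \<le> 1"
  shows "norm (mult_L2 m u) \<le> norm u"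
  by (rule norm_L2_leI) (use rep_mult_L2[OF assms(1), of u] in \<open>eventually_elim, simp add: norm_mult mult_left_le_one_le assms(2)\<close>)

lemma norm_mult_L2_eq:
  assumes "bounded_symbol m" "\<And>\<xi>. norm (m \<xi>) = 1"
  shows "norm (mult_L2 m u) = norm u"
  by (rule norm_L2_eqI) (use rep_mult_L2[OF assms(1), of u] in \<open>eventually_elim, simp add: norm_mult assms(2)\<close>)

lemma bounded_symbol_mult: 
  assumes "bounded_symbol m" "bounded_symbol n" shows "bounded_symbol (\<lambda>\<xi>. m \<xi> * n \<xi>)"
proof -
  obtain C D where CD: "m \<in> borel_measurable borel" "\<And>\<xi>. norm (m \<xi>) \<le> C" "n \<in> borel_measurable borel" "\<And>\<xi>. norm (n \<xi>) \<le> D"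
    using assms by (auto simp: bounded_symbol_def)
  note [measurable] = CD(1,3)
  have "norm (m \<xi> * n \<xi>) \<le> C * D" for \<xi>
    unfolding norm_mult using CD(2)[of \<xi>] CD(4)[of \<xi>] order_trans[OF norm_ge_zero CD(2)[of \<xi>]] by (intro mult_mono) auto
  then show ?thesis by (intro bounded_symbolI[of _ "C * D"]) auto
qed

lemma mult_L2_mult: 
  assumes "bounded_symbol m" "bounded_symbol n"
  shows "mult_L2 m (mult_L2 n u) = mult_L2 (\<lambda>\<xi>. m \<xi> * n \<xi>) u"
  unfolding L2_eq_iff using rep_mult_L2[OF assms(1), of "mult_L2 n u"] rep_mult_L2[OF assms(2), of u] rep_mult_L2[OF bounded_symbol_mult[OF assms], of u]
  by eventually_elim (simp add: mult.assoc)

lemma mult_L2_one: "mult_L2 (\<lambda>_. 1) u = u"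
  by (simp add: mult_L2_def)

text \<open>Pointwise convergence of the symbols gives strong convergence, by domination with a
  multiple of the squared modulus of u. It serves the continuity of the group, the density of the
  domain and the removal of \<epsilon>.\<close>

lemma mult_L2_tendsto:
  fixes m :: "nat \<Rightarrow> 'a::euclidean_space \<Rightarrow> complex"
  assumes m: "\<And>k. m k \<in> borel_measurable borel" "\<And>k \<xi>. norm (m k \<xi>) \<le> 1"
    and n: "n \<in> borel_measurable borel" "\<And>\<xi>. norm (n \<xi>) \<le> 1" and lim: "\<And>\<xi>. (\<lambda>k. m k \<xi>) \<longlonglongrightarrow> n \<xi>"
  shows "(\<lambda>k. mult_L2 (m k) u) \<longlonglongrightarrow> mult_L2 n u"
  unfolding mult_L2_def
proof (rule tendsto_abs_L2)
  show "square_integrable (\<lambda>\<xi>. m k \<xi> * rep_L2 u \<xi>)" for k by (intro square_integrable_symbol bounded_symbolI[OF m])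
  show "square_integrable (\<lambda>\<xi>. n \<xi> * rep_L2 u \<xi>)" by (intro square_integrable_symbol bounded_symbolI[OF n])
  have [measurable]: "m k \<in> borel_measurable lebesgue" "n \<in> borel_measurable lebesgue" for k
    using m(1) n(1) by (auto intro: measurable_completion)
  have "(\<lambda>k. \<integral>x. (norm (m k x * rep_L2 u x - n x * rep_L2 u x))\<^sup>2 \<partial>lebesgue) \<longlonglongrightarrow> (\<integral>x. 0 \<partial>(lebesgue :: 'a measure))"
  proof (rule integral_dominated_convergence[where w = "\<lambda>x. 4 * (norm (rep_L2 u x))\<^sup>2"])
    show "integrable lebesgue (\<lambda>x. 4 * (norm (rep_L2 u x))\<^sup>2)" using square_integrable_rep_L2[of u] by (simp add: square_integrable_def)
    show "AE x in lebesgue. (\<lambda>k. (norm (m k x * rep_L2 u x - n x * rep_L2 u x))\<^sup>2) \<longlonglongrightarrow> 0"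
    proof (rule AE_I2)
      fix x
      have "(\<lambda>k. (norm (m k x * rep_L2 u x - n x * rep_L2 u x))\<^sup>2) \<longlonglongrightarrow> (norm (n x * rep_L2 u x - n x * rep_L2 u x))\<^sup>2"
        by (intro tendsto_intros lim)
      then show "(\<lambda>k. (norm (m k x * rep_L2 u x - n x * rep_L2 u x))\<^sup>2) \<longlonglongrightarrow> 0" by simp
    qed
    show "AE x in lebesgue. norm ((norm (m k x * rep_L2 u x - n x * rep_L2 u x))\<^sup>2) \<le> 4 * (norm (rep_L2 u x))\<^sup>2" for k
    proof (rule AE_I2)
      fix x
      have "norm (m k x - n x) \<le> 2" using norm_triangle_ineq4[of "m k x" "n x"] m(2)[of k x] n(2)[of x] by linarith
      then have "norm (m k x - n x) * norm (rep_L2 u x) \<le> 2 * norm (rep_L2 u x)" by (intro mult_right_mono) auto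
      then have "norm (m k x * rep_L2 u x - n x * rep_L2 u x) \<le> 2 * norm (rep_L2 u x)"
        by (simp add: norm_mult[symmetric] left_diff_distrib)
      then have "(norm (m k x * rep_L2 u x - n x * rep_L2 u x))\<^sup>2 \<le> (2 * norm (rep_L2 u x))\<^sup>2" by (intro power_mono) auto
      then show "norm ((norm (m k x * rep_L2 u x - n x * rep_L2 u x))\<^sup>2) \<le> 4 * (norm (rep_L2 u x))\<^sup>2" by (simp add: power_mult_distrib)
    qed
  qed measurable
  then show "(\<lambda>k. \<integral>x. (norm (m k x * rep_L2 u x - n x * rep_L2 u x))\<^sup>2 \<partial>lebesgue) \<longlonglongrightarrow> 0" by simp
qed

definition fourier_multiplier :: "('a::euclidean_space \<Rightarrow> complex) \<Rightarrow> 'a L2 \<Rightarrow> 'a L2" where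
  "fourier_multiplier m u = fourier_inv (mult_L2 m (fourier_L2 u))"

lemma linear_fourier_multiplier: "bounded_symbol m \<Longrightarrow> linear_L2 (fourier_multiplier m)"
  using linear_mult_L2[of m] linear_fourier_L2[where 'a='a] linear_fourier_inv[where 'a='a]
  unfolding linear_L2_def fourier_multiplier_def by simp

lemma fourier_multiplier_tendsto:
  fixes m :: "nat \<Rightarrow> 'a::euclidean_space \<Rightarrow> complex"
  assumes "\<And>k. m k \<in> borel_measurable borel" "\<And>k \<xi>. norm (m k \<xi>) \<le> 1"
    "n \<in> borel_measurable borel" "\<And>\<xi>. norm (n \<xi>) \<le> 1" "\<And>\<xi>. (\<lambda>k. m k \<xi>) \<longlonglongrightarrow> n \<xi>"
  shows "(\<lambda>k. fourier_multiplier (m k) u) \<longlonglongrightarrow> fourier_multiplier n u"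
  unfolding fourier_multiplier_def
  by (rule isometry_tendsto[OF linear_fourier_inv norm_fourier_inv mult_L2_tendsto[OF assms]])

section \<open>The propagator and its generator\<close>

definition propagator :: "real \<Rightarrow> real \<Rightarrow> 'a::euclidean_space L2 \<Rightarrow> 'a L2" where
  "propagator \<alpha> t = fourier_multiplier (\<lambda>\<xi>. cis (- t * norm \<xi> powr (2 * \<alpha>)))"

context
  fixes \<alpha> :: real
begin

lemma symbol_cis: "bounded_symbol (\<lambda>\<xi>::'a::euclidean_space. cis (- t * norm \<xi> powr (2 * \<alpha>)))"
  by (rule bounded_symbolI[of _ 1]) auto

lemma linear_propagator: "linear_L2 (propagator \<alpha> t)"
  unfolding propagator_def by (intro linear_fourier_multiplier symbol_cis)

lemma norm_propagator: "norm (propagator \<alpha> t u) = norm u"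
  unfolding propagator_def fourier_multiplier_def norm_fourier_inv
  by (subst norm_mult_L2_eq[OF symbol_cis]) (auto simp: norm_fourier_L2)

lemma propagator_add: "propagator \<alpha> (s + t) u = propagator \<alpha> s (propagator \<alpha> t u)"
proof -
  have "cis (- (s + t) * r) = cis (- s * r) * cis (- t * r)" for r by (simp add: cis_mult algebra_simps)
  then show ?thesis
    unfolding propagator_def fourier_multiplier_def by (simp only: mult_L2_mult[OF symbol_cis symbol_cis] fourier_fourier_inv)
qed

lemma propagator_zero: "propagator \<alpha> 0 u = u"
  unfolding propagator_def fourier_multiplier_def by (simp add: mult_L2_one)

lemma propagator_continuous: "continuous_on UNIV (\<lambda>t. propagator \<alpha> t (u :: 'a::euclidean_space L2))"
  unfolding continuous_on_eq_continuous_at[OF open_UNIV] continuous_at_sequentially o_def propagator_def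
proof (intro ballI allI impI)
  fix t X assume "X \<longlonglongrightarrow> (t::real)"
  then show "(\<lambda>k. fourier_multiplier (\<lambda>\<xi>. cis (- X k * norm \<xi> powr (2 * \<alpha>))) u) \<longlonglongrightarrow> fourier_multiplier (\<lambda>\<xi>. cis (- t * norm \<xi> powr (2 * \<alpha>))) u"
    by (intro fourier_multiplier_tendsto) (auto simp: cis_conv_exp intro!: tendsto_intros)
qed

text \<open>The truncation to \<open>S\<close> lets both directions of the generator identity follow from the same
  limit: with \<open>S = UNIV\<close> it gives membership in the domain, with bounded \<open>S\<close> the converse.\<close>

lemma difference_quotient_limit:
  fixes f g :: "'a::euclidean_space L2"
  assumes S: "S \<in> sets borel" and fg: "AE \<xi> in lebesgue. rep_L2 g \<xi> = indicator S \<xi> * of_real (norm \<xi> powr (2 * \<alpha>)) * rep_L2 f \<xi>"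
    and X: "X \<longlonglongrightarrow> (0::real)" "\<And>k::nat. X k \<noteq> 0"
  shows "(\<lambda>k. mult_L2 (indicator S) ((mult_L2 (\<lambda>\<xi>. cis (- X k * norm \<xi> powr (2 * \<alpha>))) f - f) /\<^sub>R X k)) \<longlonglongrightarrow> (- \<i>) *\<^sub>C g"
proof -
  define p where "p \<xi> = norm \<xi> powr (2 * \<alpha>)" for \<xi> :: 'a
  have p0: "p \<xi> \<ge> 0" for \<xi> by (simp add: p_def)
  have Sb: "bounded_symbol (indicator S :: 'a \<Rightarrow> complex)"
    using S by (intro bounded_symbolI[of _ 1]) (auto simp: indicator_def)
  define D where "D k = mult_L2 (indicator S) ((mult_L2 (\<lambda>\<xi>. cis (- X k * p \<xi>)) f - f) /\<^sub>R X k) - (- \<i>) *\<^sub>C g" for k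
  define q where "q k \<xi> = (cis (- X k * p \<xi>) - 1) / of_real (X k) + \<i> * of_real (p \<xi>)" for k \<xi>
  have [measurable]: "(\<lambda>\<xi>. complex_of_real (p \<xi>)) \<in> borel_measurable (lborel :: 'a measure)" "q k \<in> borel_measurable borel" for k
    unfolding q_def[abs_def] p_def[abs_def] by measurable
  have qm [measurable]: "q k \<in> borel_measurable lebesgue" for k by (intro measurable_completion) auto
  have Sm [measurable]: "(indicator S :: 'a \<Rightarrow> complex) \<in> borel_measurable lebesgue" using S by (intro measurable_completion borel_measurable_indicator) simp
  have Drep: "AE \<xi> in lebesgue. rep_L2 (D k) \<xi> = indicator S \<xi> * q k \<xi> * rep_L2 f \<xi>" for k
  proof -
    define e where "e = mult_L2 (\<lambda>\<xi>. cis (- X k * p \<xi>)) f"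
    have e: "AE \<xi> in lebesgue. rep_L2 e \<xi> = cis (- X k * p \<xi>) * rep_L2 f \<xi>"
      unfolding e_def p_def by (rule rep_mult_L2[OF symbol_cis])
    show ?thesis unfolding D_def e_def[symmetric]
      using rep_minus_L2[of "mult_L2 (indicator S) ((e - f) /\<^sub>R X k)" "(- \<i>) *\<^sub>C g"] rep_mult_L2[OF Sb, of "(e - f) /\<^sub>R X k"]
        rep_scaleR_L2[of "inverse (X k)" "e - f"] rep_minus_L2[of e f] e rep_scaleC_L2[of "- \<i>" g] fg
    proof eventually_elim
      case (elim \<xi>)
      then have "rep_L2 (mult_L2 (indicator S) ((e - f) /\<^sub>R X k) - (- \<i>) *\<^sub>C g) \<xi>
          = indicator S \<xi> * (of_real (inverse (X k)) * (cis (- X k * p \<xi>) * rep_L2 f \<xi> - rep_L2 f \<xi>)) - (- \<i>) * (indicator S \<xi> * of_real (p \<xi>) * rep_L2 f \<xi>)"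
        by (simp only: p_def)
      also have "\<dots> = indicator S \<xi> * q k \<xi> * rep_L2 f \<xi>" using X(2)[of k] by (simp add: q_def field_simps)
      finally show ?case .
    qed
  qed
  \<comment> \<open>From the estimate of \<open>cis \<theta> - 1\<close> by the modulus of \<theta>,
    uniformly in the step. It turns twice the modulus of g into the dominating function.\<close>
  have qb: "norm (q k \<xi>) \<le> 2 * p \<xi>" for k \<xi>
  proof -
    have "norm (cis (- X k * p \<xi>) - 1) \<le> \<bar>X k * p \<xi>\<bar>"
      using iexp_approx1[of "- X k * p \<xi>" 0] by (simp add: cis_conv_exp)
    then have "norm ((cis (- X k * p \<xi>) - 1) / of_real (X k)) \<le> p \<xi>"
      using X(2)[of k] p0[of \<xi>] by (simp add: norm_divide divide_le_eq abs_mult mult.commute)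
    then show ?thesis unfolding q_def using p0[of \<xi>] norm_triangle_ineq[of "(cis (- X k * p \<xi>) - 1) / of_real (X k)" "\<i> * of_real (p \<xi>)"]
      by (simp add: norm_mult)
  qed
  have ql: "(\<lambda>k. q k \<xi>) \<longlonglongrightarrow> 0" for \<xi>
  proof -
    have "((\<lambda>w. exp (- \<i> * of_real (p \<xi>) * w)) has_field_derivative (- \<i> * of_real (p \<xi>))) (at 0)"
      by (auto intro!: derivative_eq_intros)
    then have "((\<lambda>w. (exp (- \<i> * of_real (p \<xi>) * w) - 1) / w) \<longlongrightarrow> - \<i> * of_real (p \<xi>)) (at 0)"
      by (simp add: has_field_derivative_iff)
    moreover have "filterlim (\<lambda>k. complex_of_real (X k)) (at 0) sequentially"
      using X by (auto simp: filterlim_at intro!: tendsto_eq_intros)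
    ultimately have "(\<lambda>k. (exp (- \<i> * of_real (p \<xi>) * of_real (X k)) - 1) / of_real (X k)) \<longlonglongrightarrow> - \<i> * of_real (p \<xi>)"
      by (rule filterlim_compose)
    then have "(\<lambda>k. (exp (- \<i> * of_real (p \<xi>) * of_real (X k)) - 1) / of_real (X k) + \<i> * of_real (p \<xi>)) \<longlonglongrightarrow> - \<i> * of_real (p \<xi>) + \<i> * of_real (p \<xi>)"
      by (intro tendsto_intros)
    then show ?thesis by (simp add: q_def cis_conv_exp mult_ac)
  qed
  have gm [measurable]: "rep_L2 g \<in> borel_measurable lebesgue" by simp
  have "(\<lambda>k. \<integral>\<xi>. (norm (rep_L2 (D k) \<xi>))\<^sup>2 \<partial>lebesgue) \<longlonglongrightarrow> (\<integral>\<xi>. 0 \<partial>(lebesgue :: 'a measure))"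
  proof (rule integral_dominated_convergence[where w = "\<lambda>\<xi>. 4 * (norm (rep_L2 g \<xi>))\<^sup>2"])
    show "integrable lebesgue (\<lambda>x. 4 * (norm (rep_L2 g x))\<^sup>2)" using square_integrable_rep_L2[of g] by (simp add: square_integrable_def)
    have all: "AE \<xi> in lebesgue. \<forall>k. rep_L2 (D k) \<xi> = indicator S \<xi> * q k \<xi> * rep_L2 f \<xi>" using Drep by (simp add: AE_all_countable)
    then show "AE \<xi> in lebesgue. (\<lambda>k. (norm (rep_L2 (D k) \<xi>))\<^sup>2) \<longlonglongrightarrow> 0"
    proof eventually_elim
      case (elim \<xi>)
      have "(\<lambda>k. (norm (indicator S \<xi> * q k \<xi> * rep_L2 f \<xi>))\<^sup>2) \<longlonglongrightarrow> (norm (indicator S \<xi> * 0 * rep_L2 f \<xi>))\<^sup>2"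
        by (intro tendsto_intros ql)
      then show ?case using elim by simp
    qed
    show "AE \<xi> in lebesgue. norm ((norm (rep_L2 (D k) \<xi>))\<^sup>2) \<le> 4 * (norm (rep_L2 g \<xi>))\<^sup>2" for k
      using Drep[of k] fg
    proof eventually_elim
      case (elim \<xi>)
      have "norm (q k \<xi>) * norm (indicator S \<xi> * rep_L2 f \<xi>) \<le> 2 * p \<xi> * norm (indicator S \<xi> * rep_L2 f \<xi>)"
        by (intro mult_right_mono qb) auto
      then have "norm (rep_L2 (D k) \<xi>) \<le> 2 * norm (rep_L2 g \<xi>)"
        using elim p0[of \<xi>] by (simp add: norm_mult p_def mult_ac)
      then have "(norm (rep_L2 (D k) \<xi>))\<^sup>2 \<le> (2 * norm (rep_L2 g \<xi>))\<^sup>2" by (intro power_mono) auto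
      then show ?case by (simp add: power_mult_distrib)
    qed
  qed measurable
  then have "(\<lambda>k. sqrt ((norm (D k))\<^sup>2)) \<longlonglongrightarrow> sqrt 0" unfolding norm_L2_rep by (intro tendsto_real_sqrt) simp
  then show ?thesis unfolding D_def p_def by (simp add: tendsto_norm_zero_iff LIM_zero_iff)
qed

text \<open>The transform and its inverse are isometries, so the limit may be taken on the Fourier
  side, where the group multiplies. For the converse the symbol is cut to the sets
  \<open>S R\<close> on which it is bounded; there the limit of the truncated quotient is computed
  in two ways, and comparing them identifies g on every \<open>S R\<close>.\<close>

lemma propagator_generator:
  "(f, g) \<in> fractional_laplacian \<alpha> \<longleftrightarrow> ((\<lambda>t. (propagator \<alpha> t f - f) /\<^sub>R t) \<longlongrightarrow> (- \<i>) *\<^sub>C g) (at 0)"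
proof -
  define f' g' where "f' = fourier_L2 f" and "g' = fourier_L2 g"
  define V where "V t = mult_L2 (\<lambda>\<xi>. cis (- t * norm \<xi> powr (2 * \<alpha>))) f'" for t
  have F: "fourier_L2 ((propagator \<alpha> t f - f) /\<^sub>R t) = (V t - f') /\<^sub>R t" for t
    by (simp add: linear_L2_scaleR[OF linear_fourier_L2] linear_L2_diff[OF linear_fourier_L2] V_def propagator_def fourier_multiplier_def f'_def)
  have Fg: "fourier_L2 ((- \<i>) *\<^sub>C g) = (- \<i>) *\<^sub>C g'"
    using linear_fourier_L2[where 'a='a] unfolding linear_L2_def g'_def by blast
  have Fi: "fourier_inv ((V t - f') /\<^sub>R t) = (propagator \<alpha> t f - f) /\<^sub>R t" for t unfolding F[symmetric] by simp
  have Fig: "fourier_inv ((- \<i>) *\<^sub>C g') = (- \<i>) *\<^sub>C g" unfolding Fg[symmetric] by simp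
  have "((\<lambda>t. (propagator \<alpha> t f - f) /\<^sub>R t) \<longlongrightarrow> (- \<i>) *\<^sub>C g) (at 0) \<longleftrightarrow> ((\<lambda>t. (V t - f') /\<^sub>R t) \<longlongrightarrow> (- \<i>) *\<^sub>C g') (at 0)"
  proof
    assume "((\<lambda>t. (propagator \<alpha> t f - f) /\<^sub>R t) \<longlongrightarrow> (- \<i>) *\<^sub>C g) (at 0)"
    from isometry_tendsto[OF linear_fourier_L2 norm_fourier_L2 this] show "((\<lambda>t. (V t - f') /\<^sub>R t) \<longlongrightarrow> (- \<i>) *\<^sub>C g') (at 0)"
      unfolding F Fg .
  next
    assume "((\<lambda>t. (V t - f') /\<^sub>R t) \<longlongrightarrow> (- \<i>) *\<^sub>C g') (at 0)"
    from isometry_tendsto[OF linear_fourier_inv norm_fourier_inv this] show "((\<lambda>t. (propagator \<alpha> t f - f) /\<^sub>R t) \<longlongrightarrow> (- \<i>) *\<^sub>C g) (at 0)"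
      unfolding Fi Fig .
  qed
  also have "\<dots> \<longleftrightarrow> (f, g) \<in> fractional_laplacian \<alpha>"
  proof
    assume "(f, g) \<in> fractional_laplacian \<alpha>"
    then have fg: "AE \<xi> in lebesgue. rep_L2 g' \<xi> = indicator UNIV \<xi> * of_real (norm \<xi> powr (2 * \<alpha>)) * rep_L2 f' \<xi>"
      by (simp add: fractional_laplacian_def f'_def g'_def)
    show "((\<lambda>t. (V t - f') /\<^sub>R t) \<longlongrightarrow> (- \<i>) *\<^sub>C g') (at 0)"
      unfolding tendsto_at_iff_sequentially o_def
    proof (intro allI impI)
      fix X :: "nat \<Rightarrow> real" assume "\<forall>i. X i \<in> UNIV - {0}" "X \<longlonglongrightarrow> 0"
      then have "(\<lambda>k. mult_L2 (indicator UNIV) ((V (X k) - f') /\<^sub>R X k)) \<longlonglongrightarrow> (- \<i>) *\<^sub>C g'"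
        unfolding V_def by (intro difference_quotient_limit fg) auto
      moreover have "mult_L2 (indicator UNIV) u = u" for u :: "'a L2" by (simp add: mult_L2_def)
      ultimately show "(\<lambda>k. (V (X k) - f') /\<^sub>R X k) \<longlonglongrightarrow> (- \<i>) *\<^sub>C g'" by simp
    qed
  next
    assume lim: "((\<lambda>t. (V t - f') /\<^sub>R t) \<longlongrightarrow> (- \<i>) *\<^sub>C g') (at 0)"
    define S where "S R = {\<xi>::'a. norm \<xi> powr (2 * \<alpha>) \<le> real R}" for R :: nat
    have Sm [measurable]: "S R \<in> sets borel" for R unfolding S_def by measurable
    have Sb: "bounded_symbol (indicator (S R) :: 'a \<Rightarrow> complex)" for R
      by (intro bounded_symbolI[of _ 1]) (auto simp: indicator_def)
    define pS where "pS R \<xi> = indicator (S R) \<xi> * complex_of_real (norm \<xi> powr (2 * \<alpha>))" for R and \<xi> :: 'a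
    have pSb: "bounded_symbol (pS R)" for R
      by (rule bounded_symbolI[of _ "real R"]) (auto simp: pS_def[abs_def] S_def indicator_def)
    define X where "X k = 1 / real (Suc k)" for k
    have X: "X \<longlonglongrightarrow> 0" "X k \<noteq> 0" for k unfolding X_def[abs_def] by (intro LIMSEQ_Suc lim_1_over_n) auto
    have "AE \<xi> in lebesgue. indicator (S R) \<xi> * rep_L2 g' \<xi> = pS R \<xi> * rep_L2 f' \<xi>" for R
    proof -
      have "AE \<xi> in lebesgue. rep_L2 (mult_L2 (pS R) f') \<xi> = indicator (S R) \<xi> * of_real (norm \<xi> powr (2 * \<alpha>)) * rep_L2 f' \<xi>"
        using rep_mult_L2[OF pSb, of R f'] by eventually_elim (simp add: pS_def)
      from difference_quotient_limit[OF Sm this X]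
      have "(\<lambda>k. mult_L2 (indicator (S R)) ((V (X k) - f') /\<^sub>R X k)) \<longlonglongrightarrow> (- \<i>) *\<^sub>C mult_L2 (pS R) f'"
        unfolding V_def .
      moreover have "(\<lambda>k. mult_L2 (indicator (S R)) ((V (X k) - f') /\<^sub>R X k)) \<longlonglongrightarrow> mult_L2 (indicator (S R)) ((- \<i>) *\<^sub>C g')"
      proof -
        have l: "(\<lambda>k. (V (X k) - f') /\<^sub>R X k) \<longlonglongrightarrow> (- \<i>) *\<^sub>C g'"
          using lim X unfolding tendsto_at_iff_sequentially o_def by blast
        have "(\<lambda>k. mult_L2 (indicator (S R)) ((V (X k) - f') /\<^sub>R X k) - mult_L2 (indicator (S R)) ((- \<i>) *\<^sub>C g')) \<longlonglongrightarrow> 0"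
        proof (rule Lim_null_comparison)
          show "\<forall>\<^sub>F k in sequentially. norm (mult_L2 (indicator (S R)) ((V (X k) - f') /\<^sub>R X k) - mult_L2 (indicator (S R)) ((- \<i>) *\<^sub>C g')) \<le> norm ((V (X k) - f') /\<^sub>R X k - (- \<i>) *\<^sub>C g')"
            unfolding linear_L2_diff[OF linear_mult_L2[OF Sb], symmetric]
            by (intro always_eventually allI norm_mult_L2_le Sb) (auto simp: indicator_def)
          show "(\<lambda>k. norm ((V (X k) - f') /\<^sub>R X k - (- \<i>) *\<^sub>C g')) \<longlonglongrightarrow> 0" using l by (simp add: LIM_zero_iff tendsto_norm_zero_iff)
        qed
        then show ?thesis by (simp add: LIM_zero_iff)
      qed
      ultimately have "(- \<i>) *\<^sub>C mult_L2 (pS R) f' = mult_L2 (indicator (S R)) ((- \<i>) *\<^sub>C g')" using LIMSEQ_unique by blast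
      then have "AE \<xi> in lebesgue. rep_L2 ((- \<i>) *\<^sub>C mult_L2 (pS R) f') \<xi> = rep_L2 (mult_L2 (indicator (S R)) ((- \<i>) *\<^sub>C g')) \<xi>" by simp
      then show ?thesis
        using rep_scaleC_L2[of "- \<i>" "mult_L2 (pS R) f'"] rep_mult_L2[OF pSb, of R f'] rep_mult_L2[OF Sb, of R "(- \<i>) *\<^sub>C g'"] rep_scaleC_L2[of "- \<i>" g']
      proof eventually_elim
        case (elim \<xi>)
        then have "- \<i> * (pS R \<xi> * rep_L2 f' \<xi>) = - \<i> * (indicator (S R) \<xi> * rep_L2 g' \<xi>)" by simp
        then show ?case by simp
      qed
    qed
    \<comment> \<open>Countably many exceptional null sets are united; every \<xi> lies in some
      \<open>S R\<close>, which removes the cutoff.\<close>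
    then have "AE \<xi> in lebesgue. \<forall>R. indicator (S R) \<xi> * rep_L2 g' \<xi> = pS R \<xi> * rep_L2 f' \<xi>" by (simp add: AE_all_countable)
    then have "AE \<xi> in lebesgue. rep_L2 g' \<xi> = of_real (norm \<xi> powr (2 * \<alpha>)) * rep_L2 f' \<xi>"
    proof eventually_elim
      case (elim \<xi>)
      have "\<xi> \<in> S (nat \<lceil>norm \<xi> powr (2 * \<alpha>)\<rceil>)" by (simp add: S_def)
      then show ?case using elim[rule_format, of "nat \<lceil>norm \<xi> powr (2 * \<alpha>)\<rceil>"] by (simp add: pS_def)
    qed
    then show "(f, g) \<in> fractional_laplacian \<alpha>" by (simp add: fractional_laplacian_def f'_def g'_def)
  qed
  finally show ?thesis by simp
qed

lemma is_unitary_group_propagator: "is_unitary_group (propagator \<alpha>) (fractional_laplacian \<alpha>)"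
  unfolding is_unitary_group_def unitary_L2_def
proof (intro conjI allI)
  fix t
  show "linear_L2 (propagator \<alpha> t)" by (rule linear_propagator)
  show "surj (propagator \<alpha> t)"
    by (rule surjI[of _ "propagator \<alpha> (- t)"]) (simp add: propagator_add[symmetric] propagator_zero)
  show "norm (propagator \<alpha> t f) = norm f" for f by (rule norm_propagator)
  show "propagator \<alpha> 0 = id" by (simp add: fun_eq_iff propagator_zero)
  show "propagator \<alpha> (s + t) = propagator \<alpha> s \<circ> propagator \<alpha> t" for s by (simp add: fun_eq_iff propagator_add)
  show "continuous_on UNIV (\<lambda>t. propagator \<alpha> t f)" for f by (rule propagator_continuous)
  show "(f, g) \<in> fractional_laplacian \<alpha> \<longleftrightarrow> ((\<lambda>t. (propagator \<alpha> t f - f) /\<^sub>R t) \<longlongrightarrow> (- \<i>) *\<^sub>C g) (at 0)" for f g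
    by (rule propagator_generator)
qed

text \<open>Spectral truncations: cutting the transform of f to a set where the symbol is bounded
  puts it in the domain, and the cutoffs tend to 1 pointwise.\<close>

lemma domain_dense:
  obtains h k where "\<And>n::nat. (h n, k n) \<in> fractional_laplacian \<alpha>" "h \<longlonglongrightarrow> (f :: 'a::euclidean_space L2)"
proof -
  define S where "S R = {\<xi>::'a. norm \<xi> powr (2 * \<alpha>) \<le> real R}" for R :: nat
  have Sm [measurable]: "S R \<in> sets borel" for R unfolding S_def by measurable
  have Sb: "bounded_symbol (indicator (S R) :: 'a \<Rightarrow> complex)" for R
    by (intro bounded_symbolI[of _ 1]) (auto simp: indicator_def)
  define pS where "pS R \<xi> = indicator (S R) \<xi> * complex_of_real (norm \<xi> powr (2 * \<alpha>))" for R and \<xi> :: 'a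
  have pSb: "bounded_symbol (pS R)" for R
    by (rule bounded_symbolI[of _ "real R"]) (auto simp: pS_def[abs_def] S_def indicator_def)
  have "(fourier_multiplier (indicator (S n)) f, fourier_multiplier (pS n) f) \<in> fractional_laplacian \<alpha>" for n
  proof -
    have "AE \<xi> in lebesgue. rep_L2 (mult_L2 (pS n) (fourier_L2 f)) \<xi>
        = of_real (norm \<xi> powr (2 * \<alpha>)) * rep_L2 (mult_L2 (indicator (S n)) (fourier_L2 f)) \<xi>"
      using rep_mult_L2[OF Sb, of n "fourier_L2 f"] rep_mult_L2[OF pSb, of n "fourier_L2 f"]
      by eventually_elim (simp add: pS_def)
    then show ?thesis by (simp add: fractional_laplacian_def fourier_multiplier_def)
  qed
  moreover have "(\<lambda>n. fourier_multiplier (indicator (S n)) f) \<longlonglongrightarrow> fourier_multiplier (\<lambda>_. 1) f"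
  proof (rule fourier_multiplier_tendsto)
    show "(\<lambda>n. indicator (S n) \<xi> :: complex) \<longlonglongrightarrow> 1" for \<xi>
      by (rule tendsto_eventually, rule eventually_sequentiallyI[of "nat \<lceil>norm \<xi> powr (2 * \<alpha>)\<rceil>"])
        (auto simp: S_def indicator_def nat_le_iff ceiling_le_iff)
  qed (auto simp: indicator_def)
  moreover have "fourier_multiplier (\<lambda>_. 1) f = f" by (simp add: fourier_multiplier_def mult_L2_one)
  ultimately show thesis using that[of "\<lambda>n. fourier_multiplier (indicator (S n)) f" "\<lambda>n. fourier_multiplier (pS n) f"] by simp
qed

end

section \<open>Uniqueness of the group with a given generator\<close>

lemma unitary_group_derivative:
  assumes U: "is_unitary_group U H" and fg: "(f, g) \<in> H"
  shows "(U t f, U t g) \<in> H" "((\<lambda>t. U t f) has_vector_derivative (- \<i>) *\<^sub>C U t g) (at t)"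
proof -
  have lin: "linear_L2 (U t)" and nrm: "norm (U t u) = norm u" and add: "U (s + t) u = U s (U t u)" for s t u
    using U by (auto simp: is_unitary_group_def unitary_L2_def)
  have gen: "(f, g) \<in> H \<longleftrightarrow> ((\<lambda>t. (U t f - f) /\<^sub>R t) \<longlongrightarrow> (- \<i>) *\<^sub>C g) (at 0)" for f g
    using U by (auto simp: is_unitary_group_def)
  have "((\<lambda>s. U t ((U s f - f) /\<^sub>R s)) \<longlongrightarrow> U t ((- \<i>) *\<^sub>C g)) (at 0)"
    using fg by (rule_tac isometry_tendsto[OF lin nrm]) (simp add: gen)
  moreover have "U t ((U s f - f) /\<^sub>R s) = (U (t + s) f - U t f) /\<^sub>R s" for s
    by (simp add: linear_L2_scaleR[OF lin] linear_L2_diff[OF lin] add)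
  moreover have "U t ((- \<i>) *\<^sub>C g) = (- \<i>) *\<^sub>C U t g" using lin unfolding linear_L2_def by blast
  ultimately have l: "((\<lambda>s. (U (t + s) f - U t f) /\<^sub>R s) \<longlongrightarrow> (- \<i>) *\<^sub>C U t g) (at 0)" by simp
  moreover have "U (t + s) f = U s (U t f)" for s using add[of s t f] by (simp add: add.commute)
  ultimately show "(U t f, U t g) \<in> H" by (simp add: gen)
  show "((\<lambda>t. U t f) has_vector_derivative (- \<i>) *\<^sub>C U t g) (at t)"
    unfolding has_vector_derivative_def has_derivative_at
  proof (intro conjI bounded_linear_scaleR_left)
    have "((\<lambda>s. norm ((U (t + s) f - U t f) /\<^sub>R s - (- \<i>) *\<^sub>C U t g)) \<longlongrightarrow> 0) (at 0)"
      using l by (simp add: LIM_zero_iff tendsto_norm_zero_iff)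
    moreover have "norm ((U (t + s) f - U t f) /\<^sub>R s - (- \<i>) *\<^sub>C U t g) = norm (U (t + s) f - U t f - s *\<^sub>R ((- \<i>) *\<^sub>C U t g)) / norm s" if "s \<noteq> 0" for s
    proof -
      have "U (t + s) f - U t f - s *\<^sub>R ((- \<i>) *\<^sub>C U t g) = s *\<^sub>R ((U (t + s) f - U t f) /\<^sub>R s - (- \<i>) *\<^sub>C U t g)"
        using that by (simp add: scaleR_diff_right)
      then show ?thesis using that by simp
    qed
    ultimately show "(\<lambda>h. norm (U (t + h) f - U t f - h *\<^sub>R ((- \<i>) *\<^sub>C U t g)) / norm h) \<midarrow>0\<rightarrow> 0"
      by (rule_tac Lim_transform_eventually) (auto simp: eventually_at_filter)
  qed
qed

lemma unitary_group_unique: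
  assumes U: "is_unitary_group U H" and V: "is_unitary_group V H"
    and dense: "\<And>f. \<exists>h k. (\<forall>n::nat. (h n, k n) \<in> H) \<and> h \<longlonglongrightarrow> f"
  shows "U = V"
proof -
  have lin: "linear_L2 (U t)" and nrm: "norm (U t u) = norm u" and linV: "linear_L2 (V t)" and nrmV: "norm (V t u) = norm u"
    and U0: "U 0 u = u" and V0: "V 0 u = u" for t u
    using U V by (auto simp: is_unitary_group_def unitary_L2_def)
  have gen: "(f, g) \<in> H \<longleftrightarrow> ((\<lambda>t. (V t f - f) /\<^sub>R t) \<longlongrightarrow> (- \<i>) *\<^sub>C g) (at 0)" for f g
    using V by (auto simp: is_unitary_group_def)
  have Hdiff: "(f - f', g - g') \<in> H" if "(f, g) \<in> H" "(f', g') \<in> H" for f g f' g'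
  proof -
    have "((\<lambda>t. (V t f - f) /\<^sub>R t - (V t f' - f') /\<^sub>R t) \<longlongrightarrow> (- \<i>) *\<^sub>C g - (- \<i>) *\<^sub>C g') (at 0)"
      using that by (intro tendsto_intros) (simp_all add: gen)
    moreover have "(V t f - f) /\<^sub>R t - (V t f' - f') /\<^sub>R t = (V t (f - f') - (f - f')) /\<^sub>R t" for t
      by (simp add: linear_L2_diff[OF linV] algebra_simps)
    ultimately show ?thesis by (simp add: gen scaleC_diff_right)
  qed
  \<comment> \<open>Symmetry of the generator, in the form of skewness of - i H for the real inner
    product, is read off by differentiating the conserved norm at time 0.\<close>
  have sym: "f \<bullet> ((- \<i>) *\<^sub>C g) = 0" if "(f, g) \<in> H" for f g
  proof -
    have d: "((\<lambda>t. V t f) has_vector_derivative (- \<i>) *\<^sub>C V 0 g) (at 0)" by (rule unitary_group_derivative[OF V that])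
    have "((\<lambda>t. V t f \<bullet> V t f) has_vector_derivative (V 0 f \<bullet> ((- \<i>) *\<^sub>C V 0 g) + ((- \<i>) *\<^sub>C V 0 g) \<bullet> V 0 f)) (at 0)"
      by (rule bounded_bilinear.has_vector_derivative[OF bounded_bilinear_inner d d])
    moreover have "V t f \<bullet> V t f = f \<bullet> f" for t using nrmV[of t f] by (simp add: power2_norm_eq_inner[symmetric])
    ultimately have "((\<lambda>t::real. f \<bullet> f) has_vector_derivative (f \<bullet> ((- \<i>) *\<^sub>C g) + ((- \<i>) *\<^sub>C g) \<bullet> f)) (at 0)" by (simp add: V0)
    from vector_derivative_unique_at[OF this has_vector_derivative_const] show ?thesis by (simp add: inner_commute)
  qed
  have dom: "U t f = V t f" if "(f, g) \<in> H" for f g t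
  proof -
    define d where "d t = U t f - V t f" for t
    have "((\<lambda>t. d t \<bullet> d t) has_real_derivative 0) (at t)" for t
    proof -
      have dd: "(d has_vector_derivative ((- \<i>) *\<^sub>C U t g - (- \<i>) *\<^sub>C V t g)) (at t)"
        unfolding d_def[abs_def] by (intro has_vector_derivative_diff unitary_group_derivative[OF U that] unitary_group_derivative[OF V that])
      \<comment> \<open>Both groups preserve the domain and move f and g along together, so the
        difference stays in the domain with known image and skewness applies at every time.\<close>
      have "(d t, U t g - V t g) \<in> H" unfolding d_def by (intro Hdiff unitary_group_derivative[OF U that] unitary_group_derivative[OF V that])
      from sym[OF this] have "d t \<bullet> ((- \<i>) *\<^sub>C U t g - (- \<i>) *\<^sub>C V t g) = 0" by (simp add: scaleC_diff_right)
      with bounded_bilinear.has_vector_derivative[OF bounded_bilinear_inner dd dd]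
      show ?thesis by (simp add: has_real_derivative_iff_has_vector_derivative inner_commute)
    qed
    then have "d t \<bullet> d t = d 0 \<bullet> d 0" by (intro DERIV_isconst_all) auto
    then show ?thesis by (simp add: d_def U0 V0)
  qed
  show ?thesis
  proof (intro ext)
    fix t f
    obtain h k where h: "\<And>n::nat. (h n, k n) \<in> H" "h \<longlonglongrightarrow> f" using dense by blast
    have "(\<lambda>n. U t (h n)) \<longlonglongrightarrow> U t f" by (rule isometry_tendsto[OF lin nrm h(2)])
    moreover have "(\<lambda>n. U t (h n)) \<longlonglongrightarrow> V t f" unfolding dom[OF h(1)] by (rule isometry_tendsto[OF linV nrmV h(2)])
    ultimately show "U t f = V t f" by (rule LIMSEQ_unique)
  qed
qed

lemma unitary_group_fractional_laplacian: "unitary_group (fractional_laplacian \<alpha>) = (propagator \<alpha> :: real \<Rightarrow> 'a::euclidean_space L2 \<Rightarrow> 'a L2)"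
  unfolding unitary_group_def
proof (rule the_equality)
  fix U :: "real \<Rightarrow> 'a L2 \<Rightarrow> 'a L2" assume "is_unitary_group U (fractional_laplacian \<alpha>)"
  then show "U = propagator \<alpha>"
    by (rule unitary_group_unique[OF _ is_unitary_group_propagator]) (metis domain_dense)
qed (rule is_unitary_group_propagator)

section \<open>Hilbert--Schmidt operators\<close>

text \<open>Finiteness is built in: the Hilbert-Schmidt bound is a supremum of finite sums, and a
  finite family allows limits to be taken term by term.\<close>

definition orthonormal :: "'a::real_inner set \<Rightarrow> bool" where
  "orthonormal B \<longleftrightarrow> finite B \<and> (\<forall>b\<in>B. \<forall>c\<in>B. b \<bullet> c = (if b = c then 1 else 0))"

lemma orthonormal_projection:
  fixes B :: "'a::real_inner set"
  assumes B: "orthonormal B" and p: "p = (\<Sum>b\<in>B. (u \<bullet> b) *\<^sub>R b)"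
  shows "b \<in> B \<Longrightarrow> (u - p) \<bullet> b = 0" "(u - p) \<bullet> p = 0" "p \<bullet> p = (\<Sum>b\<in>B. (u \<bullet> b)\<^sup>2)"
    "norm (u - p) \<le> norm u" "(\<Sum>b\<in>B. (u \<bullet> b)\<^sup>2) \<le> (norm u)\<^sup>2"
proof -
  have fin: "finite B" using B by (simp add: orthonormal_def)
  have pb: "p \<bullet> b = u \<bullet> b" if "b \<in> B" for b
  proof -
    have "p \<bullet> b = (\<Sum>c\<in>B. if c = b then u \<bullet> c else 0)"
      unfolding p inner_sum_left using B that by (intro sum.cong) (auto simp: orthonormal_def)
    then show ?thesis using fin that by simp
  qed
  show orth: "b \<in> B \<Longrightarrow> (u - p) \<bullet> b = 0" for b by (simp add: inner_diff_left pb)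
  have "(u - p) \<bullet> p = (\<Sum>b\<in>B. (u \<bullet> b) * ((u - p) \<bullet> b))" by (subst (2) p) (simp add: inner_sum_right)
  then show op: "(u - p) \<bullet> p = 0" by (simp add: orth)
  have "p \<bullet> p = (\<Sum>b\<in>B. (u \<bullet> b) * (p \<bullet> b))" by (subst (2) p) (simp add: inner_sum_right)
  then show pp: "p \<bullet> p = (\<Sum>b\<in>B. (u \<bullet> b)\<^sup>2)" by (simp add: pb power2_eq_square)
  have "(norm u)\<^sup>2 = (norm (u - p))\<^sup>2 + p \<bullet> p"
    using op by (simp add: power2_norm_eq_inner inner_diff_left inner_diff_right inner_commute)
  then show "norm (u - p) \<le> norm u" "(\<Sum>b\<in>B. (u \<bullet> b)\<^sup>2) \<le> (norm u)\<^sup>2"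
    unfolding pp[symmetric] by (auto intro: power2_le_imp_le)
qed

text \<open>Continuous images of intervals, added one at a time. It supplies compactness in the span
  of finitely many image vectors, which need not be independent.\<close>

lemma compact_coefficient_box:
  fixes v :: "'i \<Rightarrow> 'b::real_normed_vector"
  assumes "finite B"
  shows "compact {\<Sum>b\<in>B. c b *\<^sub>R v b | c. \<forall>b\<in>B. \<bar>c b\<bar> \<le> M}"
  using assms
proof induction
  case empty
  then show ?case by simp
next
  case (insert b B)
  define Q where "Q B = {\<Sum>b\<in>B. c b *\<^sub>R v b | c. \<forall>b\<in>B. \<bar>c b\<bar> \<le> M}" for B
  have "compact {x + y | x y. x \<in> (\<lambda>t. t *\<^sub>R v b) ` {-M..M} \<and> y \<in> Q B}"
    by (rule compact_sums) (use insert.IH in \<open>auto simp: Q_def intro!: compact_continuous_image continuous_intros\<close>)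
  also have "{x + y | x y. x \<in> (\<lambda>t. t *\<^sub>R v b) ` {-M..M} \<and> y \<in> Q B} = Q (insert b B)"
  proof (intro set_eqI iffI)
    fix z assume "z \<in> {x + y | x y. x \<in> (\<lambda>t. t *\<^sub>R v b) ` {-M..M} \<and> y \<in> Q B}"
    then obtain t c where tc: "\<bar>t\<bar> \<le> M" "\<forall>b\<in>B. \<bar>c b\<bar> \<le> M" "z = t *\<^sub>R v b + (\<Sum>b\<in>B. c b *\<^sub>R v b)"
      unfolding Q_def by (smt (verit, best) atLeastAtMost_iff image_iff mem_Collect_eq)
    have "(\<Sum>a\<in>B. (c(b := t)) a *\<^sub>R v a) = (\<Sum>a\<in>B. c a *\<^sub>R v a)" using insert.hyps by (intro sum.cong) auto
    then have "z = (\<Sum>a\<in>insert b B. (c(b := t)) a *\<^sub>R v a)" using insert.hyps tc by simp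
    moreover have "\<forall>a\<in>insert b B. \<bar>(c(b := t)) a\<bar> \<le> M" using tc by simp
    ultimately show "z \<in> Q (insert b B)" unfolding Q_def by blast
  next
    fix z assume "z \<in> Q (insert b B)"
    then obtain c where c: "\<forall>b\<in>insert b B. \<bar>c b\<bar> \<le> M" "z = (\<Sum>a\<in>insert b B. c a *\<^sub>R v a)" by (auto simp: Q_def)
    have "c b *\<^sub>R v b \<in> (\<lambda>t. t *\<^sub>R v b) ` {-M..M}" using c(1) by (auto simp: abs_le_iff)
    moreover have "(\<Sum>a\<in>B. c a *\<^sub>R v a) \<in> Q B" using c(1) by (auto simp: Q_def)
    ultimately show "z \<in> {x + y | x y. x \<in> (\<lambda>t. t *\<^sub>R v b) ` {-M..M} \<and> y \<in> Q B}" using insert.hyps c(2) by auto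
  qed
  finally show ?case by (simp add: Q_def)
qed

text \<open>If the sums of \<open>(norm (K e))\<^sup>2\<close> over orthonormal families are bounded, then \<open>K\<close> is small on the
  orthogonal complement of a family that nearly attains the supremum.\<close>

lemma hilbert_schmidt_compact:
  fixes K :: "'a::real_inner \<Rightarrow> 'b::{real_normed_vector, complete_space}"
  assumes lin: "linear K" and hs: "\<And>B. orthonormal B \<Longrightarrow> (\<Sum>e\<in>B. (norm (K e))\<^sup>2) \<le> C"
    and S: "bounded S"
  shows "compact (closure (K ` S))"
  unfolding compact_eq_totally_bounded complete_eq_closed
proof (intro conjI allI impI closed_closure)
  fix e :: real assume e: "e > 0"
  obtain M where M: "M > 0" "\<And>u. u \<in> S \<Longrightarrow> norm u \<le> M" using S unfolding bounded_pos by blast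
  \<comment> \<open>Chosen so that K moves the component orthogonal to B, of norm at most M, by at
    most e / 4.\<close>
  define \<delta> where "\<delta> = e / (4 * M)"
  have \<delta>: "\<delta> > 0" "\<delta> * M = e / 4" using e M by (auto simp: \<delta>_def)
  define V where "V = (\<lambda>B. \<Sum>e\<in>B. (norm (K e))\<^sup>2) ` Collect orthonormal"
  have ne: "V \<noteq> {}" by (auto simp: V_def orthonormal_def intro: exI[of _ "{}"])
  have bd: "bdd_above V" using hs by (auto simp: V_def bdd_above_def)
  have "Sup V - \<delta>\<^sup>2 < Sup V" using \<delta> by simp
  then obtain B where B: "orthonormal B" "Sup V - \<delta>\<^sup>2 < (\<Sum>e\<in>B. (norm (K e))\<^sup>2)"
    unfolding less_cSup_iff[OF ne bd] by (auto simp: V_def)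
  have fin: "finite B" using B(1) by (simp add: orthonormal_def)
  have small_unit: "norm (K v) \<le> \<delta>" if v: "norm v = 1" "\<And>b. b \<in> B \<Longrightarrow> v \<bullet> b = 0" for v
  proof -
    have vv: "v \<bullet> v = 1" using v(1) by (simp add: norm_eq_1)
    then have vB: "v \<notin> B" using v(2)[of v] by auto
    have "orthonormal (insert v B)"
      using B(1) v(2) vv vB by (auto simp: orthonormal_def inner_commute)
    then have "(\<Sum>e\<in>insert v B. (norm (K e))\<^sup>2) \<le> Sup V" by (intro cSup_upper bd) (auto simp: V_def)
    then have "(norm (K v))\<^sup>2 \<le> \<delta>\<^sup>2" using fin vB B(2) by simp
    then show ?thesis using \<delta> by (auto intro: power2_le_imp_le)
  qed
  have small: "norm (K w) \<le> \<delta> * norm w" if w: "\<And>b. b \<in> B \<Longrightarrow> w \<bullet> b = 0" for w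
  proof (cases "w = 0")
    case True
    then show ?thesis using linear_0[OF lin] by simp
  next
    case False
    have "norm (K ((1 / norm w) *\<^sub>R w)) \<le> \<delta>" using False w by (intro small_unit) auto
    then have "norm (K w) / norm w \<le> \<delta>" by (simp add: linear_cmul[OF lin])
    then show ?thesis using False by (simp add: divide_le_eq)
  qed
  define Q where "Q = {\<Sum>b\<in>B. c b *\<^sub>R K b | c. \<forall>b\<in>B. \<bar>c b\<bar> \<le> M}"
  have "compact Q" unfolding Q_def by (rule compact_coefficient_box[OF fin])
  then obtain k where k: "finite k" "Q \<subseteq> (\<Union>x\<in>k. ball x (e / 2))"
    using e unfolding compact_eq_totally_bounded by (meson half_gt_zero)
  \<comment> \<open>A distance below e / 2 to the net of Q plus e / 4 for the orthogonal component.
    The slack up to e allows closed balls, whose finite union also contains the closure.\<close>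
  have "K u \<in> (\<Union>x\<in>k. cball x (3 * e / 4))" if u: "u \<in> S" for u
  proof -
    define p where "p = (\<Sum>b\<in>B. (u \<bullet> b) *\<^sub>R b)"
    note P = orthonormal_projection[OF B(1) p_def]
    have Kp: "K p = (\<Sum>b\<in>B. (u \<bullet> b) *\<^sub>R K b)" unfolding p_def by (simp add: linear_sum[OF lin] linear_cmul[OF lin])
    have "\<bar>u \<bullet> b\<bar> \<le> M" if "b \<in> B" for b
    proof -
      have "norm b = 1" using B(1) that by (simp add: orthonormal_def norm_eq_1)
      then show ?thesis using Cauchy_Schwarz_ineq2[of u b] M(2)[OF u] by simp
    qed
    then have "K p \<in> Q" unfolding Kp Q_def by blast
    then obtain x where x: "x \<in> k" "dist x (K p) < e / 2" using k by auto
    have "norm (K (u - p)) \<le> \<delta> * norm (u - p)" by (rule small[OF P(1)])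
    also have "\<dots> \<le> \<delta> * M" using P(4) M(2)[OF u] \<delta> by (intro mult_left_mono) auto
    finally have "dist (K p) (K u) \<le> e / 4" using \<delta> by (simp add: linear_diff[OF lin] dist_norm norm_minus_commute)
    then have "dist x (K u) \<le> 3 * e / 4" using x(2) dist_triangle[of x "K u" "K p"] by linarith
    then show ?thesis using x(1) by auto
  qed
  then have "closure (K ` S) \<subseteq> (\<Union>x\<in>k. cball x (3 * e / 4))" using k(1) by (intro closure_minimal closed_UN) auto
  also have "\<dots> \<subseteq> (\<Union>x\<in>k. ball x e)"
  proof (intro UN_mono subsetI order_refl)
    fix x y :: 'b assume "y \<in> cball x (3 * e / 4)"
    then show "y \<in> ball x e" using e by simp
  qed
  finally show "\<exists>k. finite k \<and> closure (K ` S) \<subseteq> (\<Union>x\<in>k. ball x e)" using k(1) by blast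
qed

section \<open>Integral kernels of truncated multipliers\<close>

lemma fourier_multiplier_kernel:
  fixes m f :: "'a::euclidean_space \<Rightarrow> complex"
  assumes m: "integrable lborel m" "\<And>\<xi>. norm (m \<xi>) \<le> 1"
    and f: "f \<in> borel_measurable borel" "square_integrable f" "integrable lborel f"
  shows "AE x in lebesgue. rep_L2 (fourier_multiplier m (abs_L2 f)) x
    = (\<integral>y. of_real ((fourier_const TYPE('a))\<^sup>2) * (\<integral>\<xi>. cis ((x - y) \<bullet> \<xi>) * m \<xi> \<partial>lborel) * f y \<partial>lborel)"
proof -
  have mm [measurable]: "m \<in> borel_measurable borel" using m(1) by auto
  have mb: "bounded_symbol m" by (rule bounded_symbolI[OF mm m(2)])
  note [measurable] = f(1)
  define c where "c = fourier_const TYPE('a)"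
  define Ff where "Ff = fourier_integral f"
  have i: "in_L1 (abs_L2 f)" using in_L1_abs(1)[OF f(1,2)] f(3) by simp
  have Fm [measurable]: "Ff \<in> borel_measurable borel" unfolding Ff_def by (rule borel_measurable_fourier_integral[OF f(3)])
  have Fs: "square_integrable Ff"
    using fourier_L1_square_integrable(2)[OF i] in_L1_abs(2)[OF f(1,2)] by (simp add: Ff_def)
  have F: "fourier_L2 (abs_L2 f) = abs_L2 Ff"
    unfolding fourier_L2_in_L1[OF i] by (simp add: fourier_L1_def in_L1_abs(2)[OF f(1,2)] Ff_def)
  define g where "g \<xi> = m \<xi> * Ff \<xi>" for \<xi>
  have gm [measurable]: "g \<in> borel_measurable borel" unfolding g_def[abs_def] by measurable
  have gl: "g \<in> borel_measurable lebesgue" by (intro measurable_completion) simp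
  have gs: "square_integrable g"
  proof (rule square_integrable_bound[OF Fs gl], rule AE_I2)
    show "norm (g \<xi>) \<le> norm (Ff \<xi>)" for \<xi> using mult_right_mono[OF m(2)[of \<xi>], of "norm (Ff \<xi>)"] by (simp add: g_def norm_mult)
  qed
  have gi: "integrable lborel g"
  proof (rule Bochner_Integration.integrable_bound)
    show "integrable lborel (\<lambda>\<xi>. of_real (c * (\<integral>x. norm (f x) \<partial>lborel)) * m \<xi>)" using m(1) by simp
    show "AE \<xi> in lborel. norm (g \<xi>) \<le> norm (of_real (c * (\<integral>x. norm (f x) \<partial>lborel)) * m \<xi>)"
    proof (rule AE_I2)
      fix \<xi>
      have "norm (Ff \<xi>) \<le> \<bar>c * (\<integral>x. norm (f x) \<partial>lborel)\<bar>"
        unfolding Ff_def c_def by (rule order_trans[OF norm_fourier_integral_le[OF f(3)] abs_ge_self])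
      from mult_left_mono[OF this, of "norm (m \<xi>)"]
      show "norm (g \<xi>) \<le> norm (of_real (c * (\<integral>x. norm (f x) \<partial>lborel)) * m \<xi>)"
        by (simp only: g_def norm_mult norm_of_real norm_ge_zero mult.commute)
    qed
  qed simp
  have M: "mult_L2 m (abs_L2 Ff) = abs_L2 g"
    unfolding mult_L2_def
  proof (rule abs_L2_eqI[OF square_integrable_symbol[OF mb] gs])
    show "AE x in lebesgue. m x * rep_L2 (abs_L2 Ff) x = g x" using rep_abs_L2[OF Fs] by eventually_elim (simp add: g_def)
  qed
  have eq: "of_real c * (\<integral>\<xi>. cis (x \<bullet> \<xi>) * g \<xi> \<partial>lborel)
      = (\<integral>y. of_real (c\<^sup>2) * (\<integral>\<xi>. cis ((x - y) \<bullet> \<xi>) * m \<xi> \<partial>lborel) * f y \<partial>lborel)" for x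
  proof -
    \<comment> \<open>Integrability of the symbol m, which the unregularised propagator lacks,
      together with that of f, is what permits exchanging the two integrals.\<close>
    have H: "integrable (lborel \<Otimes>\<^sub>M lborel) (\<lambda>(\<xi>, y). cis ((x - y) \<bullet> \<xi>) * m \<xi> * f y)"
    proof (rule Bochner_Integration.integrable_bound)
      show "integrable (lborel \<Otimes>\<^sub>M lborel) (\<lambda>z. m (fst z) * f (snd z))"
        by (rule integrable_pair_mult[OF _ _ m(1) f(3)]) unfold_locales
    qed (auto simp: norm_mult)
    have "(\<integral>\<xi>. cis (x \<bullet> \<xi>) * g \<xi> \<partial>lborel) = (\<integral>\<xi>. of_real c * (\<integral>y. cis ((x - y) \<bullet> \<xi>) * m \<xi> * f y \<partial>lborel) \<partial>lborel)"
    proof (intro Bochner_Integration.integral_cong refl)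
      fix \<xi> :: 'a
      have "cis ((x - y) \<bullet> \<xi>) = cis (x \<bullet> \<xi>) * cis (y \<bullet> - \<xi>)" for y by (simp add: cis_mult inner_diff_left)
      then have *: "cis ((x - y) \<bullet> \<xi>) * m \<xi> * f y = (cis (x \<bullet> \<xi>) * m \<xi>) * (cis (y \<bullet> - \<xi>) * f y)" for y
        by (simp only: mult_ac)
      have "(\<integral>y. cis ((x - y) \<bullet> \<xi>) * m \<xi> * f y \<partial>lborel) = (cis (x \<bullet> \<xi>) * m \<xi>) * (\<integral>y. cis (y \<bullet> - \<xi>) * f y \<partial>lborel)"
        unfolding * by (rule Bochner_Integration.integral_mult_right_zero)
      then show "cis (x \<bullet> \<xi>) * g \<xi> = of_real c * (\<integral>y. cis ((x - y) \<bullet> \<xi>) * m \<xi> * f y \<partial>lborel)"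
        by (simp add: g_def Ff_def fourier_integral_lborel[OF f(1)] c_def)
    qed
    also have "\<dots> = of_real c * (\<integral>\<xi>. (\<integral>y. cis ((x - y) \<bullet> \<xi>) * m \<xi> * f y \<partial>lborel) \<partial>lborel)" by simp
    also have "(\<integral>\<xi>. (\<integral>y. cis ((x - y) \<bullet> \<xi>) * m \<xi> * f y \<partial>lborel) \<partial>lborel) = (\<integral>y. (\<integral>\<xi>. cis ((x - y) \<bullet> \<xi>) * m \<xi> * f y \<partial>lborel) \<partial>lborel)"
      using lborel_pair.Fubini_integral[of "\<lambda>\<xi> y. cis ((x - y) \<bullet> \<xi>) * m \<xi> * f y"] H by simp
    also have "\<dots> = (\<integral>y. (\<integral>\<xi>. cis ((x - y) \<bullet> \<xi>) * m \<xi> \<partial>lborel) * f y \<partial>lborel)"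
      by (simp only: Bochner_Integration.integral_mult_left_zero)
    finally show ?thesis by (simp add: power2_eq_square mult.assoc)
  qed
  show ?thesis
    unfolding fourier_multiplier_def F M
    using fourier_inv_in_L1[OF gm gs gi refl] by eventually_elim (simp only: c_def[symmetric] eq)
qed

lemma integrable_square_integrable_mult:
  assumes "square_integrable f" "square_integrable g"
  shows "integrable lebesgue (\<lambda>x. f x * g x)"
  by (rule Bochner_Integration.integrable_bound[OF Cauchy_Schwarz_square_integrable(1)[OF assms]])
    (use assms in \<open>auto simp: square_integrable_def norm_mult\<close>)

text \<open>The inner product on \<open>L2\<close> is the real one; Bessel's inequality is applied to the real and the
  imaginary part separately, whence the factor 2.\<close>

lemma bessel_complex:
  fixes B :: "'a::euclidean_space L2 set"
  assumes B: "orthonormal B" and h: "square_integrable h"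
  shows "(\<Sum>e\<in>B. (norm (\<integral>y. h y * rep_L2 e y \<partial>lebesgue))\<^sup>2) \<le> 2 * (\<integral>y. (norm (h y))\<^sup>2 \<partial>lebesgue)"
proof -
  have hm [measurable]: "h \<in> borel_measurable lebesgue" using h by (simp add: square_integrable_def)
  have a: "square_integrable (\<lambda>y. cnj (h y))" "square_integrable (\<lambda>y. \<i> * cnj (h y))"
    by (rule square_integrable_bound[OF h]; simp add: norm_mult)+
  have inner: "abs_L2 g \<bullet> e = (\<integral>y. g y \<bullet> rep_L2 e y \<partial>lebesgue)" if "square_integrable g" for g and e :: "'a L2"
    unfolding inner_L2_rep
  proof (rule integral_cong_AE)
    show "AE y in lebesgue. rep_L2 (abs_L2 g) y \<bullet> rep_L2 e y = g y \<bullet> rep_L2 e y"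
      using rep_abs_L2[OF that] by eventually_elim simp
    show "(\<lambda>y. g y \<bullet> rep_L2 e y) \<in> borel_measurable lebesgue"
      using square_integrable_inner[OF that square_integrable_rep_L2] by auto
  qed measurable
  have eq: "(norm (\<integral>y. h y * rep_L2 e y \<partial>lebesgue))\<^sup>2 = (abs_L2 (\<lambda>y. cnj (h y)) \<bullet> e)\<^sup>2 + (abs_L2 (\<lambda>y. \<i> * cnj (h y)) \<bullet> e)\<^sup>2" for e
  proof -
    have i: "integrable lebesgue (\<lambda>y. h y * rep_L2 e y)" by (rule integrable_square_integrable_mult[OF h square_integrable_rep_L2])
    have "Re (\<integral>y. h y * rep_L2 e y \<partial>lebesgue) = abs_L2 (\<lambda>y. cnj (h y)) \<bullet> e"
      unfolding inner[OF a(1)] integral_Re[OF i, symmetric]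
      by (intro Bochner_Integration.integral_cong refl) (simp add: inner_complex_def)
    moreover have "Im (\<integral>y. h y * rep_L2 e y \<partial>lebesgue) = abs_L2 (\<lambda>y. \<i> * cnj (h y)) \<bullet> e"
      unfolding inner[OF a(2)] integral_Im[OF i, symmetric]
      by (intro Bochner_Integration.integral_cong refl) (simp add: inner_complex_def)
    ultimately show ?thesis by (simp add: cmod_power2)
  qed
  have "(\<Sum>e\<in>B. (norm (\<integral>y. h y * rep_L2 e y \<partial>lebesgue))\<^sup>2)
      \<le> (norm (abs_L2 (\<lambda>y. cnj (h y))))\<^sup>2 + (norm (abs_L2 (\<lambda>y. \<i> * cnj (h y))))\<^sup>2"
    unfolding eq sum.distrib by (intro add_mono orthonormal_projection(5)[OF B refl])
  also have "\<dots> = 2 * (\<integral>y. (norm (h y))\<^sup>2 \<partial>lebesgue)"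
    unfolding norm_abs_L2[OF a(1)] norm_abs_L2[OF a(2)] by (simp add: norm_mult)
  finally show ?thesis .
qed

lemma nn_integral_norm_rep_L2: "ennreal ((norm u)\<^sup>2) = (\<integral>\<^sup>+x. ennreal ((norm (rep_L2 u x))\<^sup>2) \<partial>lebesgue)"
  unfolding norm_L2_rep using square_integrable_rep_L2[of u]
  by (intro nn_integral_eq_integral[symmetric]) (auto simp: square_integrable_def)

text \<open>At fixed x all values \<open>rep_L2 (K e) x\<close> are pairings of e with one function
  \<open>h x\<close>, so Bessel's inequality bounds their square sum before integrating in x.
  Boundedness of k and finite measure of E make \<open>h x\<close> square integrable for every x.
  The factor 2 is the one of \<open>bessel_complex\<close>.\<close>

lemma hilbert_schmidt_kernel:
  fixes K :: "'a::euclidean_space L2 \<Rightarrow> 'a L2" and k :: "'a \<Rightarrow> complex"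
  assumes k [measurable]: "k \<in> borel_measurable borel" and kM: "\<And>z. norm (k z) \<le> M"
    and E [measurable]: "E \<in> sets borel" and F [measurable]: "F \<in> sets borel" and Efin: "emeasure lborel E < \<infinity>"
    and K: "\<And>u. AE x in lebesgue. rep_L2 (K u) x = indicator F x * (\<integral>y. (k (x - y) * indicator E y) * rep_L2 u y \<partial>lebesgue)"
    and C: "(\<integral>\<^sup>+x. \<integral>\<^sup>+y. ennreal (indicator F x * (norm (k (x - y)))\<^sup>2 * indicator E y) \<partial>lborel \<partial>lborel) \<le> ennreal C" "C \<ge> 0"
    and B: "orthonormal B"
  shows "(\<Sum>e\<in>B. (norm (K e))\<^sup>2) \<le> 2 * C"
proof -
  have fin: "finite B" using B by (simp add: orthonormal_def)
  define h where "h x y = k (x - y) * indicator E y" for x y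
  have h [measurable]: "h x \<in> borel_measurable borel" for x unfolding h_def[abs_def] by measurable
  have h2: "integrable lborel (\<lambda>y. (norm (h x y))\<^sup>2)" for x
  proof (rule Bochner_Integration.integrable_bound)
    show "integrable lborel (\<lambda>y. M\<^sup>2 * indicator E y)" using Efin by (intro integrable_mult_right integrable_real_indicator) auto
    have "(norm (k z))\<^sup>2 \<le> M\<^sup>2" for z by (intro power_mono kM) simp
    then show "AE y in lborel. norm ((norm (h x y))\<^sup>2) \<le> norm (M\<^sup>2 * indicator E y)"
      by (auto simp: h_def indicator_def)
  qed measurable
  have hs: "square_integrable (h x)" for x using h2[of x] square_integrable_borel_iff[OF h[of x]] by simp
  define P where "P x = (\<integral>\<^sup>+y. ennreal (indicator F x * (norm (k (x - y)))\<^sup>2 * indicator E y) \<partial>lborel)" for x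
  have Pm [measurable]: "P \<in> borel_measurable borel" unfolding P_def[abs_def] by measurable
  \<comment> \<open>As B is finite, one null set serves all its members.\<close>
  have "AE x in lebesgue. \<forall>e\<in>B. rep_L2 (K e) x = indicator F x * (\<integral>y. h x y * rep_L2 e y \<partial>lebesgue)"
    using K fin by (simp add: h_def AE_finite_all)
  then have pointwise: "AE x in lebesgue. (\<Sum>e\<in>B. ennreal ((norm (rep_L2 (K e) x))\<^sup>2)) \<le> 2 * P x"
  proof eventually_elim
    case (elim x)
    have "(\<Sum>e\<in>B. ennreal ((norm (rep_L2 (K e) x))\<^sup>2)) = ennreal (indicator F x * (\<Sum>e\<in>B. (norm (\<integral>y. h x y * rep_L2 e y \<partial>lebesgue))\<^sup>2))"
      using elim by (simp add: sum_ennreal norm_mult power_mult_distrib indicator_def)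
    also have "\<dots> \<le> ennreal (indicator F x * (2 * (\<integral>y. (norm (h x y))\<^sup>2 \<partial>lebesgue)))"
      by (intro ennreal_leI mult_left_mono bessel_complex[OF B hs]) simp
    also have "(\<integral>y. (norm (h x y))\<^sup>2 \<partial>lebesgue) = (\<integral>y. (norm (h x y))\<^sup>2 \<partial>lborel)" by (subst integral_completion) auto
    also have "ennreal (indicator F x * (2 * (\<integral>y. (norm (h x y))\<^sup>2 \<partial>lborel))) = 2 * (indicator F x * (\<integral>\<^sup>+y. ennreal ((norm (h x y))\<^sup>2) \<partial>lborel))"
      unfolding nn_integral_eq_integral[OF h2 AE_I2[OF zero_le_power2]]
      by (auto simp: indicator_def ennreal_mult)
    also have "indicator F x * (\<integral>\<^sup>+y. ennreal ((norm (h x y))\<^sup>2) \<partial>lborel) = P x"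
      by (auto simp: P_def h_def indicator_def norm_mult power_mult_distrib intro!: nn_integral_cong)
    finally show ?case .
  qed
  have "ennreal (\<Sum>e\<in>B. (norm (K e))\<^sup>2) = (\<Sum>e\<in>B. \<integral>\<^sup>+x. ennreal ((norm (rep_L2 (K e) x))\<^sup>2) \<partial>lebesgue)"
    unfolding nn_integral_norm_rep_L2[symmetric] by (simp add: sum_ennreal)
  also have "\<dots> = (\<integral>\<^sup>+x. (\<Sum>e\<in>B. ennreal ((norm (rep_L2 (K e) x))\<^sup>2)) \<partial>lebesgue)"
    by (subst nn_integral_sum) auto
  also have "\<dots> \<le> (\<integral>\<^sup>+x. 2 * P x \<partial>lebesgue)" by (rule nn_integral_mono_AE[OF pointwise])
  also have "\<dots> = 2 * (\<integral>\<^sup>+x. P x \<partial>lborel)" unfolding nn_integral_completion by (rule nn_integral_cmult) simp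
  also have "\<dots> \<le> 2 * ennreal C" using C(1) by (intro mult_left_mono) (auto simp: P_def)
  also have "\<dots> = ennreal (2 * C)" using C(2) by (simp add: ennreal_mult)
  finally show ?thesis using C(2) by simp
qed

lemma indicator_L2_eq_mult: "indicator_L2 A = mult_L2 (indicator A)"
  by (simp add: fun_eq_iff indicator_L2_def mult_L2_def)

lemma bounded_symbol_indicator: "A \<in> sets borel \<Longrightarrow> bounded_symbol (indicator A)"
  by (rule bounded_symbolI[of _ 1]) (auto simp: indicator_def)

lemma multiplier_cutoff_kernel:
  fixes m :: "'a::euclidean_space \<Rightarrow> complex"
  assumes m: "integrable lborel m" "\<And>\<xi>. norm (m \<xi>) \<le> 1"
    and E [measurable]: "E \<in> sets borel" and F: "F \<in> sets borel" and Efin: "emeasure lborel E < \<infinity>"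
  shows "AE x in lebesgue. rep_L2 (indicator_L2 F (fourier_multiplier m (indicator_L2 E u))) x
    = indicator F x * (\<integral>y. (of_real ((fourier_const TYPE('a))\<^sup>2) * (\<integral>\<xi>. cis ((x - y) \<bullet> \<xi>) * m \<xi> \<partial>lborel) * indicator E y) * rep_L2 u y \<partial>lebesgue)"
proof -
  obtain f where f [measurable]: "f \<in> borel_measurable borel" and fs: "square_integrable f" and fu: "AE x in lebesgue. rep_L2 u x = f x"
    using L2_borel_representative[of u] by metis
  have mm [measurable]: "m \<in> borel_measurable borel" using m(1) by auto
  define g where "g x = indicator E x * f x" for x
  have gm [measurable]: "g \<in> borel_measurable borel" unfolding g_def[abs_def] by measurable
  have gl: "g \<in> borel_measurable lebesgue" by (intro measurable_completion) simp
  have gs: "square_integrable g" by (rule square_integrable_bound[OF fs gl]) (auto simp: g_def indicator_def)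
  have "square_integrable (indicator E :: 'a \<Rightarrow> complex)"
  proof -
    have "integrable lborel (\<lambda>x. indicator E x :: real)" using Efin by (intro integrable_real_indicator) auto
    moreover have "(norm (indicator E x :: complex))\<^sup>2 = indicator E x" for x by (simp add: indicator_def)
    ultimately show ?thesis by (subst square_integrable_borel_iff) auto
  qed
  from integrable_square_integrable_mult[OF this fs]
  have gi: "integrable lborel g" unfolding g_def[abs_def, symmetric] by (simp add: integrable_completion)
  have "indicator_L2 E u = abs_L2 g"
    unfolding indicator_L2_eq_mult mult_L2_def
    by (rule abs_L2_eqI[OF square_integrable_symbol[OF bounded_symbol_indicator[OF E]] gs])
      (use fu in \<open>eventually_elim, simp add: g_def\<close>)
  then have 1: "AE x in lebesgue. rep_L2 (fourier_multiplier m (indicator_L2 E u)) x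
    = (\<integral>y. of_real ((fourier_const TYPE('a))\<^sup>2) * (\<integral>\<xi>. cis ((x - y) \<bullet> \<xi>) * m \<xi> \<partial>lborel) * g y \<partial>lborel)"
    using fourier_multiplier_kernel[OF m gm gs gi] by simp
  have 2: "(\<integral>y. of_real ((fourier_const TYPE('a))\<^sup>2) * (\<integral>\<xi>. cis ((x - y) \<bullet> \<xi>) * m \<xi> \<partial>lborel) * g y \<partial>lborel)
    = (\<integral>y. (of_real ((fourier_const TYPE('a))\<^sup>2) * (\<integral>\<xi>. cis ((x - y) \<bullet> \<xi>) * m \<xi> \<partial>lborel) * indicator E y) * rep_L2 u y \<partial>lebesgue)" for x
  proof -
    define q where "q y = of_real ((fourier_const TYPE('a))\<^sup>2) * (\<integral>\<xi>. cis ((x - y) \<bullet> \<xi>) * m \<xi> \<partial>lborel)" for y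
    have qm [measurable]: "q \<in> borel_measurable borel" unfolding q_def[abs_def] by measurable
    have [measurable]: "q \<in> borel_measurable lebesgue" "g \<in> borel_measurable lebesgue" "E \<in> sets lebesgue"
      using gl by (auto intro!: measurable_completion)
    have "(\<integral>y. q y * g y \<partial>lborel) = (\<integral>y. q y * g y \<partial>lebesgue)" by (subst integral_completion) auto
    also have "\<dots> = (\<integral>y. (q y * indicator E y) * rep_L2 u y \<partial>lebesgue)"
    proof (rule integral_cong_AE)
      show "AE y in lebesgue. q y * g y = (q y * indicator E y) * rep_L2 u y" using fu by eventually_elim (simp add: g_def)
    qed measurable
    finally show ?thesis by (simp add: q_def)
  qed
  have 3: "AE x in lebesgue. rep_L2 (indicator_L2 F (fourier_multiplier m (indicator_L2 E u))) x
    = indicator F x * rep_L2 (fourier_multiplier m (indicator_L2 E u)) x"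
    unfolding indicator_L2_eq_mult by (rule rep_mult_L2[OF bounded_symbol_indicator[OF F]])
  show ?thesis using 1 3
  proof eventually_elim
    case (elim x)
    show ?case unfolding elim(2) elim(1) 2 ..
  qed
qed

text \<open>W majorises the squared kernels of all regularised symbols at once, so the
  Hilbert-Schmidt bound is independent of k. For a fixed finite family the sum is continuous under
  strong convergence, so the bound carries over to the symbol n, which need not be integrable. The
  factor \<open>c ^ 4\<close> is the squared kernel normalisation.\<close>

lemma multiplier_cutoff_compact:
  fixes m :: "nat \<Rightarrow> 'a::euclidean_space \<Rightarrow> complex" and W :: "'a \<Rightarrow> real"
  assumes m: "\<And>k. integrable lborel (m k)" "\<And>k \<xi>. norm (m k \<xi>) \<le> 1"
    and n: "n \<in> borel_measurable borel" "\<And>\<xi>. norm (n \<xi>) \<le> 1" "\<And>\<xi>. (\<lambda>k. m k \<xi>) \<longlonglongrightarrow> n \<xi>"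
    and W: "\<And>k z. (norm (\<integral>\<xi>. cis (z \<bullet> \<xi>) * m k \<xi> \<partial>lborel))\<^sup>2 \<le> W z" "W \<in> borel_measurable borel"
    and E [measurable]: "E \<in> sets borel" and F [measurable]: "F \<in> sets borel" and Efin: "emeasure lborel E < \<infinity>"
    and fin: "(\<integral>\<^sup>+x. \<integral>\<^sup>+y. ennreal (indicator F x * W (x - y) * indicator E y) \<partial>lborel \<partial>lborel) < \<infinity>"
  shows "compact_operator_L2 (indicator_L2 F \<circ> fourier_multiplier n \<circ> indicator_L2 E)"
proof -
  note [measurable] = W(2)
  have mm [measurable]: "m k \<in> borel_measurable borel" for k using m(1)[of k] by auto
  note bE = bounded_symbol_indicator[OF E] and bF = bounded_symbol_indicator[OF F]
  have nb: "bounded_symbol n" by (rule bounded_symbolI[OF n(1,2)])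
  define K where "K = indicator_L2 F \<circ> fourier_multiplier n \<circ> indicator_L2 E"
  have linK: "linear_L2 K"
    using linear_mult_L2[OF bE] linear_mult_L2[OF bF] linear_fourier_multiplier[OF nb]
    unfolding linear_L2_def K_def indicator_L2_eq_mult by simp
  have "linear K"
    using linear_L2_scaleR[OF linK] linK by (intro linearI) (simp_all add: linear_L2_def)
  define c where "c = fourier_const TYPE('a)"
  define D where "D = enn2real (\<integral>\<^sup>+x. \<integral>\<^sup>+y. ennreal (indicator F x * W (x - y) * indicator E y) \<partial>lborel \<partial>lborel)"
  have D: "ennreal D = (\<integral>\<^sup>+x. \<integral>\<^sup>+y. ennreal (indicator F x * W (x - y) * indicator E y) \<partial>lborel \<partial>lborel)" "D \<ge> 0"
    using fin by (auto simp: D_def less_top)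
  have W0: "W z \<ge> 0" for z using W(1)[where z = z] by (rule order_trans[OF zero_le_power2])
  have bound: "(\<Sum>e\<in>B. (norm (K e))\<^sup>2) \<le> 2 * (c ^ 4 * D)" if B: "orthonormal B" for B
  proof -
    define Kk where "Kk k e = indicator_L2 F (fourier_multiplier (m k) (indicator_L2 E e))" for k e
    have "(\<Sum>e\<in>B. (norm (Kk k e))\<^sup>2) \<le> 2 * (c ^ 4 * D)" for k
    proof (rule hilbert_schmidt_kernel[OF _ _ E F Efin _ _ _ B])
      show "(\<lambda>z. of_real (c\<^sup>2) * (\<integral>\<xi>. cis (z \<bullet> \<xi>) * m k \<xi> \<partial>lborel)) \<in> borel_measurable borel" by measurable
      show "norm (of_real (c\<^sup>2) * (\<integral>\<xi>. cis (z \<bullet> \<xi>) * m k \<xi> \<partial>lborel)) \<le> c\<^sup>2 * (\<integral>\<xi>. norm (m k \<xi>) \<partial>lborel)" for z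
      proof -
        have "norm (\<integral>\<xi>. cis (z \<bullet> \<xi>) * m k \<xi> \<partial>lborel) \<le> (\<integral>\<xi>. norm (cis (z \<bullet> \<xi>) * m k \<xi>) \<partial>lborel)" by (rule integral_norm_bound)
        also have "\<dots> = (\<integral>\<xi>. norm (m k \<xi>) \<partial>lborel)" by (simp add: norm_mult)
        finally show ?thesis unfolding norm_mult by (intro mult_mono) (auto simp: norm_power)
      qed
      show "AE x in lebesgue. rep_L2 (Kk k u) x = indicator F x * (\<integral>y. (of_real (c\<^sup>2) * (\<integral>\<xi>. cis ((x - y) \<bullet> \<xi>) * m k \<xi> \<partial>lborel) * indicator E y) * rep_L2 u y \<partial>lebesgue)" for u
        unfolding Kk_def c_def by (rule multiplier_cutoff_kernel[OF m E F Efin])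
      have "(\<integral>\<^sup>+x. \<integral>\<^sup>+y. ennreal (indicator F x * (norm (of_real (c\<^sup>2) * (\<integral>\<xi>. cis ((x - y) \<bullet> \<xi>) * m k \<xi> \<partial>lborel)))\<^sup>2 * indicator E y) \<partial>lborel \<partial>lborel)
         \<le> (\<integral>\<^sup>+x. \<integral>\<^sup>+y. ennreal (c ^ 4) * ennreal (indicator F x * W (x - y) * indicator E y) \<partial>lborel \<partial>lborel)"
      proof (intro nn_integral_mono)
        fix x y :: 'a
        have "(norm (of_real (c\<^sup>2) * (\<integral>\<xi>. cis ((x - y) \<bullet> \<xi>) * m k \<xi> \<partial>lborel)))\<^sup>2 \<le> c ^ 4 * W (x - y)"
          using mult_left_mono[OF W(1)[of "x - y" k], of "c ^ 4"] by (simp add: norm_mult power_mult_distrib norm_power)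
        then have "ennreal (indicator F x * (norm (of_real (c\<^sup>2) * (\<integral>\<xi>. cis ((x - y) \<bullet> \<xi>) * m k \<xi> \<partial>lborel)))\<^sup>2 * indicator E y)
            \<le> ennreal (c ^ 4 * (indicator F x * W (x - y) * indicator E y))"
          by (intro ennreal_leI) (auto simp: indicator_def)
        also have "\<dots> = ennreal (c ^ 4) * ennreal (indicator F x * W (x - y) * indicator E y)"
          using W0 by (intro ennreal_mult) (auto simp: indicator_def)
        finally show "ennreal (indicator F x * (norm (of_real (c\<^sup>2) * (\<integral>\<xi>. cis ((x - y) \<bullet> \<xi>) * m k \<xi> \<partial>lborel)))\<^sup>2 * indicator E y)
            \<le> ennreal (c ^ 4) * ennreal (indicator F x * W (x - y) * indicator E y)" .
      qed
      also have "\<dots> = ennreal (c ^ 4) * ennreal D"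
        unfolding D by (simp add: nn_integral_cmult)
      also have "\<dots> = ennreal (c ^ 4 * D)" using D(2) by (simp add: ennreal_mult)
      finally show "(\<integral>\<^sup>+x. \<integral>\<^sup>+y. ennreal (indicator F x * (norm (of_real (c\<^sup>2) * (\<integral>\<xi>. cis ((x - y) \<bullet> \<xi>) * m k \<xi> \<partial>lborel)))\<^sup>2 * indicator E y) \<partial>lborel \<partial>lborel) \<le> ennreal (c ^ 4 * D)" .
      show "c ^ 4 * D \<ge> 0" using D(2) by simp
    qed
    moreover have "(\<lambda>k. Kk k e) \<longlonglongrightarrow> K e" for e
    proof -
      have l: "(\<lambda>k. fourier_multiplier (m k) (indicator_L2 E e)) \<longlonglongrightarrow> fourier_multiplier n (indicator_L2 E e)"
        by (rule fourier_multiplier_tendsto[OF mm m(2) n])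
      have "(\<lambda>k. Kk k e - K e) \<longlonglongrightarrow> 0"
      proof (rule Lim_null_comparison)
        show "\<forall>\<^sub>F k in sequentially. norm (Kk k e - K e) \<le> norm (fourier_multiplier (m k) (indicator_L2 E e) - fourier_multiplier n (indicator_L2 E e))"
          unfolding Kk_def K_def o_def indicator_L2_eq_mult[of F] linear_L2_diff[OF linear_mult_L2[OF bF], symmetric]
          by (intro always_eventually allI norm_mult_L2_le bF) (auto simp: indicator_def)
        show "(\<lambda>k. norm (fourier_multiplier (m k) (indicator_L2 E e) - fourier_multiplier n (indicator_L2 E e))) \<longlonglongrightarrow> 0"
          using l by (simp add: LIM_zero_iff tendsto_norm_zero_iff)
      qed
      then show ?thesis by (simp add: LIM_zero_iff)
    qed
    then have "(\<lambda>k. \<Sum>e\<in>B. (norm (Kk k e))\<^sup>2) \<longlonglongrightarrow> (\<Sum>e\<in>B. (norm (K e))\<^sup>2)" by (intro tendsto_sum tendsto_power tendsto_norm)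
    ultimately show ?thesis by (intro LIMSEQ_le_const2[where X = "\<lambda>k. \<Sum>e\<in>B. (norm (Kk k e))\<^sup>2"]) auto
  qed
  have "compact (closure (K ` S))" if "bounded S" for S
    by (rule hilbert_schmidt_compact[OF \<open>linear K\<close> bound that])
  then show ?thesis using linK by (simp add: compact_operator_L2_def K_def)
qed

section \<open>Compactness of the truncated propagator\<close>

lemma sigma_finite_lebesgue: "sigma_finite_measure (lebesgue :: 'a::euclidean_space measure)"
proof
  obtain A :: "'a set set" where A: "countable A" "A \<subseteq> sets lborel" "\<Union>A = space lborel" "\<forall>a\<in>A. emeasure lborel a \<noteq> \<infinity>"
    using lborel.sigma_finite_countable by blast
  show "\<exists>A. countable A \<and> A \<subseteq> sets lebesgue \<and> \<Union>A = space (lebesgue :: 'a measure) \<and> (\<forall>a\<in>A. emeasure lebesgue a \<noteq> \<infinity>)"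
    using A by (intro exI[of _ A]) auto
qed

text \<open>Connects the product of completed measures, in which the hypothesis is expressed, with
  iterated Borel-Lebesgue integrals.\<close>

lemma nn_integral_lebesgue_pair:
  fixes f :: "'a::euclidean_space \<times> 'b::euclidean_space \<Rightarrow> ennreal"
  assumes "f \<in> borel_measurable (lebesgue \<Otimes>\<^sub>M lebesgue)"
  shows "(\<integral>\<^sup>+z. f z \<partial>(lebesgue \<Otimes>\<^sub>M lebesgue)) = (\<integral>\<^sup>+x. \<integral>\<^sup>+y. f (x, y) \<partial>lborel \<partial>lborel)"
  using sigma_finite_measure.nn_integral_fst[OF sigma_finite_lebesgue assms] by (simp add: nn_integral_completion)

text \<open>A Lebesgue measurable set differs from its Borel main part by a null set, which
  multiplication on L2 does not see. This reduces the cutoffs to Borel sets.\<close>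

lemma indicator_L2_main_part:
  fixes A :: "'a::euclidean_space set"
  assumes "A \<in> sets lebesgue"
  shows "indicator_L2 A = indicator_L2 (main_part lborel A)"
proof
  fix u :: "'a L2"
  have "main_part lborel A \<in> sets borel" using main_part_sets[OF assms] by simp
  then have "main_part lborel A \<in> sets lebesgue" by (metis sets_completionI_sets sets_lborel)
  have s: "square_integrable (\<lambda>x. indicator B x * rep_L2 u x)" if "B \<in> sets lebesgue" for B
    using that by (intro square_integrable_bound[OF square_integrable_rep_L2[of u]]) (auto simp: indicator_def)
  have "AE x in lebesgue. x \<in> main_part lborel A \<longleftrightarrow> x \<in> A" by (rule AE_completion[OF AE_in_main_part[OF assms]])
  then have "AE x in lebesgue. indicator A x * rep_L2 u x = indicator (main_part lborel A) x * rep_L2 u x"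
    by eventually_elim (simp add: indicator_def)
  then show "indicator_L2 A u = indicator_L2 (main_part lborel A) u"
    unfolding indicator_L2_def by (intro abs_L2_eqI s assms \<open>main_part lborel A \<in> sets lebesgue\<close>)
qed

text \<open>Squaring the kernel bound by \<open>(1 + s)\<^sup>2 \<le> 2 + 2 * s\<^sup>2\<close>
  splits W into a constant, integrable over F \<times> E because both measures are finite, and a
  multiple of norm z powr (2\<gamma>), integrable by the assumption \<open>fin\<close>. For \<alpha>
  \<ge> 1 the second part is absent.\<close>

lemma propagator_cutoff_compact:
  fixes E F :: "'a::euclidean_space set" and \<alpha> T :: real
  defines "\<gamma> \<equiv> real DIM('a) * (1 - \<alpha>) / (2 * \<alpha> - 1)"
  assumes E: "E \<in> sets borel" "emeasure lborel E < \<infinity>" and F: "F \<in> sets borel" "emeasure lborel F < \<infinity>"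
    and \<alpha>: "\<alpha> > 1 / 2" and T: "T \<noteq> 0"
    and fin: "\<alpha> \<ge> 1 \<or> (\<integral>\<^sup>+x. \<integral>\<^sup>+y. ennreal (indicator F x * norm (x - y) powr (2 * \<gamma>) * indicator E y) \<partial>lborel \<partial>lborel) < \<infinity>"
  shows "compact_operator_L2 (indicator_L2 F \<circ> propagator \<alpha> T \<circ> indicator_L2 E)"
proof -
  note [measurable] = E(1) F(1)
  obtain C where C: "C \<ge> 0" and b: "\<And>\<epsilon> (z::'a). 0 < \<epsilon> \<Longrightarrow> \<epsilon> \<le> 1 \<Longrightarrow>
    norm (\<integral>\<xi>. cis (z \<bullet> \<xi>) * exp (- (Complex \<epsilon> T * of_real (norm \<xi> powr (2 * \<alpha>)))) \<partial>lborel)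
      \<le> C * (if \<alpha> \<ge> 1 then 1 else 1 + norm z powr \<gamma>)"
    using dispersive_multiplier_kernel_bound[OF \<alpha> T] unfolding \<gamma>_def by blast
  \<comment> \<open>The damping 1 / (k + 1) runs through (0, 1], the range in which the kernel bound
    is uniform.\<close>
  define m where "m k \<xi> = exp (- (Complex (1 / real (Suc k)) T * of_real (norm \<xi> powr (2 * \<alpha>))))" for k and \<xi> :: 'a
  define r where "r z = (if \<alpha> \<ge> 1 then 0 else norm z powr (2 * \<gamma>))" for z :: 'a
  define W where "W z = 2 * C\<^sup>2 + 2 * C\<^sup>2 * r z" for z
  have rm [measurable]: "r \<in> borel_measurable borel" unfolding r_def[abs_def] by measurable
  have r0: "r z \<ge> 0" for z by (simp add: r_def)
  have mm [measurable]: "m k \<in> borel_measurable borel" for k unfolding m_def[abs_def] by measurable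
  have nm: "norm (m k \<xi>) = exp (0 * norm \<xi> - 1 / real (Suc k) * norm \<xi> powr (2 * \<alpha>))" for k \<xi>
    by (simp add: m_def)
  show ?thesis
    unfolding propagator_def
  proof (rule multiplier_cutoff_compact[of m _ W])
    show "integrable lborel (m k)" for k
    proof (rule Bochner_Integration.integrable_bound)
      show "integrable lborel (\<lambda>\<xi>::'a. exp (0 * norm \<xi> - 1 / real (Suc k) * norm \<xi> powr (2 * \<alpha>)))"
        using \<alpha> by (intro integrable_exp_neg_norm_powr) auto
      show "AE \<xi> in lborel. norm (m k \<xi>) \<le> norm (exp (0 * norm \<xi> - 1 / real (Suc k) * norm \<xi> powr (2 * \<alpha>)))"
        unfolding nm by simp
    qed simp
    show "norm (m k \<xi>) \<le> 1" for k \<xi> unfolding nm by simp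
    show "(\<lambda>k. m k \<xi>) \<longlonglongrightarrow> cis (- T * norm \<xi> powr (2 * \<alpha>))" for \<xi>
    proof -
      have "(\<lambda>k. exp (- ((of_real (1 / real (Suc k)) + \<i> * of_real T) * of_real (norm \<xi> powr (2 * \<alpha>)))))
          \<longlonglongrightarrow> exp (- ((of_real 0 + \<i> * of_real T) * of_real (norm \<xi> powr (2 * \<alpha>))))"
        by (intro tendsto_intros LIMSEQ_Suc[OF lim_1_over_n])
      then show ?thesis by (simp add: m_def Complex_eq cis_conv_exp mult_ac)
    qed
    show "(norm (\<integral>\<xi>. cis (z \<bullet> \<xi>) * m k \<xi> \<partial>lborel))\<^sup>2 \<le> W z" for k z
    proof -
      define s where "s = (if \<alpha> \<ge> 1 then 0 else norm z powr \<gamma>)"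
      have s: "s\<^sup>2 = r z" by (simp add: s_def r_def power2_eq_square powr_add[symmetric])
      have "norm (\<integral>\<xi>. cis (z \<bullet> \<xi>) * m k \<xi> \<partial>lborel) \<le> C * (1 + s)"
        using b[of "1 / real (Suc k)" z] by (simp add: m_def s_def split: if_splits)
      then have "(norm (\<integral>\<xi>. cis (z \<bullet> \<xi>) * m k \<xi> \<partial>lborel))\<^sup>2 \<le> (C * (1 + s))\<^sup>2" by (intro power_mono) auto
      also have "\<dots> = C\<^sup>2 * (1 + s)\<^sup>2" by (rule power_mult_distrib)
      also have "\<dots> \<le> C\<^sup>2 * (2 + 2 * s\<^sup>2)"
        using sum_squares_bound[of 1 s] by (intro mult_left_mono) (auto simp: power2_sum)
      finally show ?thesis by (simp add: W_def s algebra_simps)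
    qed
    show "W \<in> borel_measurable borel" unfolding W_def[abs_def] by measurable
    define c where "c = ennreal (2 * C\<^sup>2)"
    have W: "ennreal (indicator F x * W (x - y) * indicator E y)
        = c * (indicator F x * indicator E y) + c * ennreal (indicator F x * r (x - y) * indicator E y)" for x y
      using r0 by (auto simp: W_def c_def indicator_def ennreal_plus ennreal_mult)
    have 1: "(\<integral>\<^sup>+x. \<integral>\<^sup>+y. indicator F x * indicator E y \<partial>lborel \<partial>lborel) = emeasure lborel F * emeasure lborel E"
      by (simp add: nn_integral_cmult nn_integral_multc)
    have 2: "(\<integral>\<^sup>+x. \<integral>\<^sup>+y. ennreal (indicator F x * r (x - y) * indicator E y) \<partial>lborel \<partial>lborel) < \<infinity>"
      using fin by (cases "\<alpha> \<ge> 1") (simp_all add: r_def)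
    have "(\<integral>\<^sup>+x. \<integral>\<^sup>+y. ennreal (indicator F x * W (x - y) * indicator E y) \<partial>lborel \<partial>lborel)
      = c * (emeasure lborel F * emeasure lborel E) + c * (\<integral>\<^sup>+x. \<integral>\<^sup>+y. ennreal (indicator F x * r (x - y) * indicator E y) \<partial>lborel \<partial>lborel)"
      unfolding W 1[symmetric] by (simp add: nn_integral_add nn_integral_cmult)
    also have "\<dots> < \<infinity>" using 2 E(2) F(2) by (auto simp: c_def ennreal_mult_less_top)
    finally show "(\<integral>\<^sup>+x. \<integral>\<^sup>+y. ennreal (indicator F x * W (x - y) * indicator E y) \<partial>lborel \<partial>lborel) < \<infinity>" .
  qed (use E F mm in auto)
qed

theorem theorem3p2:
  fixes E F :: "(real ^ 'n) set" and \<alpha> T :: real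
  assumes E: "E \<in> lmeasurable" and F: "F \<in> lmeasurable"
    and cases: "\<alpha> \<ge> 1 \<or>
      (1 / 2 < \<alpha> \<and> \<alpha> < 1 \<and>
       (let \<gamma> = real CARD('n) * (1 - \<alpha>) / (2 * \<alpha> - 1) in
        (\<integral>\<^sup>+ (x, y). ennreal (indicator F x * norm (x - y) powr (2 * \<gamma>) * indicator E y)
           \<partial>(lebesgue \<Otimes>\<^sub>M lebesgue)) < \<infinity>))"
    and T: "T \<noteq> 0"
  shows "compact_operator_L2
    (indicator_L2 F \<circ> unitary_group (fractional_laplacian \<alpha>) T \<circ> indicator_L2 E)"
proof -
  define \<gamma> where "\<gamma> = real DIM(real ^ 'n) * (1 - \<alpha>) / (2 * \<alpha> - 1)"
  have s [measurable]: "E \<in> sets lebesgue" "F \<in> sets lebesgue" using E F by auto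
  define E' F' where "E' = main_part lborel E" and "F' = main_part lborel F"
  have b: "E' \<in> sets borel" "F' \<in> sets borel" using main_part_sets[OF s(1)] main_part_sets[OF s(2)] by (auto simp: E'_def F'_def)
  have e: "emeasure lborel E' < \<infinity>" "emeasure lborel F' < \<infinity>"
    using E F emeasure_completion[OF s(1)] emeasure_completion[OF s(2)] by (auto simp: fmeasurable_def E'_def F'_def)
  have ae: "AE x in lborel. x \<in> E' \<longleftrightarrow> x \<in> E" "AE x in lborel. x \<in> F' \<longleftrightarrow> x \<in> F"
    unfolding E'_def F'_def by (intro AE_in_main_part s)+
  have "\<alpha> > 1 / 2" using cases by auto
  moreover have "\<alpha> \<ge> 1 \<or> (\<integral>\<^sup>+x. \<integral>\<^sup>+y. ennreal (indicator F' x * norm (x - y) powr (2 * \<gamma>) * indicator E' y) \<partial>lborel \<partial>lborel) < \<infinity>"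
  \<comment> \<open>Suppose the Borel integral diverges. It equals the integral in the hypothesis,
    so the second alternative of \<open>cases\<close> is excluded.\<close>
  proof (rule disjCI)
    assume "\<not> (\<integral>\<^sup>+x. \<integral>\<^sup>+y. ennreal (indicator F' x * norm (x - y) powr (2 * \<gamma>) * indicator E' y) \<partial>lborel \<partial>lborel) < \<infinity>"
    moreover have "(\<integral>\<^sup>+x. \<integral>\<^sup>+y. ennreal (indicator F' x * norm (x - y) powr (2 * \<gamma>) * indicator E' y) \<partial>lborel \<partial>lborel)
      = (\<integral>\<^sup>+x. \<integral>\<^sup>+y. ennreal (indicator F x * norm (x - y) powr (2 * \<gamma>) * indicator E y) \<partial>lborel \<partial>lborel)"
    proof (rule nn_integral_cong_AE, use ae(2) in eventually_elim)
      fix x assume x: "(x \<in> F') = (x \<in> F)"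
      show "(\<integral>\<^sup>+y. ennreal (indicator F' x * norm (x - y) powr (2 * \<gamma>) * indicator E' y) \<partial>lborel)
        = (\<integral>\<^sup>+y. ennreal (indicator F x * norm (x - y) powr (2 * \<gamma>) * indicator E y) \<partial>lborel)"
        by (rule nn_integral_cong_AE, use ae(1) in eventually_elim) (simp add: x indicator_def)
    qed
    moreover have "(\<integral>\<^sup>+x. \<integral>\<^sup>+y. ennreal (indicator F x * norm (x - y) powr (2 * \<gamma>) * indicator E y) \<partial>lborel \<partial>lborel)
      = (\<integral>\<^sup>+ (x, y). ennreal (indicator F x * norm (x - y) powr (2 * \<gamma>) * indicator E y) \<partial>(lebesgue \<Otimes>\<^sub>M lebesgue))"
    proof -
      \<comment> \<open>The difference x - y is handled through Borel valued coordinates: the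
        identity is measurable from the completion to the Borel sets, while the indicators use
        Lebesgue measurability directly.\<close>
      have [measurable]: "(\<lambda>x. x) \<in> lebesgue \<rightarrow>\<^sub>M (borel :: (real ^ 'n) measure)" by (intro measurable_completion) simp
      have [measurable]: "fst \<in> lebesgue \<Otimes>\<^sub>M lebesgue \<rightarrow>\<^sub>M (borel :: (real ^ 'n) measure)" "snd \<in> lebesgue \<Otimes>\<^sub>M lebesgue \<rightarrow>\<^sub>M (borel :: (real ^ 'n) measure)"
        using measurable_compose[OF measurable_fst \<open>(\<lambda>x. x) \<in> lebesgue \<rightarrow>\<^sub>M borel\<close>] measurable_compose[OF measurable_snd \<open>(\<lambda>x. x) \<in> lebesgue \<rightarrow>\<^sub>M borel\<close>]
        by (simp_all add: fun_eq_iff cong: measurable_cong_simp)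
      have "(\<lambda>(x, y). ennreal (indicator F x * norm (x - y) powr (2 * \<gamma>) * indicator E y)) \<in> borel_measurable (lebesgue \<Otimes>\<^sub>M lebesgue)"
        unfolding case_prod_unfold by measurable
      from nn_integral_lebesgue_pair[OF this] show ?thesis by simp
    qed
    ultimately show "\<alpha> \<ge> 1" using cases by (auto simp: \<gamma>_def Let_def)
  qed
  ultimately have "compact_operator_L2 (indicator_L2 F' \<circ> propagator \<alpha> T \<circ> indicator_L2 E')"
    unfolding \<gamma>_def by (intro propagator_cutoff_compact b e T) auto
  then show ?thesis
    unfolding unitary_group_fractional_laplacian E'_def F'_def indicator_L2_main_part[OF s(1)] indicator_L2_main_part[OF s(2)] .
qed

end
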